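(* Let $n\ge 1$, let $p\in\mathcal{P}^{\log}(\mathbb{R}^n)$ with $1<p^-\leq p^+<+\infty$, let $0<s<n/p^+$, let $\beta>0$, and let $s_1$ be fixed with $0\leq s_1<s$. Set $$\theta=\frac{s-s_1}{\beta+s}<1,\qquad q(\cdot)=\frac{p(\cdot)}{1-\theta}.$$ Then there is a constant $C>0$ (independent of $f$) such that for every measurable function $f:\mathbb{R}^n\to\mathbb{R}$ with $f\in\dot{W}^{s,p(\cdot)}(\mathbb{R}^n)$ and $f\in\dot{B}^{-\beta,\infty}_{\infty}(\mathbb{R}^n)$, one has $f\in\dot{W}^{s_1,q(\cdot)}(\mathbb{R}^n)$ and $$\|f\|_{\dot{W}^{s_1,q(\cdot)}(\mathbb{R}^n)}\leq C\,\|f\|_{\dot{W}^{s,p(\cdot)}(\mathbb{R}^n)}^{1-\theta}\,\|f\|_{\dot{B}^{-\beta,\infty}_{\infty}(\mathbb{R}^n)}^{\theta}.$$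
   Context: Variable exponents: $\mathcal{P}(\mathbb{R}^n)$ is the set of measurable functions $p:\mathbb{R}^n\to[1,+\infty]$; $p^-=\operatorname{ess\,inf}_{x}p(x)$ and $p^+=\operatorname{ess\,sup}_{x}p(x)$. The class $\mathcal{P}^{\log}(\mathbb{R}^n)$ consists of those $p\in\mathcal{P}(\mathbb{R}^n)$ for which there is a constant $C$ with $$\left|\frac{1}{p(x)}-\frac{1}{p(y)}\right|\leq\frac{C}{\log(e+1/|x-y|)}\ \text{ for all }x,y\in\mathbb{R}^n,\qquad \left|\frac{1}{p(x)}-\frac{1}{p_\infty}\right|\leq\frac{C}{\log(e+|x|)}\ \text{ for all }x\in\mathbb{R}^n,$$ where $\frac{1}{p_\infty}=\lim_{|x|\to+\infty}\frac{1}{p(x)}$. Variable Lebesgue space: for $p\in\mathcal{P}(\mathbb{R}^n)$ with $1<p^-\le p^+<+\infty$, $L^{p(\cdot)}(\mathbb{R}^n)$ is the set of measurable functions $f$ for which the Luxemburg norm $\|f\|_{L^{p(\cdot)}(\mathbb{R}^n)}=\inf\{\lambda>0:\int_{\mathbb{R}^n}|f(x)/\lambda|^{p(x)}dx\leq1\}$ is finite. Fractional Laplacian: for $s>0$, $\widehat{(-\Delta)^{\frac s2}(f)}(\xi)=|\xi|^s\widehat{f}(\xi)$, extended to tempered distributions by standard procedures. Sobolev space: for $0<s<n/p^+$, $\dot{W}^{s,p(\cdot)}(\mathbb{R}^n)$ is the closure of smooth functions with respect to the functional $\|f\|_{\dot{W}^{s,p(\cdot)}(\mathbb{R}^n)}=\|(-\Delta)^{\frac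 s2}(f)\|_{L^{p(\cdot)}(\mathbb{R}^n)}$. For smoothness index $0$, $\dot{W}^{0,q(\cdot)}(\mathbb{R}^n)=L^{q(\cdot)}(\mathbb{R}^n)$ with the same norm. Besov space: for $\beta>0$, $\dot{B}^{-\beta,\infty}_{\infty}(\mathbb{R}^n)$ is the set of tempered distributions $f$ for which $\|f\|_{\dot{B}^{-\beta,\infty}_{\infty}(\mathbb{R}^n)}=\sup_{t>0}t^{\frac{\beta}{2}}\|h_t\ast f\|_{L^\infty(\mathbb{R}^n)}$ is finite, where $h_t(x)=(4\pi t)^{-\frac n2}e^{-\frac{|x|^2}{4t}}$ is the heat kernel. *)

theory Defs
  imports "HOL-Probability.Essential_Supremum"
begin

section \<open>Variable exponents\<close>

definition exponents :: "('a::euclidean_space \<Rightarrow> ereal) set" where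
  "exponents = {p \<in> borel_measurable lebesgue. \<forall>x. 1 \<le> p x}"

definition p_plus :: "('a::euclidean_space \<Rightarrow> ereal) \<Rightarrow> ereal" where
  "p_plus p = esssup lebesgue p"

definition p_minus :: "('a::euclidean_space \<Rightarrow> ereal) \<Rightarrow> ereal" where
  "p_minus p = Sup {c. AE x in lebesgue. c \<le> p x}"

text \<open>With \<open>p \<ge> 1\<close> the quotient below is a genuine real number in \<open>[0, 1]\<close>; it is \<open>0\<close> where
  \<open>p x = \<infinity>\<close>.\<close>

definition recip :: "('a \<Rightarrow> ereal) \<Rightarrow> 'a \<Rightarrow> real" where
  "recip p x = real_of_ereal (1 / p x)"

text \<open>The number \<open>L\<close> plays the role of \<open>1 / p\<^sub>\<infinity>\<close>. For \<open>x = y\<close> the first inequality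
  only says \<open>0 \<le> C\<close>, because \<open>1 / 0 = 0\<close>.\<close>

definition log_exponents :: "('a::euclidean_space \<Rightarrow> ereal) set" where
  "log_exponents = {p \<in> exponents. \<exists>C L.
      (\<forall>x y. \<bar>recip p x - recip p y\<bar> \<le> C / ln (exp 1 + 1 / norm (x - y))) \<and>
      (recip p \<longlongrightarrow> L) at_infinity \<and>
      (\<forall>x. \<bar>recip p x - L\<bar> \<le> C / ln (exp 1 + norm x))}"


section \<open>Variable Lebesgue spaces\<close>

text \<open>Only exponents with \<open>p_plus p < \<infinity>\<close> are of interest, so the value of
  \<open>real_of_ereal (p x)\<close> at \<open>p x = \<infinity>\<close> matters on a null set only. The infimum of the empty
  set is \<open>\<infinity>\<close>.\<close>

definition Lp_norm :: "('a::euclidean_space \<Rightarrow> ereal) \<Rightarrow> ('a \<Rightarrow> 'b::real_normed_vector) \<Rightarrow> ennreal" where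
  "Lp_norm p f = Inf {ennreal l | l. 0 < l \<and>
      (\<integral>\<^sup>+x. ennreal ((norm (f x) / l) powr real_of_ereal (p x)) \<partial>lebesgue) \<le> 1}"

definition Lp_space :: "('a::euclidean_space \<Rightarrow> ereal) \<Rightarrow> ('a \<Rightarrow> 'b::real_normed_vector) set" where
  "Lp_space p = {f \<in> borel_measurable lebesgue. Lp_norm p f < \<infinity>}"


section \<open>Test functions and tempered distributions\<close>

text \<open>Iterated partial derivatives along a list of basis vectors; such lists stand in for
  multi-indices.\<close>

fun iter_deriv :: "'a::euclidean_space list \<Rightarrow> ('a \<Rightarrow> complex) \<Rightarrow> 'a \<Rightarrow> complex" where
  "iter_deriv [] \<phi> = \<phi>"
| "iter_deriv (b # bs) \<phi> = (\<lambda>x. frechet_derivative (iter_deriv bs \<phi>) (at x) b)"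

definition smooth :: "('a::euclidean_space \<Rightarrow> complex) \<Rightarrow> bool" where
  "smooth \<phi> \<longleftrightarrow> (\<forall>bs \<in> lists Basis. \<forall>x. iter_deriv bs \<phi> differentiable (at x))"

definition test_functions :: "('a::euclidean_space \<Rightarrow> complex) set" where
  "test_functions = {\<phi>. smooth \<phi> \<and> compact (closure {x. \<phi> x \<noteq> 0})}"

definition schwartz :: "('a::euclidean_space \<Rightarrow> complex) set" where
  "schwartz = {\<phi>. smooth \<phi> \<and> (\<forall>N. \<forall>bs \<in> lists Basis.
      bounded (range (\<lambda>x. (1 + norm x) ^ N *\<^sub>R iter_deriv bs \<phi> x)))}"

definition schwartz_norm :: "nat \<Rightarrow> ('a::euclidean_space \<Rightarrow> complex) \<Rightarrow> real" where
  "schwartz_norm N \<phi> = (SUP (x, bs) \<in> UNIV \<times> {bs \<in> lists Basis. length bs \<le> N}.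
      (1 + norm x) ^ N * norm (iter_deriv bs \<phi> x))"

text \<open>A distribution is a functional on functions of which only the values on
  \<^const>\<open>schwartz\<close> are ever used.\<close>

type_synonym 'a distr = "('a \<Rightarrow> complex) \<Rightarrow> complex"

definition tempered :: "('a::euclidean_space) distr set" where
  "tempered = {T.
      (\<forall>\<phi> \<in> schwartz. \<forall>\<psi> \<in> schwartz. \<forall>c. T (\<lambda>x. c * \<phi> x + \<psi> x) = c * T \<phi> + T \<psi>) \<and>
      (\<exists>C N. \<forall>\<phi> \<in> schwartz. norm (T \<phi>) \<le> C * schwartz_norm N \<phi>)}"

definition regular_distr :: "('a::euclidean_space \<Rightarrow> complex) \<Rightarrow> 'a distr" where
  "regular_distr g = (\<lambda>\<phi>. \<integral>x. g x * \<phi> x \<partial>lebesgue)"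

text \<open>\<open>represents g T\<close>: the tempered distribution \<open>T\<close> is the function \<open>g\<close>. Testing against
  compactly supported functions suffices, these being dense in \<^const>\<open>schwartz\<close>, and
  makes sense for every locally integrable \<open>g\<close>.\<close>

definition represents :: "('a::euclidean_space \<Rightarrow> complex) \<Rightarrow> 'a distr \<Rightarrow> bool" where
  "represents g T \<longleftrightarrow> T \<in> tempered \<and> g \<in> borel_measurable lebesgue \<and>
      (\<forall>K. compact K \<longrightarrow> set_integrable lebesgue K g) \<and>
      (\<forall>\<phi> \<in> test_functions. T \<phi> = regular_distr g \<phi>)"

definition fourier :: "('a::euclidean_space \<Rightarrow> complex) \<Rightarrow> 'a \<Rightarrow> complex" where
  "fourier \<phi> \<xi> = (\<integral>x. exp (- \<i> * complex_of_real (x \<bullet> \<xi>)) * \<phi> x \<partial>lebesgue)"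

definition fourier_distr :: "('a::euclidean_space) distr \<Rightarrow> 'a distr" where
  "fourier_distr T = (\<lambda>\<phi>. T (fourier \<phi>))"


section \<open>Fractional Laplacian and homogeneous Sobolev spaces\<close>

text \<open>\<open>frac_laplacian s T U\<close>: \<open>U\<close> is \<open>(-\<Delta>)\<close> to the power \<open>s / 2\<close> applied to \<open>T\<close>, that is, the
  Fourier transform of \<open>U\<close> is \<open>\<bar>\<xi>\<bar>\<close> to the power \<open>s\<close> times that of \<open>T\<close>. The multiplier is in
  general not smooth at the origin, so the product is a well-defined distribution away from the
  origin only, and the identity is required there. This is the usual realisation modulo
  polynomials, which are the distributions whose Fourier transform is supported at the origin.\<close>

definition frac_laplacian :: "real \<Rightarrow> ('a::euclidean_space) distr \<Rightarrow> 'a distr \<Rightarrow> bool" where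
  "frac_laplacian s T U \<longleftrightarrow> T \<in> tempered \<and> U \<in> tempered \<and>
      (\<forall>\<psi> \<in> test_functions. 0 \<notin> closure {\<xi>. \<psi> \<xi> \<noteq> 0} \<longrightarrow>
        fourier_distr U \<psi> = fourier_distr T (\<lambda>\<xi>. complex_of_real (norm \<xi> powr s) * \<psi> \<xi>))"

text \<open>The infimum does not select among competing values: if \<open>p_plus p < \<infinity>\<close>, no nonzero
  polynomial has finite norm, so all representatives \<open>g\<close> of finite norm agree almost everywhere.
  If there is none, the value is \<open>\<infinity>\<close>.\<close>

definition sobolev_norm :: "real \<Rightarrow> ('a::euclidean_space \<Rightarrow> ereal) \<Rightarrow> 'a distr \<Rightarrow> ennreal" where
  "sobolev_norm s p T =
    (if s = 0 then Inf {Lp_norm p g | g. represents g T}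
     else Inf {Lp_norm p g | g. \<exists>U. frac_laplacian s T U \<and> represents g U})"

text \<open>The smooth functions whose closure is taken are the Schwartz functions.\<close>

definition sobolev :: "real \<Rightarrow> ('a::euclidean_space \<Rightarrow> ereal) \<Rightarrow> 'a distr set" where
  "sobolev s p =
    (if s = 0 then {T \<in> tempered. \<exists>g \<in> Lp_space p. represents g T}
     else {T \<in> tempered. sobolev_norm s p T < \<infinity> \<and>
       (\<forall>\<epsilon>>0. \<exists>\<phi> \<in> schwartz. sobolev_norm s p (\<lambda>\<psi>. T \<psi> - regular_distr \<phi> \<psi>) < \<epsilon>)})"


section \<open>Homogeneous Besov spaces of negative order\<close>

definition heat_kernel :: "real \<Rightarrow> 'a::euclidean_space \<Rightarrow> real" where
  "heat_kernel t x = (4 * pi * t) powr (- real DIM('a) / 2) * exp (- (norm x)\<^sup>2 / (4 * t))"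

definition convolve :: "('a::euclidean_space \<Rightarrow> real) \<Rightarrow> 'a distr \<Rightarrow> 'a \<Rightarrow> complex" where
  "convolve h T x = T (\<lambda>y. complex_of_real (h (x - y)))"

definition besov_norm :: "real \<Rightarrow> ('a::euclidean_space) distr \<Rightarrow> ennreal" where
  "besov_norm \<beta> T = (SUP t \<in> {0<..}. ennreal (t powr (\<beta> / 2)) *
      esssup lebesgue (\<lambda>x. ennreal (norm (convolve (heat_kernel t) T x))))"

text \<open>The index \<open>\<beta>\<close> corresponds to smoothness \<open>- \<beta>\<close>.\<close>

definition besov :: "real \<Rightarrow> ('a::euclidean_space) distr set" where
  "besov \<beta> = {T \<in> tempered. besov_norm \<beta> T < \<infinity>}"

end

(*
  Suppose that (-Delta)^(s/2) T is the function g. At frequency 2^j the Littlewood-Paley piece of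
  (-Delta)^(s1/2) T is pointwise at most a constant times 2^(-j (s - s1)) M g, where M is the
  Hardy-Littlewood maximal operator, and at most a constant times 2^(j (s1 + beta)) times the Besov
  norm of T, because a multiplier supported in an annulus factors through the heat semigroup.
  Summing the smaller of the two bounds over j gives Hedberg's inequality
  |(-Delta)^(s1/2) T| <= C (M g)^(1 - theta) B^theta, where B is the Besov norm. Since
  q (1 - theta) = p, the norm estimate follows from the boundedness of M on log-Hoelder exponents,
  applied to the modular. Large values of g are handled with the local condition on the exponent and
  small values with the condition at infinity.

  The partial Littlewood-Paley sums converge to (-Delta)^(s1/2) T dominatedly, hence in norm.
  Multiplied by slowly dilated Schwartz functions of compact spectrum they become Schwartz functions
  whose spectrum avoids the origin, and on these (-Delta)^(s1/2) can be inverted. This puts T into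
  the closure of the Schwartz functions.
*)

theory Submission
  imports Defs "HOL-Probability.Probability"
begin

text \<open>The modular of a variable exponent space is not homogeneous, so every estimate is made
  at a fixed level \<open>l\<close> of the function \<open>g\<close>, and the infimum over
  \<open>l\<close> is taken only at the end. The maximal theorem holds for modular at most 1;
  homogeneity of the maximal operator puts \<open>l\<close> back. The fractional Laplacian is
  prescribed only away from frequency zero. Identities are therefore tested with multipliers
  supported in annuli, and (-Delta)^(s1/2) T is not given beforehand: it is constructed as the
  pointwise limit of dyadic sums, whose convergence is a consequence of the summed bounds. For
  \<open>s1 = 0\<close> the limit has to be T itself, not T up to a polynomial; here \<beta> > 0
  gives the part of T below frequency 2^-J the size 2^(-J \<beta>), which leaves no room for a
  polynomial. One pointwise majorant accompanies the limit. It yields the slow growth of the limit,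
  its norm, and the dominated convergence behind the density of Schwartz functions. The exponent
  \<theta> is where the two powers of 2^j balance, with rates s - s1 and s1 + \<beta>.\<close>

subsection \<open>The dyadic maximal function\<close>

text \<open>The maximal function can be infinite, and \<open>enn2real\<close> alone would turn that
  value into 0. Sending \<open>top\<close> to \<open>top\<close> keeps it visible, so that a finite
  modular proves finiteness almost everywhere.\<close>

definition epow :: "ennreal \<Rightarrow> real \<Rightarrow> ennreal" where
  "epow a r = (if a = top then top else ennreal (enn2real a powr r))"

lemma epow_ennreal [simp]: "0 \<le> a \<Longrightarrow> epow (ennreal a) r = ennreal (a powr r)"
  by (simp add: epow_def)

lemma nn_integral_powr_0:
  assumes "-1 < (c::real)" "0 \<le> a" "0 \<le> k"
  shows "(\<integral>\<^sup>+t. ennreal (k * t powr c) * indicator {0<..<a} t \<partial>lborel) = ennreal (k * (a powr (c + 1) / (c + 1)))"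
proof -
  have 1: "((\<lambda>t. k * t powr c) has_integral k * (a powr (c + 1) / (c + 1))) {0..a}"
    by (intro has_integral_mult_right has_integral_powr_from_0 assms)
  have "(\<integral>\<^sup>+t. ennreal (k * t powr c) * indicator {0..a} t \<partial>lborel) = ennreal (k * (a powr (c + 1) / (c + 1)))"
  proof -
    have eq: "(\<lambda>t. ennreal (k * t powr c) * indicator {0..a} t) = (\<lambda>t. ennreal (if t \<in> {0..a} then k * t powr c else 0))"
      by (rule ext) (auto simp: indicator_def)
    have "((\<lambda>t. if t \<in> {0..a} then k * t powr c else 0) has_integral k * (a powr (c + 1) / (c + 1))) UNIV"
      by (rule has_integral_restrict_UNIV[THEN iffD2, OF 1])
    then show ?thesis
      unfolding eq using assms by (intro nn_integral_has_integral_lborel) auto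
  qed
  moreover have "(\<integral>\<^sup>+t. ennreal (k * t powr c) * indicator {0<..<a} t \<partial>lborel)
    = (\<integral>\<^sup>+t. ennreal (k * t powr c) * indicator {0..a} t \<partial>lborel)"
  proof (rule nn_integral_cong_AE)
    have "AE t in lborel. t \<noteq> (0::real)" "AE t in lborel. t \<noteq> a" by (auto intro: AE_lborel_singleton)
    then show "AE t in lborel. ennreal (k * t powr c) * indicator {0<..<a} t = ennreal (k * t powr c) * indicator {0..a} t"
      by eventually_elim (auto simp: indicator_def)
  qed
  ultimately show ?thesis by simp
qed

text \<open>The layer-cake formula, written as an integral over the whole line so that Fubini can
  exchange it with the integral over space. For \<open>a = top\<close> the truncated integrals
  exceed every natural number.\<close>

lemma epow_layer_cake:
  assumes r: "1 < (r::real)"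
  shows "epow a r = (\<integral>\<^sup>+t. ennreal (r * t powr (r - 1)) * indicator {t. 0 < t \<and> ennreal t < a} t \<partial>lborel)"
proof (cases a)
  case (real b)
  have "{t. 0 < t \<and> ennreal t < a} = {0<..<b}"
    using real by (auto simp: ennreal_less_iff)
  then show ?thesis
    using real r by (simp add: nn_integral_powr_0)
next
  case top
  have *: "(\<integral>\<^sup>+t. ennreal (r * t powr (r - 1)) * indicator {t. 0 < t \<and> ennreal t < a} t \<partial>lborel) \<ge> ennreal (real m)" for m
  proof -
    have "(real m + 1) powr 1 \<le> (real m + 1) powr r" using r by (intro powr_mono) auto
    then have "ennreal (real m) \<le> ennreal (r * ((real m + 1) powr (r-1+1) / (r-1+1)))"
      using r by (intro ennreal_leI) auto
    also have "\<dots> = (\<integral>\<^sup>+t. ennreal (r * t powr (r-1)) * indicator {0<..<real m + 1} t \<partial>lborel)"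
      using r by (intro nn_integral_powr_0[symmetric]) auto
    also have "\<dots> \<le> (\<integral>\<^sup>+t. ennreal (r * t powr (r - 1)) * indicator {t. 0 < t \<and> ennreal t < a} t \<partial>lborel)"
      using top by (intro nn_integral_mono) (auto simp: indicator_def)
    finally show ?thesis .
  qed
  have "(\<integral>\<^sup>+t. ennreal (r * t powr (r - 1)) * indicator {t. 0 < t \<and> ennreal t < a} t \<partial>lborel) = top"
  proof (rule ccontr)
    assume "\<not> ?thesis"
    then obtain c where c: "0 \<le> c" "(\<integral>\<^sup>+t. ennreal (r * t powr (r - 1)) * indicator {t. 0 < t \<and> ennreal t < a} t \<partial>lborel) = ennreal c"
      by (cases "(\<integral>\<^sup>+t. ennreal (r * t powr (r - 1)) * indicator {t. 0 < t \<and> ennreal t < a} t \<partial>lborel)") auto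
    obtain m where "c < real m" using reals_Archimedean2 by blast
    with *[of m] c show False by (simp add: not_less)
  qed
  with top show ?thesis by (simp add: epow_def)
qed

definition avg :: "('a::euclidean_space \<Rightarrow> ennreal) \<Rightarrow> 'a \<Rightarrow> real \<Rightarrow> ennreal" where
  "avg f x r = (\<integral>\<^sup>+y. f y * indicator (ball x r) y \<partial>lborel) / emeasure lborel (ball x r)"

text \<open>Only dyadic radii enter, so that measurability is that of a countable supremum.\<close>

definition maximal :: "('a::euclidean_space \<Rightarrow> ennreal) \<Rightarrow> 'a \<Rightarrow> ennreal" where
  "maximal f x = (SUP k::int. avg f x (2 powr k))"

lemma emeasure_ball_pos: "0 < r \<Longrightarrow> 0 < emeasure lborel (ball (x::'a::euclidean_space) r)"
  by (simp add: emeasure_ball)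

lemma emeasure_ball_finite [simp]: "emeasure lborel (ball (x::'a::euclidean_space) r) \<noteq> top"
  using emeasure_lborel_ball_finite[of x r] by simp

lemma avg_mono: "(\<And>y. f y \<le> g y) \<Longrightarrow> avg f x r \<le> avg g x r"
  unfolding avg_def by (intro divide_right_mono_ennreal nn_integral_mono mult_right_mono) auto

lemma maximal_mono: "(\<And>y. f y \<le> g y) \<Longrightarrow> maximal f x \<le> maximal g x"
  unfolding maximal_def by (intro SUP_mono) (auto intro: avg_mono)

lemma avg_le_maximal: "avg f x (2 powr real_of_int k) \<le> maximal f x"
  unfolding maximal_def by (rule SUP_upper) auto

lemma avg_const: "0 < r \<Longrightarrow> avg (\<lambda>_. c) x r = c"
  unfolding avg_def
  by (subst nn_integral_cmult_indicator) (use emeasure_ball_pos[of r x] in \<open>auto intro!: ennreal_mult_divide_eq\<close>)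

lemma maximal_const: "maximal (\<lambda>_. c) x = c"
  unfolding maximal_def by (simp add: avg_const)

lemma avg_add:
  assumes [measurable]: "f \<in> borel_measurable borel" "g \<in> borel_measurable borel"
  shows "avg (\<lambda>y. f y + g y) x r = avg f x r + avg g x r"
  unfolding avg_def distrib_right by (subst nn_integral_add) (auto simp: add_divide_distrib_ennreal intro!: borel_measurable_times_ennreal borel_measurable_indicator)

lemma avg_cmult:
  assumes [measurable]: "f \<in> borel_measurable borel"
  shows "avg (\<lambda>y. c * f y) x r = c * avg f x r"
  unfolding avg_def mult.assoc by (subst nn_integral_cmult) (auto simp: ennreal_times_divide intro!: borel_measurable_times_ennreal borel_measurable_indicator)

lemma maximal_add:
  assumes [measurable]: "f \<in> borel_measurable borel" "g \<in> borel_measurable borel"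
  shows "maximal (\<lambda>y. f y + g y) x \<le> maximal f x + maximal g x"
  unfolding maximal_def
  by (intro SUP_least) (auto simp: avg_add intro!: add_mono SUP_upper)

lemma maximal_cmult:
  assumes [measurable]: "f \<in> borel_measurable borel"
  shows "maximal (\<lambda>y. c * f y) x = c * maximal f x"
  unfolding maximal_def by (simp add: avg_cmult SUP_mult_left_ennreal)

lemma avg_measurable [measurable]:
  assumes [measurable]: "f \<in> borel_measurable borel"
  shows "(\<lambda>x. avg f x r) \<in> borel_measurable borel"
proof -
  have [measurable]: "(\<lambda>x::'a. \<integral>\<^sup>+y. f y * indicator (ball x r) y \<partial>lborel) \<in> borel_measurable borel"
  proof -
    have "(\<lambda>x::'a. \<integral>\<^sup>+y. f y * indicator {z. dist (fst z) (snd z) < r} (x, y) \<partial>lborel) \<in> borel_measurable borel"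
      by measurable
    then show ?thesis by (simp add: indicator_def ball_def)
  qed
  have "emeasure lborel (ball x r) = emeasure lborel (ball (0::'a) r)" for x :: 'a
    by (cases "0 \<le> r") (auto simp: emeasure_ball ball_empty)
  then show ?thesis unfolding avg_def by (subst \<open>\<And>x::'a. emeasure lborel (ball x r) = _\<close>) measurable
qed

lemma maximal_measurable [measurable]:
  "f \<in> borel_measurable borel \<Longrightarrow> maximal f \<in> borel_measurable borel"
  unfolding maximal_def[abs_def] by measurable

text \<open>Vitali covering: every point of the superlevel set has a dyadic ball with average above
  \<open>t\<close>, and a disjoint subfamily covers the set after fivefold enlargement. The
  enlargement is the source of the factor \<open>5 ^ DIM('a)\<close>.\<close>

lemma maximal_weak_type:
  fixes f :: "'a::euclidean_space \<Rightarrow> ennreal"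
  assumes f[measurable]: "f \<in> borel_measurable borel" and t: "0 < (t::real)"
  shows "ennreal t * emeasure lborel {x. ennreal t < maximal f x} \<le> 5 ^ DIM('a) * (\<integral>\<^sup>+y. f y \<partial>lborel)"
proof (cases "(\<integral>\<^sup>+y. f y \<partial>lborel)")
  case top
  then show ?thesis by (simp add: ennreal_mult_top)
next
  case (real I)
  define S where "S = {x. ennreal t < maximal f x}"
  define n where "n = DIM('a)"
  have n: "0 < n" by (simp add: n_def)
  define w where "w = unit_ball_vol (real n)"
  have w: "0 < w" by (simp add: w_def)
  have "\<exists>k::int. ennreal t < avg f x (2 powr k)" if "x \<in> S" for x
    using that unfolding S_def maximal_def by (simp add: less_SUP_iff)
  then obtain k :: "'a \<Rightarrow> int" where k: "\<And>x. x \<in> S \<Longrightarrow> ennreal t < avg f x (2 powr k x)"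
    by metis
  define r where "r x = 2 powr real_of_int (k x)" for x
  have r0: "0 < r x" for x by (simp add: r_def)
  have em: "emeasure lborel (ball x (c * r x)) = ennreal (w * (c * r x) ^ n)" if "0 \<le> c" for x::'a and c
    using r0[of x] that by (simp add: emeasure_ball w_def n_def)
  have key: "ennreal (t * (w * r x ^ n)) \<le> (\<integral>\<^sup>+y. f y * indicator (ball x (r x)) y \<partial>lborel)" if "x \<in> S" for x
  proof -
    have "ennreal t \<le> (\<integral>\<^sup>+y. f y * indicator (ball x (r x)) y \<partial>lborel) / ennreal (w * r x ^ n)"
      using k[OF that] em[of 1 x] by (simp add: avg_def r_def less_imp_le)
    then have "ennreal t * ennreal (w * r x ^ n) \<le> (\<integral>\<^sup>+y. f y * indicator (ball x (r x)) y \<partial>lborel) / ennreal (w * r x ^ n) * ennreal (w * r x ^ n)"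
      by (rule mult_right_mono) auto
    also have "\<dots> = (\<integral>\<^sup>+y. f y * indicator (ball x (r x)) y \<partial>lborel)"
      using w r0[of x] by (intro ennreal_divide_times[THEN trans]) (simp add: ennreal_times_divide[symmetric] ennreal_divide_self)
    finally show ?thesis using t w r0[of x] by (simp add: ennreal_mult'[symmetric] less_imp_le)
  qed
  \<comment> \<open>The covering lemma needs bounded radii. A ball with average above
    \<open>t\<close> has volume at most \<open>I / t\<close>, and a radius above 1 is at most its
    own n-th power.\<close>
  have bdd: "0 < r x \<and> r x \<le> max 1 (I / (t * w))" if "x \<in> S" for x
  proof (rule conjI[OF r0], cases "r x \<le> 1")
    case False
    have "ennreal (t * (w * r x ^ n)) \<le> (\<integral>\<^sup>+y. f y \<partial>lborel)"
      using key[OF that] by (rule order_trans) (auto intro!: nn_integral_mono simp: indicator_def)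
    then have "t * (w * r x ^ n) \<le> I" using real by simp
    moreover have "r x ^ 1 \<le> r x ^ n" using False n by (intro power_increasing) auto
    ultimately have "t * (w * r x) \<le> I"
      using t w by (smt (verit) mult_left_mono power_one_right)
    then have "r x \<le> I / (t * w)" using t w by (simp add: field_simps)
    then show "r x \<le> max 1 (I / (t * w))" by simp
  qed simp
  obtain C where C: "countable C" "C \<subseteq> S"
     "pairwise (\<lambda>i j. disjnt (ball i (r i)) (ball j (r j))) C"
     "S \<subseteq> (\<Union>i\<in>C. ball i (5 * r i))"
    using Vitali_covering_lemma_balls[where S=S and K=S and a="\<lambda>x. x" and r=r and B="max 1 (I / (t * w))"] bdd r0
    by (force)
  define A where "A m = (if m \<in> to_nat_on C ` C then ball (from_nat_into C m) (r (from_nat_into C m)) else {})" for m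
  define A5 where "A5 m = (if m \<in> to_nat_on C ` C then ball (from_nat_into C m) (5 * r (from_nat_into C m)) else {})" for m
  have [measurable]: "A m \<in> sets borel" "A5 m \<in> sets borel" for m by (auto simp: A_def A5_def)
  have disj: "disjoint_family A"
    unfolding disjoint_family_on_def
  proof (intro ballI impI)
    fix m m' :: nat assume "m \<noteq> m'"
    show "A m \<inter> A m' = {}"
    proof (cases "m \<in> to_nat_on C ` C \<and> m' \<in> to_nat_on C ` C")
      case True
      then obtain x y where xy: "x \<in> C" "y \<in> C" "m = to_nat_on C x" "m' = to_nat_on C y" by blast
      with \<open>m \<noteq> m'\<close> have "x \<noteq> y" by auto
      then show ?thesis
        using C(1,3) xy by (simp add: A_def pairwise_def disjnt_def)
    qed (auto simp: A_def)
  qed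
  have cover: "S \<subseteq> (\<Union>m. A5 m)"
  proof
    fix x assume "x \<in> S"
    then obtain i where i: "i \<in> C" "x \<in> ball i (5 * r i)" using C(4) by blast
    then have "x \<in> A5 (to_nat_on C i)" using C(1) by (simp add: A5_def)
    then show "x \<in> (\<Union>m. A5 m)" by blast
  qed
  have A5A: "ennreal t * emeasure lborel (A5 m) \<le> 5 ^ n * (\<integral>\<^sup>+y. f y * indicator (A m) y \<partial>lborel)" for m
  proof (cases "m \<in> to_nat_on C ` C")
    case True
    then obtain i where i: "i \<in> C" "m = to_nat_on C i" by blast
    then have "i \<in> S" "from_nat_into C m = i" using C(1,2) by auto
    then have "ennreal t * emeasure lborel (A5 m) = ennreal (5 ^ n * (t * (w * r i ^ n)))"
      using True em[of 5 i] t w r0[of i] by (simp add: A5_def ennreal_mult'[symmetric] power_mult_distrib mult_ac)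
    also have "\<dots> = 5 ^ n * ennreal (t * (w * r i ^ n))"
      using t w r0[of i] by (simp add: ennreal_mult less_imp_le flip: ennreal_power)
    also have "\<dots> \<le> 5 ^ n * (\<integral>\<^sup>+y. f y * indicator (A m) y \<partial>lborel)"
      using True key[OF \<open>i \<in> S\<close>] \<open>from_nat_into C m = i\<close> by (intro mult_left_mono) (auto simp: A_def)
    finally show ?thesis .
  qed (simp add: A5_def)
  have "ennreal t * emeasure lborel S \<le> ennreal t * (\<Sum>m. emeasure lborel (A5 m))"
    by (intro mult_left_mono order_trans[OF emeasure_mono[OF cover] emeasure_subadditive_countably]) auto
  also have "\<dots> = (\<Sum>m. ennreal t * emeasure lborel (A5 m))" by simp
  also have "\<dots> \<le> (\<Sum>m. 5 ^ n * (\<integral>\<^sup>+y. f y * indicator (A m) y \<partial>lborel))"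
    by (intro suminf_le A5A) auto
  also have "\<dots> = 5 ^ n * (\<Sum>m. \<integral>\<^sup>+y. f y * indicator (A m) y \<partial>lborel)" by simp
  also have "(\<Sum>m. \<integral>\<^sup>+y. f y * indicator (A m) y \<partial>lborel) = (\<integral>\<^sup>+y. (\<Sum>m. f y * indicator (A m) y) \<partial>lborel)"
    by (rule nn_integral_suminf[symmetric]) measurable
  also have "\<dots> = (\<integral>\<^sup>+y. f y * indicator (\<Union>m. A m) y \<partial>lborel)"
    using disj by (simp add: suminf_indicator)
  also have "\<dots> \<le> (\<integral>\<^sup>+y. f y \<partial>lborel)"
    by (intro nn_integral_mono) (auto simp: indicator_def)
  finally show ?thesis by (simp add: S_def n_def mult_left_mono)
qed

text \<open>Marcinkiewicz interpolation between the weak (1,1) bound and the trivial bound at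
  infinity: at height \<open>t\<close> only the part of \<open>f\<close> above \<open>t / 2\<close>
  matters. The constant blows up as \<open>r\<close> approaches 1.\<close>

lemma maximal_strong_type:
  fixes f :: "'a::euclidean_space \<Rightarrow> real"
  assumes f[measurable]: "f \<in> borel_measurable borel" and f0: "\<And>x. 0 \<le> f x" and r: "1 < r"
  shows "(\<integral>\<^sup>+x. epow (maximal (\<lambda>y. ennreal (f y)) x) r \<partial>lborel)
    \<le> ennreal (2 * 5 ^ DIM('a) * r * 2 powr (r - 1) / (r - 1)) * (\<integral>\<^sup>+x. ennreal (f x powr r) \<partial>lborel)"
proof -
  let ?M = "maximal (\<lambda>y. ennreal (f y))"
  let ?D = "2 * 5 ^ DIM('a) * r :: real"
  have weak: "ennreal (r * t powr (r - 1)) * emeasure lborel {x. ennreal t < ?M x}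
      \<le> (\<integral>\<^sup>+y. ennreal (?D * t powr (r - 2)) * (ennreal (f y) * indicator {y. t < 2 * f y} y) \<partial>lborel)" if t: "0 < t" for t
  proof -
    let ?g = "\<lambda>y. ennreal (f y) * indicator {y. t < 2 * f y} y"
    \<comment> \<open>The discarded part is at most \<open>t / 2\<close>, and so is its maximal
      function; half of the height \<open>t\<close> remains for the part that is kept.\<close>
    have "ennreal (f y) \<le> ?g y + ennreal (t / 2)" for y
      using t f0[of y] by (auto simp: indicator_def intro!: ennreal_leI)
    then have "?M x \<le> maximal (\<lambda>y. ?g y + ennreal (t / 2)) x" for x by (intro maximal_mono)
    also have "maximal (\<lambda>y. ?g y + ennreal (t / 2)) x \<le> maximal ?g x + ennreal (t / 2)" for x
      by (rule order_trans[OF maximal_add]) (auto simp: maximal_const)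
    finally have Mle: "?M x \<le> maximal ?g x + ennreal (t / 2)" for x .
    have "{x. ennreal t < ?M x} \<subseteq> {x. ennreal (t/2) < maximal ?g x}"
    proof
      fix x assume "x \<in> {x. ennreal t < ?M x}"
      then have "ennreal (t/2) + ennreal (t/2) < maximal ?g x + ennreal (t / 2)"
        using Mle[of x] t by (simp flip: ennreal_plus)
      then show "x \<in> {x. ennreal (t/2) < maximal ?g x}"
        by (metis (mono_tags, lifting) add_right_mono linorder_not_less mem_Collect_eq)
    qed
    then have "emeasure lborel {x. ennreal t < ?M x} \<le> emeasure lborel {x. ennreal (t/2) < maximal ?g x}"
      by (intro emeasure_mono) auto
    then have "ennreal (r * t powr (r - 1)) * emeasure lborel {x. ennreal t < ?M x}
      \<le> ennreal (2 * r * t powr (r - 2)) * (ennreal (t/2) * emeasure lborel {x. ennreal (t/2) < maximal ?g x})"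
    proof -
      have "2 * r * t powr (r - 2) * (t/2) = r * t powr (r - 1)"
        using t by (simp add: powr_diff)  (simp add: power2_eq_square)
      then have "ennreal (2 * r * t powr (r - 2)) * ennreal (t/2) = ennreal (r * t powr (r - 1))"
        using t r by (subst ennreal_mult[symmetric]) auto
      then show ?thesis
        using \<open>emeasure lborel _ \<le> _\<close> by (simp add: mult.assoc[symmetric] mult_left_mono)
    qed
    also have "\<dots> \<le> ennreal (2 * r * t powr (r - 2)) * (5 ^ DIM('a) * (\<integral>\<^sup>+y. ?g y \<partial>lborel))"
      using t by (intro mult_left_mono maximal_weak_type) auto
    also have "\<dots> = (\<integral>\<^sup>+y. ennreal (?D * t powr (r - 2)) * ?g y \<partial>lborel)"
    proof -
      have "ennreal (2 * r * t powr (r - 2)) * 5 ^ DIM('a) = ennreal (2 * r * t powr (r - 2)) * ennreal (5 ^ DIM('a))"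
        by (simp flip: ennreal_power)
      also have "\<dots> = ennreal (?D * t powr (r - 2))"
        using t r by (simp add: ennreal_mult[symmetric] mult_ac)
      finally show ?thesis by (subst nn_integral_cmult) (auto simp: mult.assoc[symmetric])
    qed
    finally show ?thesis .
  qed
  have "(\<integral>\<^sup>+x. epow (?M x) r \<partial>lborel)
      = (\<integral>\<^sup>+x. \<integral>\<^sup>+t. ennreal (r * t powr (r - 1)) * indicator {t. 0 < t \<and> ennreal t < ?M x} t \<partial>lborel \<partial>lborel)"
    using r by (simp add: epow_layer_cake)
  also have "\<dots> = (\<integral>\<^sup>+x. \<integral>\<^sup>+t. ennreal (r * t powr (r - 1)) * indicator {z. 0 < fst z \<and> ennreal (fst z) < ?M (snd z)} (t, x) \<partial>lborel \<partial>lborel)"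
    by (simp add: indicator_def)
  also have "\<dots> = (\<integral>\<^sup>+t. \<integral>\<^sup>+x. ennreal (r * t powr (r - 1)) * indicator {z. 0 < fst z \<and> ennreal (fst z) < ?M (snd z)} (t, x) \<partial>lborel \<partial>lborel)"
    by (rule lborel_pair.Fubini') measurable
  also have "\<dots> \<le> (\<integral>\<^sup>+t. indicator {0<..} t * (\<integral>\<^sup>+y. ennreal (?D * t powr (r - 2)) * (ennreal (f y) * indicator {y. t < 2 * f y} y) \<partial>lborel) \<partial>lborel)"
  proof (rule nn_integral_mono)
    fix t :: real
    show "(\<integral>\<^sup>+x. ennreal (r * t powr (r - 1)) * indicator {z. 0 < fst z \<and> ennreal (fst z) < ?M (snd z)} (t, x) \<partial>lborel)
      \<le> indicator {0<..} t * (\<integral>\<^sup>+y. ennreal (?D * t powr (r - 2)) * (ennreal (f y) * indicator {y. t < 2 * f y} y) \<partial>lborel)"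
    proof (cases "0 < t")
      case True
      have "(\<integral>\<^sup>+x. ennreal (r * t powr (r - 1)) * indicator {z. 0 < fst z \<and> ennreal (fst z) < ?M (snd z)} (t, x) \<partial>lborel)
         = (\<integral>\<^sup>+x. ennreal (r * t powr (r - 1)) * indicator {x. ennreal t < ?M x} x \<partial>lborel)"
        using True by (intro nn_integral_cong) (auto simp: indicator_def)
      also have "\<dots> = ennreal (r * t powr (r - 1)) * emeasure lborel {x. ennreal t < ?M x}"
        by (rule nn_integral_cmult_indicator) measurable
      finally show ?thesis using weak[OF True] True by simp
    qed (simp add: indicator_def)
  qed
  also have "\<dots> = (\<integral>\<^sup>+t. \<integral>\<^sup>+y. indicator {0<..} t * (ennreal (?D * t powr (r - 2)) * (ennreal (f y) * indicator {z. fst z < 2 * f (snd z)} (t, y))) \<partial>lborel \<partial>lborel)"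
    by (intro nn_integral_cong, subst nn_integral_cmult[symmetric]) (auto simp: indicator_def)
  also have "\<dots> = (\<integral>\<^sup>+y. \<integral>\<^sup>+t. indicator {0<..} t * (ennreal (?D * t powr (r - 2)) * (ennreal (f y) * indicator {z. fst z < 2 * f (snd z)} (t, y))) \<partial>lborel \<partial>lborel)"
    by (rule lborel_pair.Fubini'[symmetric]) measurable
  \<comment> \<open>For fixed \<open>y\<close> the heights run through
    \<open>{0<..<2 * f y}\<close>, and \<open>t powr (r - 2)\<close> is integrable at 0 because
    \<open>r > 1\<close>.\<close>
  also have "\<dots> = (\<integral>\<^sup>+y. ennreal (f y) * (\<integral>\<^sup>+t. ennreal (?D * t powr (r - 2)) * indicator {0<..<2 * f y} t \<partial>lborel) \<partial>lborel)"
    by (intro nn_integral_cong, subst nn_integral_cmult[symmetric]) (auto simp: indicator_def mult_ac intro!: nn_integral_cong)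
  also have "\<dots> = (\<integral>\<^sup>+y. ennreal (?D * 2 powr (r - 1) / (r - 1)) * ennreal (f y powr r) \<partial>lborel)"
  proof (rule nn_integral_cong)
    fix y
    have "ennreal (f y) * (\<integral>\<^sup>+t. ennreal (?D * t powr (r - 2)) * indicator {0<..<2 * f y} t \<partial>lborel)
       = ennreal (f y) * ennreal (?D * ((2 * f y) powr (r - 2 + 1) / (r - 2 + 1)))"
      using f0[of y] r by (subst nn_integral_powr_0) auto
    also have "\<dots> = ennreal (f y * (?D * ((2 * f y) powr (r - 2 + 1) / (r - 2 + 1))))"
      using f0[of y] r by (subst ennreal_mult) auto
    also have "f y * (?D * ((2 * f y) powr (r - 2 + 1) / (r - 2 + 1))) = (?D * 2 powr (r - 1) / (r - 1)) * f y powr r"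
    proof (cases "f y = 0")
      case False
      then have "f y * f y powr (r - 1) = f y powr r" using f0[of y] by (simp add: powr_diff)
      then show ?thesis using f0[of y] r by (simp add: powr_mult field_simps)
    qed (use r in auto)
    also have "ennreal \<dots> = ennreal (?D * 2 powr (r - 1) / (r - 1)) * ennreal (f y powr r)"
      using r by (subst ennreal_mult) auto
    finally show "ennreal (f y) * (\<integral>\<^sup>+t. ennreal (?D * t powr (r - 2)) * indicator {0<..<2 * f y} t \<partial>lborel)
       = ennreal (?D * 2 powr (r - 1) / (r - 1)) * ennreal (f y powr r)" .
  qed
  also have "\<dots> = ennreal (?D * 2 powr (r - 1) / (r - 1)) * (\<integral>\<^sup>+y. ennreal (f y powr r) \<partial>lborel)"
    by (rule nn_integral_cmult) measurable
  finally show ?thesis .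
qed

text \<open>A kernel of this decay is dominated by a sum of multiples of ball indicators. The ball
  of radius 2^(k+i) enters with weight 2^(-i(n+1)) against volume 2^(i n), so the averages sum like
  a geometric series of ratio 1/2.\<close>

lemma nn_integral_decay_maximal:
  fixes f :: "'a::euclidean_space \<Rightarrow> ennreal" and k :: int
  assumes f[measurable]: "f \<in> borel_measurable borel"
  shows "(\<integral>\<^sup>+y. f y * ennreal (1 / (1 + norm (x - y) / 2 powr k) ^ (DIM('a) + 1)) \<partial>lborel)
    \<le> ennreal (unit_ball_vol (real DIM('a)) * 2 ^ (DIM('a) + 2) * (2 powr k) ^ DIM('a)) * maximal f x"
proof -
  define n where "n = DIM('a)"
  define w where "w = unit_ball_vol (real n)"
  have w: "0 < w" by (simp add: w_def)
  define R where "R = (2::real) powr k"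
  have R: "0 < R" by (simp add: R_def)
  have pt: "ennreal (1 / (1 + s) ^ (n+1)) \<le> (\<Sum>i. ennreal (2^(n+1) / 2^(i*(n+1))) * indicator {..< 2^i} s)" if s: "0 \<le> s" for s :: real
  proof -
    obtain i0 where "s < 2 ^ i0" using real_arch_pow[of 2 s] by auto
    \<comment> \<open>Minimality gives \<open>2 ^ i \<le> 2 * (1 + s)\<close>: either
      \<open>i = 0\<close>, or \<open>s\<close> is at least half of \<open>2 ^ i\<close>.\<close>
    define i where "i = (LEAST i. s < 2 ^ i)"
    have i: "s < 2 ^ i" unfolding i_def using \<open>s < 2 ^ i0\<close> by (rule LeastI)
    have le: "2 ^ i \<le> 2 * (1 + s)"
    proof (cases i)
      case (Suc j)
      then have "\<not> s < 2 ^ j" unfolding i_def using not_less_Least[of j "\<lambda>i. s < 2 ^ i"] i_def by auto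
      then show ?thesis using Suc by simp
    qed (use s in auto)
    have "(2^i)^(n+1) \<le> (2 * (1 + s))^(n+1)" using le by (intro power_mono) auto
    then have "1 / (1 + s) ^ (n+1) \<le> 2^(n+1) / 2^(i*(n+1))"
      using s by (simp only: power_mult power_mult_distrib) (simp add: divide_simps mult_ac)
    then have "ennreal (1 / (1 + s) ^ (n+1)) \<le> ennreal (2^(n+1) / 2^(i*(n+1))) * indicator {..< 2^i} s"
      using i by (simp add: ennreal_leI)
    also have "\<dots> = (\<Sum>j\<in>{i}. ennreal (2^(n+1) / 2^(j*(n+1))) * indicator {..< 2^j} s)"
      by (subst sum.insert) simp_all
    also have "\<dots> \<le> (\<Sum>i. ennreal (2^(n+1) / 2^(i*(n+1))) * indicator {..< 2^i} s)"
      by (rule sum_le_suminf) auto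
    finally show ?thesis .
  qed
  have ball: "(\<integral>\<^sup>+y. f y * indicator (ball x (2 powr real_of_int l)) y \<partial>lborel)
    \<le> ennreal (w * (2 powr real_of_int l) ^ n) * maximal f x" for l :: int
  proof -
    have em: "emeasure lborel (ball x (2 powr real_of_int l)) = ennreal (w * (2 powr real_of_int l) ^ n)"
      by (simp add: emeasure_ball w_def n_def)
    have "avg f x (2 powr real_of_int l) * ennreal (w * (2 powr real_of_int l) ^ n)
      = (\<integral>\<^sup>+y. f y * indicator (ball x (2 powr real_of_int l)) y \<partial>lborel)"
      unfolding avg_def em using w
      by (intro ennreal_divide_times[THEN trans]) (simp add: ennreal_times_divide[symmetric] ennreal_divide_self)
    then show ?thesis
      using mult_right_mono[OF avg_le_maximal[of f x l]] by (metis mult.commute zero_le)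
  qed
  have "(\<integral>\<^sup>+y. f y * ennreal (1 / (1 + norm (x - y) / R) ^ (n + 1)) \<partial>lborel)
     \<le> (\<integral>\<^sup>+y. (\<Sum>i. ennreal (2^(n+1) / 2^(i*(n+1))) * (f y * indicator (ball x (2 powr real_of_int (k + int i))) y)) \<partial>lborel)"
  proof (rule nn_integral_mono)
    fix y
    have "f y * ennreal (1 / (1 + norm (x - y) / R) ^ (n + 1))
      \<le> f y * (\<Sum>i. ennreal (2^(n+1) / 2^(i*(n+1))) * indicator {..< 2^i} (norm (x - y) / R))"
      using R by (intro mult_left_mono pt) auto
    also have "\<dots> = (\<Sum>i. f y * (ennreal (2^(n+1) / 2^(i*(n+1))) * indicator {..< 2^i} (norm (x - y) / R)))"
      by simp
    also have "\<dots> = (\<Sum>i. ennreal (2^(n+1) / 2^(i*(n+1))) * (f y * indicator (ball x (2 powr real_of_int (k + int i))) y))"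
    proof (rule suminf_cong)
      fix i :: nat
      have "norm (x - y) / R < 2^i \<longleftrightarrow> y \<in> ball x (2 powr real_of_int (k + int i))"
        using R by (simp add: dist_norm R_def powr_add powr_realpow field_simps)
      then show "f y * (ennreal (2^(n+1) / 2^(i*(n+1))) * indicator {..< 2^i} (norm (x - y) / R))
        = ennreal (2^(n+1) / 2^(i*(n+1))) * (f y * indicator (ball x (2 powr real_of_int (k + int i))) y)"
        by (auto simp: indicator_def mult_ac)
    qed
    finally show "f y * ennreal (1 / (1 + norm (x - y) / R) ^ (n + 1))
      \<le> (\<Sum>i. ennreal (2^(n+1) / 2^(i*(n+1))) * (f y * indicator (ball x (2 powr real_of_int (k + int i))) y))" .
  qed
  also have "\<dots> = (\<Sum>i. ennreal (2^(n+1) / 2^(i*(n+1))) * (\<integral>\<^sup>+y. f y * indicator (ball x (2 powr real_of_int (k + int i))) y \<partial>lborel))"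
    by (subst nn_integral_suminf) (auto intro!: suminf_cong nn_integral_cmult borel_measurable_times_ennreal borel_measurable_indicator)
  also have "\<dots> \<le> (\<Sum>i. ennreal (w * 2^(n+1) * R ^ n) * maximal f x * ennreal ((1/2)^i))"
  proof (rule suminf_le)
    fix i :: nat
    have "ennreal (2^(n+1) / 2^(i*(n+1))) * (\<integral>\<^sup>+y. f y * indicator (ball x (2 powr real_of_int (k + int i))) y \<partial>lborel)
      \<le> ennreal (2^(n+1) / 2^(i*(n+1))) * (ennreal (w * (2 powr real_of_int (k + int i)) ^ n) * maximal f x)"
      by (intro mult_left_mono ball) auto
    also have "\<dots> = ennreal (2^(n+1) / 2^(i*(n+1)) * (w * (2 powr real_of_int (k + int i)) ^ n)) * maximal f x"
      by (subst ennreal_mult[of "2^(n+1) / 2^(i*(n+1))"]) (use w in \<open>auto simp only: mult.assoc zero_le_divide_iff zero_le_mult_iff zero_le_power zero_le_numeral powr_ge_zero less_imp_le\<close>)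
    also have "2^(n+1) / 2^(i*(n+1)) * (w * (2 powr real_of_int (k + int i)) ^ n) = w * 2^(n+1) * R ^ n * (1/2)^i"
      by (simp add: R_def powr_add powr_realpow power_mult_distrib power_add power_mult field_simps)
    also have "ennreal \<dots> = ennreal (w * 2^(n+1) * R ^ n) * ennreal ((1/2)^i)"
      using w R by (intro ennreal_mult) auto
    finally show "ennreal (2^(n+1) / 2^(i*(n+1))) * (\<integral>\<^sup>+y. f y * indicator (ball x (2 powr real_of_int (k + int i))) y \<partial>lborel)
      \<le> ennreal (w * 2^(n+1) * R ^ n) * maximal f x * ennreal ((1/2)^i)"
      by (simp add: mult_ac)
  qed auto
  also have "\<dots> = ennreal (w * 2^(n+1) * R ^ n) * maximal f x * (\<Sum>i. ennreal ((1/2)^i))" by simp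
  \<comment> \<open>This 2 joins the 2^(n+1) lost by rounding the radius up to a power of 2, hence
    2^(n+2) in the statement.\<close>
  also have "(\<Sum>i. ennreal ((1/2)^i)) = ennreal 2"
    by (intro suminf_ennreal_eq) (auto intro: geometric_sums[of "1/2::real", simplified])
  also have "ennreal (w * 2^(n+1) * R ^ n) * maximal f x * ennreal 2 = ennreal (w * 2^(n+2) * R ^ n) * maximal f x"
    using w R by (simp add: mult_ac ennreal_mult)
  finally show ?thesis by (simp add: n_def w_def R_def)
qed

text \<open>Integrability of the decay weight is the kernel estimate for the constant function 1,
  whose maximal function is 1.\<close>

lemma nn_integral_decay_finite:
  "(\<integral>\<^sup>+y. ennreal (1 / (1 + norm (y::'a::euclidean_space)) ^ (DIM('a) + 1)) \<partial>lborel) < \<infinity>"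
proof -
  have "(\<integral>\<^sup>+y. 1 * ennreal (1 / (1 + norm ((0::'a) - y) / 2 powr real_of_int 0) ^ (DIM('a) + 1)) \<partial>lborel)
    \<le> ennreal (unit_ball_vol (real DIM('a)) * 2 ^ (DIM('a) + 2) * (2 powr real_of_int 0) ^ DIM('a)) * maximal (\<lambda>_. 1) (0::'a)"
    by (rule nn_integral_decay_maximal) simp
  also have "\<dots> < \<infinity>" by (simp add: maximal_const)
  finally show ?thesis by simp
qed

subsection \<open>Log-Hoelder exponents\<close>

text \<open>Absorption: half of a finite quantity is cancelled from a bound in which it reappears on
  the right. In \<open>ennreal\<close> this depends on finiteness of \<open>A\<close>.\<close>

lemma ennreal_self_le_half:
  fixes A B :: ennreal
  assumes "A \<le> ennreal (c/2) + B" "A = ennreal c" "0 \<le> c"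
  shows "ennreal (c/2) \<le> B"
proof (cases B)
  case (real b)
  then have "ennreal c \<le> ennreal (c/2 + b)" using assms by simp
  then have "c \<le> c / 2 + b" using assms real by (subst (asm) ennreal_le_iff) auto
  then show ?thesis using real by (simp add: ennreal_leI)
qed simp

lemma epow_mono: "a \<le> b \<Longrightarrow> 0 \<le> r \<Longrightarrow> epow a r \<le> epow b r"
  by (cases a; cases b) (auto simp: epow_def simp: top_unique intro!: ennreal_leI powr_mono2)

lemma epow_measurable [measurable]:
  assumes [measurable]: "f \<in> borel_measurable M" "p \<in> borel_measurable M"
  shows "(\<lambda>x. epow (f x) (p x)) \<in> borel_measurable M"
  unfolding epow_def by measurable

text \<open>Both hypotheses are consequences of the log-Hoelder conditions for \<open>1 / P\<close>, since \<open>P\<close> is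
  bounded.\<close>

locale log_exponent =
  fixes P :: "'a::euclidean_space \<Rightarrow> real" and a b K Pinf :: real
  assumes P_measurable [measurable]: "P \<in> borel_measurable borel"
    and a1: "1 < a" and Pa: "a \<le> P x" and Pb: "P x \<le> b"
    and Pinfa: "a \<le> Pinf" and K0: "0 \<le> K"
    and log_local: "\<bar>P x - P y\<bar> \<le> K / ln (exp 1 + 1 / norm (x - y))"
    and log_decay: "\<bar>P x - Pinf\<bar> \<le> K / ln (exp 1 + norm x)"
begin

lemma P_pos: "0 < P x" "0 \<le> P x" "1 < P x" using a1 Pa[of x] by auto

lemma ab: "a \<le> b" using Pa[of 0] Pb[of 0] by linarith

text \<open>Dividing by \<open>a\<close> leaves an exponent of at least 1, enough for pointwise
  estimates of averages, and reserves the constant exponent \<open>a > 1\<close> for the strong type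
  inequality.\<close>

abbreviation q :: "'a \<Rightarrow> real" where "q x \<equiv> P x / a"

lemma q1: "1 \<le> q x" and qb: "q x \<le> b"
proof -
  show "1 \<le> q x" using a1 Pa[of x] by simp
  have "q x \<le> P x" using a1 P_pos[of x] by (simp add: divide_le_eq)
  then show "q x \<le> b" using Pb[of x] by linarith
qed

text \<open>The averages of \<open>f \<le> f powr P\<close> are at most the reciprocal volume of the ball, so that the
  local log-Hoelder condition limits the oscillation of the exponent to a bounded factor.\<close>

lemma avg_powr_le:
  assumes f[measurable]: "f \<in> borel_measurable borel" and f0: "\<And>y. f y = 0 \<or> 1 \<le> f y"
    and m: "(\<integral>\<^sup>+y. ennreal (f y powr P y) \<partial>lborel) \<le> 1" and r: "0 < r"
  shows "epow (avg (\<lambda>y. ennreal (f y)) x r) (q x)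
    \<le> ennreal (2 powr b * exp (K * (\<bar>ln (unit_ball_vol (real DIM('a)))\<bar> + DIM('a)))) * avg (\<lambda>y. ennreal (f y powr q y)) x r"
proof -
  define n where "n = real DIM('a)"
  define w where "w = unit_ball_vol n"
  have w: "0 < w" by (simp add: w_def n_def)
  define v where "v = w * r ^ DIM('a)"
  have v: "0 < v" using w r by (simp add: v_def)
  define D where "D = exp (K * (\<bar>ln w\<bar> + n))"
  have D1: "1 \<le> D" using K0 by (simp add: D_def n_def)
  have em: "emeasure lborel (ball x r) = ennreal v"
    using r by (simp add: emeasure_ball v_def w_def n_def)
  have fnn: "0 \<le> f y" for y using f0[of y] by auto
  let ?A = "avg (\<lambda>y. ennreal (f y)) x r" and ?G = "avg (\<lambda>y. ennreal (f y powr q y)) x r"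
  have fle: "f y \<le> f y powr s" if "1 \<le> s" for y s
  proof (cases "f y = 0")
    case False
    then have "f y powr 1 \<le> f y powr s" using f0[of y] that by (intro powr_mono) auto
    then show ?thesis using False f0[of y] by simp
  qed simp
  have "?A \<le> 1 / ennreal v"
  proof -
    have "(\<integral>\<^sup>+y. ennreal (f y) * indicator (ball x r) y \<partial>lborel) \<le> (\<integral>\<^sup>+y. ennreal (f y powr P y) \<partial>lborel)"
      using fle[OF less_imp_le[OF P_pos(3)]] by (intro nn_integral_mono) (auto simp: indicator_def intro!: ennreal_leI)
    also have "\<dots> \<le> 1" by (rule m)
    finally show ?thesis unfolding avg_def em by (rule divide_right_mono_ennreal)
  qed
  then have Ale: "?A \<le> ennreal (1 / v)" using v by (simp add: divide_ennreal flip: ennreal_1)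
  then obtain A where A: "0 \<le> A" "?A = ennreal A" "A \<le> 1 / v"
    using v by (cases ?A) (auto simp: top_unique)
  have AG: "?A \<le> ?G" by (intro avg_mono ennreal_leI fle q1)
  have "epow ?A (q x) \<le> ennreal (2 powr b * D) * ?G"
  \<comment> \<open>For small averages \<open>f \<le> f powr q\<close> suffices, since the power of
    \<open>A\<close> costs at most \<open>2 powr b\<close>. In the other case \<open>A / 2\<close>
    is at least 1, so its logarithm is nonnegative and the oscillation of the exponent can be
    measured against it.\<close>
  proof (cases "A < 2")
    case True
    have "A powr q x \<le> 2 powr b * D * A"
    proof (cases "A = 0")
      case False
      have "A powr q x = A powr (q x - 1) * A" using A False by (simp add: powr_diff)
      also have "A powr (q x - 1) \<le> 2 powr (q x - 1)" using A True q1[of x] by (intro powr_mono2) auto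
      also have "(2::real) powr (q x - 1) \<le> 2 powr b" using qb[of x] by (intro powr_mono) auto
      also have "2 powr b \<le> 2 powr b * D" using D1 by simp
      finally show ?thesis using A by (simp add: mult_right_mono)
    qed simp
    then have "epow ?A (q x) \<le> ennreal (2 powr b * D * A)" using A by (simp add: ennreal_leI)
    also have "\<dots> = ennreal (2 powr b * D) * ?A" using A D1 by (subst ennreal_mult) auto
    also have "\<dots> \<le> ennreal (2 powr b * D) * ?G" by (intro mult_left_mono AG) auto
    finally show ?thesis .
  next
    case False
    then have A2: "2 \<le> A" by simp
    \<comment> \<open>Because \<open>A \<le> 1 / v\<close>, the logarithm of \<open>A\<close> is at
      most a multiple of the one in the modulus of continuity at scale \<open>r\<close>. The two
      logarithms cancel in the product, and what remains is the constant that defines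
      \<open>D\<close>.\<close>
    have key: "(A / 2) powr (q x - q y) \<le> D" if y: "y \<in> ball x r" for y
    proof (cases "x = y")
      case True then show ?thesis using D1 A2 by simp
    next
      case False
      define d where "d = norm (x - y)"
      have d: "0 < d" "d < r" using False y by (auto simp: d_def dist_norm)
      define lr where "lr = ln (exp 1 + 1 / r)"
      have lr1: "1 \<le> lr" unfolding lr_def using r by (subst ln_ge_iff) (auto intro: add_pos_pos)
      have "ln (1 / r) \<le> lr" unfolding lr_def using r by (intro ln_mono) (auto intro: add_pos_pos)
      have "ln A \<le> ln (1 / v)" using A A2 v by (intro ln_mono) auto
      also have "\<dots> = - ln w + n * ln (1/r)"
        using w r by (simp add: v_def ln_div ln_mult ln_realpow n_def)
      also have "\<dots> \<le> \<bar>ln w\<bar> * 1 + n * lr" using \<open>ln (1/r) \<le> lr\<close> by (intro add_mono mult_left_mono) (auto simp: n_def)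
      also have "\<dots> \<le> \<bar>ln w\<bar> * lr + n * lr" using lr1 by (intro add_mono mult_left_mono) (auto simp: n_def)
      finally have lnA: "ln A \<le> (\<bar>ln w\<bar> + n) * lr" by (simp add: distrib_right)
      have "lr \<le> ln (exp 1 + 1 / d)" unfolding lr_def using d r
        by (intro ln_mono add_left_mono) (auto intro: add_pos_pos simp: frac_le)
      have "\<bar>q x - q y\<bar> = \<bar>P x - P y\<bar> / a" using a1 by (simp add: diff_divide_distrib[symmetric] abs_divide)
      also have "\<dots> \<le> \<bar>P x - P y\<bar>" using a1 by (simp add: divide_le_eq mult_le_cancel_left1)
      also have "\<dots> \<le> K / ln (exp 1 + 1 / d)" unfolding d_def by (rule log_local)
      also have "\<dots> \<le> K / lr" using K0 lr1 \<open>lr \<le> _\<close> by (intro divide_left_mono) auto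
      finally have qq: "\<bar>q x - q y\<bar> \<le> K / lr" .
      have "ln (A / 2) \<le> ln A" "0 \<le> ln (A / 2)" using A2 by auto
      have "(q x - q y) * ln (A / 2) \<le> \<bar>q x - q y\<bar> * ln A"
        using \<open>ln (A / 2) \<le> ln A\<close> \<open>0 \<le> ln (A / 2)\<close> by (intro mult_mono) auto
      also have "\<dots> \<le> (K / lr) * ((\<bar>ln w\<bar> + n) * lr)"
        using qq lnA K0 lr1 A2 by (intro mult_mono) auto
      also have "\<dots> = K * (\<bar>ln w\<bar> + n)" using lr1 by simp
      finally show ?thesis unfolding D_def powr_def using A2 by simp
    qed
    \<comment> \<open>The values of \<open>f\<close> are split at height \<open>A / 2\<close>. Above
      it \<open>f\<close> is dominated by its power \<open>q y\<close>, and \<open>E\<close>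
      includes the cost of exchanging \<open>q y\<close> for \<open>q x\<close>.\<close>
    define E where "E = D * (A / 2) powr (1 - q x)"
    have E0: "0 \<le> E" using D1 by (simp add: E_def)
    have pt: "f y * indicator (ball x r) y \<le> (A / 2 + E * f y powr q y) * indicator (ball x r) y" for y
    proof (cases "y \<in> ball x r \<and> A / 2 < f y")
      case True
      then have fy: "A / 2 < f y" "1 \<le> f y" using A2 by auto
      have "f y = f y powr q y * f y powr (1 - q y)" using fy by (simp flip: powr_add)
      also have "\<dots> \<le> f y powr q y * (A / 2) powr (1 - q y)"
        using fy A2 q1[of y] by (intro mult_left_mono powr_mono2') auto
      also have "(A / 2) powr (1 - q y) = (A / 2) powr (1 - q x) * (A / 2) powr (q x - q y)"
        by (simp flip: powr_add)
      also have "f y powr q y * \<dots> \<le> f y powr q y * ((A / 2) powr (1 - q x) * D)"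
        using key[of y] True by (intro mult_left_mono) auto
      finally have "f y \<le> E * f y powr q y" by (simp add: E_def mult_ac)
      then show ?thesis using A2 by (auto simp: indicator_def)
    next
      case False
      then show ?thesis using E0 fnn[of y] by (auto simp: indicator_def intro: order_trans[of _ "A/2"])
    qed
    have "?A \<le> avg (\<lambda>y. ennreal (A / 2) + ennreal E * ennreal (f y powr q y)) x r"
    proof -
      have "ennreal (f y) * indicator (ball x r) y \<le> (ennreal (A / 2) + ennreal E * ennreal (f y powr q y)) * indicator (ball x r) y" for y
        using pt[of y] E0 A2 by (auto simp: indicator_def ennreal_mult'[symmetric] simp flip: ennreal_plus intro!: ennreal_leI)
      then show ?thesis unfolding avg_def by (intro divide_right_mono_ennreal nn_integral_mono)
    qed
    also have "\<dots> = ennreal (A / 2) + ennreal E * ?G"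
      using r by (simp add: avg_add avg_cmult avg_const)
    \<comment> \<open>The average of the constant \<open>A / 2\<close> is half of the left-hand side
      and is absorbed there.\<close>
    finally have "ennreal (A / 2) \<le> ennreal E * ?G"
      using A by (intro ennreal_self_le_half) auto
    then have "ennreal ((A / 2) powr (q x - 1)) * ennreal (A / 2) \<le> ennreal ((A / 2) powr (q x - 1)) * (ennreal E * ?G)"
      by (intro mult_left_mono) auto
    also have "ennreal ((A / 2) powr (q x - 1)) * ennreal (A / 2) = ennreal ((A / 2) powr q x)"
      using A2 by (simp add: ennreal_mult'[symmetric] powr_diff)
    also have "ennreal ((A / 2) powr (q x - 1)) * (ennreal E * ?G) = ennreal ((A / 2) powr (q x - 1) * E) * ?G"
      using E0 by (simp add: ennreal_mult mult.assoc)
    also have "(A / 2) powr (q x - 1) * E = D"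
      using A2 by (simp add: E_def mult.left_commute[of _ D] flip: powr_add)
    finally have *: "ennreal ((A / 2) powr q x) \<le> ennreal D * ?G" .
    have "A powr q x = 2 powr q x * (A / 2) powr q x" using A2 by (simp add: powr_divide)
    also have "\<dots> \<le> 2 powr b * (A / 2) powr q x" using qb[of x] by (intro mult_right_mono powr_mono) auto
    finally have "epow ?A (q x) \<le> ennreal (2 powr b * (A / 2) powr q x)" using A by (simp add: ennreal_leI)
    also have "\<dots> = ennreal (2 powr b) * ennreal ((A / 2) powr q x)" by (rule ennreal_mult) auto
    also have "\<dots> \<le> ennreal (2 powr b) * (ennreal D * ?G)" using * by (rule mult_left_mono) simp
    also have "\<dots> = ennreal (2 powr b * D) * ?G" using D1 by (simp add: ennreal_mult mult.assoc)
    finally show ?thesis .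
  qed
  then show ?thesis by (simp add: D_def w_def n_def)
qed

text \<open>The constant for a single average is independent of the radius. Roots of order
  \<open>q x\<close> turn the bound into one for the averages themselves, which passes to the
  supremum before the power is restored.\<close>

lemma maximal_powr_le:
  assumes f[measurable]: "f \<in> borel_measurable borel" and f0: "\<And>y. f y = 0 \<or> 1 \<le> f y"
    and m: "(\<integral>\<^sup>+y. ennreal (f y powr P y) \<partial>lborel) \<le> 1"
  shows "epow (maximal (\<lambda>y. ennreal (f y)) x) (q x)
    \<le> ennreal (2 powr b * exp (K * (\<bar>ln (unit_ball_vol (real DIM('a)))\<bar> + DIM('a)))) * maximal (\<lambda>y. ennreal (f y powr q y)) x"
    (is "_ \<le> ennreal ?D * ?G")
proof (cases "ennreal ?D * ?G")
  case (real g)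
  have "avg (\<lambda>y. ennreal (f y)) x (2 powr real_of_int k) \<le> ennreal (g powr (1 / q x))" for k
  proof -
    let ?A = "avg (\<lambda>y. ennreal (f y)) x (2 powr real_of_int k)"
    have "epow ?A (q x) \<le> ennreal ?D * avg (\<lambda>y. ennreal (f y powr q y)) x (2 powr real_of_int k)"
      by (rule avg_powr_le[OF f f0 m]) auto
    also have "\<dots> \<le> ennreal ?D * ?G" by (intro mult_left_mono avg_le_maximal) auto
    finally have *: "epow ?A (q x) \<le> ennreal g" using real by simp
    then obtain A where A: "?A = ennreal A" "0 \<le> A" by (cases ?A) (auto simp: epow_def top_unique)
    then have "A powr q x \<le> g" using * real by simp
    then have "(A powr q x) powr (1 / q x) \<le> g powr (1 / q x)" using P_pos(2)[of x] a1 by (intro powr_mono2) auto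
    moreover have "q x * (1 / q x) = 1" using q1[of x] by auto
    ultimately show ?thesis using A by (simp add: powr_powr ennreal_leI)
  qed
  then have "maximal (\<lambda>y. ennreal (f y)) x \<le> ennreal (g powr (1 / q x))"
    unfolding maximal_def by (rule SUP_least)
  then have "epow (maximal (\<lambda>y. ennreal (f y)) x) (q x) \<le> epow (ennreal (g powr (1 / q x))) (q x)"
    using q1[of x] by (intro epow_mono) auto
  also have "\<dots> = ennreal g"
  proof -
    have "1 / q x * q x = 1" using q1[of x] by auto
    then show ?thesis using real by (simp add: powr_powr)
  qed
  finally show ?thesis using real by simp
qed simp

lemma epow_epow: "0 < s \<Longrightarrow> 0 < t \<Longrightarrow> epow (epow c s) t = epow c (s * t)"
  by (cases c) (auto simp: epow_def powr_powr)

lemma epow_mult: "0 \<le> c \<Longrightarrow> 0 < t \<Longrightarrow> 0 < c \<Longrightarrow> epow (ennreal c * d) t = ennreal (c powr t) * epow d t"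
  by (cases d) (auto simp: epow_def powr_mult ennreal_mult'[symmetric] ennreal_mult_top)

text \<open>Since \<open>P = q * a\<close>, the \<open>a\<close>-th power of the pointwise bound
  leads to the strong type inequality for \<open>f powr q\<close>, whose integral of the
  \<open>a\<close>-th power is the modular of \<open>f\<close>.\<close>

lemma modular_large:
  assumes f[measurable]: "f \<in> borel_measurable borel" and f0: "\<And>y. f y = 0 \<or> 1 \<le> f y"
    and m: "(\<integral>\<^sup>+y. ennreal (f y powr P y) \<partial>lborel) \<le> 1"
  shows "(\<integral>\<^sup>+x. epow (maximal (\<lambda>y. ennreal (f y)) x) (P x) \<partial>lborel)
    \<le> ennreal ((2 powr b * exp (K * (\<bar>ln (unit_ball_vol (real DIM('a)))\<bar> + DIM('a)))) powr a
        * (2 * 5 ^ DIM('a) * a * 2 powr (a - 1) / (a - 1)))"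
proof -
  let ?D = "2 powr b * exp (K * (\<bar>ln (unit_ball_vol (real DIM('a)))\<bar> + DIM('a)))"
  let ?Ca = "2 * 5 ^ DIM('a) * a * 2 powr (a - 1) / (a - 1)"
  have "(\<integral>\<^sup>+x. epow (maximal (\<lambda>y. ennreal (f y)) x) (P x) \<partial>lborel)
    \<le> (\<integral>\<^sup>+x. ennreal (?D powr a) * epow (maximal (\<lambda>y. ennreal (f y powr q y)) x) a \<partial>lborel)"
  proof (rule nn_integral_mono)
    fix x
    have "epow (maximal (\<lambda>y. ennreal (f y)) x) (P x) = epow (epow (maximal (\<lambda>y. ennreal (f y)) x) (q x)) a"
      using P_pos[of x] a1 by (subst epow_epow) auto
    also have "\<dots> \<le> epow (ennreal ?D * maximal (\<lambda>y. ennreal (f y powr q y)) x) a"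
      using a1 by (intro epow_mono maximal_powr_le f f0 m) auto
    also have "\<dots> = ennreal (?D powr a) * epow (maximal (\<lambda>y. ennreal (f y powr q y)) x) a"
      using a1 by (subst epow_mult) auto
    finally show "epow (maximal (\<lambda>y. ennreal (f y)) x) (P x)
       \<le> ennreal (?D powr a) * epow (maximal (\<lambda>y. ennreal (f y powr q y)) x) a" .
  qed
  also have "\<dots> = ennreal (?D powr a) * (\<integral>\<^sup>+x. epow (maximal (\<lambda>y. ennreal (f y powr q y)) x) a \<partial>lborel)"
    by (rule nn_integral_cmult) measurable
  also have "\<dots> \<le> ennreal (?D powr a) * (ennreal ?Ca * (\<integral>\<^sup>+x. ennreal ((f x powr q x) powr a) \<partial>lborel))"
    using a1 by (intro mult_left_mono maximal_strong_type) auto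
  also have "(\<integral>\<^sup>+x. ennreal ((f x powr q x) powr a) \<partial>lborel) = (\<integral>\<^sup>+y. ennreal (f y powr P y) \<partial>lborel)"
    using a1 by (simp add: powr_powr)
  also have "ennreal (?D powr a) * (ennreal ?Ca * (\<integral>\<^sup>+y. ennreal (f y powr P y) \<partial>lborel)) \<le> ennreal (?D powr a) * (ennreal ?Ca * 1)"
    by (intro mult_left_mono m) auto
  also have "\<dots> = ennreal (?D powr a * ?Ca)" using a1 by (subst ennreal_mult) auto
  finally show ?thesis .
qed

abbreviation W :: "'a \<Rightarrow> real" where "W x \<equiv> 1 / (1 + norm x) ^ (DIM('a) + 1)"

text \<open>Where \<open>t\<close> exceeds a fixed negative power of \<open>exp 1 + norm x\<close>, exchanging the exponents costs a
  bounded factor. Elsewhere the left-hand sides are below the integrable function \<open>W\<close>.\<close>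

lemma powr_compare:
  assumes t: "0 \<le> t" "t \<le> 1"
  defines "D \<equiv> exp (K * (DIM('a) + 1))"
  shows "t powr P x \<le> D * t powr Pinf + W x" "t powr Pinf \<le> D * t powr P x + W x"
proof -
  define E where "E = exp 1 + norm x"
  \<comment> \<open>The power \<open>DIM('a) + 1\<close> is the one in \<open>W\<close>, which is
    integrable; it enters \<open>D\<close> as the factor of \<open>K\<close> in the
    exponent.\<close>
  define m where "m = DIM('a) + 1"
  have E: "exp 1 \<le> E" "1 + norm x \<le> E" "0 < E" by (auto simp: E_def add_pos_nonneg)
  have lnE: "1 \<le> ln E" using E by (subst ln_ge_iff) auto
  have gen: "t powr u \<le> D * t powr v + W x" if uv: "\<bar>u - v\<bar> \<le> K / ln E" "1 \<le> u" "1 \<le> v" for u v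
  proof (cases "t < 1 / E ^ m")
    case True
    have "t powr u \<le> t powr 1" using t uv by (intro powr_mono') auto
    also have "\<dots> \<le> 1 / E ^ m" using t True by simp
    also have "\<dots> \<le> W x" unfolding m_def using E by (intro divide_left_mono power_mono) (auto intro!: mult_pos_pos zero_less_power add_pos_nonneg)
    also have "\<dots> \<le> D * t powr v + W x" by (simp add: D_def)
    finally show ?thesis .
  next
    case False
    then have tE: "1 / E ^ m \<le> t" by simp
    have t0: "0 < t" using tE E by (meson less_le_trans zero_less_divide_1_iff zero_less_power)
    have "- ln t \<le> m * ln E"
    proof -
      have "ln (1 / E ^ m) \<le> ln t" using tE E t0 by (subst ln_le_cancel_iff) auto
      then show ?thesis using E by (simp add: ln_div ln_realpow)
    qed
    have "(u - v) * ln t \<le> \<bar>u - v\<bar> * (- ln t)"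
      using t t0 by (metis abs_ge_minus_self abs_le_D2 abs_mult abs_of_nonpos abs_ge_self ln_le_zero_iff)
    also have "\<dots> \<le> (K / ln E) * (m * ln E)"
      using uv \<open>- ln t \<le> m * ln E\<close> K0 lnE t t0 by (intro mult_mono) auto
    also have "\<dots> = K * m" using lnE by simp
    finally have "t powr (u - v) \<le> D" unfolding powr_def D_def m_def using t0 by simp
    then have "t powr v * t powr (u - v) \<le> t powr v * D" by (intro mult_left_mono) auto
    then have "t powr u \<le> D * t powr v" using t0 by (simp add: mult.commute flip: powr_add)
    then show ?thesis by (simp add: add_increasing2)
  qed
  have d: "\<bar>P x - Pinf\<bar> \<le> K / ln E" "\<bar>Pinf - P x\<bar> \<le> K / ln E"
    using log_decay[of x] by (auto simp: E_def abs_minus_commute)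
  show "t powr P x \<le> D * t powr Pinf + W x" "t powr Pinf \<le> D * t powr P x + W x"
    using gen[OF d(1)] gen[OF d(2)] P_pos[of x] Pinfa a1 by auto
qed

text \<open>Both \<open>f\<close> and its maximal function take values in [0,1], so the variable
  exponent can be exchanged for \<open>Pinf\<close> and back, each time with the integrable error
  \<open>W\<close>. In between stands the strong type inequality with constant exponent
  \<open>Pinf\<close>.\<close>

lemma modular_small:
  "\<exists>C. \<forall>f. f \<in> borel_measurable borel \<longrightarrow> (\<forall>y. 0 \<le> f y \<and> f y \<le> 1) \<longrightarrow>
    (\<integral>\<^sup>+y. ennreal (f y powr P y) \<partial>lborel) \<le> 1 \<longrightarrow>
    (\<integral>\<^sup>+x. epow (maximal (\<lambda>y. ennreal (f y)) x) (P x) \<partial>lborel) \<le> ennreal C"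
proof -
  obtain w where w: "0 \<le> w" "(\<integral>\<^sup>+x. ennreal (W (x::'a)) \<partial>lborel) = ennreal w"
    using nn_integral_decay_finite[where 'a='a] by (cases "\<integral>\<^sup>+x. ennreal (W (x::'a)) \<partial>lborel") auto
  let ?D = "exp (K * (DIM('a) + 1))"
  let ?Ca = "2 * 5 ^ DIM('a) * Pinf * 2 powr (Pinf - 1) / (Pinf - 1)"
  have Ca: "0 \<le> ?Ca" using Pinfa a1 by simp
  show ?thesis
  proof (intro exI[of _ "?D * (?Ca * (?D + w)) + w"] allI impI)
    fix f :: "'a \<Rightarrow> real"
    assume f[measurable]: "f \<in> borel_measurable borel" and f01: "\<forall>y. 0 \<le> f y \<and> f y \<le> 1"
      and m: "(\<integral>\<^sup>+y. ennreal (f y powr P y) \<partial>lborel) \<le> 1"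
    let ?M = "maximal (\<lambda>y. ennreal (f y))"
    have M1: "?M x \<le> 1" for x
    proof -
      have "?M x \<le> maximal (\<lambda>_. 1) x" using f01 by (intro maximal_mono) (auto simp: ennreal_le_1)
      then show ?thesis by (simp add: maximal_const)
    qed
    have "(\<integral>\<^sup>+x. epow (?M x) (P x) \<partial>lborel) \<le> (\<integral>\<^sup>+x. ennreal ?D * epow (?M x) Pinf + ennreal (W x) \<partial>lborel)"
    proof (rule nn_integral_mono)
      fix x
      obtain t where t: "0 \<le> t" "?M x = ennreal t" using M1[of x] by (cases "?M x") (auto simp: top_unique)
      then have "t \<le> 1" using M1[of x] by simp
      then have "ennreal (t powr P x) \<le> ennreal (?D * t powr Pinf + W x)"
        using powr_compare(1)[of t x] t by (intro ennreal_leI) auto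
      then show "epow (?M x) (P x) \<le> ennreal ?D * epow (?M x) Pinf + ennreal (W x)"
        using t by (simp add: ennreal_mult ennreal_plus)
    qed
    also have "\<dots> = ennreal ?D * (\<integral>\<^sup>+x. epow (?M x) Pinf \<partial>lborel) + ennreal w"
      unfolding w(2)[symmetric] by (subst nn_integral_add) (auto simp: nn_integral_cmult)
    also have "\<dots> \<le> ennreal ?D * (ennreal ?Ca * (\<integral>\<^sup>+x. ennreal (f x powr Pinf) \<partial>lborel)) + ennreal w"
      using f01 Pinfa a1 by (intro add_mono mult_left_mono maximal_strong_type) auto
    also have "\<dots> \<le> ennreal ?D * (ennreal ?Ca * ennreal (?D + w)) + ennreal w"
    proof (intro add_mono mult_left_mono)
      have "(\<integral>\<^sup>+x. ennreal (f x powr Pinf) \<partial>lborel) \<le> (\<integral>\<^sup>+x. ennreal ?D * ennreal (f x powr P x) + ennreal (W x) \<partial>lborel)"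
        using powr_compare(2) f01 
        by (intro nn_integral_mono) (auto simp: ennreal_mult'[symmetric] simp flip: ennreal_plus intro!: ennreal_leI)
      also have "\<dots> = ennreal ?D * (\<integral>\<^sup>+x. ennreal (f x powr P x) \<partial>lborel) + ennreal w"
        unfolding w(2)[symmetric] by (subst nn_integral_add) (auto simp: nn_integral_cmult)
      also have "\<dots> \<le> ennreal ?D * 1 + ennreal w"
        by (intro add_mono mult_left_mono m) auto
      finally show "(\<integral>\<^sup>+x. ennreal (f x powr Pinf) \<partial>lborel) \<le> ennreal (?D + w)"
        using w by (simp add: ennreal_plus)
    qed auto
    also have "\<dots> = ennreal (?D * (?Ca * (?D + w)) + w)"
    proof -
      have "0 \<le> ?D + w" using w by (simp add: add_nonneg_nonneg)
      then have Q: "0 \<le> ?Ca * (?D + w)" using Ca by (rule mult_nonneg_nonneg[rotated])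
      have "ennreal ?Ca * ennreal (?D + w) = ennreal (?Ca * (?D + w))"
        using Ca by (rule ennreal_mult'[symmetric])
      then have "ennreal ?D * (ennreal ?Ca * ennreal (?D + w)) = ennreal (?D * (?Ca * (?D + w)))"
        by (simp only: ennreal_mult'[symmetric] exp_ge_zero)
      moreover have "0 \<le> ?D * (?Ca * (?D + w))" using Q by (intro mult_nonneg_nonneg[OF exp_ge_zero])
      ultimately show ?thesis using w by (simp only: ennreal_plus)
    qed
    finally show "(\<integral>\<^sup>+x. epow (?M x) (P x) \<partial>lborel) \<le> ennreal (?D * (?Ca * (?D + w)) + w)" .
  qed
qed

lemma epow_add_le:
  assumes "0 \<le> r"
  shows "epow (c + d) r \<le> ennreal (2 powr r) * (epow c r + epow d r)"
proof -
  have "epow (c + d) r \<le> epow (2 * max c d) r"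
  proof (rule epow_mono)
    have "c + d \<le> max c d + max c d" by (intro add_mono) auto
    then show "c + d \<le> 2 * max c d" by (simp add: mult_2)
  qed (use assms in auto)
  also have "epow (2 * m) r = ennreal (2 powr r) * epow m r" for m
    by (cases m) (auto simp: epow_def powr_mult ennreal_mult'[symmetric] ennreal_mult_top ennreal_top_mult simp flip: ennreal_numeral)
  also have "epow (max c d) r \<le> epow c r + epow d r"
    by (simp add: max_def add_increasing add_increasing2)
  finally show ?thesis by (simp add: mult_left_mono)
qed

text \<open>The function is split at height 1 into the two regimes, each part having modular at most
  1, and the maximal operator is subadditive. The normalisation \<open>1 \<le> C\<close> later
  allows a factor \<open>1 / C\<close> to be moved inside powers with exponents of at least
  1.\<close>

theorem modular_maximal:
  "\<exists>C\<ge>1. \<forall>f. f \<in> borel_measurable borel \<longrightarrow> (\<forall>y. 0 \<le> f y) \<longrightarrow>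
    (\<integral>\<^sup>+y. ennreal (f y powr P y) \<partial>lborel) \<le> 1 \<longrightarrow>
    (\<integral>\<^sup>+x. epow (maximal (\<lambda>y. ennreal (f y)) x) (P x) \<partial>lborel) \<le> ennreal C"
proof -
  obtain C2 where C2: "\<And>f. f \<in> borel_measurable borel \<Longrightarrow> (\<And>y. 0 \<le> f y \<and> f y \<le> 1) \<Longrightarrow>
    (\<integral>\<^sup>+y. ennreal (f y powr P y) \<partial>lborel) \<le> 1 \<Longrightarrow>
    (\<integral>\<^sup>+x. epow (maximal (\<lambda>y. ennreal (f y)) x) (P x) \<partial>lborel) \<le> ennreal C2"
    using modular_small by blast
  obtain C1 where C1: "\<And>f. f \<in> borel_measurable borel \<Longrightarrow> (\<And>y. f y = 0 \<or> 1 \<le> f y) \<Longrightarrow>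
    (\<integral>\<^sup>+y. ennreal (f y powr P y) \<partial>lborel) \<le> 1 \<Longrightarrow>
    (\<integral>\<^sup>+x. epow (maximal (\<lambda>y. ennreal (f y)) x) (P x) \<partial>lborel) \<le> ennreal C1"
    using modular_large by blast
  have b0: "0 \<le> b" using ab a1 by simp
  show ?thesis
  proof (intro exI[of _ "max 1 (2 powr b * (max 0 C1 + max 0 C2))"] conjI allI impI)
    fix f :: "'a \<Rightarrow> real"
    assume f[measurable]: "f \<in> borel_measurable borel" and f0: "\<forall>y. 0 \<le> f y"
      and m: "(\<integral>\<^sup>+y. ennreal (f y powr P y) \<partial>lborel) \<le> 1"
    define f1 where "f1 y = (if 1 \<le> f y then f y else 0)" for y
    define f2 where "f2 y = (if 1 \<le> f y then 0 else f y)" for y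
    have [measurable]: "f1 \<in> borel_measurable borel" "f2 \<in> borel_measurable borel"
      unfolding f1_def f2_def by measurable
    have 1: "(\<integral>\<^sup>+x. epow (maximal (\<lambda>y. ennreal (f1 y)) x) (P x) \<partial>lborel) \<le> ennreal (max 0 C1)"
    proof -
      have "(\<integral>\<^sup>+y. ennreal (f1 y powr P y) \<partial>lborel) \<le> (\<integral>\<^sup>+y. ennreal (f y powr P y) \<partial>lborel)"
        by (intro nn_integral_mono) (auto simp: f1_def)
      with m have "(\<integral>\<^sup>+x. epow (maximal (\<lambda>y. ennreal (f1 y)) x) (P x) \<partial>lborel) \<le> ennreal C1"
        by (intro C1) (auto simp: f1_def)
      then show ?thesis by (rule order_trans) (auto intro: ennreal_leI)
    qed
    have 2: "(\<integral>\<^sup>+x. epow (maximal (\<lambda>y. ennreal (f2 y)) x) (P x) \<partial>lborel) \<le> ennreal (max 0 C2)"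
    proof -
      have "(\<integral>\<^sup>+y. ennreal (f2 y powr P y) \<partial>lborel) \<le> (\<integral>\<^sup>+y. ennreal (f y powr P y) \<partial>lborel)"
        by (intro nn_integral_mono) (auto simp: f2_def)
      with m f0 have "(\<integral>\<^sup>+x. epow (maximal (\<lambda>y. ennreal (f2 y)) x) (P x) \<partial>lborel) \<le> ennreal C2"
        by (intro C2) (auto simp: f2_def)
      then show ?thesis by (rule order_trans) (auto intro: ennreal_leI)
    qed
    have "maximal (\<lambda>y. ennreal (f y)) x \<le> maximal (\<lambda>y. ennreal (f1 y)) x + maximal (\<lambda>y. ennreal (f2 y)) x" for x
    proof -
      have "(\<lambda>y. ennreal (f y)) = (\<lambda>y. ennreal (f1 y) + ennreal (f2 y))" by (auto simp: f1_def f2_def)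
      then show ?thesis by (simp add: maximal_add)
    qed
    then have "(\<integral>\<^sup>+x. epow (maximal (\<lambda>y. ennreal (f y)) x) (P x) \<partial>lborel)
      \<le> (\<integral>\<^sup>+x. ennreal (2 powr b) * (epow (maximal (\<lambda>y. ennreal (f1 y)) x) (P x) + epow (maximal (\<lambda>y. ennreal (f2 y)) x) (P x)) \<partial>lborel)"
      using P_pos Pb 
      by (intro nn_integral_mono order_trans[OF epow_mono order_trans[OF epow_add_le mult_right_mono]])
         (auto intro!: ennreal_leI powr_mono less_imp_le)
    also have "\<dots> = ennreal (2 powr b) * ((\<integral>\<^sup>+x. epow (maximal (\<lambda>y. ennreal (f1 y)) x) (P x) \<partial>lborel)
        + (\<integral>\<^sup>+x. epow (maximal (\<lambda>y. ennreal (f2 y)) x) (P x) \<partial>lborel))"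
      by (simp add: nn_integral_cmult nn_integral_add)
    also have "\<dots> \<le> ennreal (2 powr b) * (ennreal (max 0 C1) + ennreal (max 0 C2))"
      by (intro mult_left_mono add_mono 1 2) auto
    also have "\<dots> = ennreal (2 powr b * (max 0 C1 + max 0 C2))"
      by (subst ennreal_plus[symmetric], simp, simp, subst ennreal_mult[symmetric]) auto
    also have "\<dots> \<le> ennreal (max 1 (2 powr b * (max 0 C1 + max 0 C2)))" by (intro ennreal_leI) simp
    finally show "(\<integral>\<^sup>+x. epow (maximal (\<lambda>y. ennreal (f y)) x) (P x) \<partial>lborel)
       \<le> ennreal (max 1 (2 powr b * (max 0 C1 + max 0 C2)))" .
  qed simp
qed

end

subsection \<open>Smooth functions\<close>

abbreviation pd :: "'a::euclidean_space \<Rightarrow> ('a \<Rightarrow> complex) \<Rightarrow> 'a \<Rightarrow> complex" where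
  "pd b f \<equiv> (\<lambda>x. frechet_derivative f (at x) b)"

lemma pd_eq: "(f has_derivative f') (at x) \<Longrightarrow> pd b f x = f' b"
  by (metis frechet_derivative_at)

lemma iter_deriv_append: "iter_deriv (as @ bs) f = iter_deriv as (iter_deriv bs f)"
  by (induction as) auto

lemma iter_deriv_snoc: "iter_deriv (bs @ [b]) f = iter_deriv bs (pd b f)"
  by (simp add: iter_deriv_append)

lemma smooth_differentiable: "smooth f \<Longrightarrow> f differentiable (at x)"
  unfolding smooth_def by (metis iter_deriv.simps(1) lists.Nil)

lemma smooth_has_derivative: "smooth f \<Longrightarrow> (f has_derivative frechet_derivative f (at x)) (at x)"
  using smooth_differentiable frechet_derivative_works by blast

lemma smooth_continuous: "smooth f \<Longrightarrow> continuous_on UNIV f"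
  by (meson continuous_at_imp_continuous_on differentiable_imp_continuous_within smooth_differentiable)

lemma smooth_borel [measurable_dest, intro]: "smooth f \<Longrightarrow> f \<in> borel_measurable borel"
  by (rule borel_measurable_continuous_onI) (rule smooth_continuous)

lemma smooth_iter_deriv: "smooth f \<Longrightarrow> bs \<in> lists Basis \<Longrightarrow> smooth (iter_deriv bs f)"
  unfolding smooth_def by (simp flip: iter_deriv_append)

lemma smooth_pd: "smooth f \<Longrightarrow> b \<in> Basis \<Longrightarrow> smooth (pd b f)"
  using smooth_iter_deriv[of f "[b]"] by simp

text \<open>Smoothness ranges over all lists of directions. A set closed under one partial
  derivative serves as a coinductive invariant and removes the lists from later arguments.\<close>

lemma smooth_coinduct:
  assumes "f \<in> S" and "\<And>u x. u \<in> S \<Longrightarrow> u differentiable (at x)"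
    and "\<And>u b. u \<in> S \<Longrightarrow> b \<in> Basis \<Longrightarrow> pd b u \<in> S"
  shows "smooth f"
proof -
  have "iter_deriv bs f \<in> S" if "bs \<in> lists Basis" for bs
    using that by induction (auto intro: assms)
  then show ?thesis unfolding smooth_def using assms(2) by blast
qed

text \<open>The candidate invariant for \<open>smooth_coinduct\<close>: by the product rule, sums
  and products of generators are closed under partial derivatives as soon as the derivatives of the
  generators themselves lie in this set.\<close>

inductive_set alg :: "('a::euclidean_space \<Rightarrow> complex) set \<Rightarrow> ('a \<Rightarrow> complex) set" for G where
  alg_base: "g \<in> G \<Longrightarrow> g \<in> alg G"
| alg_add: "f \<in> alg G \<Longrightarrow> g \<in> alg G \<Longrightarrow> (\<lambda>x. f x + g x) \<in> alg G"
| alg_mult: "f \<in> alg G \<Longrightarrow> g \<in> alg G \<Longrightarrow> (\<lambda>x. f x * g x) \<in> alg G"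

lemma pd_add:
  assumes "f differentiable (at x)" "g differentiable (at x)"
  shows "pd b (\<lambda>x. f x + g x) x = pd b f x + pd b g x"
proof -
  have "((\<lambda>x. f x + g x) has_derivative (\<lambda>h. frechet_derivative f (at x) h + frechet_derivative g (at x) h)) (at x)"
    using assms by (intro has_derivative_add) (auto simp: frechet_derivative_works)
  then show ?thesis by (rule pd_eq)
qed

lemma pd_mult:
  fixes f g :: "'a::euclidean_space \<Rightarrow> complex"
  assumes "f differentiable (at x)" "g differentiable (at x)"
  shows "pd b (\<lambda>x. f x * g x) x = f x * pd b g x + pd b f x * g x"
proof -
  have "((\<lambda>x. f x * g x) has_derivative (\<lambda>h. f x * frechet_derivative g (at x) h + frechet_derivative f (at x) h * g x)) (at x)"
    using assms by (intro has_derivative_mult) (auto simp: frechet_derivative_works)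
  then show ?thesis by (rule pd_eq)
qed

lemma alg_differentiable:
  assumes "\<And>g x. g \<in> G \<Longrightarrow> g differentiable (at x)" "f \<in> alg G"
  shows "f differentiable (at x)"
  using assms(2) by (induction) (auto intro: assms(1) differentiable_add differentiable_mult)

lemma alg_smooth:
  assumes d: "\<And>g x. g \<in> G \<Longrightarrow> g differentiable (at x)"
    and p: "\<And>g b. g \<in> G \<Longrightarrow> b \<in> Basis \<Longrightarrow> pd b g \<in> alg G" and f: "f \<in> alg G"
  shows "smooth f"
proof (rule smooth_coinduct[OF f])
  show "u differentiable (at x)" if "u \<in> alg G" for u x
    using alg_differentiable[OF d that] by blast
  show "pd b u \<in> alg G" if "u \<in> alg G" "b \<in> Basis" for u b
    using that(1)
  proof induction
    case (alg_add f g)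
    then have "pd b (\<lambda>x. f x + g x) = (\<lambda>x. pd b f x + pd b g x)"
      by (intro ext pd_add alg_differentiable[OF d])
    with alg_add show ?case by (simp add: alg.alg_add)
  next
    case (alg_mult f g)
    then have "pd b (\<lambda>x. f x * g x) = (\<lambda>x. f x * pd b g x + pd b f x * g x)"
      by (intro ext pd_mult alg_differentiable[OF d])
    with alg_mult show ?case by (simp add: alg.alg_add alg.alg_mult)
  qed (use that(2) p in auto)
qed

lemma smooth_alg: "f \<in> alg (Collect smooth) \<Longrightarrow> smooth f"
  by (rule alg_smooth[of "Collect smooth"]) (auto intro: smooth_differentiable smooth_pd alg_base)

lemma smooth_add: "smooth f \<Longrightarrow> smooth g \<Longrightarrow> smooth (\<lambda>x. f x + g x)"
  by (auto intro!: smooth_alg alg_add intro: alg_base)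

lemma smooth_mult: "smooth f \<Longrightarrow> smooth g \<Longrightarrow> smooth (\<lambda>x. f x * g x)"
  by (auto intro!: smooth_alg alg_mult intro: alg_base)

lemma smooth_const [simp]: "smooth (\<lambda>_. c)"
  by (rule smooth_coinduct[of _ "range (\<lambda>c _. c)"]) auto

lemma smooth_cmult: "smooth f \<Longrightarrow> smooth (\<lambda>x. c * f x)"
  by (rule smooth_mult) auto

lemma smooth_uminus: "smooth f \<Longrightarrow> smooth (\<lambda>x. - f x)"
  using smooth_cmult[of f "-1"] by simp

lemma smooth_diff: "smooth f \<Longrightarrow> smooth g \<Longrightarrow> smooth (\<lambda>x. f x - g x)"
  using smooth_add[of f "\<lambda>x. - g x"] smooth_uminus[of g] by simp

lemma smooth_sum: "finite I \<Longrightarrow> (\<And>i. i \<in> I \<Longrightarrow> smooth (f i)) \<Longrightarrow> smooth (\<lambda>x. \<Sum>i\<in>I. f i x)"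
  by (induction I rule: finite_induct) (auto intro: smooth_add)

section \<open>Linear and radial functions\<close>

lemma has_derivative_inner_of_real:
  "((\<lambda>x. complex_of_real (x \<bullet> c)) has_derivative (\<lambda>h. complex_of_real (h \<bullet> c))) (at x)"
  by (auto intro!: derivative_eq_intros)

lemma smooth_inner: "smooth (\<lambda>x. complex_of_real (x \<bullet> c))"
proof (rule smooth_coinduct[of _ "insert (\<lambda>x. complex_of_real (x \<bullet> c)) (range (\<lambda>c _. c))"])
  fix u :: "'a \<Rightarrow> complex" and b :: 'a
  assume "u \<in> insert (\<lambda>x. complex_of_real (x \<bullet> c)) (range (\<lambda>c _. c))"
  then show "pd b u \<in> insert (\<lambda>x. complex_of_real (x \<bullet> c)) (range (\<lambda>c _. c))"
    by (auto simp: pd_eq[OF has_derivative_inner_of_real])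
next
  fix u :: "'a \<Rightarrow> complex" and x :: 'a
  assume "u \<in> insert (\<lambda>x. complex_of_real (x \<bullet> c)) (range (\<lambda>c _. c))"
  then show "u differentiable (at x)"
    using has_derivative_inner_of_real[of c x] unfolding differentiable_def by (auto intro: has_derivative_const)
qed auto

text \<open>In one variable smoothness is witnessed by an explicit sequence of derivatives, which
  suits functions whose derivatives are known in closed form.\<close>

definition smooth1 :: "(real \<Rightarrow> real) \<Rightarrow> bool" where
  "smooth1 h \<longleftrightarrow> (\<exists>d. d 0 = h \<and> (\<forall>k x. (d k has_real_derivative d (Suc k) x) (at x)))"

text \<open>A partial derivative of \<open>d k (x \<bullet> x)\<close> is
  \<open>d (Suc k) (x \<bullet> x)\<close> times a linear function, so these functions together with
  the smooth ones generate an algebra closed under differentiation.\<close>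

lemma smooth_radial:
  assumes "smooth1 h"
  shows "smooth (\<lambda>x::'a::euclidean_space. complex_of_real (h (x \<bullet> x)))"
proof -
  obtain d where d: "d 0 = h" "\<And>k x. (d k has_real_derivative d (Suc k) x) (at x)"
    using assms unfolding smooth1_def by auto
  define G where "G = Collect smooth \<union> range (\<lambda>k (x::'a). complex_of_real (d k (x \<bullet> x)))"
  have der: "((\<lambda>x::'a. complex_of_real (d k (x \<bullet> x))) has_derivative
      (\<lambda>y. complex_of_real (d (Suc k) (x \<bullet> x) * (2 * (y \<bullet> x))))) (at x)" for k x
  proof -
    have 1: "((\<lambda>x::'a. x \<bullet> x) has_derivative (\<lambda>y. 2 * (y \<bullet> x))) (at x)"
      by (auto intro!: derivative_eq_intros simp: inner_commute)
    have "(d k has_derivative (\<lambda>h. h * d (Suc k) (x \<bullet> x))) (at (x \<bullet> x))"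
      using d(2)[of k "x \<bullet> x"] by (simp add: has_field_derivative_def mult_commute_abs)
    from has_derivative_compose[OF 1 this] show ?thesis
      by (intro has_derivative_of_real) (simp add: mult.commute)
  qed
  show ?thesis
  proof (rule alg_smooth[of G])
    show "g differentiable (at x)" if "g \<in> G" for g x
      using that der unfolding G_def by (auto intro: smooth_differentiable differentiableI)
    show "pd b g \<in> alg G" if "g \<in> G" "b \<in> Basis" for g b
      using that(1) unfolding G_def
    proof
      assume "g \<in> Collect smooth"
      then show "pd b g \<in> alg (Collect smooth \<union> range (\<lambda>k (x::'a). complex_of_real (d k (x \<bullet> x))))"
        using that(2) by (auto intro: alg_base smooth_pd)
    next
      assume "g \<in> range (\<lambda>k (x::'a). complex_of_real (d k (x \<bullet> x)))"
      then obtain k where g: "g = (\<lambda>x::'a. complex_of_real (d k (x \<bullet> x)))" by blast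
      have "pd b g = (\<lambda>x. complex_of_real (d (Suc k) (x \<bullet> x)) * (2 * complex_of_real (x \<bullet> b)))"
        unfolding g by (rule ext, subst pd_eq[OF der]) (simp add: inner_commute)
      moreover have "smooth (\<lambda>x::'a. 2 * complex_of_real (x \<bullet> b))" by (intro smooth_cmult smooth_inner)
      ultimately show "pd b g \<in> alg (Collect smooth \<union> range (\<lambda>k (x::'a). complex_of_real (d k (x \<bullet> x))))"
        by (simp only:) (intro alg_mult alg_base; blast)
    qed
    show "(\<lambda>x. complex_of_real (h (x \<bullet> x))) \<in> alg G"
      unfolding G_def d(1)[symmetric] by (rule alg_base) blast
  qed
qed

section \<open>Iterated derivatives: affine substitution, linearity and locality\<close>

lemma pd_affine:
  assumes "f differentiable (at (c *\<^sub>R x + a))"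
  shows "pd b (\<lambda>x. f (c *\<^sub>R x + a)) x = c *\<^sub>R pd b f (c *\<^sub>R x + a)"
proof -
  have f: "(f has_derivative frechet_derivative f (at (c *\<^sub>R x + a))) (at (c *\<^sub>R x + a))"
    using assms frechet_derivative_works by blast
  have "((\<lambda>x. f (c *\<^sub>R x + a)) has_derivative (\<lambda>h. frechet_derivative f (at (c *\<^sub>R x + a)) (c *\<^sub>R h))) (at x)"
    by (rule has_derivative_compose[where g=f and f="\<lambda>x. c *\<^sub>R x + a", OF _ f]) (auto intro!: derivative_eq_intros)
  then show ?thesis
    using linear_cmul[OF linear_frechet_derivative[OF assms]] by (subst pd_eq) auto
qed

lemma differentiable_affine:
  assumes "\<And>x. f differentiable (at x)"
  shows "(\<lambda>x. f (c *\<^sub>R x + a)) differentiable (at x)"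
  using differentiable_chain_at[of "\<lambda>x. c *\<^sub>R x + a" x f] assms by (simp add: o_def)

lemma pd_scaleR:
  fixes f :: "'a::euclidean_space \<Rightarrow> complex"
  assumes "f differentiable (at x)"
  shows "pd b (\<lambda>x. c *\<^sub>R f x) x = c *\<^sub>R pd b f x"
proof -
  have "((\<lambda>x. c *\<^sub>R f x) has_derivative (\<lambda>h. c *\<^sub>R frechet_derivative f (at x) h)) (at x)"
    using assms by (intro has_derivative_scaleR_right) (auto simp: frechet_derivative_works)
  then show ?thesis by (rule pd_eq)
qed

lemma iter_deriv_affine:
  assumes "smooth f" "bs \<in> lists Basis"
  shows "iter_deriv bs (\<lambda>x. f (c *\<^sub>R x + a)) = (\<lambda>x. c ^ length bs *\<^sub>R iter_deriv bs f (c *\<^sub>R x + a))"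
  using assms(2)
proof induction
  case (Cons b bs)
  have sm: "smooth (iter_deriv bs f)" using Cons assms(1) by (intro smooth_iter_deriv) auto
  show ?case
  proof (rule ext)
    fix x
    have "iter_deriv (b # bs) (\<lambda>x. f (c *\<^sub>R x + a)) x = pd b (\<lambda>x. c ^ length bs *\<^sub>R iter_deriv bs f (c *\<^sub>R x + a)) x"
      by (simp add: Cons.IH)
    also have "\<dots> = c ^ length bs *\<^sub>R (c *\<^sub>R pd b (iter_deriv bs f) (c *\<^sub>R x + a))"
      by (subst pd_scaleR) (auto simp: pd_affine smooth_differentiable[OF sm] intro!: differentiable_affine)
    finally show "iter_deriv (b # bs) (\<lambda>x. f (c *\<^sub>R x + a)) x = c ^ length (b # bs) *\<^sub>R iter_deriv (b # bs) f (c *\<^sub>R x + a)"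
      by (simp add: mult.commute)
  qed
qed simp

lemma smooth_affine:
  assumes "smooth f" shows "smooth (\<lambda>x. f (c *\<^sub>R x + a))"
  unfolding smooth_def
proof (intro ballI allI)
  fix bs :: "'a list" and x assume bs: "bs \<in> lists Basis"
  show "iter_deriv bs (\<lambda>x. f (c *\<^sub>R x + a)) differentiable (at x)"
    unfolding iter_deriv_affine[OF assms bs]
    by (intro differentiable_scaleR differentiable_const
        differentiable_affine[where f="iter_deriv bs f"] smooth_differentiable[OF smooth_iter_deriv[OF assms bs]])
qed

lemma iter_deriv_add:
  assumes "smooth f" "smooth g" "bs \<in> lists Basis"
  shows "iter_deriv bs (\<lambda>x. f x + g x) = (\<lambda>x. iter_deriv bs f x + iter_deriv bs g x)"
  using assms(3)
proof induction
  case (Cons b bs)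
  have "smooth (iter_deriv bs f)" "smooth (iter_deriv bs g)"
    using Cons assms by (auto intro: smooth_iter_deriv)
  then show ?case by (auto simp: Cons.IH intro!: pd_add smooth_differentiable)
qed simp

lemma iter_deriv_cmult:
  assumes "smooth f" "bs \<in> lists Basis"
  shows "iter_deriv bs (\<lambda>x. c * f x) = (\<lambda>x. c * iter_deriv bs f x)"
  using assms(2)
proof induction
  case (Cons b bs)
  have "smooth (iter_deriv bs f)" using Cons assms by (auto intro: smooth_iter_deriv)
  then show ?case by (auto simp: Cons.IH pd_mult smooth_differentiable)
qed simp

lemma iter_deriv_diff:
  assumes "smooth f" "smooth g" "bs \<in> lists Basis"
  shows "iter_deriv bs (\<lambda>x. f x - g x) = (\<lambda>x. iter_deriv bs f x - iter_deriv bs g x)"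
proof -
  have "iter_deriv bs (\<lambda>x. f x + (-1) * g x) = (\<lambda>x. iter_deriv bs f x + (-1) * iter_deriv bs g x)"
    unfolding iter_deriv_add[OF assms(1) smooth_cmult[OF assms(2), of "-1"] assms(3)] iter_deriv_cmult[OF assms(2,3), of "-1"] ..
  then show ?thesis by simp
qed

lemma iter_deriv_sum:
  assumes "finite I" "\<And>i. i \<in> I \<Longrightarrow> smooth (f i)" "bs \<in> lists Basis"
  shows "iter_deriv bs (\<lambda>x. \<Sum>i\<in>I. f i x) = (\<lambda>x. \<Sum>i\<in>I. iter_deriv bs (f i) x)"
  using assms(1,2)
proof (induction I rule: finite_induct)
  case empty
  show ?case using iter_deriv_cmult[of "\<lambda>_. 0" bs 0] assms(3) by simp
next
  case (insert i I)
  then show ?case using assms(3) by (simp add: iter_deriv_add smooth_sum)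
qed

lemma iter_deriv_local:
  assumes "open S" "\<And>x. x \<in> S \<Longrightarrow> f x = g x" "x \<in> S"
  shows "iter_deriv bs f x = iter_deriv bs g x"
  using assms(3)
proof (induction bs arbitrary: x)
  case (Cons b bs)
  have "frechet_derivative (iter_deriv bs f) (at x) = frechet_derivative (iter_deriv bs g) (at x)"
  proof -
    have "(iter_deriv bs f has_derivative F) (at x) \<longleftrightarrow> (iter_deriv bs g has_derivative F) (at x)" for F
      using has_derivative_transform_within_open[OF _ assms(1) Cons.prems] Cons.IH by (metis (no_types, lifting))
    then show ?thesis unfolding frechet_derivative_def by simp
  qed
  then show ?case by simp
qed (use assms in auto)

lemma iter_deriv_support:
  assumes "x \<notin> closure {x. f x \<noteq> 0}"
  shows "iter_deriv bs f x = 0"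
proof -
  have "iter_deriv bs f x = iter_deriv bs (\<lambda>_. 0) x"
    by (rule iter_deriv_local[of "- closure {x. f x \<noteq> 0}"])
       (use assms closure_subset[of "{x. f x \<noteq> 0}"] in auto)
  also have "iter_deriv bs (\<lambda>_::'a. 0::complex) x = 0"
  proof (induction bs arbitrary: x)
    case (Cons b bs)
    then have "iter_deriv bs (\<lambda>_::'a. 0::complex) = (\<lambda>_. 0)" by (intro ext)
    then show ?case by (simp add: frechet_derivative_const)
  qed simp
  finally show ?thesis .
qed

subsection \<open>Families of Schwartz functions\<close>

text \<open>The bounds are uniform in the index. A single function is a family over \<open>unit\<close>.\<close>

definition schwartz_family :: "('i \<Rightarrow> 'a::euclidean_space \<Rightarrow> complex) \<Rightarrow> bool" where
  "schwartz_family F \<longleftrightarrow> (\<forall>i. smooth (F i)) \<and>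
    (\<forall>N. \<forall>bs \<in> lists Basis. \<exists>C. \<forall>i x. (1 + norm x) ^ N * norm (iter_deriv bs (F i) x) \<le> C)"

text \<open>These are the multipliers that preserve Schwartz families: the order of growth may
  depend on the derivative but not on the index.\<close>

definition moderate_family :: "('i \<Rightarrow> 'a::euclidean_space \<Rightarrow> complex) \<Rightarrow> bool" where
  "moderate_family G \<longleftrightarrow> (\<forall>i. smooth (G i)) \<and>
    (\<forall>bs \<in> lists Basis. \<exists>N C. \<forall>i x. norm (iter_deriv bs (G i) x) \<le> C * (1 + norm x) ^ N)"

lemma schwartz_family_schwartz: "schwartz_family (\<lambda>_::unit. f) \<longleftrightarrow> f \<in> schwartz"
  unfolding schwartz_family_def schwartz_def bounded_iff
  by (auto simp: abs_of_nonneg[OF zero_le_power[OF add_nonneg_nonneg]])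

lemma schwartz_familyD: "schwartz_family F \<Longrightarrow> F i \<in> schwartz"
  unfolding schwartz_family_schwartz[symmetric] unfolding schwartz_family_def by blast

lemma schwartz_smooth: "f \<in> schwartz \<Longrightarrow> smooth f"
  by (simp add: schwartz_def)

lemma schwartz_bound:
  assumes "f \<in> schwartz" "bs \<in> lists Basis"
  obtains C where "0 < C" "\<And>x. (1 + norm x) ^ N * norm (iter_deriv bs f x) \<le> C"
proof -
  obtain C where "\<And>x. (1 + norm x) ^ N * norm (iter_deriv bs f x) \<le> C"
    using assms unfolding schwartz_family_schwartz[symmetric] schwartz_family_def by blast
  then have "\<And>x. (1 + norm x) ^ N * norm (iter_deriv bs f x) \<le> max C 1" by (simp add: le_max_iff_disj)
  then show ?thesis using that[of "max C 1"] by auto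
qed

lemma schwartz_bound0:
  assumes "f \<in> schwartz"
  obtains C where "0 < C" "\<And>x. norm (f x) \<le> C / (1 + norm x) ^ N"
proof -
  obtain C where C: "0 < C" "\<And>x. (1 + norm x) ^ N * norm (f x) \<le> C"
    using schwartz_bound[OF assms, of "[]" N] by auto
  have "norm (f x) \<le> C / (1 + norm x) ^ N" for x
    using C(2)[of x] by (simp add: pos_le_divide_eq add_pos_nonneg mult.commute)
  with C that show ?thesis by blast
qed

lemma schwartz_family_pd:
  assumes "schwartz_family F" "b \<in> Basis" shows "schwartz_family (\<lambda>i. pd b (F i))"
  using assms unfolding schwartz_family_def
  by (auto simp: smooth_pd simp flip: iter_deriv_snoc)

lemma moderate_family_pd:
  assumes "moderate_family F" "b \<in> Basis" shows "moderate_family (\<lambda>i. pd b (F i))"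
  using assms unfolding moderate_family_def
  by (auto simp: smooth_pd simp flip: iter_deriv_snoc)

lemma schwartz_family_add:
  assumes F: "schwartz_family F" and G: "schwartz_family G"
  shows "schwartz_family (\<lambda>i x. F i x + G i x)"
  unfolding schwartz_family_def
proof (intro conjI allI ballI)
  show "smooth (\<lambda>x. F i x + G i x)" for i using F G by (auto simp: schwartz_family_def smooth_add)
  fix N and bs :: "'b list" assume bs: "bs \<in> lists Basis"
  obtain C D where "\<And>i x. (1 + norm x) ^ N * norm (iter_deriv bs (F i) x) \<le> C"
     "\<And>i x. (1 + norm x) ^ N * norm (iter_deriv bs (G i) x) \<le> D"
    using F G bs unfolding schwartz_family_def by meson
  moreover have "(1 + norm x) ^ N * norm (iter_deriv bs (\<lambda>x. F i x + G i x) x)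
     \<le> (1 + norm x) ^ N * norm (iter_deriv bs (F i) x) + (1 + norm x) ^ N * norm (iter_deriv bs (G i) x)" for i x
    using F G bs unfolding schwartz_family_def distrib_left[symmetric]
    by (subst iter_deriv_add) (auto intro!: mult_left_mono norm_triangle_ineq)
  ultimately show "\<exists>C. \<forall>i x. (1 + norm x) ^ N * norm (iter_deriv bs (\<lambda>x. F i x + G i x) x) \<le> C"
    by (intro exI[of _ "C + D"]) (meson add_mono order_trans)
qed

text \<open>Taking off the innermost derivative turns the product into two products of the same
  kind, with one factor differentiated. The induction is therefore over the list from its end, with
  both families arbitrary.\<close>

lemma schwartz_family_mult:
  assumes F: "schwartz_family F" and G: "moderate_family G"
  shows "schwartz_family (\<lambda>i x. F i x * G i x)"
proof -
  have sm: "smooth (\<lambda>x. F i x * G i x)" if "schwartz_family F" "moderate_family G" for i and F :: "'a \<Rightarrow> 'b \<Rightarrow> complex" and G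
    using that by (auto simp: schwartz_family_def moderate_family_def smooth_mult)
  have "\<exists>C. \<forall>i x. (1 + norm x) ^ N * norm (iter_deriv bs (\<lambda>x. F i x * G i x) x) \<le> C" if "bs \<in> lists Basis" for N bs
    using that F G
  proof (induction bs arbitrary: F G rule: rev_induct)
    case Nil
    obtain M D where D: "\<And>i x. norm (G i x) \<le> D * (1 + norm x) ^ M"
      using Nil(3) unfolding moderate_family_def by (metis iter_deriv.simps(1) lists.Nil)
    obtain C where C: "\<And>i x. (1 + norm x) ^ (N + M) * norm (F i x) \<le> C"
      using Nil(2) unfolding schwartz_family_def by (metis iter_deriv.simps(1) lists.Nil)
    have D0: "0 \<le> D" using order_trans[OF norm_ge_zero D[of undefined 0]] by simp
    have "(1 + norm x) ^ N * norm (F i x * G i x) \<le> D * C" for i x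
    proof -
      have "(1 + norm x) ^ N * norm (F i x * G i x) \<le> (1 + norm x) ^ N * (norm (F i x) * (D * (1 + norm x) ^ M))"
        unfolding norm_mult by (intro mult_left_mono D) auto
      also have "\<dots> = D * ((1 + norm x) ^ (N + M) * norm (F i x))" by (simp add: power_add mult_ac)
      also have "\<dots> \<le> D * C" by (intro mult_left_mono C D0)
      finally show ?thesis .
    qed
    then show ?case by auto
  next
    case (snoc b bs)
    have b: "b \<in> Basis" "bs \<in> lists Basis" using snoc.prems by auto
    have s: "smooth (F i)" "smooth (G i)" for i
      using snoc.prems by (auto simp: schwartz_family_def moderate_family_def)
    have eq: "iter_deriv (bs @ [b]) (\<lambda>x. F i x * G i x)
      = (\<lambda>x. iter_deriv bs (\<lambda>x. F i x * pd b (G i) x) x + iter_deriv bs (\<lambda>x. pd b (F i) x * G i x) x)" for i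
    proof -
      have "pd b (\<lambda>x. F i x * G i x) = (\<lambda>x. F i x * pd b (G i) x + pd b (F i) x * G i x)"
        using s by (auto intro!: pd_mult smooth_differentiable)
      then show ?thesis
        unfolding iter_deriv_snoc using s b by (simp add: iter_deriv_add smooth_mult smooth_pd)
    qed
    obtain C where C: "\<And>i x. (1 + norm x) ^ N * norm (iter_deriv bs (\<lambda>x. F i x * pd b (G i) x) x) \<le> C"
      using snoc.IH[OF b(2) snoc.prems(2) moderate_family_pd[OF snoc.prems(3) b(1)]] by blast
    obtain D where D: "\<And>i x. (1 + norm x) ^ N * norm (iter_deriv bs (\<lambda>x. pd b (F i) x * G i x) x) \<le> D"
      using snoc.IH[OF b(2) schwartz_family_pd[OF snoc.prems(2) b(1)] snoc.prems(3)] by blast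
    have "(1 + norm x) ^ N * norm (iter_deriv (bs @ [b]) (\<lambda>x. F i x * G i x) x) \<le> C + D" for i x
    proof -
      have "(1 + norm x) ^ N * norm (iter_deriv (bs @ [b]) (\<lambda>x. F i x * G i x) x)
        \<le> (1 + norm x) ^ N * (norm (iter_deriv bs (\<lambda>x. F i x * pd b (G i) x) x) + norm (iter_deriv bs (\<lambda>x. pd b (F i) x * G i x) x))"
        unfolding eq by (intro mult_left_mono norm_triangle_ineq) auto
      also have "\<dots> \<le> C + D" unfolding distrib_left by (intro add_mono C D)
      finally show ?thesis .
    qed
    then show ?case by blast
  qed
  with sm[OF F G] show ?thesis unfolding schwartz_family_def by blast
qed

abbreviation moderate :: "('a::euclidean_space \<Rightarrow> complex) \<Rightarrow> bool" where
  "moderate f \<equiv> moderate_family (\<lambda>_::unit. f)"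

lemma schwartz_pd: "f \<in> schwartz \<Longrightarrow> b \<in> Basis \<Longrightarrow> pd b f \<in> schwartz"
  using schwartz_family_pd[of "\<lambda>_::unit. f"] by (simp add: schwartz_family_schwartz)

lemma schwartz_iter_deriv: "f \<in> schwartz \<Longrightarrow> bs \<in> lists Basis \<Longrightarrow> iter_deriv bs f \<in> schwartz"
  by (induction bs) (auto intro: schwartz_pd)

lemma schwartz_add: "f \<in> schwartz \<Longrightarrow> g \<in> schwartz \<Longrightarrow> (\<lambda>x. f x + g x) \<in> schwartz"
  using schwartz_family_add[of "\<lambda>_::unit. f" "\<lambda>_. g"] by (simp add: schwartz_family_schwartz)

lemma schwartz_mult: "f \<in> schwartz \<Longrightarrow> moderate g \<Longrightarrow> (\<lambda>x. f x * g x) \<in> schwartz"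
  using schwartz_family_mult[of "\<lambda>_::unit. f" "\<lambda>_. g"] by (simp add: schwartz_family_schwartz)

lemma iter_deriv_const_bound: "bs \<in> lists Basis \<Longrightarrow> norm (iter_deriv bs (\<lambda>_. c) x) \<le> norm c"
proof -
  have *: "iter_deriv bs (\<lambda>_::'a. 0) = (\<lambda>_. 0)" for bs :: "'a list"
    by (rule ext, rule iter_deriv_support) simp
  show ?thesis
  proof (cases bs rule: rev_cases)
    case (snoc xs b)
    then show ?thesis by (simp add: iter_deriv_snoc * del: iter_deriv.simps)
  qed simp
qed

lemma moderate_family_const: "moderate_family (\<lambda>_ _. c)"
  unfolding moderate_family_def
  by (auto intro!: exI[of _ 0] exI[of _ "norm c"] iter_deriv_const_bound)

lemma schwartz_cmult: "f \<in> schwartz \<Longrightarrow> (\<lambda>x. c * f x) \<in> schwartz"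
  using schwartz_mult[OF _ moderate_family_const, of f c] by (simp add: mult.commute)

lemma schwartz_uminus: "f \<in> schwartz \<Longrightarrow> (\<lambda>x. - f x) \<in> schwartz"
  using schwartz_cmult[of f "-1"] by simp

lemma schwartz_diff: "f \<in> schwartz \<Longrightarrow> g \<in> schwartz \<Longrightarrow> (\<lambda>x. f x - g x) \<in> schwartz"
  using schwartz_add[OF _ schwartz_uminus, of f g] by simp

lemma schwartz_zero: "(\<lambda>_. 0) \<in> schwartz"
  unfolding schwartz_family_schwartz[symmetric] schwartz_family_def
proof (intro conjI allI ballI)
  fix N and bs :: "'a list" assume "bs \<in> lists Basis"
  then have "iter_deriv bs (\<lambda>_. 0) x = 0" for x using iter_deriv_const_bound[of bs 0 x] by simp
  then show "\<exists>C. \<forall>(i::unit) x. (1 + norm x) ^ N * norm (iter_deriv bs (\<lambda>_. 0) x) \<le> C"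
    by (intro exI[of _ 0]) simp
qed simp

lemma schwartz_sum: "finite I \<Longrightarrow> (\<And>i. i \<in> I \<Longrightarrow> f i \<in> schwartz) \<Longrightarrow> (\<lambda>x. \<Sum>i\<in>I. f i x) \<in> schwartz"
  by (induction I rule: finite_induct) (auto intro: schwartz_add schwartz_zero)

text \<open>Peetre's inequality with exponent 1. It moves polynomial weights between a point and its
  translate.\<close>

lemma one_plus_norm_le:
  fixes x y :: "'a::real_normed_vector"
  shows "1 + norm x \<le> (1 + norm y) * (1 + norm (x - y))"
proof -
  have "norm x \<le> norm y + norm (x - y)" by (metis add.commute norm_triangle_sub)
  then have "1 + norm x \<le> 1 + norm y + norm (x - y)" by simp
  also have "\<dots> \<le> (1 + norm y) * (1 + norm (x - y))" by (simp add: algebra_simps)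
  finally show ?thesis .
qed

lemma schwartz_affine:
  assumes f: "f \<in> schwartz" and c: "c \<noteq> 0"
  shows "(\<lambda>x. f (c *\<^sub>R x + a)) \<in> schwartz"
  unfolding schwartz_family_schwartz[symmetric] schwartz_family_def
proof (intro conjI allI ballI)
  have sm: "smooth f" using f by (rule schwartz_smooth)
  show "smooth (\<lambda>x. f (c *\<^sub>R x + a))" by (rule smooth_affine[OF sm])
  fix N and bs :: "'a list" assume bs: "bs \<in> lists Basis"
  obtain C where C: "0 < C" "\<And>x. (1 + norm x) ^ N * norm (iter_deriv bs f x) \<le> C"
    using schwartz_bound[OF f bs] by blast
  define k where "k = max 1 (1 / \<bar>c\<bar>) * (1 + norm a)"
  have k: "0 < k" by (auto simp: k_def add_pos_nonneg)
  have "1 + norm x \<le> k * (1 + norm (c *\<^sub>R x + a))" for x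
  proof -
    have "\<bar>c\<bar> \<ge> 1 / max 1 (1 / \<bar>c\<bar>)" using c by (simp add: max_def divide_simps)
    then have "norm x / max 1 (1 / \<bar>c\<bar>) \<le> norm (c *\<^sub>R x)"
      using mult_right_mono[of _ _ "norm x"] by fastforce
    then have "norm x \<le> max 1 (1 / \<bar>c\<bar>) * norm (c *\<^sub>R x)"
      by (simp add: pos_divide_le_eq mult.commute)
    then have "1 + norm x \<le> max 1 (1 / \<bar>c\<bar>) * (1 + norm (c *\<^sub>R x))"
      by (simp add: distrib_left)
    also have "1 + norm (c *\<^sub>R x) \<le> (1 + norm (- a)) * (1 + norm (c *\<^sub>R x - (- a)))"
      by (metis mult.commute norm_minus_cancel one_plus_norm_le minus_diff_eq)
    then have "max 1 (1 / \<bar>c\<bar>) * (1 + norm (c *\<^sub>R x)) \<le> max 1 (1 / \<bar>c\<bar>) * ((1 + norm (- a)) * (1 + norm (c *\<^sub>R x - (- a))))"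
      by (intro mult_left_mono) auto
    finally show ?thesis by (simp add: k_def mult.assoc)
  qed
  then have kN: "(1 + norm x) ^ N \<le> k ^ N * (1 + norm (c *\<^sub>R x + a)) ^ N" for x
    unfolding power_mult_distrib[symmetric] by (intro power_mono) auto
  have "(1 + norm x) ^ N * norm (iter_deriv bs (\<lambda>x. f (c *\<^sub>R x + a)) x) \<le> k ^ N * (\<bar>c\<bar> ^ length bs * C)" for x
  proof -
    have "(1 + norm x) ^ N * norm (iter_deriv bs (\<lambda>x. f (c *\<^sub>R x + a)) x)
       \<le> (k ^ N * (1 + norm (c *\<^sub>R x + a)) ^ N) * (\<bar>c\<bar> ^ length bs * norm (iter_deriv bs f (c *\<^sub>R x + a)))"
      unfolding iter_deriv_affine[OF sm bs] by (simp add: power_abs) (intro mult_right_mono kN, auto)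
    also have "\<dots> = k ^ N * (\<bar>c\<bar> ^ length bs * ((1 + norm (c *\<^sub>R x + a)) ^ N * norm (iter_deriv bs f (c *\<^sub>R x + a))))"
      by (simp add: mult_ac)
    also have "\<dots> \<le> k ^ N * (\<bar>c\<bar> ^ length bs * C)"
      using k by (intro mult_left_mono C) auto
    finally show ?thesis .
  qed
  then show "\<exists>C. \<forall>(i::unit) x. (1 + norm x) ^ N * norm (iter_deriv bs (\<lambda>x. f (c *\<^sub>R x + a)) x) \<le> C"
    by blast
qed

lemma schwartz_translate: "f \<in> schwartz \<Longrightarrow> (\<lambda>y. f (y - x)) \<in> schwartz"
  using schwartz_affine[of f 1 "-x"] by simp

lemma schwartz_reflect: "f \<in> schwartz \<Longrightarrow> (\<lambda>y. f (x - y)) \<in> schwartz"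
  using schwartz_affine[of f "-1" x] by simp

lemma schwartz_dilate: "f \<in> schwartz \<Longrightarrow> c \<noteq> 0 \<Longrightarrow> (\<lambda>y. f (c *\<^sub>R y)) \<in> schwartz"
  using schwartz_affine[of f c 0] by simp

subsection \<open>Polynomials and Gaussians\<close>

text \<open>Constants and linear functionals; the algebra \<open>alg monomials\<close> that they
  generate consists of the polynomials, including products of any degree.\<close>

definition monomials :: "('a::euclidean_space \<Rightarrow> complex) set" where
  "monomials = range (\<lambda>c _. c) \<union> range (\<lambda>c x. complex_of_real (x \<bullet> c))"

lemma monomials_differentiable: "g \<in> monomials \<Longrightarrow> g differentiable (at x)"
  unfolding monomials_def by (auto intro: smooth_differentiable smooth_inner)

lemma monomials_pd: "g \<in> monomials \<Longrightarrow> pd b g \<in> monomials"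
  unfolding monomials_def by (auto simp: pd_eq[OF has_derivative_inner_of_real])

lemma polynomial_pd:
  assumes "f \<in> alg monomials" shows "pd b f \<in> alg monomials"
  using assms
proof induction
  case (alg_add f g)
  then have "pd b (\<lambda>x. f x + g x) = (\<lambda>x. pd b f x + pd b g x)"
    by (intro ext pd_add alg_differentiable[OF monomials_differentiable])
  with alg_add show ?case by (simp add: alg.alg_add)
next
  case (alg_mult f g)
  then have "pd b (\<lambda>x. f x * g x) = (\<lambda>x. f x * pd b g x + pd b f x * g x)"
    by (intro ext pd_mult alg_differentiable[OF monomials_differentiable])
  with alg_mult show ?case by (simp add: alg.alg_add alg.alg_mult)
qed (auto intro: alg_base monomials_pd)

lemma polynomial_bound:
  assumes "f \<in> alg monomials" shows "\<exists>N C. 0 \<le> C \<and> (\<forall>x. norm (f x) \<le> C * (1 + norm x) ^ N)"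
  using assms
proof induction
  case (alg_base g)
  then consider (const) c where "g = (\<lambda>_. c)" | (inner) c where "g = (\<lambda>x. complex_of_real (x \<bullet> c))"
    unfolding monomials_def by auto
  then show ?case
  proof cases
    case const
    then show ?thesis by (auto intro!: exI[of _ 0] exI[of _ "norm c"])
  next
    case inner
    have "norm (g x) \<le> norm c * (1 + norm x) ^ 1" for x
    proof -
      have "\<bar>x \<bullet> c\<bar> \<le> norm x * norm c" by (rule Cauchy_Schwarz_ineq2)
      then show ?thesis unfolding inner by (simp add: distrib_left mult.commute add_increasing)
    qed
    then show ?thesis by (intro exI[of _ 1] exI[of _ "norm c"]) auto
  qed
next
  case (alg_add f g)
  then obtain N C M D where *: "0 \<le> C" "\<And>x. norm (f x) \<le> C * (1 + norm x) ^ N" "0 \<le> D" "\<And>x. norm (g x) \<le> D * (1 + norm x) ^ M"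
    by auto
  have "norm (f x + g x) \<le> (C + D) * (1 + norm x) ^ (N + M)" for x
  proof -
    have "norm (f x + g x) \<le> C * (1 + norm x) ^ N + D * (1 + norm x) ^ M"
      using *(2)[of x] *(4)[of x] norm_triangle_ineq[of "f x" "g x"] by linarith
    also have "\<dots> \<le> C * (1 + norm x) ^ (N + M) + D * (1 + norm x) ^ (N + M)"
      using * by (intro add_mono mult_left_mono power_increasing) auto
    finally show ?thesis by (simp add: distrib_right)
  qed
  with * show ?case by (intro exI[of _ "N + M"] exI[of _ "C + D"]) auto
next
  case (alg_mult f g)
  then obtain N C M D where *: "0 \<le> C" "\<And>x. norm (f x) \<le> C * (1 + norm x) ^ N" "0 \<le> D" "\<And>x. norm (g x) \<le> D * (1 + norm x) ^ M"
    by auto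
  have "norm (f x * g x) \<le> (C * D) * (1 + norm x) ^ (N + M)" for x
  proof -
    have "norm (f x * g x) \<le> (C * (1 + norm x) ^ N) * (D * (1 + norm x) ^ M)"
      unfolding norm_mult using * by (intro mult_mono) auto
    then show ?thesis by (simp add: power_add mult_ac)
  qed
  with * show ?case by (intro exI[of _ "N + M"] exI[of _ "C * D"]) auto
qed

lemma polynomial_smooth: "f \<in> alg monomials \<Longrightarrow> smooth f"
  by (rule alg_smooth[OF monomials_differentiable alg_base[OF monomials_pd]])

lemma polynomial_moderate:
  assumes "f \<in> alg monomials" shows "moderate f"
  unfolding moderate_family_def
proof (intro conjI allI ballI)
  show "smooth f" by (rule polynomial_smooth[OF assms])
  fix bs :: "'a list" assume "bs \<in> lists Basis"
  have "iter_deriv bs f \<in> alg monomials"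
    using assms by (induction bs) (auto intro: polynomial_pd)
  from polynomial_bound[OF this]
  show "\<exists>N C. \<forall>(i::unit) x. norm (iter_deriv bs f x) \<le> C * (1 + norm x) ^ N" by blast
qed

lemma polynomial_inner: "(\<lambda>x. complex_of_real (x \<bullet> c)) \<in> alg monomials"
  by (rule alg_base) (auto simp: monomials_def)

lemma polynomial_const: "(\<lambda>x. c) \<in> alg monomials"
  by (rule alg_base) (auto simp: monomials_def)

lemma smooth1_exp: "smooth1 (\<lambda>r. exp (c * r))"
  unfolding smooth1_def
  by (rule exI[of _ "\<lambda>k r. c ^ k * exp (c * r)"]) (auto intro!: derivative_eq_intros)

lemma smooth_gauss: "smooth (\<lambda>x. complex_of_real (exp (c * (norm x)\<^sup>2)))"
  using smooth_radial[OF smooth1_exp[of c]] by (simp add: dot_square_norm)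

text \<open>Every iterated derivative is a polynomial times the Gaussian, and the Gaussian outweighs
  any polynomial.\<close>

lemma schwartz_gauss:
  assumes t: "0 < t"
  shows "(\<lambda>x::'a::euclidean_space. complex_of_real (exp (- t * (norm x)\<^sup>2))) \<in> schwartz" (is "?g \<in> _")
  unfolding schwartz_family_schwartz[symmetric] schwartz_family_def
proof (intro conjI allI ballI)
  have sm: "smooth ?g" by (rule smooth_gauss)
  then show "smooth ?g" .
  have pdg: "pd b ?g = (\<lambda>x. complex_of_real (- 2 * t) * complex_of_real (x \<bullet> b) * ?g x)" for b
  proof
    fix x :: 'a
    have "((\<lambda>x::'a. exp (- t * (x \<bullet> x))) has_derivative (\<lambda>h. exp (- t * (x \<bullet> x)) * (- t * (x \<bullet> h + h \<bullet> x)))) (at x)"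
      by (auto intro!: derivative_eq_intros)
    then have "(?g has_derivative (\<lambda>h. complex_of_real (exp (- t * (x \<bullet> x)) * (- t * (x \<bullet> h + h \<bullet> x))))) (at x)"
      unfolding dot_square_norm[symmetric] by (intro has_derivative_of_real)
    from pd_eq[OF this, of b]
    show "pd b ?g x = complex_of_real (- 2 * t) * complex_of_real (x \<bullet> b) * ?g x"
      by (simp add: inner_commute dot_square_norm)
  qed
  fix N and bs :: "'a list"
  have "\<exists>P \<in> alg monomials. iter_deriv bs ?g = (\<lambda>x. P x * ?g x)"
  proof (induction bs)
    case Nil
    show ?case by (rule bexI[OF _ polynomial_const[of 1]]) simp
  next
    case (Cons b bs)
    then obtain P where P: "P \<in> alg monomials" "iter_deriv bs ?g = (\<lambda>x. P x * ?g x)" by blast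
    have "iter_deriv (b # bs) ?g = pd b (\<lambda>x. P x * ?g x)" using P by simp
    also have "\<dots> = (\<lambda>x. P x * pd b ?g x + pd b P x * ?g x)"
      using polynomial_smooth[OF P(1)] sm by (intro ext pd_mult smooth_differentiable)
    also have "\<dots> = (\<lambda>x. P x * (complex_of_real (- 2 * t) * complex_of_real (x \<bullet> b) * ?g x) + pd b P x * ?g x)"
      by (simp only: fun_cong[OF pdg])
    also have "\<dots> = (\<lambda>x. (P x * (complex_of_real (- 2 * t) * complex_of_real (x \<bullet> b)) + pd b P x) * ?g x)"
      by (simp add: algebra_simps)
    finally have "iter_deriv (b # bs) ?g = (\<lambda>x. (P x * (complex_of_real (- 2 * t) * complex_of_real (x \<bullet> b)) + pd b P x) * ?g x)" .
    moreover have "(\<lambda>x. P x * (complex_of_real (- 2 * t) * complex_of_real (x \<bullet> b)) + pd b P x) \<in> alg monomials"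
      by (intro alg_add alg_mult polynomial_inner polynomial_const polynomial_pd P(1))
    ultimately show ?case by (rule bexI)
  qed
  then obtain P where P: "P \<in> alg monomials" "iter_deriv bs ?g = (\<lambda>x. P x * ?g x)" by blast
  obtain M C where C: "0 \<le> C" "\<And>x. norm (P x) \<le> C * (1 + norm x) ^ M" using polynomial_bound[OF P(1)] by blast
  let ?K = "real (M + N) ^ (M + N)"
  have "(1 + norm x) ^ N * norm (iter_deriv bs ?g x) \<le> C * (?K * exp (1 + 1 / (4 * t)))" for x
  proof -
    define s where "s = norm x"
    have s: "0 \<le> s" by (simp add: s_def)
    \<comment> \<open>The estimate \<open>(1 + y / n) ^ n \<le> exp y\<close> trades the power for
      an exponential; completing the square then compares that exponential with the
      Gaussian.\<close>
    have "(1 + s) ^ (M + N) \<le> ?K * exp (1 + s)"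
    proof (cases "M + N = 0")
      case False
      let ?n = "real (M + N)"
      have "(1 + s) ^ (M + N) = ?n ^ (M + N) * ((1 + s) / ?n) ^ (M + N)"
        using False by (simp add: power_divide del: of_nat_add)
      also have "((1 + s) / ?n) ^ (M + N) \<le> (1 + (1 + s) / ?n) ^ (M + N)"
        using s by (intro power_mono) auto
      also have "(1 + (1 + s) / ?n) ^ (M + N) \<le> exp (1 + s)"
        using False s by (intro exp_ge_one_plus_x_over_n_power_n) auto
      finally show ?thesis by (simp add: mult_left_mono)
    qed (use s in auto)
    then have "(1 + s) ^ (M + N) * exp (- t * s\<^sup>2) \<le> ?K * exp (1 + s) * exp (- t * s\<^sup>2)"
      by (intro mult_right_mono) auto
    also have "\<dots> = ?K * exp (1 + s - t * s\<^sup>2)" by (simp add: exp_diff exp_minus field_simps)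
    also have "\<dots> \<le> ?K * exp (1 + 1 / (4 * t))"
    proof -
      have "0 \<le> (2 * t * s - 1)\<^sup>2 / (4 * t)" using t by simp
      also have "\<dots> = t * s\<^sup>2 - s + 1 / (4 * t)" using t by (simp add: power2_eq_square field_simps)
      finally show ?thesis by (intro mult_left_mono) auto
    qed
    finally have 1: "(1 + s) ^ (M + N) * exp (- t * s\<^sup>2) \<le> ?K * exp (1 + 1 / (4 * t))" .
    have "(1 + norm x) ^ N * norm (iter_deriv bs ?g x) = (1 + s) ^ N * (norm (P x) * exp (- t * s\<^sup>2))"
      unfolding P(2) norm_mult by (simp add: s_def)
    also have "\<dots> \<le> (1 + s) ^ N * ((C * (1 + s) ^ M) * exp (- t * s\<^sup>2))"
      using s C(2)[of x] by (intro mult_left_mono mult_right_mono) (auto simp: s_def)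
    also have "\<dots> = C * ((1 + s) ^ (M + N) * exp (- t * s\<^sup>2))" by (simp add: power_add mult_ac)
    also have "\<dots> \<le> C * (?K * exp (1 + 1 / (4 * t)))" by (intro mult_left_mono 1 C)
    finally show ?thesis .
  qed
  then show "\<exists>C. \<forall>(i::unit) x. (1 + norm x) ^ N * norm (iter_deriv bs ?g x) \<le> C" by blast
qed

lemma schwartz_heat_kernel:
  assumes "0 < t"
  shows "(\<lambda>y. complex_of_real (heat_kernel t y)) \<in> schwartz"
proof -
  have "(\<lambda>y. complex_of_real ((4 * pi * t) powr (- real DIM('a) / 2)) * complex_of_real (exp (- (1 / (4 * t)) * (norm (y::'a))\<^sup>2))) \<in> schwartz"
    using assms by (intro schwartz_cmult schwartz_gauss) auto
  moreover have "(\<lambda>y::'a. complex_of_real (heat_kernel t y))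
    = (\<lambda>y. complex_of_real ((4 * pi * t) powr (- real DIM('a) / 2)) * complex_of_real (exp (- (1 / (4 * t)) * (norm y)\<^sup>2)))"
    by (rule ext) (simp add: heat_kernel_def)
  ultimately show ?thesis by simp
qed

subsection \<open>Characters\<close>

lemma has_derivative_cis:
  "((\<lambda>x::'a::euclidean_space. exp (\<i> * complex_of_real (x \<bullet> \<xi>))) has_derivative
    (\<lambda>h. exp (\<i> * complex_of_real (x \<bullet> \<xi>)) * (\<i> * complex_of_real (h \<bullet> \<xi>)))) (at x)"
proof -
  have 1: "((\<lambda>x. \<i> * complex_of_real (x \<bullet> \<xi>)) has_derivative (\<lambda>h. \<i> * complex_of_real (h \<bullet> \<xi>))) (at x)"
    by (rule has_derivative_mult_right[OF has_derivative_inner_of_real])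
  have 2: "(exp has_derivative (*) (exp z)) (at z)" for z :: complex
    using DERIV_exp[of z] unfolding has_field_derivative_def .
  show ?thesis
    using has_derivative_compose[OF 1 2] by blast
qed

lemma iter_deriv_cis:
  "\<exists>c. iter_deriv bs (\<lambda>x. exp (\<i> * complex_of_real (x \<bullet> \<xi>))) = (\<lambda>x. c * exp (\<i> * complex_of_real (x \<bullet> \<xi>)))"
proof (induction bs)
  case Nil
  show ?case by (intro exI[of _ 1]) simp
next
  case (Cons b bs)
  then obtain c where c: "iter_deriv bs (\<lambda>x. exp (\<i> * complex_of_real (x \<bullet> \<xi>))) = (\<lambda>x. c * exp (\<i> * complex_of_real (x \<bullet> \<xi>)))"
    by blast
  have "iter_deriv (b # bs) (\<lambda>x. exp (\<i> * complex_of_real (x \<bullet> \<xi>))) x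
     = (c * (\<i> * complex_of_real (b \<bullet> \<xi>))) * exp (\<i> * complex_of_real (x \<bullet> \<xi>))" for x
    unfolding iter_deriv.simps c by (subst pd_eq[OF has_derivative_mult_right[OF has_derivative_cis]]) (simp add: mult_ac)
  then show ?case by blast
qed

lemma moderate_cis: "moderate (\<lambda>x. exp (\<i> * complex_of_real (x \<bullet> \<xi>)))"
  unfolding moderate_family_def
proof (intro conjI allI ballI)
  show "smooth (\<lambda>x. exp (\<i> * complex_of_real (x \<bullet> \<xi>)))"
    unfolding smooth_def
  proof (intro ballI allI)
    fix bs :: "'a list" and x
    obtain c where c: "iter_deriv bs (\<lambda>x. exp (\<i> * complex_of_real (x \<bullet> \<xi>))) = (\<lambda>x. c * exp (\<i> * complex_of_real (x \<bullet> \<xi>)))"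
      using iter_deriv_cis by blast
    show "iter_deriv bs (\<lambda>x. exp (\<i> * complex_of_real (x \<bullet> \<xi>))) differentiable (at x)"
      unfolding c differentiable_def using has_derivative_mult_right[OF has_derivative_cis] by blast
  qed
  fix bs :: "'a list"
  obtain c where c: "iter_deriv bs (\<lambda>x. exp (\<i> * complex_of_real (x \<bullet> \<xi>))) = (\<lambda>x. c * exp (\<i> * complex_of_real (x \<bullet> \<xi>)))"
    using iter_deriv_cis by blast
  show "\<exists>N C. \<forall>(i::unit) x. norm (iter_deriv bs (\<lambda>x. exp (\<i> * complex_of_real (x \<bullet> \<xi>))) x) \<le> C * (1 + norm x) ^ N"
    unfolding c by (intro exI[of _ 0] exI[of _ "norm c"]) (simp add: norm_mult)
qed

subsection \<open>Schwartz seminorms and tempered distributions\<close>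

lemma schwartz_norm_le:
  assumes "\<And>x bs. bs \<in> lists Basis \<Longrightarrow> length bs \<le> N \<Longrightarrow> (1 + norm x) ^ N * norm (iter_deriv bs f x) \<le> C"
  shows "schwartz_norm N f \<le> C"
  unfolding schwartz_norm_def
proof (rule cSUP_least)
  show "(UNIV::'a set) \<times> {bs \<in> lists Basis. length bs \<le> N} \<noteq> {}" by (auto intro!: exI[of _ "[]"])
qed (use assms in auto)

text \<open>A supremum of reals is informative only for a bounded set. There are finitely many
  derivative lists up to a given length, and each one has its own Schwartz bound.\<close>

lemma schwartz_norm_ge:
  assumes f: "f \<in> schwartz" and bs: "bs \<in> lists Basis" "length bs \<le> N"
  shows "(1 + norm x) ^ N * norm (iter_deriv bs f x) \<le> schwartz_norm N f"
proof -
  let ?B = "{bs::'a list. bs \<in> lists Basis \<and> length bs \<le> N}"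
  have "finite ?B" using finite_lists_length_le[of "Basis::'a set" N] by (simp add: in_lists_conv_set subset_eq)
  have "\<forall>bs\<in>?B. \<exists>C. \<forall>x. (1 + norm x) ^ N * norm (iter_deriv bs f x) \<le> C"
    using schwartz_bound[OF f] by (metis (no_types, lifting) mem_Collect_eq)
  then obtain C where C: "\<And>bs x. bs \<in> ?B \<Longrightarrow> (1 + norm x) ^ N * norm (iter_deriv bs f x) \<le> C bs" by metis
  have "bdd_above ((\<lambda>(x, bs). (1 + norm x) ^ N * norm (iter_deriv bs f x)) ` (UNIV \<times> ?B))"
  proof (rule bdd_aboveI)
    fix y assume "y \<in> (\<lambda>(x, bs). (1 + norm x) ^ N * norm (iter_deriv bs f x)) ` (UNIV \<times> ?B)"
    then obtain x bs where "bs \<in> ?B" "y = (1 + norm x) ^ N * norm (iter_deriv bs f x)" by auto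
    then show "y \<le> Max (C ` ?B)"
      using C[of bs x] Max_ge[of "C ` ?B" "C bs"] \<open>finite ?B\<close> by fastforce
  qed
  then show ?thesis
    unfolding schwartz_norm_def using bs
    by (intro cSUP_upper2[where x="(x, bs)"]) auto
qed

lemma schwartz_norm_nonneg: "f \<in> schwartz \<Longrightarrow> 0 \<le> schwartz_norm N f"
  using schwartz_norm_ge[of f "[]" N 0] norm_ge_zero[of "f 0"] by (simp del: norm_ge_zero)

lemma tempered_linear:
  assumes "T \<in> tempered" "f \<in> schwartz" "g \<in> schwartz"
  shows "T (\<lambda>x. c * f x + g x) = c * T f + T g"
proof -
  have "\<forall>\<phi> \<in> schwartz. \<forall>\<psi> \<in> schwartz. \<forall>c. T (\<lambda>x. c * \<phi> x + \<psi> x) = c * T \<phi> + T \<psi>"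
    using assms(1) unfolding tempered_def by blast
  from this[THEN bspec, OF assms(2), THEN bspec, OF assms(3)] show ?thesis by blast
qed

lemma tempered_add: "T \<in> tempered \<Longrightarrow> f \<in> schwartz \<Longrightarrow> g \<in> schwartz \<Longrightarrow> T (\<lambda>x. f x + g x) = T f + T g"
  using tempered_linear[of T f g 1] by simp

lemma tempered_zero: "T \<in> tempered \<Longrightarrow> T (\<lambda>_. 0) = 0"
  using tempered_add[OF _ schwartz_zero schwartz_zero, of T] by simp

lemma tempered_cmult:
  assumes "T \<in> tempered" "f \<in> schwartz" shows "T (\<lambda>x. c * f x) = c * T f"
proof -
  show ?thesis using tempered_linear[OF assms schwartz_zero] tempered_zero[OF assms(1)] by simp
qed

lemma tempered_diff: "T \<in> tempered \<Longrightarrow> f \<in> schwartz \<Longrightarrow> g \<in> schwartz \<Longrightarrow> T (\<lambda>x. f x - g x) = T f - T g"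
  using tempered_add[of T f "\<lambda>x. -1 * g x"] tempered_cmult[of T g "-1"] schwartz_uminus[of g] by simp

lemma tempered_sum:
  assumes "T \<in> tempered" "finite I" "\<And>i. i \<in> I \<Longrightarrow> f i \<in> schwartz"
  shows "T (\<lambda>x. \<Sum>i\<in>I. f i x) = (\<Sum>i\<in>I. T (f i))"
  using assms(2,3)
proof (induction I rule: finite_induct)
  case (insert i I)
  then have "T (\<lambda>x. f i x + (\<Sum>i\<in>I. f i x)) = T (f i) + T (\<lambda>x. \<Sum>i\<in>I. f i x)"
    by (intro tempered_add[OF assms(1)] schwartz_sum) auto
  with insert show ?case by simp
qed (simp add: tempered_zero assms(1))

lemma tempered_bound:
  assumes "T \<in> tempered"
  obtains C N where "0 < C" "\<And>f. f \<in> schwartz \<Longrightarrow> norm (T f) \<le> C * schwartz_norm N f"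
proof -
  obtain C N where C: "\<And>f. f \<in> schwartz \<Longrightarrow> norm (T f) \<le> C * schwartz_norm N f"
    using assms unfolding tempered_def by blast
  have "norm (T f) \<le> max C 1 * schwartz_norm N f" if "f \<in> schwartz" for f
    using C[OF that] schwartz_norm_nonneg[OF that, of N] by (meson max.cobounded1 mult_right_mono order_trans)
  then show ?thesis using that[of "max C 1" N] by auto
qed

lemma tempered_tendsto:
  assumes T: "T \<in> tempered" and s: "\<And>i. f i \<in> schwartz" "g \<in> schwartz"
    and lim: "\<And>N. ((\<lambda>i. schwartz_norm N (\<lambda>x. f i x - g x)) \<longlongrightarrow> 0) F"
  shows "((\<lambda>i. T (f i)) \<longlongrightarrow> T g) F"
proof -
  obtain C N where C: "\<And>f. f \<in> schwartz \<Longrightarrow> norm (T f) \<le> C * schwartz_norm N f"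
    using tempered_bound[OF T] by blast
  have "((\<lambda>i. T (f i) - T g) \<longlongrightarrow> 0) F"
  proof (rule Lim_null_comparison)
    show "\<forall>\<^sub>F i in F. norm (T (f i) - T g) \<le> C * schwartz_norm N (\<lambda>x. f i x - g x)"
      using C[OF schwartz_diff[OF s]] by (simp add: tempered_diff[OF T s])
    show "((\<lambda>i. C * schwartz_norm N (\<lambda>x. f i x - g x)) \<longlongrightarrow> 0) F"
      using tendsto_mult_left[OF lim[of N], of C] by simp
  qed
  then show ?thesis by (simp add: LIM_zero_iff)
qed

section \<open>Test functions\<close>

lemma test_smooth: "f \<in> test_functions \<Longrightarrow> smooth f"
  by (simp add: test_functions_def)

lemma test_schwartz:
  assumes f: "f \<in> test_functions" shows "f \<in> schwartz"
  unfolding schwartz_family_schwartz[symmetric] schwartz_family_def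
proof (intro conjI allI ballI)
  show sm: "smooth f" using f by (rule test_smooth)
  fix N and bs :: "'a list" assume bs: "bs \<in> lists Basis"
  let ?K = "closure {x. f x \<noteq> 0}"
  let ?g = "\<lambda>x. (1 + norm x) ^ N * norm (iter_deriv bs f x)"
  have "continuous_on ?K ?g"
    using smooth_continuous[OF smooth_iter_deriv[OF sm bs]]
    by (intro continuous_intros) (auto intro: continuous_on_subset)
  moreover have "compact ?K" using f by (simp add: test_functions_def)
  ultimately have "bounded (?g ` ?K)" by (intro compact_imp_bounded compact_continuous_image)
  then obtain C where C: "\<And>x. x \<in> ?K \<Longrightarrow> norm (?g x) \<le> C" unfolding bounded_iff by blast
  have "?g x \<le> max C 0" for x
    using C[of x] iter_deriv_support[of x f bs] by (cases "x \<in> ?K") (auto simp: max_def)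
  then show "\<exists>C. \<forall>(i::unit) x. ?g x \<le> C" by blast
qed

lemma test_mult:
  assumes f: "f \<in> test_functions" and g: "smooth g"
  shows "(\<lambda>x. f x * g x) \<in> test_functions"
proof -
  have "closure {x. f x * g x \<noteq> 0} \<subseteq> closure {x. f x \<noteq> 0}" by (intro closure_mono) auto
  then have "compact (closure {x. f x * g x \<noteq> 0})"
    using f compact_Int_closed[of "closure {x. f x \<noteq> 0}" "closure {x. f x * g x \<noteq> 0}"]
    by (simp add: test_functions_def Int_absorb1)
  then show ?thesis using f g by (simp add: test_functions_def smooth_mult)
qed

lemma test_mult':
  "f \<in> test_functions \<Longrightarrow> smooth g \<Longrightarrow> (\<lambda>x. g x * f x) \<in> test_functions"
  using test_mult[of f g] by (simp add: mult.commute)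

lemma testI_bounded:
  assumes "smooth f" "\<And>x. R \<le> norm x \<Longrightarrow> f x = 0"
  shows "f \<in> test_functions"
proof -
  have "closure {x. f x \<noteq> 0} \<subseteq> cball 0 R"
    using assms(2) by (intro closure_minimal) (auto, meson nle_le)
  then have "compact (closure {x. f x \<noteq> 0})"
    by (meson bounded_cball bounded_subset closed_closure compact_eq_bounded_closed)
  with assms(1) show ?thesis by (simp add: test_functions_def)
qed

text \<open>The exponent \<open>a - 2\<close> with the factor \<open>x \<bullet> h\<close>, instead
  of \<open>a - 1\<close> with \<open>sgn x \<bullet> h\<close>, exhibits the derivative as a power
  of the norm times a function that is smooth at the origin too.\<close>

lemma has_derivative_norm_powr:
  fixes x :: "'a::euclidean_space"
  assumes "x \<noteq> 0"
  shows "((\<lambda>x. norm x powr a) has_derivative (\<lambda>h. a * norm x powr (a - 2) * (x \<bullet> h))) (at x)"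
proof -
  have n: "(norm has_derivative (\<lambda>h. sgn x \<bullet> h)) (at x)"
    using has_derivative_norm[OF assms] by (simp add: inner_commute)
  have "((\<lambda>r. r powr a) has_derivative (\<lambda>h. a * norm x powr (a - 1) * h)) (at (norm x))"
    using has_real_derivative_powr[of "norm x" a] assms by (simp add: has_field_derivative_def)
  from has_derivative_compose[OF n this]
  have "((\<lambda>x. norm x powr a) has_derivative (\<lambda>h. a * norm x powr (a - 1) * (sgn x \<bullet> h))) (at x)" .
  moreover have "a * norm x powr (a - 1) * (sgn x \<bullet> h) = a * norm x powr (a - 2) * (x \<bullet> h)" for h
  proof -
    have "norm x powr (a - 1) = norm x powr (a - 2) * norm x"
      using assms powr_add[of "norm x" "a - 2" 1] by simp
    then show ?thesis using assms by (simp add: sgn_div_norm)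
  qed
  ultimately show ?thesis by simp
qed

text \<open>Multiplication by \<open>norm powr a\<close> is coinductively smooth on functions vanishing near the
  origin: a partial derivative produces two such products, with exponents \<open>a\<close> and \<open>a - 2\<close>.\<close>

lemma smooth_norm_powr_mult:
  assumes u: "smooth u" and u0: "\<And>x. norm x < r \<Longrightarrow> u x = 0" and r: "0 < r"
  shows "smooth (\<lambda>x::'a::euclidean_space. complex_of_real (norm x powr a) * u x)"
proof -
  define G where "G = {(\<lambda>x::'a. complex_of_real (norm x powr a) * u x) | a u. smooth u \<and> (\<forall>x. norm x < r \<longrightarrow> u x = 0)}"
  have pd0: "pd b u x = 0" if "\<And>x. norm x < r \<Longrightarrow> u x = 0" "norm x < r" for u b and x :: 'a
  proof -
    have "iter_deriv [b] u x = iter_deriv [b] (\<lambda>_. 0) x"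
      by (rule iter_deriv_local[of "ball 0 r"]) (use that in auto)
    then show ?thesis by simp
  qed
  have key: "((\<lambda>x. complex_of_real (norm x powr a) * u x) has_derivative (\<lambda>b.
      complex_of_real (norm x powr a) * pd b u x + complex_of_real (norm x powr (a - 2)) * (complex_of_real (a * (x \<bullet> b)) * u x))) (at x)"
    if u: "smooth u" "\<And>x. norm x < r \<Longrightarrow> u x = 0" for a u and x :: 'a
  \<comment> \<open>On the ball the product vanishes identically, so the singularity of the norm
    power is never met.\<close>
  proof (cases "norm x < r")
    case True
    have "((\<lambda>_. 0) has_derivative (\<lambda>b. 0)) (at x)" by simp
    then have "((\<lambda>x. complex_of_real (norm x powr a) * u x) has_derivative (\<lambda>b. 0)) (at x)"
      by (rule has_derivative_transform_within_open[of _ _ _ _ "ball 0 r"]) (use True u in auto)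
    then show ?thesis using True u(2) pd0[OF u(2) True] by simp
  next
    case False
    then have "x \<noteq> 0" using r by auto
    from has_derivative_mult[OF has_derivative_of_real[OF has_derivative_norm_powr[OF this]] smooth_has_derivative[OF u(1)]]
    show ?thesis by (rule has_derivative_eq_rhs) (auto simp: mult_ac)
  qed
  show ?thesis
  proof (rule alg_smooth[of G])
    show "g differentiable (at x)" if "g \<in> G" for g x
      using that key unfolding G_def differentiable_def by blast
    show "pd b g \<in> alg G" if "g \<in> G" "b \<in> Basis" for g b
    proof -
      obtain a u where g: "g = (\<lambda>x. complex_of_real (norm x powr a) * u x)" "smooth u" "\<And>x. norm x < r \<Longrightarrow> u x = 0"
        using \<open>g \<in> G\<close> unfolding G_def by blast
      have "pd b g = (\<lambda>x. complex_of_real (norm x powr a) * pd b u x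
           + complex_of_real (norm x powr (a - 2)) * (complex_of_real (x \<bullet> (a *\<^sub>R b)) * u x))"
        unfolding g(1) by (rule ext, subst pd_eq[OF key[OF g(2,3)]]) auto
      moreover have "(\<lambda>x. complex_of_real (norm x powr a) * pd b u x) \<in> G"
        unfolding G_def using pd0[where u=u and b=b, OF g(3)] smooth_pd[OF g(2) that(2)]
        by (intro CollectI exI[of _ a] exI[of _ "pd b u"]) auto
      moreover have "(\<lambda>x. complex_of_real (norm x powr (a - 2)) * (complex_of_real (x \<bullet> (a *\<^sub>R b)) * u x)) \<in> G"
      proof -
        have "smooth (\<lambda>x. complex_of_real (x \<bullet> (a *\<^sub>R b)) * u x)" by (intro smooth_mult smooth_inner g)
        moreover have "\<forall>x. norm x < r \<longrightarrow> complex_of_real (x \<bullet> (a *\<^sub>R b)) * u x = 0" using g(3) by simp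
        ultimately show ?thesis unfolding G_def
          by (intro CollectI exI[of _ "a - 2"] exI[of _ "\<lambda>x. complex_of_real (x \<bullet> (a *\<^sub>R b)) * u x"]) auto
      qed
      ultimately show ?thesis by (simp add: alg_add alg_base)
    qed
    show "(\<lambda>x. complex_of_real (norm x powr a) * u x) \<in> alg G"
      by (rule alg_base) (use u u0 in \<open>auto simp: G_def\<close>)
  qed
qed

subsection \<open>A smooth cutoff\<close>

text \<open>With u = 1/t, the k-th derivative of exp(-1/t) is P_k(u) exp(-u), and differentiation
  gives P_(k+1) = u^2 (P_k - P_k').\<close>

fun bump_poly :: "nat \<Rightarrow> real poly" where
  "bump_poly 0 = 1"
| "bump_poly (Suc k) = [:0, 0, 1:] * (bump_poly k - pderiv (bump_poly k))"

lemma poly_exp_tendsto: "((\<lambda>u. poly p u * exp (- u)) \<longlongrightarrow> (0::real)) at_top"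
proof -
  have "((\<lambda>u. \<Sum>i\<le>degree p. coeff p i * (u ^ i / exp u)) \<longlongrightarrow> (\<Sum>i\<le>degree p. coeff p i * 0)) at_top"
    by (intro tendsto_sum tendsto_mult tendsto_const tendsto_power_div_exp_0)
  moreover have "(\<Sum>i\<le>degree p. coeff p i * (u ^ i / exp u)) = poly p u * exp (- u)" for u
    by (simp add: poly_altdef sum_distrib_right exp_minus divide_inverse mult.assoc)
  ultimately show ?thesis by simp
qed

definition bump_deriv :: "nat \<Rightarrow> real \<Rightarrow> real" where
  "bump_deriv k t = (if 0 < t then poly (bump_poly k) (1 / t) * exp (- (1 / t)) else 0)"

lemma bump_deriv_deriv: "(bump_deriv k has_real_derivative bump_deriv (Suc k) t) (at t)"
proof -
  consider "0 < t" | "t < 0" | "t = 0" by linarith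
  then show ?thesis
  proof cases
    case 1
    have "((\<lambda>t. poly (bump_poly k) (1 / t) * exp (- (1 / t))) has_real_derivative
       (poly (pderiv (bump_poly k)) (1 / t) * (- 1 / t\<^sup>2)) * exp (- (1 / t)) + exp (- (1 / t)) * (1 / t\<^sup>2) * poly (bump_poly k) (1 / t)) (at t)"
      using 1 by (auto intro!: derivative_eq_intros DERIV_chain2[OF poly_DERIV] simp: power2_eq_square)
    moreover have "(poly (pderiv (bump_poly k)) (1 / t) * (- 1 / t\<^sup>2)) * exp (- (1 / t)) + exp (- (1 / t)) * (1 / t\<^sup>2) * poly (bump_poly k) (1 / t)
      = bump_deriv (Suc k) t"
      using 1 by (simp add: bump_deriv_def field_simps power2_eq_square)
    ultimately have "((\<lambda>t. poly (bump_poly k) (1 / t) * exp (- (1 / t))) has_real_derivative bump_deriv (Suc k) t) (at t)"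
      by simp
    then show ?thesis
      by (rule has_field_derivative_transform_within_open[of _ _ _ "{0<..}"]) (use 1 in \<open>auto simp: bump_deriv_def\<close>)
  next
    case 2
    have "((\<lambda>_. 0) has_real_derivative 0) (at t)" by simp
    then have "(bump_deriv k has_real_derivative 0) (at t)"
      by (rule has_field_derivative_transform_within_open[of _ _ _ "{..<0}"]) (use 2 in \<open>auto simp: bump_deriv_def\<close>)
    then show ?thesis using 2 by (simp add: bump_deriv_def)
  next
    case 3
    have "((\<lambda>y. (bump_deriv k y - bump_deriv k 0) / (y - 0)) \<longlongrightarrow> 0) (at 0)"
      unfolding filterlim_at_split
    proof
      have "((\<lambda>y::real. 0) \<longlongrightarrow> (0::real)) (at_left 0)" by simp
      moreover have "\<forall>\<^sub>F y in at_left 0. (bump_deriv k y - bump_deriv k 0) / (y - 0) = (0::real)"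
        using eventually_at_left_real[of "-1" "0::real", simplified] by (rule eventually_mono) (simp add: bump_deriv_def)
      ultimately show "((\<lambda>y. (bump_deriv k y - bump_deriv k 0) / (y - 0)) \<longlongrightarrow> 0) (at_left 0)"
        by (subst tendsto_cong)
      \<comment> \<open>Dividing by \<open>y\<close> multiplies by \<open>inverse y\<close>, which
        is the shift \<open>pCons 0\<close>; at 0 every difference quotient from the right is again
        a polynomial in \<open>inverse y\<close> times the decaying exponential.\<close>
      have "((\<lambda>y. poly (pCons 0 (bump_poly k)) (inverse y) * exp (- inverse y)) \<longlongrightarrow> 0) (at_right 0)"
        by (rule filterlim_compose[OF poly_exp_tendsto filterlim_inverse_at_top_right])
      moreover have "\<forall>\<^sub>F y in at_right 0. (bump_deriv k y - bump_deriv k 0) / (y - 0)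
          = poly (pCons 0 (bump_poly k)) (inverse y) * exp (- inverse y)"
        using eventually_at_right_less[of "0::real"] by (rule eventually_mono) (simp add: bump_deriv_def field_simps)
      ultimately show "((\<lambda>y. (bump_deriv k y - bump_deriv k 0) / (y - 0)) \<longlongrightarrow> 0) (at_right 0)"
        by (subst tendsto_cong)
    qed
    then show ?thesis using 3 by (simp add: has_field_derivative_iff bump_deriv_def)
  qed
qed

lemma smooth1_bump: "smooth1 (bump_deriv 0)"
  unfolding smooth1_def using bump_deriv_deriv by blast

lemma bump_pos: "0 < t \<Longrightarrow> 0 < bump_deriv 0 t" "t \<le> 0 \<Longrightarrow> bump_deriv 0 t = 0"
  by (auto simp: bump_deriv_def)

lemma smooth1_smooth:
  assumes "smooth1 h" shows "smooth (\<lambda>x::real. complex_of_real (h x))"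
proof -
  obtain d where d: "d 0 = h" "\<And>k x. (d k has_real_derivative d (Suc k) x) (at x)"
    using assms unfolding smooth1_def by auto
  have der: "((\<lambda>x. complex_of_real (d k x)) has_derivative (\<lambda>y. complex_of_real (y * d (Suc k) x))) (at x)" for k x
    using d(2)[of k x] by (intro has_derivative_of_real) (simp add: has_field_derivative_def mult_commute_abs)
  show ?thesis
  proof (rule smooth_coinduct[of _ "range (\<lambda>k x. complex_of_real (d k x))"])
    show "(\<lambda>x. complex_of_real (h x)) \<in> range (\<lambda>k x. complex_of_real (d k x))" using d(1) by blast
    fix u and x b :: real assume "u \<in> range (\<lambda>k x. complex_of_real (d k x))"
    then obtain k where k: "u = (\<lambda>x. complex_of_real (d k x))" by blast
    show "u differentiable (at x)" using der k differentiable_def by blast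
    assume "b \<in> Basis"
    then have "pd b u = (\<lambda>x. complex_of_real (d (Suc k) x))"
      unfolding k by (intro ext, subst pd_eq[OF der]) auto
    then show "pd b u \<in> range (\<lambda>k x. complex_of_real (d k x))" by blast
  qed
qed

text \<open>Together with \<open>smooth1_smooth\<close> this gives one-variable functions closure
  under products and affine substitution from the general theory. The sequence of derivatives is
  read off along the only basis vector 1.\<close>

lemma smooth_smooth1:
  assumes "smooth (\<lambda>x::real. complex_of_real (h x))" shows "smooth1 h"
  unfolding smooth1_def
proof (intro exI[of _ "\<lambda>k x. Re (iter_deriv (replicate k 1) (\<lambda>x. complex_of_real (h x)) x)"] conjI allI)
  fix k and x :: real
  let ?u = "iter_deriv (replicate k 1) (\<lambda>x. complex_of_real (h x))"
  have sm: "smooth ?u" by (rule smooth_iter_deriv[OF assms]) (auto simp: in_lists_conv_set)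
  have "((\<lambda>x. Re (?u x)) has_derivative (\<lambda>y. Re (frechet_derivative ?u (at x) y))) (at x)"
    by (rule has_derivative_Re[OF smooth_has_derivative[OF sm]])
  moreover have lin: "frechet_derivative ?u (at x) y = y *\<^sub>R frechet_derivative ?u (at x) 1" for y
    using linear_cmul[OF linear_frechet_derivative[OF smooth_differentiable[OF sm]], of x y 1]
    unfolding real_scaleR_def mult_1_right .
  have "(\<lambda>y. Re (frechet_derivative ?u (at x) y)) = (*) (Re (frechet_derivative ?u (at x) 1))"
  proof
    show "Re (frechet_derivative ?u (at x) y) = Re (frechet_derivative ?u (at x) 1) * y" for y
      by (subst lin[of y]) (simp only: scaleR_complex.sel mult.commute)
  qed
  ultimately show "((\<lambda>x. Re (?u x)) has_real_derivative Re (iter_deriv (replicate (Suc k) 1) (\<lambda>x. complex_of_real (h x)) x)) (at x)"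
    by (simp add: has_field_derivative_def)
qed simp

lemma smooth1_mult: "smooth1 f \<Longrightarrow> smooth1 g \<Longrightarrow> smooth1 (\<lambda>x. f x * g x)"
  using smooth_mult[OF smooth1_smooth smooth1_smooth, of f g] by (intro smooth_smooth1) simp

lemma smooth1_affine: "smooth1 f \<Longrightarrow> smooth1 (\<lambda>x. f (c * x + a))"
  using smooth_affine[OF smooth1_smooth, of f c a] by (intro smooth_smooth1) simp

lemma smooth1_continuous: assumes "smooth1 f" shows "continuous_on S f"
proof -
  obtain d where d: "d 0 = f" "\<And>k x. (d k has_real_derivative d (Suc k) x) (at x)"
    using assms unfolding smooth1_def by auto
  have "(f has_real_derivative d 1 x) (at x within S)" for x
    using has_field_derivative_at_within[OF d(2)[of 0 x]] d(1) by simp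
  then show ?thesis by (rule DERIV_continuous_on)
qed

text \<open>One minus the normalised primitive of a bump supported in [1,4]. The thresholds are the
  squares of the radii 1 and 2, because the step is applied to \<open>x \<bullet> x\<close>.\<close>

lemma smooth_step_exists:
  "\<exists>h. smooth1 h \<and> (\<forall>r\<le>1. h r = 1) \<and> (\<forall>r\<ge>4. h r = 0)"
proof -
  define b where "b u = bump_deriv 0 (u - 1) * bump_deriv 0 (4 - u)" for u
  have sb: "smooth1 b"
  proof -
    have "smooth1 (\<lambda>u. bump_deriv 0 (1 * u + (-1)) * bump_deriv 0 ((-1) * u + 4))"
      by (intro smooth1_mult smooth1_affine smooth1_bump)
    then show ?thesis by (simp add: b_def[abs_def])
  qed
  have b0: "b u = 0" if "u \<le> 1 \<or> 4 \<le> u" for u using that by (auto simp: b_def bump_pos)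
  have bp: "0 < b u" if "1 < u" "u < 4" for u using that by (auto simp: b_def intro!: mult_pos_pos bump_pos)
  \<comment> \<open>For negative \<open>x\<close> the interval is empty and the integral is 0, in
    agreement with \<open>b\<close> vanishing there.\<close>
  define B where "B x = integral {0..x} b" for x
  have B0: "B x = 0" if "x \<le> 1" for x
  proof -
    have "integral {0..x} b = integral {0..x} (\<lambda>_. 0)" using that by (intro integral_cong) (auto intro: b0)
    then show ?thesis by (simp add: B_def)
  qed
  have dB: "(B has_real_derivative b x) (at x)" for x
  proof (cases "0 < x")
    case True
    have "((\<lambda>x. integral {0..x} b) has_real_derivative b x) (at x within {0..x + 1})"
      using True by (intro integral_has_real_derivative smooth1_continuous[OF sb]) auto
    then show ?thesis using True by (simp add: B_def[abs_def] at_within_Icc_at)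
  next
    case False
    have "((\<lambda>_. 0) has_real_derivative 0) (at x)" by simp
    then have "(B has_real_derivative 0) (at x)"
      by (rule has_field_derivative_transform_within_open[of _ _ _ "{..<1}"]) (use False B0 in auto)
    then show ?thesis using False by (simp add: b0)
  qed
  have "B 2 < B 3" by (rule DERIV_pos_imp_increasing) (use dB bp in \<open>auto intro!: exI[of _ "b _"]\<close>)
  moreover have mono: "B x \<le> B y" if "x \<le> y" for x y
    by (rule DERIV_nonneg_imp_nondecreasing[OF that]) (use dB bp b0 in \<open>metis less_eq_real_def not_less\<close>)
  ultimately have B4: "0 < B 4" using B0[of 1] mono[of 1 2] mono[of 3 4] by linarith
  have BE: "B r = B 4" if "4 \<le> r" for r
  proof (cases "r = 4")
    case False
    then have "4 < r" using that by simp
    have "DERIV B x :> 0" if "4 < x" for x using dB[of x] b0[of x] that by simp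
    then show ?thesis
      using DERIV_isconst_end[OF \<open>4 < r\<close> DERIV_continuous_on[of "{4..r}" B b]] dB has_field_derivative_at_within by blast
  qed simp
  obtain d where d: "d 0 = b" "\<And>k x. (d k has_real_derivative d (Suc k) x) (at x)"
    using sb unfolding smooth1_def by auto
  let ?h = "\<lambda>r. 1 - B r / B 4"
  have "smooth1 ?h"
    unfolding smooth1_def
  proof (intro exI[of _ "\<lambda>k. case k of 0 \<Rightarrow> ?h | Suc j \<Rightarrow> (\<lambda>x. - (d j x / B 4))"] conjI allI)
    fix k x
    show "((case k of 0 \<Rightarrow> ?h | Suc j \<Rightarrow> (\<lambda>x. - (d j x / B 4))) has_real_derivative
       (case Suc k of 0 \<Rightarrow> ?h | Suc j \<Rightarrow> (\<lambda>x. - (d j x / B 4))) x) (at x)"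
      using dB d B4 by (cases k) (auto intro!: derivative_eq_intros)
  qed simp
  moreover have "?h r = 1" if "r \<le> 1" for r using B0[OF that] by simp
  moreover have "?h r = 0" if "4 \<le> r" for r
    unfolding BE[OF that] using B4 by (simp del: right_minus_eq)
  ultimately show ?thesis by blast
qed

text \<open>One profile on the line is chosen once, independently of the dimension, so all cutoffs
  are radial and take real values.\<close>

definition cutoff :: "'a::euclidean_space \<Rightarrow> complex" where
  "cutoff x = complex_of_real ((SOME h. smooth1 h \<and> (\<forall>r\<le>1. h r = 1) \<and> (\<forall>r\<ge>4. h r = 0)) (x \<bullet> x))"

lemma cutoff_smooth: "smooth cutoff"
  and cutoff_1: "norm x \<le> 1 \<Longrightarrow> cutoff x = 1"
  and cutoff_0: "2 \<le> norm x \<Longrightarrow> cutoff x = 0"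
proof -
  define h where "h = (SOME h. smooth1 h \<and> (\<forall>r\<le>1. h r = 1) \<and> (\<forall>r\<ge>4. h r = 0))"
  have h: "smooth1 h" "\<And>r. r \<le> 1 \<Longrightarrow> h r = 1" "\<And>r. 4 \<le> r \<Longrightarrow> h r = 0"
    using someI_ex[OF smooth_step_exists] unfolding h_def by blast+
  show "smooth cutoff" unfolding cutoff_def[abs_def] h_def[symmetric] by (rule smooth_radial[OF h(1)])
  show "cutoff x = 1" if "norm x \<le> 1"
    using that power_mono[of "norm x" 1 2] by (simp add: cutoff_def h_def[symmetric] h dot_square_norm)
  show "cutoff x = 0" if "2 \<le> norm x"
    using that power_mono[of 2 "norm x" 2] by (simp add: cutoff_def h_def[symmetric] h dot_square_norm)
qed

lemma cutoff_test: "cutoff \<in> test_functions"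
  by (rule testI_bounded[OF cutoff_smooth cutoff_0])

lemma cutoff_dilate_smooth: "smooth (\<lambda>x. cutoff (c *\<^sub>R x))"
  using smooth_affine[OF cutoff_smooth, of c 0] by simp

lemma cutoff_dilate_test: "c \<noteq> 0 \<Longrightarrow> (\<lambda>x. cutoff (c *\<^sub>R x)) \<in> test_functions"
proof (rule testI_bounded[OF cutoff_dilate_smooth])
  assume c: "c \<noteq> 0"
  fix x :: 'a assume "2 / \<bar>c\<bar> \<le> norm x"
  then have "2 \<le> norm (c *\<^sub>R x)" using c by (simp add: pos_divide_le_eq mult.commute)
  then show "cutoff (c *\<^sub>R x) = 0" by (rule cutoff_0)
qed

text \<open>The dilation factors are at most 1, so differentiation only makes them smaller and the
  bounds for a single cutoff hold for the whole family.\<close>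

lemma moderate_cutoffs: "moderate_family (\<lambda>(i::nat) x. cutoff ((1 / real (Suc i)) *\<^sub>R x))"
  unfolding moderate_family_def
proof (intro conjI allI ballI)
  show "smooth (\<lambda>x. cutoff ((1 / real (Suc i)) *\<^sub>R x))" for i by (rule cutoff_dilate_smooth)
  fix bs :: "'a list" assume bs: "bs \<in> lists Basis"
  obtain C where C: "0 < C" "\<And>x. (1 + norm x) ^ 0 * norm (iter_deriv bs cutoff x) \<le> C"
    using schwartz_bound[OF test_schwartz[OF cutoff_test] bs] by blast
  have "norm (iter_deriv bs (\<lambda>x. cutoff ((1 / real (Suc i)) *\<^sub>R x)) x) \<le> C * (1 + norm x) ^ 0" for i x
  proof -
    have "(1 / real (Suc i)) ^ length bs * norm (iter_deriv bs cutoff ((1 / real (Suc i)) *\<^sub>R x)) \<le> 1 * C"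
      using C(2) by (intro mult_mono power_le_one) auto
    then show ?thesis
      using iter_deriv_affine[OF cutoff_smooth bs, of "1 / real (Suc i)" 0] by simp
  qed
  then show "\<exists>N C. \<forall>i x. norm (iter_deriv bs (\<lambda>x. cutoff ((1 / real (Suc i)) *\<^sub>R x)) x) \<le> C * (1 + norm x) ^ N" by blast
qed

lemma schwartz_cutoff_test:
  assumes f: "f \<in> schwartz"
  shows "(\<lambda>x. f x * cutoff ((1 / real (Suc i)) *\<^sub>R x)) \<in> test_functions"
proof -
  have "(\<lambda>x. cutoff ((1 / real (Suc i)) *\<^sub>R x)) \<in> test_functions" by (rule cutoff_dilate_test) simp
  from test_mult'[OF this schwartz_smooth[OF f]] show ?thesis by simp
qed

section \<open>Truncation of Schwartz functions in the Schwartz topology\<close>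

lemma schwartz_family_const:
  assumes "f \<in> schwartz" shows "schwartz_family (\<lambda>_. f)"
  unfolding schwartz_family_def
proof (intro conjI allI ballI)
  show "smooth f" by (rule schwartz_smooth[OF assms])
  fix N and bs :: "'a list" assume "bs \<in> lists Basis"
  from schwartz_bound[OF assms this, of N] show "\<exists>C. \<forall>i x. (1 + norm x) ^ N * norm (iter_deriv bs f x) \<le> C" by metis
qed

lemma schwartz_family_norm_bound:
  assumes F: "schwartz_family (F :: 'i \<Rightarrow> 'a::euclidean_space \<Rightarrow> complex)"
  shows "\<exists>D\<ge>0. \<forall>i. schwartz_norm N (F i) \<le> D"
proof -
  let ?B = "{bs::'a list. bs \<in> lists Basis \<and> length bs \<le> N}"
  have fin: "finite ?B" using finite_lists_length_le[of "Basis::'a set" N] by (simp add: in_lists_conv_set subset_eq)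
  have "\<forall>bs\<in>?B. \<exists>C. \<forall>i x. (1 + norm x) ^ N * norm (iter_deriv bs (F i) x) \<le> C"
    using F unfolding schwartz_family_def by blast
  from bchoice[OF this] obtain C where
    C: "\<And>bs i x. bs \<in> ?B \<Longrightarrow> (1 + norm x) ^ N * norm (iter_deriv bs (F i) x) \<le> C bs" by blast
  have "schwartz_norm N (F i) \<le> Max (insert 0 (C ` ?B))" for i
  proof (rule schwartz_norm_le)
    fix x :: 'a and bs :: "'a list" assume "bs \<in> lists Basis" "length bs \<le> N"
    then have "bs \<in> ?B" by simp
    from C[OF this, of x i] this show "(1 + norm x) ^ N * norm (iter_deriv bs (F i) x) \<le> Max (insert 0 (C ` ?B))"
      using Max_ge[of "insert 0 (C ` ?B)" "C bs"] fin by fastforce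
  qed
  moreover have "0 \<le> Max (insert 0 (C ` ?B))" using fin by (intro Max_ge) auto
  ultimately show ?thesis by blast
qed

text \<open>The truncation error is of size \<open>1 / Suc i\<close> in every seminorm, since it is supported where
  the weight \<open>1 + norm x\<close> exceeds \<open>Suc i\<close>.\<close>

lemma schwartz_family_cutoff:
  assumes f: "f \<in> schwartz"
  shows "schwartz_family (\<lambda>(i::nat) x. of_nat (Suc i) * (f x * cutoff ((1 / real (Suc i)) *\<^sub>R x) - f x))"
proof -
  let ?F = "\<lambda>(i::nat) x. f x * cutoff ((1 / real (Suc i)) *\<^sub>R x) + (- f x)"
  have sF: "schwartz_family ?F"
    by (rule schwartz_family_add[OF schwartz_family_mult[OF schwartz_family_const[OF f] moderate_cutoffs]
        schwartz_family_const[OF schwartz_uminus[OF f]]])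
  have sm: "smooth (?F i)" for i using sF by (simp add: schwartz_family_def)
  have "schwartz_family (\<lambda>i x. of_nat (Suc i) * ?F i x)"
    unfolding schwartz_family_def
  proof (intro conjI allI ballI)
    show "smooth (\<lambda>x. of_nat (Suc i) * ?F i x)" for i by (rule smooth_cmult[OF sm])
    fix N and bs :: "'a list" assume bs: "bs \<in> lists Basis"
    obtain C where C: "\<And>i x. (1 + norm x) ^ Suc N * norm (iter_deriv bs (?F i) x) \<le> C"
      using sF bs unfolding schwartz_family_def by blast
    have C0: "0 \<le> C" by (rule order_trans[OF _ C[of 0 0]]) simp
    have "(1 + norm x) ^ N * norm (iter_deriv bs (\<lambda>x. of_nat (Suc i) * ?F i x) x) \<le> C" for i x
    proof (cases "norm x < real (Suc i)")
      case True
      have "iter_deriv bs (?F i) x = iter_deriv bs (\<lambda>_. 0) x"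
      proof (rule iter_deriv_local[of "ball 0 (real (Suc i))"])
        show "?F i y = 0" if "y \<in> ball 0 (real (Suc i))" for y
          using that by (subst cutoff_1) (auto simp: field_simps)
      qed (use True in auto)
      also have "\<dots> = 0" using iter_deriv_const_bound[OF bs, of 0 x] by simp
      finally show ?thesis unfolding iter_deriv_cmult[OF sm bs] using C0 by simp
    next
      case False
      have "(1 + norm x) ^ N * norm (iter_deriv bs (\<lambda>x. of_nat (Suc i) * ?F i x) x)
        = real (Suc i) * ((1 + norm x) ^ N * norm (iter_deriv bs (?F i) x))"
        unfolding iter_deriv_cmult[OF sm bs] norm_mult norm_of_nat by (simp only: mult_ac)
      also have "\<dots> \<le> (1 + norm x) * ((1 + norm x) ^ N * norm (iter_deriv bs (?F i) x))"
        using False by (intro mult_right_mono) auto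
      also have "\<dots> \<le> C" using C[of x i] by simp
      finally show ?thesis .
    qed
    then show "\<exists>C. \<forall>i x. (1 + norm x) ^ N * norm (iter_deriv bs (\<lambda>x. of_nat (Suc i) * ?F i x) x) \<le> C" by blast
  qed
  then show ?thesis by simp
qed

text \<open>Convergence is encoded as boundedness of the family multiplied by \<open>Suc i\<close>.
  Closure properties of families, such as stability under the Fourier transform, thereby serve as
  continuity statements.\<close>

lemma schwartz_norm_scaled_tendsto:
  assumes F: "schwartz_family (\<lambda>(i::nat) x. of_nat (Suc i) * u i x)"
  shows "(\<lambda>i. schwartz_norm N (u i)) \<longlonglongrightarrow> 0"
proof -
  have u: "u i \<in> schwartz" for i
  proof -
    have "(\<lambda>x. (1 / of_nat (Suc i)) * (of_nat (Suc i) * u i x)) \<in> schwartz"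
      by (rule schwartz_cmult[OF schwartz_familyD[OF F]])
    moreover have "(1 / of_nat (Suc i)) * (of_nat (Suc i) * u i x) = u i x" for x
      by (simp del: of_nat_Suc)
    ultimately show ?thesis by simp
  qed
  obtain D where D: "\<And>i. schwartz_norm N (\<lambda>x. of_nat (Suc i) * u i x) \<le> D"
    using schwartz_family_norm_bound[OF F] by blast
  have bd: "schwartz_norm N (u i) \<le> D / real (Suc i)" for i
  proof (rule schwartz_norm_le)
    fix x and bs :: "'a list" assume bs: "bs \<in> lists Basis" "length bs \<le> N"
    have "real (Suc i) * ((1 + norm x) ^ N * norm (iter_deriv bs (u i) x)) \<le> D"
      using order_trans[OF schwartz_norm_ge[OF schwartz_familyD[OF F, of i] bs, of x] D[of i]]
      unfolding iter_deriv_cmult[OF schwartz_smooth[OF u] bs(1)] norm_mult norm_of_nat by (simp only: mult_ac)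
    then show "(1 + norm x) ^ N * norm (iter_deriv bs (u i) x) \<le> D / real (Suc i)"
      by (simp add: pos_le_divide_eq mult.commute)
  qed
  show ?thesis
  proof (rule tendsto_sandwich[of "\<lambda>_. 0" _ _ "\<lambda>i. D / real (Suc i)"])
    show "\<forall>\<^sub>F i in sequentially. 0 \<le> schwartz_norm N (u i)"
      using schwartz_norm_nonneg[OF u] by simp
    show "(\<lambda>i. D / real (Suc i)) \<longlonglongrightarrow> 0" by (rule LIMSEQ_Suc[OF lim_const_over_n])
  qed (use bd in auto)
qed

lemmas schwartz_cutoff_tendsto = schwartz_norm_scaled_tendsto[OF schwartz_family_cutoff]

section \<open>Affine changes of variable in integrals\<close>

lemma lborel_integral_affine:
  fixes f :: "'a::euclidean_space \<Rightarrow> 'b::{banach, second_countable_topology}"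
  assumes c: "c \<noteq> 0" and f[measurable]: "f \<in> borel_measurable borel"
  shows "integrable lborel (\<lambda>x. f (t + c *\<^sub>R x)) \<longleftrightarrow> integrable lborel f"
    and "(\<integral>x. f (t + c *\<^sub>R x) \<partial>lborel) = (1 / \<bar>c\<bar> ^ DIM('a)) *\<^sub>R (\<integral>x. f x \<partial>lborel)"
proof -
  let ?T = "\<lambda>x::'a. t + c *\<^sub>R x"
  have eq: "lborel = density (distr lborel borel ?T) (\<lambda>_. ennreal (\<bar>c\<bar> ^ DIM('a)))"
    using lborel_affine[OF c, of t] by simp
  have cp: "0 < \<bar>c\<bar> ^ DIM('a)" using c by simp
  have "integrable lborel f \<longleftrightarrow> integrable (density (distr lborel borel ?T) (\<lambda>_. ennreal (\<bar>c\<bar> ^ DIM('a)))) f"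
    using eq by simp
  also have "\<dots> \<longleftrightarrow> integrable (distr lborel borel ?T) (\<lambda>x. (\<bar>c\<bar> ^ DIM('a)) *\<^sub>R f x)"
    by (subst integrable_density) auto
  also have "\<dots> \<longleftrightarrow> integrable (distr lborel borel ?T) f"
  proof
    assume "integrable (distr lborel borel ?T) (\<lambda>x. (\<bar>c\<bar> ^ DIM('a)) *\<^sub>R f x)"
    then have "integrable (distr lborel borel ?T) (\<lambda>x. (1 / \<bar>c\<bar> ^ DIM('a)) *\<^sub>R ((\<bar>c\<bar> ^ DIM('a)) *\<^sub>R f x))"
      by (rule integrable_scaleR_right)
    then show "integrable (distr lborel borel ?T) f" using cp by simp
  qed (rule integrable_scaleR_right)
  also have "\<dots> \<longleftrightarrow> integrable lborel (\<lambda>x. f (?T x))"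
    by (subst integrable_distr_eq) auto
  finally show "integrable lborel (\<lambda>x. f (?T x)) \<longleftrightarrow> integrable lborel f" by simp
  have "(\<integral>x. f x \<partial>lborel) = (\<integral>x. f x \<partial>(density (distr lborel borel ?T) (\<lambda>_. ennreal (\<bar>c\<bar> ^ DIM('a)))))"
    using eq by simp
  also have "\<dots> = (\<integral>x. (\<bar>c\<bar> ^ DIM('a)) *\<^sub>R f x \<partial>(distr lborel borel ?T))"
    by (subst integral_density) auto
  also have "\<dots> = (\<bar>c\<bar> ^ DIM('a)) *\<^sub>R (\<integral>x. f x \<partial>(distr lborel borel ?T))"
    by simp
  also have "\<dots> = (\<bar>c\<bar> ^ DIM('a)) *\<^sub>R (\<integral>x. f (?T x) \<partial>lborel)"
    by (subst integral_distr) auto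
  finally show "(\<integral>x. f (?T x) \<partial>lborel) = (1 / \<bar>c\<bar> ^ DIM('a)) *\<^sub>R (\<integral>x. f x \<partial>lborel)"
    using cp by simp
qed

lemma integrable_translate:
  fixes f :: "'a::euclidean_space \<Rightarrow> 'b::{banach, second_countable_topology}"
  assumes "f \<in> borel_measurable borel"
  shows "integrable lborel (\<lambda>x. f (x - t)) \<longleftrightarrow> integrable lborel f"
  using lborel_integral_affine(1)[of 1 f "-t"] assms by simp

lemma integral_translate:
  fixes f :: "'a::euclidean_space \<Rightarrow> 'b::{banach, second_countable_topology}"
  assumes "f \<in> borel_measurable borel"
  shows "(\<integral>x. f (x - t) \<partial>lborel) = (\<integral>x. f x \<partial>lborel)"
  using lborel_integral_affine(2)[of 1 f "-t"] assms by simp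

lemma integrable_reflect:
  fixes f :: "'a::euclidean_space \<Rightarrow> 'b::{banach, second_countable_topology}"
  assumes "f \<in> borel_measurable borel"
  shows "integrable lborel (\<lambda>x. f (t - x)) \<longleftrightarrow> integrable lborel f"
  using lborel_integral_affine(1)[of "-1" f t] assms by simp

lemma integral_reflect:
  fixes f :: "'a::euclidean_space \<Rightarrow> 'b::{banach, second_countable_topology}"
  assumes "f \<in> borel_measurable borel"
  shows "(\<integral>x. f (t - x) \<partial>lborel) = (\<integral>x. f x \<partial>lborel)"
  using lborel_integral_affine(2)[of "-1" f t] assms by simp

section \<open>Rapidly decreasing functions and derivatives under the integral\<close>

lemma integrable_decay: "integrable lborel (\<lambda>y::'a::euclidean_space. 1 / (1 + norm y) ^ (DIM('a) + 1))"
proof (rule integrableI_nonneg)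
  show "(\<lambda>y::'a. 1 / (1 + norm y) ^ (DIM('a) + 1)) \<in> borel_measurable lborel" by measurable
  show "(\<integral>\<^sup>+y. ennreal (1 / (1 + norm (y::'a)) ^ (DIM('a) + 1)) \<partial>lborel) < \<infinity>"
    by (rule nn_integral_decay_finite)
qed simp

text \<open>Integrability against every polynomial weight, without any smoothness. The class
  contains the Schwartz functions and is stable under Borel factors of polynomial growth.\<close>

definition rapid :: "('a::euclidean_space \<Rightarrow> complex) \<Rightarrow> bool" where
  "rapid w \<longleftrightarrow> w \<in> borel_measurable borel \<and> (\<forall>N. integrable lborel (\<lambda>x. (1 + norm x) ^ N * norm (w x)))"

lemma rapid_measurable [measurable_dest]: "rapid w \<Longrightarrow> w \<in> borel_measurable borel"
  by (simp add: rapid_def)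

lemma rapid_weight: "rapid w \<Longrightarrow> integrable lborel (\<lambda>x. (1 + norm x) ^ N * norm (w x))"
  by (simp add: rapid_def)

lemma rapid_integrable:
  assumes "rapid w" shows "integrable lborel w"
proof (rule integrable_norm_cancel)
  show "integrable lborel (\<lambda>x. norm (w x))" using rapid_weight[OF assms, of 0] by simp
  show "w \<in> borel_measurable lborel" using rapid_measurable[OF assms] by simp
qed

lemma rapid_schwartz:
  assumes "f \<in> schwartz" shows "rapid f"
  unfolding rapid_def
proof (intro conjI allI)
  show [measurable]: "f \<in> borel_measurable borel" using assms by (intro smooth_borel schwartz_smooth)
  fix N
  obtain C where C: "0 < C" "\<And>x. norm (f x) \<le> C / (1 + norm x) ^ (N + (DIM('a) + 1))"
    using schwartz_bound0[OF assms] by blast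
  show "integrable lborel (\<lambda>x. (1 + norm x) ^ N * norm (f x))"
  proof (rule Bochner_Integration.integrable_bound)
    show "integrable lborel (\<lambda>y::'a. C * (1 / (1 + norm y) ^ (DIM('a) + 1)))"
      by (intro integrable_mult_right integrable_decay)
    show "AE x in lborel. norm ((1 + norm x) ^ N * norm (f x)) \<le> norm (C * (1 / (1 + norm x) ^ (DIM('a) + 1)))"
    proof (rule AE_I2)
      fix x :: 'a
      have p: "0 < 1 + norm x" by (simp add: add_pos_nonneg)
      have "(1 + norm x) ^ N * norm (f x) \<le> (1 + norm x) ^ N * (C / (1 + norm x) ^ (N + (DIM('a) + 1)))"
        by (intro mult_left_mono C) auto
      also have "\<dots> = C * (1 / (1 + norm x) ^ (DIM('a) + 1))"
        using p by (simp add: power_add)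
      finally show "norm ((1 + norm x) ^ N * norm (f x)) \<le> norm (C * (1 / (1 + norm x) ^ (DIM('a) + 1)))"
        using C(1) by simp
    qed
  qed measurable
qed

lemmas schwartz_borel = rapid_measurable[OF rapid_schwartz]
lemmas schwartz_integrable = rapid_integrable[OF rapid_schwartz]

lemma rapid_mult_bounded_growth:
  assumes w: "rapid w" and g[measurable]: "g \<in> borel_measurable borel" and gb: "\<And>x. norm (g x) \<le> C * (1 + norm x) ^ M"
  shows "rapid (\<lambda>x. g x * w x)"
  unfolding rapid_def
proof (intro conjI allI)
  have [measurable]: "w \<in> borel_measurable borel" using w by measurable
  show "(\<lambda>x. g x * w x) \<in> borel_measurable borel" by measurable
  fix N
  show "integrable lborel (\<lambda>x. (1 + norm x) ^ N * norm (g x * w x))"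
  proof (rule Bochner_Integration.integrable_bound)
    show "integrable lborel (\<lambda>x. C * ((1 + norm x) ^ (N + M) * norm (w x)))"
      by (intro integrable_mult_right rapid_weight w)
    show "AE x in lborel. norm ((1 + norm x) ^ N * norm (g x * w x)) \<le> norm (C * ((1 + norm x) ^ (N + M) * norm (w x)))"
    proof (rule AE_I2)
      fix x :: 'a
      have "(1 + norm x) ^ N * norm (g x * w x) \<le> (1 + norm x) ^ N * ((C * (1 + norm x) ^ M) * norm (w x))"
        unfolding norm_mult by (intro mult_left_mono mult_right_mono gb) auto
      also have "\<dots> = C * ((1 + norm x) ^ (N + M) * norm (w x))" by (simp add: power_add mult_ac)
      finally show "norm ((1 + norm x) ^ N * norm (g x * w x)) \<le> norm (C * ((1 + norm x) ^ (N + M) * norm (w x)))"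
        by simp
    qed
  qed measurable
qed

text \<open>Dominated convergence along sequences: by the mean value inequality increments are
  bounded by \<open>G\<close> times the step, so the normalised remainder stays below
  \<open>2 * G\<close> and tends to 0 pointwise.\<close>

lemma has_derivative_integral:
  fixes F :: "'a::euclidean_space \<Rightarrow> 'b \<Rightarrow> complex"
  assumes int: "\<And>x. integrable M (F x)"
    and der: "\<And>x y. ((\<lambda>x. F x y) has_derivative F' x y) (at x)"
    and bd: "\<And>x y h. norm (F' x y h) \<le> norm h * G y"
    and G: "integrable M G"
    and meas: "\<And>x h. (\<lambda>y. F' x y h) \<in> borel_measurable M"
  shows "((\<lambda>x. \<integral>y. F x y \<partial>M) has_derivative (\<lambda>h. \<integral>y. F' x y h \<partial>M)) (at x)"
proof -
  have lin: "linear (F' x y)" for x y using der[of y x] by (simp add: has_derivative_linear)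
  have G0: "0 \<le> G y" for y
  proof -
    obtain b :: 'a where "norm b = 1" using nonempty_Basis norm_Basis by blast
    then show ?thesis using order_trans[OF norm_ge_zero bd[of x y b]] by simp
  qed
  have intF': "integrable M (\<lambda>y. F' x y h)" for x h
  proof (rule Bochner_Integration.integrable_bound[OF integrable_mult_right[OF G, of "norm h"] meas])
    show "AE y in M. norm (F' x y h) \<le> norm (norm h * G y)"
      using bd G0 by (intro AE_I2) (simp add: abs_mult)
  qed
  have diff_bd: "norm (F z y - F x y) \<le> G y * norm (z - x)" for z x y
  proof (rule differentiable_bound[of UNIV "\<lambda>x. F x y" "\<lambda>x. F' x y"])
    show "onorm (F' x y) \<le> G y" for x
      using bd G0 by (intro onorm_le) (simp add: mult.commute)
  qed (use der in \<open>auto intro: has_derivative_at_withinI\<close>)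
  show ?thesis
    unfolding has_derivative_within
  proof (intro conjI)
    show "bounded_linear (\<lambda>h. \<integral>y. F' x y h \<partial>M)"
    proof (rule bounded_linear_intro[where K="\<integral>y. G y \<partial>M"])
      show "(\<integral>y. F' x y (h + k) \<partial>M) = (\<integral>y. F' x y h \<partial>M) + (\<integral>y. F' x y k \<partial>M)" for h k
        by (simp add: linear_add[OF lin] intF')
      show "(\<integral>y. F' x y (r *\<^sub>R h) \<partial>M) = r *\<^sub>R (\<integral>y. F' x y h \<partial>M)" for r h
        by (simp add: linear_cmul[OF lin])
      show "norm (\<integral>y. F' x y h \<partial>M) \<le> norm h * (\<integral>y. G y \<partial>M)" for h
      proof -
        have "norm (\<integral>y. F' x y h \<partial>M) \<le> (\<integral>y. norm (F' x y h) \<partial>M)" by (rule integral_norm_bound)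
        also have "\<dots> \<le> (\<integral>y. norm h * G y \<partial>M)"
          using intF' G bd by (intro integral_mono) auto
        finally have "norm (\<integral>y. F' x y h \<partial>M) \<le> (\<integral>y. norm h * G y \<partial>M)" .
        then show ?thesis by simp
      qed
    qed
    show "((\<lambda>z. (1 / norm (z - x)) *\<^sub>R ((\<integral>y. F z y \<partial>M) - ((\<integral>y. F x y \<partial>M) + (\<integral>y. F' x y (z - x) \<partial>M)))) \<longlongrightarrow> 0) (at x)"
      unfolding tendsto_at_iff_sequentially
    proof (intro allI impI)
      fix X :: "nat \<Rightarrow> 'a" assume X: "\<forall>i. X i \<in> UNIV - {x}" "X \<longlonglongrightarrow> x"
      let ?R = "\<lambda>i y. (1 / norm (X i - x)) *\<^sub>R (F (X i) y - (F x y + F' x y (X i - x)))"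
      have "(\<lambda>i. \<integral>y. ?R i y \<partial>M) \<longlonglongrightarrow> (\<integral>y. 0 \<partial>M)"
      proof (rule integral_dominated_convergence[where w="\<lambda>y. 2 * G y"])
        show "integrable M (\<lambda>y. 2 * G y)" by (intro integrable_mult_right G)
        show "?R i \<in> borel_measurable M" for i
          using int[THEN borel_measurable_integrable] intF'[THEN borel_measurable_integrable] by measurable
        show "AE y in M. (\<lambda>i. ?R i y) \<longlonglongrightarrow> 0"
        proof (rule AE_I2)
          fix y
          have "((\<lambda>z. (1 / norm (z - x)) *\<^sub>R (F z y - (F x y + F' x y (z - x)))) \<longlongrightarrow> 0) (at x)"
            using der[of y x] unfolding has_derivative_within by simp
          then show "(\<lambda>i. ?R i y) \<longlonglongrightarrow> 0"
            using X unfolding tendsto_at_iff_sequentially by (auto simp: o_def)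
        qed
        show "AE y in M. norm (?R i y) \<le> 2 * G y" for i
        proof (rule AE_I2)
          fix y
          have Xi: "0 < norm (X i - x)" using X(1) by simp
          have "norm (F (X i) y - (F x y + F' x y (X i - x))) \<le> norm (F (X i) y - F x y) + norm (F' x y (X i - x))"
            by (metis diff_diff_eq norm_triangle_ineq4)
          also have "\<dots> \<le> G y * norm (X i - x) + norm (X i - x) * G y" by (intro add_mono diff_bd bd)
          finally have "norm (F (X i) y - (F x y + F' x y (X i - x))) / norm (X i - x) \<le> 2 * G y"
            using Xi by (simp add: pos_divide_le_eq mult_ac)
          then show "norm (?R i y) \<le> 2 * G y" by (simp del: scaleR_right_diff_distrib scaleR_diff_right)
        qed
      qed auto
      moreover have "(\<integral>y. F (X i) y - (F x y + F' x y (X i - x)) \<partial>M) = ((\<integral>y. F (X i) y \<partial>M) - ((\<integral>y. F x y \<partial>M) + (\<integral>y. F' x y (X i - x) \<partial>M)))" for i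
        by (simp add: int intF')
      ultimately show "((\<lambda>z. (1 / norm (z - x)) *\<^sub>R ((\<integral>y. F z y \<partial>M) - ((\<integral>y. F x y \<partial>M) + (\<integral>y. F' x y (z - x) \<partial>M)))) \<circ> X) \<longlonglongrightarrow> 0"
        by (simp add: o_def)
    qed
  qed
qed

subsection \<open>Convolution with a Schwartz kernel\<close>

text \<open>The roles are asymmetric: the weight \<open>w\<close> need only be integrable, and all
  derivatives fall on the kernel \<open>k\<close>.\<close>

definition conv :: "('a::euclidean_space \<Rightarrow> complex) \<Rightarrow> ('a \<Rightarrow> complex) \<Rightarrow> 'a \<Rightarrow> complex" where
  "conv w k y = (\<integral>x. w x * k (y - x) \<partial>lborel)"

lemma schwartz_deriv_bound:
  assumes k: "k \<in> schwartz"
  obtains C where "0 < C" "\<And>x h. norm (frechet_derivative k (at x) h) \<le> C * norm h / (1 + norm x) ^ N"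
proof -
  have "\<exists>C. 0 < C \<and> (\<forall>x. norm (pd b k x) \<le> C / (1 + norm x) ^ N)" if "b \<in> Basis" for b
    using schwartz_bound0[OF schwartz_pd[OF k that]] by metis
  then obtain C where C: "\<And>b. b \<in> Basis \<Longrightarrow> 0 < C b" "\<And>b x. b \<in> Basis \<Longrightarrow> norm (pd b k x) \<le> C b / (1 + norm x) ^ N"
    by metis
  define D where "D = (\<Sum>b\<in>Basis. C b)"
  have "0 < D" unfolding D_def using C(1) by (intro sum_pos) auto
  moreover have "norm (frechet_derivative k (at x) h) \<le> D * norm h / (1 + norm x) ^ N" for x h
  proof -
    have lin: "linear (frechet_derivative k (at x))"
      by (intro linear_frechet_derivative smooth_differentiable schwartz_smooth k)
    have "frechet_derivative k (at x) h = frechet_derivative k (at x) (\<Sum>b\<in>Basis. (h \<bullet> b) *\<^sub>R b)"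
      by (simp add: euclidean_representation)
    also have "\<dots> = (\<Sum>b\<in>Basis. (h \<bullet> b) *\<^sub>R frechet_derivative k (at x) b)"
      by (simp add: linear_sum[OF lin] linear_cmul[OF lin])
    finally have "norm (frechet_derivative k (at x) h) \<le> (\<Sum>b\<in>Basis. norm ((h \<bullet> b) *\<^sub>R frechet_derivative k (at x) b))"
      by (simp only: norm_sum)
    also have "\<dots> \<le> (\<Sum>b\<in>Basis. norm h * (C b / (1 + norm x) ^ N))"
      unfolding norm_scaleR using C by (intro sum_mono mult_mono) (auto simp: Basis_le_norm)
    also have "\<dots> = D * norm h / (1 + norm x) ^ N"
      by (simp add: D_def sum_distrib_left sum_distrib_right sum_divide_distrib mult_ac)
    finally show ?thesis .
  qed
  ultimately show ?thesis by (rule that)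
qed

lemma conv_integrable:
  assumes w: "integrable lborel w" and k: "k \<in> schwartz"
  shows "integrable lborel (\<lambda>x. w x * k (y - x))"
proof -
  obtain C where C: "0 < C" "\<And>x. norm (k x) \<le> C / (1 + norm x) ^ 0" using schwartz_bound0[OF k] by blast
  have [measurable]: "k \<in> borel_measurable borel" "w \<in> borel_measurable borel"
    using schwartz_borel[OF k] w by auto
  show ?thesis
  proof (rule Bochner_Integration.integrable_bound)
    show "integrable lborel (\<lambda>x. norm (w x) * C)" using w by (intro integrable_mult_left integrable_norm)
    show "AE x in lborel. norm (w x * k (y - x)) \<le> norm (norm (w x) * C)"
      using C by (intro AE_I2) (auto simp: norm_mult intro!: mult_left_mono)
  qed measurable
qed

lemma conv_has_derivative:
  assumes w: "integrable lborel w" and k: "k \<in> schwartz"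
  shows "(conv w k has_derivative (\<lambda>h. \<integral>x. w x * frechet_derivative k (at (y - x)) h \<partial>lborel)) (at y)"
proof -
  obtain C where C: "0 < C" "\<And>x h. norm (frechet_derivative k (at x) h) \<le> C * norm h / (1 + norm x) ^ 0"
    using schwartz_deriv_bound[OF k] by blast
  have sm: "smooth k" using k by (rule schwartz_smooth)
  have [measurable]: "k \<in> borel_measurable borel" "w \<in> borel_measurable borel"
    using schwartz_borel[OF k] w by auto
  have [measurable]: "(\<lambda>x. frechet_derivative k (at x) h) \<in> borel_measurable borel" for h
  proof -
    have lin: "linear (frechet_derivative k (at x))" for x
      by (intro linear_frechet_derivative smooth_differentiable sm)
    have "frechet_derivative k (at x) h = (\<Sum>b\<in>Basis. (h \<bullet> b) *\<^sub>R frechet_derivative k (at x) b)" for x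
      by (subst euclidean_representation[of h, symmetric]) (simp only: linear_sum[OF lin] linear_cmul[OF lin])
    moreover have "(\<lambda>x. \<Sum>b\<in>Basis. (h \<bullet> b) *\<^sub>R frechet_derivative k (at x) b) \<in> borel_measurable borel"
      using smooth_borel[OF smooth_pd[OF sm]] by measurable
    ultimately show ?thesis by simp
  qed
  show ?thesis
    unfolding conv_def[abs_def]
  proof (rule has_derivative_integral[where G="\<lambda>x. norm (w x) * C"])
    show "integrable lborel (\<lambda>x. w x * k (y - x))" for y by (rule conv_integrable[OF w k])
    show "((\<lambda>y. w x * k (y - x)) has_derivative (\<lambda>h. w x * frechet_derivative k (at (y - x)) h)) (at y)" for x y
    proof (rule has_derivative_mult_right)
      have "((\<lambda>y. y - x) has_derivative (\<lambda>h. h)) (at y)" by (auto intro!: derivative_eq_intros)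
      from has_derivative_compose[OF this smooth_has_derivative[OF sm]]
      show "((\<lambda>y. k (y - x)) has_derivative frechet_derivative k (at (y - x))) (at y)" by simp
    qed
    show "norm (w x * frechet_derivative k (at (y - x)) h) \<le> norm h * (norm (w x) * C)" for x y h
      using mult_left_mono[OF C(2)[of "y - x" h], of "norm (w x)"] by (simp add: norm_mult mult_ac)
    show "integrable lborel (\<lambda>x. norm (w x) * C)" using w by (intro integrable_mult_left integrable_norm)
  qed measurable
qed

lemma conv_iter_deriv:
  assumes w: "integrable lborel w" and k: "k \<in> schwartz" and bs: "bs \<in> lists Basis"
  shows "iter_deriv bs (conv w k) = conv w (iter_deriv bs k)"
  using bs
proof induction
  case (Cons b bs)
  have bs: "bs \<in> lists Basis" using Cons by auto
  have "iter_deriv (b # bs) (conv w k) y = conv w (iter_deriv (b # bs) k) y" for y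
  proof -
    have "iter_deriv (b # bs) (conv w k) y = pd b (conv w (iter_deriv bs k)) y"
      by (simp only: iter_deriv.simps Cons.IH)
    also have "\<dots> = conv w (iter_deriv (b # bs) k) y"
      by (subst pd_eq[OF conv_has_derivative[OF w schwartz_iter_deriv[OF k bs]]]) (simp only: conv_def iter_deriv.simps)
    finally show ?thesis .
  qed
  then show ?case by blast
qed simp

lemma conv_smooth:
  assumes w: "integrable lborel w" and k: "k \<in> schwartz"
  shows "smooth (conv w k)"
  unfolding smooth_def
proof (intro ballI allI)
  fix bs :: "'a list" and x assume bs: "bs \<in> lists Basis"
  show "iter_deriv bs (conv w k) differentiable (at x)"
    unfolding conv_iter_deriv[OF w k bs] differentiable_def
    using conv_has_derivative[OF w schwartz_iter_deriv[OF k bs]] by blast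
qed

lemma conv_weighted_bound:
  assumes w: "integrable lborel w" "integrable lborel (\<lambda>x. (1 + norm x) ^ N * norm (w x))"
    and k: "k \<in> schwartz" "\<And>x. (1 + norm x) ^ N * norm (k x) \<le> C"
  shows "(1 + norm y) ^ N * norm (conv w k y) \<le> C * (\<integral>x. (1 + norm x) ^ N * norm (w x) \<partial>lborel)"
proof -
  have "(1 + norm y) ^ N * norm (conv w k y) \<le> (1 + norm y) ^ N * (\<integral>x. norm (w x * k (y - x)) \<partial>lborel)"
    unfolding conv_def by (intro mult_left_mono integral_norm_bound) auto
  also have "\<dots> = (\<integral>x. (1 + norm y) ^ N * norm (w x * k (y - x)) \<partial>lborel)" by simp
  also have "\<dots> \<le> (\<integral>x. C * ((1 + norm x) ^ N * norm (w x)) \<partial>lborel)"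
  proof (rule integral_mono)
    show "integrable lborel (\<lambda>x. (1 + norm y) ^ N * norm (w x * k (y - x)))"
      by (intro integrable_mult_right integrable_norm conv_integrable w k)
    show "integrable lborel (\<lambda>x. C * ((1 + norm x) ^ N * norm (w x)))"
      by (intro integrable_mult_right w)
    fix x
    have "(1 + norm y) ^ N * norm (w x * k (y - x)) \<le> ((1 + norm x) * (1 + norm (y - x))) ^ N * norm (w x * k (y - x))"
      by (intro mult_right_mono power_mono one_plus_norm_le) auto
    also have "\<dots> = ((1 + norm x) ^ N * norm (w x)) * ((1 + norm (y - x)) ^ N * norm (k (y - x)))"
      by (simp add: power_mult_distrib norm_mult mult_ac)
    also have "\<dots> \<le> ((1 + norm x) ^ N * norm (w x)) * C"
      by (intro mult_left_mono k) auto
    finally show "(1 + norm y) ^ N * norm (w x * k (y - x)) \<le> C * ((1 + norm x) ^ N * norm (w x))"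
      by (simp add: mult.commute)
  qed
  finally show ?thesis by simp
qed

lemma conv_schwartz:
  assumes w: "rapid w" and k: "k \<in> schwartz"
  shows "conv w k \<in> schwartz"
  unfolding schwartz_family_schwartz[symmetric] schwartz_family_def
proof (intro conjI allI ballI)
  show "smooth (conv w k)" by (rule conv_smooth[OF rapid_integrable[OF w] k])
  fix N and bs :: "'a list" assume bs: "bs \<in> lists Basis"
  obtain C where C: "0 < C" "\<And>x. (1 + norm x) ^ N * norm (iter_deriv bs k x) \<le> C" using schwartz_bound[OF k bs] by blast
  show "\<exists>C. \<forall>(i::unit) x. (1 + norm x) ^ N * norm (iter_deriv bs (conv w k) x) \<le> C"
    unfolding conv_iter_deriv[OF rapid_integrable[OF w] k bs]
    using conv_weighted_bound[OF rapid_integrable[OF w] rapid_weight[OF w] schwartz_iter_deriv[OF k bs] C(2)] by blast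
qed

subsection \<open>The Fourier transform\<close>

lemma fourier_lborel:
  assumes [measurable]: "w \<in> borel_measurable borel"
  shows "fourier w \<xi> = (\<integral>x. exp (- \<i> * complex_of_real (x \<bullet> \<xi>)) * w x \<partial>lborel)"
  unfolding fourier_def by (rule integral_completion) measurable

lemma fourier_borel:
  assumes [measurable]: "w \<in> borel_measurable borel"
  shows "fourier w \<in> borel_measurable borel"
proof -
  have "(\<lambda>\<xi>. \<integral>x. exp (- \<i> * complex_of_real (x \<bullet> \<xi>)) * w x \<partial>lborel) \<in> borel_measurable borel"
    by measurable
  then show ?thesis by (simp add: fourier_lborel[OF assms, abs_def])
qed

lemma rapid_coord:
  assumes "rapid w" shows "rapid (\<lambda>x. (c * complex_of_real (x \<bullet> b)) * w x)"
proof (rule rapid_mult_bounded_growth[OF assms])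
  show "norm (c * complex_of_real (x \<bullet> b)) \<le> (norm c * norm b) * (1 + norm x) ^ 1" for x
  proof -
    have "\<bar>x \<bullet> b\<bar> \<le> norm x * norm b" by (rule Cauchy_Schwarz_ineq2)
    also have "\<dots> \<le> norm b * (1 + norm x)" by (simp add: distrib_left mult.commute)
    finally have "norm c * \<bar>x \<bullet> b\<bar> \<le> norm c * (norm b * (1 + norm x))" by (intro mult_left_mono) auto
    then show ?thesis by (simp add: norm_mult mult.assoc)
  qed
qed measurable

lemma rapid_cis:
  assumes "rapid w" shows "rapid (\<lambda>x. exp (- \<i> * complex_of_real (x \<bullet> b)) * w x)"
  by (rule rapid_mult_bounded_growth[OF assms, where C=1 and M=0]) (auto simp del: mult_minus_left)

lemma norm_fourier_le:
  assumes w: "integrable lborel w"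
  shows "norm (fourier w \<xi>) \<le> (\<integral>x. norm (w x) \<partial>lborel)"
proof -
  have "norm (fourier w \<xi>) \<le> (\<integral>x. norm (exp (- \<i> * complex_of_real (x \<bullet> \<xi>)) * w x) \<partial>lborel)"
    using w by (subst fourier_lborel) auto
  then show ?thesis by (simp add: norm_mult del: mult_minus_left)
qed

lemma fourier_has_derivative:
  assumes w: "rapid w"
  shows "(fourier w has_derivative (\<lambda>h. \<integral>x. exp (- \<i> * complex_of_real (x \<bullet> \<xi>)) * (- \<i> * complex_of_real (x \<bullet> h)) * w x \<partial>lborel)) (at \<xi>)"
proof -
  have [measurable]: "w \<in> borel_measurable borel" using w by measurable
  have "((\<lambda>\<xi>. \<integral>x. exp (- \<i> * complex_of_real (x \<bullet> \<xi>)) * w x \<partial>lborel) has_derivative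
     (\<lambda>h. \<integral>x. exp (- \<i> * complex_of_real (x \<bullet> \<xi>)) * (- \<i> * complex_of_real (x \<bullet> h)) * w x \<partial>lborel)) (at \<xi>)"
  proof (rule has_derivative_integral[where G="\<lambda>x. (1 + norm x) ^ 1 * norm (w x)"])
    show "integrable lborel (\<lambda>x. exp (- \<i> * complex_of_real (x \<bullet> \<xi>)) * w x)" for \<xi>
      by (rule rapid_integrable[OF rapid_cis[OF w]])
    show "((\<lambda>\<xi>. exp (- \<i> * complex_of_real (x \<bullet> \<xi>)) * w x) has_derivative
       (\<lambda>h. exp (- \<i> * complex_of_real (x \<bullet> \<xi>)) * (- \<i> * complex_of_real (x \<bullet> h)) * w x)) (at \<xi>)" for x \<xi> :: 'a
    proof -
      have "((\<lambda>\<xi>. exp (\<i> * complex_of_real (\<xi> \<bullet> (- x)))) has_derivative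
        (\<lambda>h. exp (\<i> * complex_of_real (\<xi> \<bullet> (- x))) * (\<i> * complex_of_real (h \<bullet> (- x))))) (at \<xi>)"
        by (rule has_derivative_cis)
      from has_derivative_mult_left[OF this, of "w x"] show ?thesis by (simp add: inner_commute)
    qed
    show "norm (exp (- \<i> * complex_of_real (x \<bullet> \<xi>)) * (- \<i> * complex_of_real (x \<bullet> h)) * w x)
      \<le> norm h * ((1 + norm x) ^ 1 * norm (w x))" for \<xi> x h :: 'a
    proof -
      have "\<bar>x \<bullet> h\<bar> \<le> norm x * norm h" by (rule Cauchy_Schwarz_ineq2)
      also have "\<dots> \<le> norm h * (1 + norm x)" by (simp add: distrib_left mult.commute)
      finally have "\<bar>x \<bullet> h\<bar> * norm (w x) \<le> norm h * (1 + norm x) * norm (w x)" by (intro mult_right_mono) auto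
      then show ?thesis by (simp add: norm_mult mult.assoc)
    qed
    show "integrable lborel (\<lambda>x. (1 + norm x) ^ 1 * norm (w x))" by (rule rapid_weight[OF w])
  qed measurable
  moreover have "fourier w = (\<lambda>\<xi>. \<integral>x. exp (- \<i> * complex_of_real (x \<bullet> \<xi>)) * w x \<partial>lborel)"
    by (rule ext, rule fourier_lborel) measurable
  ultimately show ?thesis by simp
qed

lemma fourier_pd:
  assumes w: "rapid w"
  shows "pd b (fourier w) = fourier (\<lambda>x. (- \<i> * complex_of_real (x \<bullet> b)) * w x)"
proof
  fix \<xi>
  have [measurable]: "w \<in> borel_measurable borel" using w by measurable
  show "pd b (fourier w) \<xi> = fourier (\<lambda>x. (- \<i> * complex_of_real (x \<bullet> b)) * w x) \<xi>"
    by (subst pd_eq[OF fourier_has_derivative[OF w]], subst fourier_lborel) (auto simp: mult.assoc)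
qed

text \<open>The transforms of rapid functions form a coinductive invariant, since differentiation
  multiplies the rapid function by a coordinate and leaves it rapid.\<close>

lemma fourier_smooth:
  assumes "rapid w" shows "smooth (fourier w)"
proof (rule smooth_coinduct[of _ "fourier ` Collect rapid"])
  show "fourier w \<in> fourier ` Collect rapid" using assms by blast
  show "u differentiable (at x)" if "u \<in> fourier ` Collect rapid" for u and x :: 'a
    using that fourier_has_derivative unfolding differentiable_def by blast
  show "pd b u \<in> fourier ` Collect rapid" if u: "u \<in> fourier ` Collect rapid" for u and b :: 'a
  proof -
    obtain w where w: "u = fourier w" "rapid w" using u by auto
    then show ?thesis using fourier_pd[OF w(2), of b] rapid_coord[OF w(2), of "- \<i>" b] by auto
  qed
qed

text \<open>The derivative is a dominated limit of difference quotients, and each of these has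
  integral 0 by translation invariance. Applied to products this is integration by parts.\<close>

lemma integral_pd_zero:
  fixes u :: "'a::euclidean_space \<Rightarrow> complex"
  assumes u: "u \<in> schwartz" and b: "b \<in> Basis"
  shows "(\<integral>x. pd b u x \<partial>lborel) = 0"
proof -
  let ?N = "DIM('a) + 1"
  obtain C where C: "0 < C" "\<And>x h. norm (frechet_derivative u (at x) h) \<le> C * norm h / (1 + norm x) ^ ?N"
    using schwartz_deriv_bound[OF u] by blast
  have sm: "smooth u" using u by (rule schwartz_smooth)
  have [measurable]: "u \<in> borel_measurable borel" using u by (rule schwartz_borel)
  have [measurable]: "pd b u \<in> borel_measurable borel" using smooth_pd[OF sm b] by (rule smooth_borel)
  define t where "t i = 1 / real (Suc i)" for i :: nat
  have t: "0 < t i" "t i \<le> 1" for i by (auto simp: t_def)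
  have t_lim: "filterlim t (at 0) sequentially"
    unfolding filterlim_at using t(1) LIMSEQ_Suc[OF lim_const_over_n[of "1::real"]]
    by (auto simp: t_def[abs_def])
  let ?D = "\<lambda>i x. (1 / t i) *\<^sub>R (u (x - (- t i *\<^sub>R b)) - u x)"
  have nb: "norm b = 1" using b by simp
  have der: "((\<lambda>r. u (x + r *\<^sub>R b)) has_vector_derivative pd b u (x + r *\<^sub>R b)) (at r)" for x :: 'a and r
  proof -
    have 1: "((\<lambda>r. x + r *\<^sub>R b) has_derivative (\<lambda>h. h *\<^sub>R b)) (at r)" by (auto intro!: derivative_eq_intros)
    have lin: "linear (frechet_derivative u (at y))" for y
      by (intro linear_frechet_derivative smooth_differentiable sm)
    from has_derivative_compose[OF 1 smooth_has_derivative[OF sm]]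
    show ?thesis unfolding has_vector_derivative_def by (simp add: linear_cmul[OF lin])
  qed
  have "(\<lambda>i. \<integral>x. ?D i x \<partial>lborel) \<longlonglongrightarrow> (\<integral>x. pd b u x \<partial>lborel)"
  proof (rule integral_dominated_convergence[where w="\<lambda>x. (C * 2 ^ ?N) * (1 / (1 + norm x) ^ ?N)"])
    show "integrable lborel (\<lambda>x::'a. (C * 2 ^ ?N) * (1 / (1 + norm x) ^ ?N))"
      by (intro integrable_mult_right integrable_decay)
    show "AE x in lborel. (\<lambda>i. ?D i x) \<longlonglongrightarrow> pd b u x"
    proof (rule AE_I2)
      fix x :: 'a
      have "((\<lambda>h. (1 / norm (h - 0)) *\<^sub>R (u (x + h *\<^sub>R b) - (u (x + 0 *\<^sub>R b) + (h - 0) *\<^sub>R pd b u (x + 0 *\<^sub>R b)))) \<longlongrightarrow> 0) (at 0)"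
        using der[of x 0] unfolding has_vector_derivative_def has_derivative_within by blast
      then have "(\<lambda>i. (1 / norm (t i - 0)) *\<^sub>R (u (x + t i *\<^sub>R b) - (u (x + 0 *\<^sub>R b) + (t i - 0) *\<^sub>R pd b u (x + 0 *\<^sub>R b)))) \<longlonglongrightarrow> 0"
        by (rule filterlim_compose[OF _ t_lim])
      moreover have "(1 / norm (t i - 0)) *\<^sub>R (u (x + t i *\<^sub>R b) - (u (x + 0 *\<^sub>R b) + (t i - 0) *\<^sub>R pd b u (x + 0 *\<^sub>R b))) = ?D i x - pd b u x" for i
        using t(1)[of i] by (simp add: scaleR_diff_right scaleR_add_right)
      ultimately show "(\<lambda>i. ?D i x) \<longlonglongrightarrow> pd b u x" by (simp only: LIM_zero_iff)
    qed
    show "AE x in lborel. norm (?D i x) \<le> (C * 2 ^ ?N) * (1 / (1 + norm x) ^ ?N)" for i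
    proof (rule AE_I2)
      fix x :: 'a
      let ?B = "C * 2 ^ ?N / (1 + norm x) ^ ?N"
      \<comment> \<open>The mean value inequality on a segment of length at most 1, along which
        \<open>1 + norm\<close> changes by a factor of at most 2; hence \<open>2 ^ ?N\<close> in the
        majorant.\<close>
      have "norm (u (x + t i *\<^sub>R b) - u (x + 0 *\<^sub>R b)) \<le> ?B * norm (t i - 0)"
      proof (rule differentiable_bound[of "{0..t i}" "\<lambda>r. u (x + r *\<^sub>R b)" "\<lambda>r h. h *\<^sub>R pd b u (x + r *\<^sub>R b)"])
        show "((\<lambda>r. u (x + r *\<^sub>R b)) has_derivative (\<lambda>h. h *\<^sub>R pd b u (x + r *\<^sub>R b))) (at r within {0..t i})" for r
          using der[of x r] unfolding has_vector_derivative_def by (rule has_derivative_at_withinI)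
        fix r assume r: "r \<in> {0..t i}"
        have "norm x \<le> norm (x + r *\<^sub>R b) + norm (r *\<^sub>R b)" by (metis add_diff_cancel_right' norm_triangle_ineq4)
        also have "\<dots> \<le> norm (x + r *\<^sub>R b) + 1" using r t[of i] nb by simp
        finally have "norm x \<le> norm (x + r *\<^sub>R b) + 1" .
        moreover have "\<lbrakk>c \<le> d + 1; 0 \<le> d\<rbrakk> \<Longrightarrow> 1 + c \<le> 2 * (1 + d)" for c d :: real by simp
        ultimately have "1 + norm x \<le> 2 * (1 + norm (x + r *\<^sub>R b))" using norm_ge_zero by blast
        then have "(1 + norm x) ^ ?N \<le> (2 * (1 + norm (x + r *\<^sub>R b))) ^ ?N" by (intro power_mono) auto
        then have le: "(1 + norm x) ^ ?N \<le> 2 ^ ?N * (1 + norm (x + r *\<^sub>R b)) ^ ?N" by (simp only: power_mult_distrib)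
        have p: "0 < (1 + norm x) ^ ?N" "0 < (1 + norm (x + r *\<^sub>R b)) ^ ?N" by (intro zero_less_power add_pos_nonneg; simp)+
        have "norm (pd b u (x + r *\<^sub>R b)) \<le> C * norm b / (1 + norm (x + r *\<^sub>R b)) ^ ?N" by (rule C)
        also have "\<dots> \<le> ?B"
        proof -
          have "C * (1 + norm x) ^ ?N \<le> C * (2 ^ ?N * (1 + norm (x + r *\<^sub>R b)) ^ ?N)" using le C(1) by (intro mult_left_mono) auto
          then show ?thesis using p nb by (simp only: frac_le_eq pos_divide_le_eq pos_le_divide_eq) (simp add: divide_simps mult_ac)
        qed
        finally have pB: "norm (pd b u (x + r *\<^sub>R b)) \<le> ?B" .
        show "onorm (\<lambda>h. h *\<^sub>R pd b u (x + r *\<^sub>R b)) \<le> ?B"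
        proof (rule onorm_le)
          show "norm (h *\<^sub>R pd b u (x + r *\<^sub>R b)) \<le> ?B * norm h" for h :: real
            unfolding norm_scaleR using mult_left_mono[OF pB, of "\<bar>h\<bar>"] by (simp only: mult.commute real_norm_def abs_ge_zero)
        qed
      qed (use t[of i] in auto)
      then have "norm (u (x + t i *\<^sub>R b) - u x) \<le> ?B * t i" using t(1)[of i] by (simp only: real_norm_def scaleR_zero_left add_0_right diff_zero abs_of_pos)
      then have "norm (u (x + t i *\<^sub>R b) - u x) / t i \<le> ?B" using t(1)[of i] by (simp only: pos_divide_le_eq)
      moreover have "norm (?D i x) = norm (u (x + t i *\<^sub>R b) - u x) / t i"
        unfolding norm_scaleR using t(1)[of i] by (simp add: divide_inverse mult.commute)
      ultimately show "norm (?D i x) \<le> (C * 2 ^ ?N) * (1 / (1 + norm x) ^ ?N)"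
        by (simp only: times_divide_eq_right mult_1_right)
    qed
  qed measurable
  moreover have "(\<integral>x. ?D i x \<partial>lborel) = 0" for i
  proof -
    have iu: "integrable lborel u" using u by (rule schwartz_integrable)
    then have "integrable lborel (\<lambda>x. u (x - (- t i *\<^sub>R b)))" by (simp only: integrable_translate schwartz_borel[OF u])
    then have "(\<integral>x. u (x - (- t i *\<^sub>R b)) - u x \<partial>lborel) = 0"
      using iu by (subst Bochner_Integration.integral_diff) (simp_all only: integral_translate schwartz_borel[OF u] diff_self)
    then show ?thesis by simp
  qed
  ultimately have "(\<lambda>i::nat. 0) \<longlonglongrightarrow> (\<integral>x. pd b u x \<partial>lborel)" by (simp only:)
  then show ?thesis by (simp add: LIMSEQ_const_iff)
qed

lemma fourier_of_pd:
  assumes f: "f \<in> schwartz" and b: "b \<in> Basis"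
  shows "fourier (pd b f) \<xi> = \<i> * complex_of_real (b \<bullet> \<xi>) * fourier f \<xi>"
proof -
  let ?e = "\<lambda>x. exp (\<i> * complex_of_real (x \<bullet> (- \<xi>)))"
  have e: "exp (- \<i> * complex_of_real (x \<bullet> \<xi>)) = ?e x" for x by simp
  have sf: "smooth f" using f by (rule schwartz_smooth)
  have s: "(\<lambda>x. f x * ?e x) \<in> schwartz" by (rule schwartz_mult[OF f moderate_cis])
  have s1: "(\<lambda>x. pd b f x * ?e x) \<in> schwartz" by (rule schwartz_mult[OF schwartz_pd[OF f b] moderate_cis])
  have pe: "pd b (\<lambda>x. f x * ?e x) x = f x * (?e x * (\<i> * complex_of_real (b \<bullet> (- \<xi>)))) + pd b f x * ?e x" for x
  proof -
    have "(?e has_derivative (\<lambda>h. ?e x * (\<i> * complex_of_real (h \<bullet> (- \<xi>))))) (at x)" by (rule has_derivative_cis)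
    then have "?e differentiable (at x)" "pd b ?e x = ?e x * (\<i> * complex_of_real (b \<bullet> (- \<xi>)))"
      using differentiable_def pd_eq by blast+
    then show ?thesis by (subst pd_mult) (auto simp: smooth_differentiable[OF sf])
  qed
  have "0 = (\<integral>x. f x * (?e x * (\<i> * complex_of_real (b \<bullet> (- \<xi>)))) + pd b f x * ?e x \<partial>lborel)"
    using integral_pd_zero[OF s b] unfolding pe by simp
  also have "\<dots> = (\<integral>x. (f x * ?e x) * (\<i> * complex_of_real (b \<bullet> (- \<xi>))) \<partial>lborel) + (\<integral>x. pd b f x * ?e x \<partial>lborel)"
    unfolding mult.assoc[symmetric]
    by (intro Bochner_Integration.integral_add integrable_mult_left schwartz_integrable[OF s] schwartz_integrable[OF s1])
  also have "(\<integral>x. (f x * ?e x) * (\<i> * complex_of_real (b \<bullet> (- \<xi>))) \<partial>lborel) = (\<integral>x. f x * ?e x \<partial>lborel) * (\<i> * complex_of_real (b \<bullet> (- \<xi>)))"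
    by simp
  also have "(\<integral>x. f x * ?e x \<partial>lborel) = fourier f \<xi>"
    by (subst fourier_lborel[OF schwartz_borel[OF f]]) (simp add: mult.commute)
  also have "(\<integral>x. pd b f x * ?e x \<partial>lborel) = fourier (pd b f) \<xi>"
    by (subst fourier_lborel[OF schwartz_borel[OF schwartz_pd[OF f b]]]) (simp add: mult.commute)
  finally show ?thesis by (simp add: add_eq_0_iff2 mult.commute)
qed

text \<open>Differentiating the function multiplies its transform by a coordinate, and
  \<open>norm \<xi>\<close> is at most the sum of the absolute coordinates. Each power of the weight
  thus costs one derivative, which changes the family and makes it arbitrary in the
  induction.\<close>

lemma fourier_decay:
  assumes "schwartz_family F"
  shows "\<exists>C. \<forall>i \<xi>. (1 + norm \<xi>) ^ N * norm (fourier (F i) \<xi>) \<le> C"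
  using assms
proof (induction N arbitrary: F)
  case 0
  obtain C where C: "\<And>i x. (1 + norm x) ^ (DIM('b) + 1) * norm (F i x) \<le> C"
    using 0 unfolding schwartz_family_def by (metis iter_deriv.simps(1) lists.Nil)
  have "norm (fourier (F i) \<xi>) \<le> (\<integral>x. C * (1 / (1 + norm (x::'b)) ^ (DIM('b) + 1)) \<partial>lborel)" for i \<xi>
  proof -
    have "norm (fourier (F i) \<xi>) \<le> (\<integral>x. norm (F i x) \<partial>lborel)"
      by (rule norm_fourier_le[OF schwartz_integrable[OF schwartz_familyD[OF 0]]])
    also have "\<dots> \<le> (\<integral>x. C * (1 / (1 + norm (x::'b)) ^ (DIM('b) + 1)) \<partial>lborel)"
    proof (rule integral_mono)
      fix x :: 'b
      have "0 < (1 + norm x) ^ (DIM('b) + 1)" by (intro zero_less_power add_pos_nonneg) auto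
      then show "norm (F i x) \<le> C * (1 / (1 + norm x) ^ (DIM('b) + 1))"
        using C[of x i] by (simp add: pos_le_divide_eq mult.commute)
    qed (intro integrable_norm integrable_mult_right integrable_decay schwartz_integrable[OF schwartz_familyD[OF 0]])+
    finally show ?thesis .
  qed
  then show ?case by auto
next
  case (Suc N)
  obtain C where C: "\<And>i \<xi>. (1 + norm \<xi>) ^ N * norm (fourier (F i) \<xi>) \<le> C" using Suc by blast
  have "\<forall>b\<in>Basis. \<exists>C. \<forall>i \<xi>. (1 + norm \<xi>) ^ N * norm (fourier (pd b (F i)) \<xi>) \<le> C"
    using Suc.IH schwartz_family_pd[OF Suc.prems] by blast
  from bchoice[OF this] obtain D where D: "\<And>b i \<xi>. b \<in> Basis \<Longrightarrow> (1 + norm \<xi>) ^ N * norm (fourier (pd b (F i)) \<xi>) \<le> D b"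
    by blast
  have "(1 + norm \<xi>) ^ Suc N * norm (fourier (F i) \<xi>) \<le> C + (\<Sum>b\<in>Basis. D b)" for i \<xi>
  proof -
    have "norm \<xi> \<le> (\<Sum>b\<in>Basis. \<bar>\<xi> \<bullet> b\<bar>)" by (rule norm_le_l1)
    then have "norm \<xi> * ((1 + norm \<xi>) ^ N * norm (fourier (F i) \<xi>)) \<le> (\<Sum>b\<in>Basis. \<bar>\<xi> \<bullet> b\<bar>) * ((1 + norm \<xi>) ^ N * norm (fourier (F i) \<xi>))"
      by (intro mult_right_mono) auto
    also have "\<dots> = (\<Sum>b\<in>Basis. (1 + norm \<xi>) ^ N * norm (fourier (pd b (F i)) \<xi>))"
      unfolding sum_distrib_right
      by (intro sum.cong refl) (simp add: fourier_of_pd[OF schwartz_familyD[OF Suc.prems]] norm_mult inner_commute mult_ac)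
    also have "\<dots> \<le> (\<Sum>b\<in>Basis. D b)" by (intro sum_mono D)
    finally show ?thesis using C[of \<xi> i] by (simp add: distrib_right mult.assoc)
  qed
  then show ?case by blast
qed

lemma fourier_iter_deriv:
  assumes "schwartz_family F"
  shows "bs \<in> lists Basis \<Longrightarrow> \<exists>G. schwartz_family G \<and> (\<forall>i. iter_deriv bs (fourier (F i)) = fourier (G i))"
proof (induction bs)
  case (Cons b bs)
  then obtain G where G: "schwartz_family G" "\<And>i. iter_deriv bs (fourier (F i)) = fourier (G i)" by auto
  have "moderate_family (\<lambda>_ x. (- \<i>) * complex_of_real (x \<bullet> b))"
    using polynomial_moderate[OF alg_mult[OF polynomial_const polynomial_inner]] unfolding moderate_family_def by blast
  from schwartz_family_mult[OF G(1) this]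
  have "schwartz_family (\<lambda>i x. (- \<i> * complex_of_real (x \<bullet> b)) * G i x)" by (simp only: mult.commute[of "G _ _"])
  moreover have "iter_deriv (b # bs) (fourier (F i)) = fourier (\<lambda>x. (- \<i> * complex_of_real (x \<bullet> b)) * G i x)" for i
    by (simp only: iter_deriv.simps G(2) fourier_pd[OF rapid_schwartz[OF schwartz_familyD[OF G(1)]]])
  ultimately show ?case by blast
qed (use assms in auto)

lemma fourier_schwartz_family:
  assumes "schwartz_family F" shows "schwartz_family (\<lambda>i. fourier (F i))"
  unfolding schwartz_family_def
proof (intro conjI allI ballI)
  show "smooth (fourier (F i))" for i by (rule fourier_smooth[OF rapid_schwartz[OF schwartz_familyD[OF assms]]])
  fix N and bs :: "'b list" assume "bs \<in> lists Basis"
  then obtain G where G: "schwartz_family G" "\<And>i. iter_deriv bs (fourier (F i)) = fourier (G i)"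
    using fourier_iter_deriv[OF assms] by blast
  show "\<exists>C. \<forall>i x. (1 + norm x) ^ N * norm (iter_deriv bs (fourier (F i)) x) \<le> C"
    unfolding G(2) by (rule fourier_decay[OF G(1)])
qed

lemma fourier_schwartz:
  assumes "f \<in> schwartz" shows "fourier f \<in> schwartz"
  using schwartz_familyD[OF fourier_schwartz_family[OF schwartz_family_const[OF assms]]] .

text \<open>Fubini for the character evaluated at \<open>z + y\<close>. The case
  \<open>y = 0\<close> is the duality of the transform; general \<open>y\<close> turns convolution
  into multiplication.\<close>

lemma fourier_exchange:
  fixes a b :: "'a::euclidean_space \<Rightarrow> complex"
  assumes a: "integrable lborel a" and b: "integrable lborel b"
  shows "(\<integral>z. a z * fourier b (z + y) \<partial>lborel) = (\<integral>\<xi>. exp (- \<i> * complex_of_real (y \<bullet> \<xi>)) * (b \<xi> * fourier a \<xi>) \<partial>lborel)"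
proof -
  have [measurable]: "a \<in> borel_measurable borel" "b \<in> borel_measurable borel" using a b by auto
  let ?f = "\<lambda>z \<xi>. a z * (exp (- \<i> * complex_of_real (\<xi> \<bullet> (z + y))) * b \<xi>)"
  have nf: "norm (?f z \<xi>) = norm (a z) * norm (b \<xi>)" for z \<xi>
    by (simp add: norm_mult del: mult_minus_left)
  have int: "integrable (lborel \<Otimes>\<^sub>M lborel) (case_prod ?f)"
  proof (rule lborel_pair.Fubini_integrable)
    show "case_prod ?f \<in> borel_measurable (lborel \<Otimes>\<^sub>M lborel)" by measurable
    show "integrable lborel (\<lambda>z. \<integral>\<xi>. norm (case_prod ?f (z, \<xi>)) \<partial>lborel)"
      unfolding prod.case nf using a b by simp
    show "AE z in lborel. integrable lborel (\<lambda>\<xi>. case_prod ?f (z, \<xi>))"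
    proof (rule AE_I2)
      fix z
      have "integrable lborel (\<lambda>\<xi>. norm (a z) * norm (b \<xi>))" using b by simp
      then show "integrable lborel (\<lambda>\<xi>. case_prod ?f (z, \<xi>))"
        by (rule Bochner_Integration.integrable_bound) (auto simp: norm_mult simp del: mult_minus_left)
    qed
  qed
  have "(\<integral>z. a z * fourier b (z + y) \<partial>lborel) = (\<integral>z. \<integral>\<xi>. ?f z \<xi> \<partial>lborel \<partial>lborel)"
    by (intro Bochner_Integration.integral_cong refl) (simp add: fourier_lborel)
  also have "\<dots> = (\<integral>\<xi>. \<integral>z. ?f z \<xi> \<partial>lborel \<partial>lborel)"
    by (rule lborel_pair.Fubini_integral[OF int, symmetric])
  also have "\<dots> = (\<integral>\<xi>. exp (- \<i> * complex_of_real (y \<bullet> \<xi>)) * (b \<xi> * fourier a \<xi>) \<partial>lborel)"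
  proof (intro Bochner_Integration.integral_cong refl)
    fix \<xi>
    have "exp (- \<i> * complex_of_real (\<xi> \<bullet> (z + y))) = exp (- \<i> * complex_of_real (y \<bullet> \<xi>)) * exp (- \<i> * complex_of_real (z \<bullet> \<xi>))" for z
      unfolding exp_add[symmetric] by (simp add: inner_add_right inner_commute algebra_simps)
    then have "(\<integral>z. ?f z \<xi> \<partial>lborel) = (\<integral>z. (exp (- \<i> * complex_of_real (y \<bullet> \<xi>)) * b \<xi>) * (exp (- \<i> * complex_of_real (z \<bullet> \<xi>)) * a z) \<partial>lborel)"
      by (simp only: mult_ac)
    also have "\<dots> = (exp (- \<i> * complex_of_real (y \<bullet> \<xi>)) * b \<xi>) * (\<integral>z. exp (- \<i> * complex_of_real (z \<bullet> \<xi>)) * a z \<partial>lborel)"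
      by (rule integral_mult_right_zero)
    finally show "(\<integral>z. ?f z \<xi> \<partial>lborel) = exp (- \<i> * complex_of_real (y \<bullet> \<xi>)) * (b \<xi> * fourier a \<xi>)"
      by (simp only: fourier_lborel[OF \<open>a \<in> borel_measurable borel\<close>] mult.assoc)
  qed
  finally show ?thesis .
qed

lemma fourier_duality:
  assumes "integrable lborel a" "integrable lborel b"
  shows "(\<integral>z. a z * fourier b z \<partial>lborel) = (\<integral>\<xi>. fourier a \<xi> * b \<xi> \<partial>lborel)"
  using fourier_exchange[OF assms, of 0] by (simp add: mult.commute)

lemma conv_fourier:
  assumes w: "integrable lborel w" and m: "integrable lborel m"
  shows "conv w (fourier m) y = fourier (\<lambda>\<xi>. m \<xi> * fourier (\<lambda>z. w (- z)) \<xi>) y"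
proof -
  have [measurable]: "w \<in> borel_measurable borel" "m \<in> borel_measurable borel" using w m by auto
  have wi: "integrable lborel (\<lambda>z. w (- z))" using w integrable_reflect[of w 0] by simp
  have fm: "fourier m \<in> borel_measurable borel" "fourier (\<lambda>z. w (- z)) \<in> borel_measurable borel"
    by (rule fourier_borel; measurable)+
  have "conv w (fourier m) y = (\<integral>x. w (0 - x) * fourier m (y - (0 - x)) \<partial>lborel)"
    unfolding conv_def by (rule integral_reflect[symmetric]) (use fm in measurable)
  also have "\<dots> = (\<integral>z. w (- z) * fourier m (z + y) \<partial>lborel)" by (simp add: add.commute)
  also have "\<dots> = (\<integral>\<xi>. exp (- \<i> * complex_of_real (y \<bullet> \<xi>)) * (m \<xi> * fourier (\<lambda>z. w (- z)) \<xi>) \<partial>lborel)"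
    by (rule fourier_exchange[OF wi m])
  also have "\<dots> = fourier (\<lambda>\<xi>. m \<xi> * fourier (\<lambda>z. w (- z)) \<xi>) y"
    using fm by (subst fourier_lborel) (auto simp: inner_commute)
  finally show ?thesis .
qed

subsection \<open>Gaussians and Fourier inversion\<close>

lemma heat_kernel_scale:
  assumes c: "0 < c" and t: "0 < t"
  shows "heat_kernel t (c *\<^sub>R z) = heat_kernel (t / c\<^sup>2) (z::'a::euclidean_space) / c ^ DIM('a)"
proof -
  have "(4 * pi * (t / c\<^sup>2)) powr (- real DIM('a) / 2) = (4 * pi * t) powr (- real DIM('a) / 2) * c ^ DIM('a)"
  proof -
    have "(4 * pi * (t / c\<^sup>2)) powr (- real DIM('a) / 2) = (4 * pi * t) powr (- real DIM('a) / 2) / (c\<^sup>2) powr (- real DIM('a) / 2)"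
      unfolding times_divide_eq_right by (rule powr_divide)
    also have "(c\<^sup>2) powr (- real DIM('a) / 2) = c powr (- real DIM('a))"
      using c by (simp add: powr_powr flip: powr_numeral)
    also have "c powr (- real DIM('a)) = inverse (c ^ DIM('a))" using c by (simp only: powr_minus powr_realpow)
    finally show ?thesis by (simp only: divide_inverse inverse_inverse_eq)
  qed
  moreover have "(norm (c *\<^sub>R z))\<^sup>2 / (4 * t) = (norm z)\<^sup>2 / (4 * (t / c\<^sup>2))"
    using c by (simp add: power_mult_distrib)
  ultimately show ?thesis using c unfolding heat_kernel_def by simp
qed

lemma heat_kernel_even: "heat_kernel t (- z) = heat_kernel t z"
  by (simp add: heat_kernel_def)

lemma heat_kernel_borel [measurable]: "heat_kernel t \<in> borel_measurable borel"
  unfolding heat_kernel_def[abs_def] by measurable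

lemma fourier_normal_density:
  "(\<integral>x. exp (- \<i> * complex_of_real (x * s)) * complex_of_real (std_normal_density x) \<partial>lborel) = complex_of_real (exp (- s\<^sup>2 / 2))"
proof -
  have "complex_of_real (exp (- (- s)\<^sup>2 / 2)) = char std_normal_distribution (- s)"
    by (simp add: char_std_normal_distribution)
  also have "\<dots> = (\<integral>x. std_normal_density x *\<^sub>R exp (\<i> * complex_of_real (- s * x)) \<partial>lborel)"
    unfolding char_def by (subst integral_density) auto
  also have "\<dots> = (\<integral>x. exp (- \<i> * complex_of_real (x * s)) * complex_of_real (std_normal_density x) \<partial>lborel)"
    by (intro Bochner_Integration.integral_cong refl) (simp add: scaleR_conv_of_real mult.commute)
  finally show ?thesis by simp
qed

text \<open>Lebesgue measure is the image, under the coordinate map, of a product of measures on the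
  line, where an integral of a product splits.\<close>

lemma integral_lborel_prod:
  fixes g :: "'a::euclidean_space \<Rightarrow> real \<Rightarrow> complex"
  assumes "\<And>b. b \<in> Basis \<Longrightarrow> integrable lborel (g b)"
  shows "(\<integral>z. (\<Prod>b\<in>Basis. g b (z \<bullet> b)) \<partial>lborel) = (\<Prod>b\<in>Basis. \<integral>x. g b x \<partial>lborel)"
proof -
  interpret product_sigma_finite "\<lambda>_::'a. lborel :: real measure" by standard
  have [measurable]: "g b \<in> borel_measurable borel" if "b \<in> Basis" for b using assms[OF that] by auto
  have "(\<integral>z. (\<Prod>b\<in>Basis. g b (z \<bullet> b)) \<partial>lborel)
    = (\<integral>f. (\<Prod>b\<in>Basis. g b ((\<Sum>c\<in>Basis. f c *\<^sub>R c) \<bullet> b)) \<partial>(\<Pi>\<^sub>M b\<in>Basis. lborel))"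
    by (subst lborel_eq, subst integral_distr) auto
  also have "\<dots> = (\<integral>f. (\<Prod>b\<in>Basis. g b (f b)) \<partial>(\<Pi>\<^sub>M b\<in>Basis. lborel))"
    by (intro Bochner_Integration.integral_cong refl prod.cong arg_cong2[where f=g])
       (simp add: inner_sum_left inner_Basis if_distrib cong: if_cong)
  also have "\<dots> = (\<Prod>b\<in>Basis. \<integral>x. g b x \<partial>lborel)"
    by (rule product_integral_prod) (use assms in auto)
  finally show ?thesis .
qed

lemma norm_sum_squares: "(norm z)\<^sup>2 = (\<Sum>b\<in>Basis. ((z::'a::euclidean_space) \<bullet> b)\<^sup>2)"
  unfolding power2_norm_eq_inner by (subst euclidean_inner) (simp add: power2_eq_square)

lemma square_powr_half: "0 < (x::real) \<Longrightarrow> (x\<^sup>2) powr (real k / 2) = x ^ k"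
proof -
  assume x: "0 < x"
  have "(x\<^sup>2) powr (real k / 2) = (x powr 2) powr (real k / 2)" using x by simp
  also have "\<dots> = x powr (2 * (real k / 2))" by (rule powr_powr)
  finally show ?thesis using x by (simp add: powr_realpow)
qed

text \<open>At time 1/2 the kernel is the standard normal density, whose characteristic function is
  available; other times follow by dilation.\<close>

lemma heat_kernel_half:
  "heat_kernel (1/2) z = (\<Prod>b\<in>Basis. std_normal_density ((z::'a::euclidean_space) \<bullet> b))"
proof -
  have "(\<Prod>b\<in>Basis. std_normal_density (z \<bullet> b)) = (1 / sqrt (2 * pi)) ^ DIM('a) * (\<Prod>b\<in>Basis. exp (- (z \<bullet> b)\<^sup>2 / 2))"
    by (simp only: std_normal_density_def prod.distrib prod_constant)
  also have "(\<Prod>b\<in>Basis. exp (- (z \<bullet> b)\<^sup>2 / 2)) = exp (\<Sum>b\<in>Basis. - (z \<bullet> b)\<^sup>2 / 2)"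
    by (simp add: exp_sum)
  also have "(\<Sum>b\<in>Basis. - (z \<bullet> b)\<^sup>2 / 2) = - (norm z)\<^sup>2 / 2"
    by (simp add: norm_sum_squares sum_negf flip: sum_divide_distrib)
  also have "(1 / sqrt (2 * pi)) ^ DIM('a) = (2 * pi) powr (- real DIM('a) / 2)"
  proof -
    have "1 / sqrt (2 * pi) = (2 * pi) powr (- (1/2))"
      by (simp only: powr_minus_divide) (simp add: powr_half_sqrt)
    then have "(1 / sqrt (2 * pi)) ^ DIM('a) = ((2 * pi) powr (- (1/2))) powr real DIM('a)"
      by (simp add: powr_realpow)
    also have "\<dots> = (2 * pi) powr ((- (1/2)) * real DIM('a))" by (rule powr_powr)
    finally show ?thesis by simp
  qed
  finally show ?thesis by (simp add: heat_kernel_def)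
qed

lemma fourier_heat_kernel:
  assumes t: "0 < t"
  shows "fourier (\<lambda>z. complex_of_real (heat_kernel t z)) \<xi> = complex_of_real (exp (- t * (norm (\<xi>::'a::euclidean_space))\<^sup>2))"
proof -
  have half: "fourier (\<lambda>z. complex_of_real (heat_kernel (1/2) z)) \<xi> = complex_of_real (exp (- (norm \<xi>)\<^sup>2 / 2))" for \<xi> :: 'a
  proof -
    have "fourier (\<lambda>z. complex_of_real (heat_kernel (1/2) z)) \<xi>
      = (\<integral>z. (\<Prod>b\<in>Basis. exp (- \<i> * complex_of_real ((z \<bullet> b) * (\<xi> \<bullet> b))) * complex_of_real (std_normal_density (z \<bullet> b))) \<partial>lborel)"
      by (subst fourier_lborel) (auto simp: heat_kernel_half prod.distrib exp_sum[symmetric] euclidean_inner[of _ \<xi>] sum_distrib_left sum_negf)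
    also have "\<dots> = (\<Prod>b\<in>Basis. \<integral>x. exp (- \<i> * complex_of_real (x * (\<xi> \<bullet> b))) * complex_of_real (std_normal_density x) \<partial>lborel)"
    proof (rule integral_lborel_prod)
      fix b :: 'a
      have "integrable lborel std_normal_density" by simp
      then show "integrable lborel (\<lambda>x. exp (- \<i> * complex_of_real (x * (\<xi> \<bullet> b))) * complex_of_real (std_normal_density x))"
        by (rule Bochner_Integration.integrable_bound) (auto simp: norm_mult simp del: mult_minus_left)
    qed
    also have "\<dots> = (\<Prod>b\<in>Basis. complex_of_real (exp (- (\<xi> \<bullet> b)\<^sup>2 / 2)))"
      by (simp only: fourier_normal_density)
    also have "\<dots> = complex_of_real (exp (- (norm \<xi>)\<^sup>2 / 2))"
      by (simp add: norm_sum_squares exp_sum[symmetric] sum_negf flip: of_real_prod sum_divide_distrib)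
    finally show ?thesis .
  qed
  \<comment> \<open>With \<open>c\<^sup>2 = 2 * t\<close> the dilated kernel has time
    \<open>t / c\<^sup>2 = 1 / 2\<close>.\<close>
  define c where "c = sqrt (2 * t)"
  have c: "0 < c" "c\<^sup>2 = 2 * t" using t by (auto simp: c_def)
  have "fourier (\<lambda>z. complex_of_real (heat_kernel t z)) \<xi>
    = (\<integral>z. exp (- \<i> * complex_of_real (z \<bullet> \<xi>)) * complex_of_real (heat_kernel t z) \<partial>lborel)"
    by (rule fourier_lborel) measurable
  also have "\<dots> = (c ^ DIM('a)) *\<^sub>R (\<integral>z. exp (- \<i> * complex_of_real ((0 + c *\<^sub>R z) \<bullet> \<xi>)) * complex_of_real (heat_kernel t (0 + c *\<^sub>R z)) \<partial>lborel)"
    using c by (subst lborel_integral_affine(2)) auto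
  also have "\<dots> = (\<integral>z. exp (- \<i> * complex_of_real (z \<bullet> (c *\<^sub>R \<xi>))) * complex_of_real (heat_kernel (1/2) z) \<partial>lborel)"
    unfolding integral_scaleR_right[symmetric]
  proof (intro Bochner_Integration.integral_cong refl)
    fix z :: 'a
    have "heat_kernel t (c *\<^sub>R z) = heat_kernel (1/2) z / c ^ DIM('a)" using heat_kernel_scale[OF c(1) t, of z] c t by simp
    then show "(c ^ DIM('a)) *\<^sub>R (exp (- \<i> * complex_of_real ((0 + c *\<^sub>R z) \<bullet> \<xi>)) * complex_of_real (heat_kernel t (0 + c *\<^sub>R z)))
      = exp (- \<i> * complex_of_real (z \<bullet> (c *\<^sub>R \<xi>))) * complex_of_real (heat_kernel (1/2) z)"
      using c by (simp add: scaleR_conv_of_real)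
  qed
  also have "\<dots> = fourier (\<lambda>z. complex_of_real (heat_kernel (1/2) z)) (c *\<^sub>R \<xi>)"
    by (rule fourier_lborel[symmetric]) measurable
  also have "\<dots> = complex_of_real (exp (- t * (norm \<xi>)\<^sup>2))"
    unfolding half using c by (simp add: power_mult_distrib)
  finally show ?thesis .
qed

lemma heat_kernel_integrable:
  assumes "0 < t"
  shows "integrable lborel (\<lambda>z::'a::euclidean_space. complex_of_real (heat_kernel t z))"
  by (rule schwartz_integrable[OF schwartz_heat_kernel[OF assms]])

lemma heat_kernel_integral:
  assumes "0 < t"
  shows "(\<integral>z. complex_of_real (heat_kernel t (z::'a::euclidean_space)) \<partial>lborel) = 1"
proof -
  have "fourier (\<lambda>z. complex_of_real (heat_kernel t z)) (0::'a) = (\<integral>z. complex_of_real (heat_kernel t (z::'a)) \<partial>lborel)"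
    by (subst fourier_lborel) auto
  then show ?thesis using fourier_heat_kernel[OF assms, of "0::'a"] by simp
qed

text \<open>The heat semigroup on the frequency side. It is what brings the Besov norm, defined by
  heat averages, into contact with arbitrary multipliers.\<close>

lemma fourier_gauss_mult:
  assumes t: "0 < t" and m: "integrable lborel m"
  shows "fourier (\<lambda>\<xi>. m \<xi> * complex_of_real (exp (- t * (norm \<xi>)\<^sup>2))) = conv (fourier m) (\<lambda>z. complex_of_real (heat_kernel t z))"
proof
  fix y :: 'a
  have [measurable]: "m \<in> borel_measurable borel" "fourier m \<in> borel_measurable borel"
    using m by (auto intro: fourier_borel)
  have "conv (fourier m) (\<lambda>z. complex_of_real (heat_kernel t z)) y = (\<integral>x. fourier m (x + y) * complex_of_real (heat_kernel t (- x)) \<partial>lborel)"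
    using integral_translate[of "\<lambda>x. fourier m x * complex_of_real (heat_kernel t (y - x))" "- y"]
    unfolding conv_def by (simp add: algebra_simps)
  also have "\<dots> = (\<integral>z. complex_of_real (heat_kernel t z) * fourier m (z + y) \<partial>lborel)"
    by (simp add: heat_kernel_even mult.commute)
  also have "\<dots> = (\<integral>\<xi>. exp (- \<i> * complex_of_real (y \<bullet> \<xi>)) * (m \<xi> * complex_of_real (exp (- t * (norm \<xi>)\<^sup>2))) \<partial>lborel)"
    unfolding fourier_exchange[OF heat_kernel_integrable[OF t] m] fourier_heat_kernel[OF t] ..
  also have "\<dots> = fourier (\<lambda>\<xi>. m \<xi> * complex_of_real (exp (- t * (norm \<xi>)\<^sup>2))) y"
    by (subst fourier_lborel) (auto simp: inner_commute)
  finally show "fourier (\<lambda>\<xi>. m \<xi> * complex_of_real (exp (- t * (norm \<xi>)\<^sup>2))) y = conv (fourier m) (\<lambda>z. complex_of_real (heat_kernel t z)) y" ..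
qed

lemma schwartz_bounded:
  assumes "f \<in> schwartz"
  obtains C where "0 < C" "\<And>x. norm (f x) \<le> C"
  using schwartz_bound0[OF assms, of 0] by auto

text \<open>Gaussian regularisation: a factor tending to 1 makes duality applicable, its transform
  is an approximate identity, and after rescaling both sides converge dominatedly.\<close>

theorem fourier_inversion:
  fixes f :: "'a::euclidean_space \<Rightarrow> complex"
  assumes f: "f \<in> schwartz"
  shows "(\<integral>x. exp (\<i> * complex_of_real (x \<bullet> \<xi>)) * fourier f x \<partial>lborel) = complex_of_real ((2 * pi) ^ DIM('a)) * f \<xi>"
proof -
  \<comment> \<open>A square, so that the rescaling by \<open>1 / real (Suc i)\<close> brings the
    heat kernel at time \<open>\<epsilon> i\<close> to time 1.\<close>
  define \<epsilon> where "\<epsilon> i = (1 / real (Suc i))\<^sup>2" for i :: nat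
  have e0: "0 < \<epsilon> i" for i by (simp add: \<epsilon>_def)
  have sq: "(\<lambda>i. 1 / real (Suc i)) \<longlonglongrightarrow> 0" by (rule LIMSEQ_Suc[OF lim_const_over_n])
  have elim: "\<epsilon> \<longlonglongrightarrow> 0" unfolding \<epsilon>_def[abs_def] using tendsto_power[OF sq, of 2] by simp
  have [measurable]: "f \<in> borel_measurable borel" "fourier f \<in> borel_measurable borel"
    using schwartz_borel f fourier_schwartz by auto
  let ?g = "\<lambda>i x. exp (\<i> * complex_of_real (x \<bullet> \<xi>)) * complex_of_real (exp (- \<epsilon> i * (norm x)\<^sup>2))"
  have gi: "integrable lborel (?g i)" for i
  proof -
    have "(\<lambda>x. complex_of_real (exp (- \<epsilon> i * (norm x)\<^sup>2)) * exp (\<i> * complex_of_real (x \<bullet> \<xi>))) \<in> schwartz"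
      by (intro schwartz_mult schwartz_gauss e0 moderate_cis)
    from schwartz_integrable[OF this] show ?thesis by (simp add: mult.commute)
  qed
  have gf: "fourier (?g i) \<eta> = complex_of_real ((2 * pi) ^ DIM('a)) * complex_of_real (heat_kernel (\<epsilon> i) (\<eta> - \<xi>))" for i \<eta>
  proof -
    \<comment> \<open>Up to the normalising constant \<open>A\<close>, the Gaussian with parameter
      \<open>\<epsilon> i\<close> is the heat kernel at this time, so its transform is already
      known.\<close>
    define t where "t = 1 / (4 * \<epsilon> i)"
    have t: "0 < t" using e0 by (simp add: t_def)
    define A where "A = (4 * pi * t) powr (- real DIM('a) / 2)"
    have A: "0 < A" using t by (simp add: A_def)
    have ga: "exp (- \<epsilon> i * (norm x)\<^sup>2) = heat_kernel t x / A" for x :: 'a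
    proof -
      have "- (norm x)\<^sup>2 / (4 * t) = - \<epsilon> i * (norm x)\<^sup>2" using e0[of i] by (simp add: t_def)
      then show ?thesis unfolding heat_kernel_def A_def[symmetric] using A by (simp only:) simp
    qed
    have "fourier (?g i) \<eta> = (\<integral>x. exp (- \<i> * complex_of_real (x \<bullet> (\<eta> - \<xi>))) * complex_of_real (heat_kernel t x) / complex_of_real A \<partial>lborel)"
    proof (subst fourier_lborel, measurable, intro Bochner_Integration.integral_cong refl)
      fix x :: 'a
      have "exp (- \<i> * complex_of_real (x \<bullet> \<eta>)) * exp (\<i> * complex_of_real (x \<bullet> \<xi>)) = exp (- \<i> * complex_of_real (x \<bullet> (\<eta> - \<xi>)))"
        unfolding exp_add[symmetric] by (simp add: inner_diff_right algebra_simps)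
      then show "exp (- \<i> * complex_of_real (x \<bullet> \<eta>)) * ?g i x
         = exp (- \<i> * complex_of_real (x \<bullet> (\<eta> - \<xi>))) * complex_of_real (heat_kernel t x) / complex_of_real A"
        unfolding ga by (simp only: mult.assoc[symmetric] of_real_divide times_divide_eq_right)
    qed
    also have "\<dots> = fourier (\<lambda>z. complex_of_real (heat_kernel t z)) (\<eta> - \<xi>) / complex_of_real A"
      by (subst fourier_lborel) auto
    also have "\<dots> = complex_of_real (exp (- t * (norm (\<eta> - \<xi>))\<^sup>2) / A)"
      by (simp add: fourier_heat_kernel[OF t])
    also have "exp (- t * (norm (\<eta> - \<xi>))\<^sup>2) / A = (2 * pi) ^ DIM('a) * heat_kernel (\<epsilon> i) (\<eta> - \<xi>)"
    proof -
      have "(1 / A) = (2 * pi) ^ DIM('a) * (4 * pi * \<epsilon> i) powr (- real DIM('a) / 2)"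
      proof -
        \<comment> \<open>The normalisations at times \<open>t\<close> and
          \<open>\<epsilon> i\<close> are reciprocal up to this constant, because
          \<open>(4 * pi * t) * (4 * pi * \<epsilon> i) = (2 * pi)\<^sup>2\<close>.\<close>
        have "(2 * pi) ^ DIM('a) = ((2 * pi)\<^sup>2) powr (real DIM('a) / 2)"
          by (rule square_powr_half[symmetric]) simp
        also have "(2 * pi)\<^sup>2 = (4 * pi * t) * (4 * pi * \<epsilon> i)"
          using e0[of i] by (simp add: t_def power2_eq_square)
        also have "\<dots> powr (real DIM('a) / 2) = (4 * pi * t) powr (real DIM('a) / 2) * (4 * pi * \<epsilon> i) powr (real DIM('a) / 2)"
          by (rule powr_mult)
        finally have XY: "(2 * pi) ^ DIM('a) = (4 * pi * t) powr (real DIM('a) / 2) * (4 * pi * \<epsilon> i) powr (real DIM('a) / 2)" .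
        have mh: "- real DIM('a) / 2 = - (real DIM('a) / 2)" by simp
        have "0 < (4 * pi * \<epsilon> i) powr (real DIM('a) / 2)" using e0[of i] by simp
        then show ?thesis unfolding XY A_def mh powr_minus by (simp only: divide_inverse inverse_inverse_eq mult_1_left mult.assoc) simp
      qed
      moreover have "- t * (norm (\<eta> - \<xi>))\<^sup>2 = - (norm (\<eta> - \<xi>))\<^sup>2 / (4 * \<epsilon> i)" by (simp add: t_def)
      moreover have "exp c / A = (1 / A) * exp c" for c by simp
      ultimately show ?thesis unfolding heat_kernel_def by (simp only: mult.assoc)
    qed
    finally show ?thesis by (simp del: of_real_power)
  qed
  have eq: "(\<integral>x. ?g i x * fourier f x \<partial>lborel) = complex_of_real ((2 * pi) ^ DIM('a)) * (\<integral>z. complex_of_real (heat_kernel 1 z) * f (\<xi> + (1 / real (Suc i)) *\<^sub>R z) \<partial>lborel)" for i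
  proof -
    let ?c = "1 / real (Suc i)"
    have "(\<integral>x. ?g i x * fourier f x \<partial>lborel) = (\<integral>\<eta>. fourier (?g i) \<eta> * f \<eta> \<partial>lborel)"
      by (rule fourier_duality[OF gi schwartz_integrable[OF f]])
    also have "\<dots> = complex_of_real ((2 * pi) ^ DIM('a)) * (\<integral>\<eta>. complex_of_real (heat_kernel (\<epsilon> i) (\<eta> - \<xi>)) * f \<eta> \<partial>lborel)"
      unfolding gf by (simp add: mult.assoc del: of_real_power)
    also have "(\<integral>\<eta>. complex_of_real (heat_kernel (\<epsilon> i) (\<eta> - \<xi>)) * f \<eta> \<partial>lborel)
      = (?c ^ DIM('a)) *\<^sub>R (\<integral>z. complex_of_real (heat_kernel (\<epsilon> i) (?c *\<^sub>R z)) * f (\<xi> + ?c *\<^sub>R z) \<partial>lborel)"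
      using lborel_integral_affine(2)[of ?c "\<lambda>\<eta>. complex_of_real (heat_kernel (\<epsilon> i) (\<eta> - \<xi>)) * f \<eta>" \<xi>]
      by (simp del: of_nat_Suc)
    also have "\<dots> = (\<integral>z. complex_of_real (heat_kernel 1 z) * f (\<xi> + ?c *\<^sub>R z) \<partial>lborel)"
      unfolding integral_scaleR_right[symmetric]
    proof (intro Bochner_Integration.integral_cong refl)
      fix z :: 'a
      have "heat_kernel (\<epsilon> i) (?c *\<^sub>R z) = heat_kernel 1 z / ?c ^ DIM('a)"
        using heat_kernel_scale[of ?c "\<epsilon> i" z] e0[of i] by (simp add: \<epsilon>_def)
      then have "?c ^ DIM('a) * heat_kernel (\<epsilon> i) (?c *\<^sub>R z) = heat_kernel 1 z" by simp
      then show "?c ^ DIM('a) *\<^sub>R (complex_of_real (heat_kernel (\<epsilon> i) (?c *\<^sub>R z)) * f (\<xi> + ?c *\<^sub>R z))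
        = complex_of_real (heat_kernel 1 z) * f (\<xi> + ?c *\<^sub>R z)"
        by (simp only: scaleR_conv_of_real mult.assoc[symmetric] of_real_mult[symmetric])
    qed
    finally show ?thesis .
  qed
  have "(\<lambda>i. \<integral>x. ?g i x * fourier f x \<partial>lborel) \<longlonglongrightarrow> (\<integral>x. exp (\<i> * complex_of_real (x \<bullet> \<xi>)) * fourier f x \<partial>lborel)"
  proof (rule integral_dominated_convergence[where w="\<lambda>x. norm (fourier f x)"])
    show "integrable lborel (\<lambda>x. norm (fourier f x))"
      by (intro integrable_norm schwartz_integrable fourier_schwartz f)
    show "AE x in lborel. (\<lambda>i. ?g i x * fourier f x) \<longlonglongrightarrow> exp (\<i> * complex_of_real (x \<bullet> \<xi>)) * fourier f x"
    proof (rule AE_I2)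
      fix x :: 'a
      have "(\<lambda>i. exp (- \<epsilon> i * (norm x)\<^sup>2)) \<longlonglongrightarrow> exp (- 0 * (norm x)\<^sup>2)"
        by (intro tendsto_intros elim)
      then have "(\<lambda>i. ?g i x * fourier f x) \<longlonglongrightarrow> exp (\<i> * complex_of_real (x \<bullet> \<xi>)) * complex_of_real (exp (- 0 * (norm x)\<^sup>2)) * fourier f x"
        by (intro tendsto_mult tendsto_of_real tendsto_const)
      then show "(\<lambda>i. ?g i x * fourier f x) \<longlonglongrightarrow> exp (\<i> * complex_of_real (x \<bullet> \<xi>)) * fourier f x" by simp
    qed
    show "AE x in lborel. norm (?g i x * fourier f x) \<le> norm (fourier f x)" for i
      using less_imp_le[OF e0[of i]] by (intro AE_I2) (simp add: norm_mult mult_left_le_one_le)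
  qed measurable
  moreover have "(\<lambda>i. \<integral>z. complex_of_real (heat_kernel 1 z) * f (\<xi> + (1 / real (Suc i)) *\<^sub>R z) \<partial>lborel) \<longlonglongrightarrow> (\<integral>z. complex_of_real (heat_kernel 1 (z::'a)) * f \<xi> \<partial>lborel)"
  proof -
    obtain C where C: "0 < C" "\<And>x. norm (f x) \<le> C" using schwartz_bounded[OF f] by blast
    show ?thesis
    proof (rule integral_dominated_convergence[where w="\<lambda>z. norm (complex_of_real (heat_kernel 1 z)) * C"])
      show "integrable lborel (\<lambda>z::'a. norm (complex_of_real (heat_kernel 1 z)) * C)"
        by (intro integrable_mult_left integrable_norm heat_kernel_integrable) auto
      show "AE z in lborel. (\<lambda>i. complex_of_real (heat_kernel 1 z) * f (\<xi> + (1 / real (Suc i)) *\<^sub>R z)) \<longlonglongrightarrow> complex_of_real (heat_kernel 1 z) * f \<xi>"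
      proof (rule AE_I2)
        fix z :: 'a
        have "(\<lambda>i. \<xi> + (1 / real (Suc i)) *\<^sub>R z) \<longlonglongrightarrow> \<xi> + 0 *\<^sub>R z" by (intro tendsto_intros sq)
        then have "(\<lambda>i. f (\<xi> + (1 / real (Suc i)) *\<^sub>R z)) \<longlonglongrightarrow> f \<xi>"
          using smooth_continuous[OF schwartz_smooth[OF f]]
          by (intro isCont_tendsto_compose[of \<xi> f]) (auto simp: continuous_on_eq_continuous_at)
        then show "(\<lambda>i. complex_of_real (heat_kernel 1 z) * f (\<xi> + (1 / real (Suc i)) *\<^sub>R z)) \<longlonglongrightarrow> complex_of_real (heat_kernel 1 z) * f \<xi>"
          by (intro tendsto_intros)
      qed
      show "AE z in lborel. norm (complex_of_real (heat_kernel 1 z) * f (\<xi> + (1 / real (Suc i)) *\<^sub>R z)) \<le> norm (complex_of_real (heat_kernel 1 z)) * C" for i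
        using C(2) by (intro AE_I2) (simp only: norm_mult, intro mult_left_mono, auto)
    qed measurable
  qed
  then have "(\<lambda>i. \<integral>x. ?g i x * fourier f x \<partial>lborel) \<longlonglongrightarrow> complex_of_real ((2 * pi) ^ DIM('a)) * (\<integral>z. complex_of_real (heat_kernel 1 (z::'a)) * f \<xi> \<partial>lborel)"
    unfolding eq by (rule tendsto_mult_left)
  moreover have "(\<integral>z. complex_of_real (heat_kernel 1 (z::'a)) * f \<xi> \<partial>lborel) = f \<xi>"
    using heat_kernel_integral[of 1, where 'a='a] by simp
  ultimately show ?thesis using LIMSEQ_unique by (metis (no_types, lifting))
qed

lemma conv_fourier_fourier:
  fixes m f :: "'a::euclidean_space \<Rightarrow> complex"
  assumes m: "m \<in> schwartz" and f: "f \<in> schwartz"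
  shows "conv (fourier f) (fourier m) = fourier (\<lambda>\<xi>. complex_of_real ((2 * pi) ^ DIM('a)) * (m \<xi> * f \<xi>))"
proof
  fix y :: 'a
  have [measurable]: "fourier f \<in> borel_measurable borel" using schwartz_borel f fourier_schwartz by auto
  have "fourier (\<lambda>z. fourier f (- z)) \<xi> = complex_of_real ((2 * pi) ^ DIM('a)) * f \<xi>" for \<xi>
  proof -
    have "fourier (\<lambda>z. fourier f (- z)) \<xi> = (\<integral>x. exp (- \<i> * complex_of_real (x \<bullet> \<xi>)) * fourier f (- x) \<partial>lborel)"
      by (rule fourier_lborel) measurable
    also have "\<dots> = (\<integral>x. exp (- \<i> * complex_of_real ((0 - x) \<bullet> \<xi>)) * fourier f (- (0 - x)) \<partial>lborel)"
      by (rule integral_reflect[symmetric]) measurable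
    also have "\<dots> = (\<integral>x. exp (\<i> * complex_of_real (x \<bullet> \<xi>)) * fourier f x \<partial>lborel)" by simp
    finally show ?thesis using fourier_inversion[OF f] by simp
  qed
  then show "conv (fourier f) (fourier m) y = fourier (\<lambda>\<xi>. complex_of_real ((2 * pi) ^ DIM('a)) * (m \<xi> * f \<xi>)) y"
    by (subst conv_fourier[OF schwartz_integrable[OF fourier_schwartz[OF f]] schwartz_integrable[OF m]]) (simp add: mult_ac)
qed

subsection \<open>Tempered distributions and convolution integrals\<close>

lemma iter_deriv_translate:
  assumes "smooth k" "bs \<in> lists Basis"
  shows "iter_deriv bs (\<lambda>y. k (y - x)) = (\<lambda>y. iter_deriv bs k (y - x))"
  using iter_deriv_affine[OF assms, of 1 "- x"] by simp

text \<open>The mean value inequality along the segment from \<open>x\<close> to \<open>x'\<close>,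
  with the weight at \<open>y\<close> carried to the segment by Peetre's inequality. It is the
  modulus of continuity of translation in the Schwartz seminorms, with polynomial growth in the
  translations.\<close>

lemma translate_diff_bound:
  assumes k: "k \<in> schwartz"
  shows "\<exists>D>0. \<forall>y x x'. (1 + norm y) ^ N * norm (k (y - x') - k (y - x)) \<le> D * (norm (x' - x) * (1 + norm x + norm x') ^ N)"
proof -
  obtain D where D: "0 < D" "\<And>x h. norm (frechet_derivative k (at x) h) \<le> D * norm h / (1 + norm x) ^ N"
    using schwartz_deriv_bound[OF k] by blast
  have sm: "smooth k" using k by (rule schwartz_smooth)
  have "(1 + norm y) ^ N * norm (k (y - x') - k (y - x)) \<le> D * (norm (x' - x) * (1 + norm x + norm x') ^ N)" for y x x'
  proof -
    let ?B = "D * (1 + norm x + norm x') ^ N / (1 + norm y) ^ N"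
    have p: "0 < (1 + norm y) ^ N" by (intro zero_less_power add_pos_nonneg) auto
    have "norm (k (y - x') - k (y - x)) \<le> ?B * norm (x' - x)"
    proof (rule differentiable_bound[of "closed_segment x x'" "\<lambda>z. k (y - z)" "\<lambda>z h. frechet_derivative k (at (y - z)) (- h)"])
      show "((\<lambda>z. k (y - z)) has_derivative (\<lambda>h. frechet_derivative k (at (y - z)) (- h))) (at z within closed_segment x x')" for z
      proof (rule has_derivative_at_withinI)
        have "((\<lambda>z. y - z) has_derivative (\<lambda>h. - h)) (at z)" by (auto intro!: derivative_eq_intros)
        from has_derivative_compose[OF this smooth_has_derivative[OF sm]]
        show "((\<lambda>z. k (y - z)) has_derivative (\<lambda>h. frechet_derivative k (at (y - z)) (- h))) (at z)" .
      qed
      fix z assume z: "z \<in> closed_segment x x'"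
      have nz: "norm z \<le> norm x + norm x'"
      proof -
        have "cball 0 (norm x + norm x') \<inter> closed_segment x x' = closed_segment x x'"
          by (intro Int_absorb1 closed_segment_subset) auto
        then show ?thesis using z by auto
      qed
      show "onorm (\<lambda>h. frechet_derivative k (at (y - z)) (- h)) \<le> ?B"
      proof (rule onorm_le)
        fix h
        have "1 + norm y \<le> (1 + norm z) * (1 + norm (y - z))" by (rule one_plus_norm_le)
        also have "\<dots> \<le> (1 + norm x + norm x') * (1 + norm (y - z))" using nz by (intro mult_right_mono) auto
        finally have "(1 + norm y) ^ N \<le> ((1 + norm x + norm x') * (1 + norm (y - z))) ^ N" by (intro power_mono) auto
        then have le: "(1 + norm y) ^ N \<le> (1 + norm x + norm x') ^ N * (1 + norm (y - z)) ^ N" by (simp only: power_mult_distrib)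
        have q: "0 < (1 + norm (y - z)) ^ N" by (intro zero_less_power add_pos_nonneg) auto
        have "norm (frechet_derivative k (at (y - z)) (- h)) \<le> D * norm h * (1 / (1 + norm (y - z)) ^ N)"
          using D(2)[of "y - z" "- h"] by simp
        also have "\<dots> \<le> D * norm h * ((1 + norm x + norm x') ^ N / (1 + norm y) ^ N)"
          using D(1) p q le by (intro mult_left_mono) (simp_all add: divide_simps mult.commute)
        finally show "norm (frechet_derivative k (at (y - z)) (- h)) \<le> ?B * norm h" by (simp add: mult_ac)
      qed
    qed auto
    then have "(1 + norm y) ^ N * norm (k (y - x') - k (y - x)) \<le> (1 + norm y) ^ N * (?B * norm (x' - x))"
      using p by (intro mult_left_mono) auto
    also have "\<dots> = D * (norm (x' - x) * (1 + norm x + norm x') ^ N)"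
    proof -
      have "q * (D * Y / q * z) = D * (z * Y)" if "0 < q" for q Y z :: real using that by simp
      from this[OF p] show ?thesis .
    qed
    finally show ?thesis .
  qed
  with D(1) show ?thesis by blast
qed

lemma finite_basis_lists: "finite {bs::'a::euclidean_space list. bs \<in> lists Basis \<and> length bs \<le> N}"
  using finite_lists_length_le[of "Basis::'a set" N] by (simp add: in_lists_conv_set subset_eq)

lemma translate_diff_bounds:
  assumes k: "(k::'a::euclidean_space \<Rightarrow> complex) \<in> schwartz"
  obtains D where "0 < D" "\<And>bs y x x'. bs \<in> lists Basis \<Longrightarrow> length bs \<le> N \<Longrightarrow>
     (1 + norm y) ^ N * norm (iter_deriv bs k (y - x') - iter_deriv bs k (y - x)) \<le> D * (norm (x' - x) * (1 + norm x + norm x') ^ N)"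
proof -
  let ?B = "{bs::'a list. bs \<in> lists Basis \<and> length bs \<le> N}"
  have "\<forall>bs\<in>?B. \<exists>D>0. \<forall>y x x'. (1 + norm y) ^ N * norm (iter_deriv bs k (y - x') - iter_deriv bs k (y - x)) \<le> D * (norm (x' - x) * (1 + norm x + norm x') ^ N)"
    using translate_diff_bound[OF schwartz_iter_deriv[OF k]] by blast
  from bchoice[OF this] obtain D where D: "\<And>bs. bs \<in> ?B \<Longrightarrow> 0 < D bs"
    "\<And>bs y x x'. bs \<in> ?B \<Longrightarrow> (1 + norm y) ^ N * norm (iter_deriv bs k (y - x') - iter_deriv bs k (y - x)) \<le> D bs * (norm (x' - x) * (1 + norm x + norm x') ^ N)"
    by blast
  have "0 < sum D ?B" by (rule sum_pos) (use D finite_basis_lists in \<open>auto intro!: exI[of _ "[]"]\<close>)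
  moreover have "(1 + norm y) ^ N * norm (iter_deriv bs k (y - x') - iter_deriv bs k (y - x)) \<le> sum D ?B * (norm (x' - x) * (1 + norm x + norm x') ^ N)"
    if bs: "bs \<in> lists Basis" "length bs \<le> N" for bs y x x'
  proof -
    have "D bs \<le> sum D ?B" using bs D(1) by (intro member_le_sum) (auto simp: finite_basis_lists less_imp_le)
    then have "D bs * (norm (x' - x) * (1 + norm x + norm x') ^ N) \<le> sum D ?B * (norm (x' - x) * (1 + norm x + norm x') ^ N)"
      by (intro mult_right_mono) auto
    then show ?thesis using D(2)[of bs y x' x] bs by auto
  qed
  ultimately show ?thesis by (rule that)
qed

lemma schwartz_norm_translate_le:
  assumes k: "k \<in> schwartz"
  shows "schwartz_norm N (\<lambda>y. k (y - x)) \<le> schwartz_norm N k * (1 + norm x) ^ N"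
proof (rule schwartz_norm_le)
  fix y and bs :: "'a list" assume bs: "bs \<in> lists Basis" "length bs \<le> N"
  have "(1 + norm y) ^ N * norm (iter_deriv bs (\<lambda>y. k (y - x)) y) \<le> ((1 + norm x) * (1 + norm (y - x))) ^ N * norm (iter_deriv bs k (y - x))"
    unfolding iter_deriv_translate[OF schwartz_smooth[OF k] bs(1)] by (intro mult_right_mono power_mono one_plus_norm_le) auto
  also have "\<dots> = (1 + norm x) ^ N * ((1 + norm (y - x)) ^ N * norm (iter_deriv bs k (y - x)))" by (simp add: power_mult_distrib)
  also have "\<dots> \<le> (1 + norm x) ^ N * schwartz_norm N k" by (intro mult_left_mono schwartz_norm_ge[OF k bs]) auto
  finally show "(1 + norm y) ^ N * norm (iter_deriv bs (\<lambda>y. k (y - x)) y) \<le> schwartz_norm N k * (1 + norm x) ^ N"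
    by (simp add: mult.commute)
qed

lemma tempered_translate_bound:
  assumes T: "T \<in> tempered" and k: "k \<in> schwartz"
  obtains C N where "0 < C" "\<And>x. norm (T (\<lambda>y. k (y - x))) \<le> C * (1 + norm x) ^ N"
proof -
  obtain C N where C: "0 < C" "\<And>f. f \<in> schwartz \<Longrightarrow> norm (T f) \<le> C * schwartz_norm N f" using tempered_bound[OF T] by blast
  have "norm (T (\<lambda>y. k (y - x))) \<le> (C * (schwartz_norm N k + 1)) * (1 + norm x) ^ N" for x
  proof -
    have "norm (T (\<lambda>y. k (y - x))) \<le> C * schwartz_norm N (\<lambda>y. k (y - x))" by (rule C(2)[OF schwartz_translate[OF k]])
    also have "\<dots> \<le> C * ((schwartz_norm N k + 1) * (1 + norm x) ^ N)"
      using C(1) schwartz_norm_translate_le[OF k, of N x] by (intro mult_left_mono) (auto simp: distrib_right intro: order_trans)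
    finally show ?thesis by (simp add: mult.assoc)
  qed
  moreover have "0 < C * (schwartz_norm N k + 1)" using C schwartz_norm_nonneg[OF k, of N] by simp
  ultimately show ?thesis using that by blast
qed

lemma tempered_translate_continuous:
  assumes T: "T \<in> tempered" and k: "k \<in> schwartz"
  shows "continuous_on UNIV (\<lambda>x. T (\<lambda>y. k (y - x)))"
proof -
  obtain C N where C: "0 < C" "\<And>f. f \<in> schwartz \<Longrightarrow> norm (T f) \<le> C * schwartz_norm N f" using tempered_bound[OF T] by blast
  obtain D where D: "0 < D" "\<And>bs y x x'. bs \<in> lists Basis \<Longrightarrow> length bs \<le> N \<Longrightarrow>
     (1 + norm y) ^ N * norm (iter_deriv bs k (y - x') - iter_deriv bs k (y - x)) \<le> D * (norm (x' - x) * (1 + norm x + norm x') ^ N)"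
    using translate_diff_bounds[OF k] by blast
  have bd: "norm (T (\<lambda>y. k (y - x')) - T (\<lambda>y. k (y - x))) \<le> C * (D * (norm (x' - x) * (1 + norm x + norm x') ^ N))" for x x'
  proof -
    have "norm (T (\<lambda>y. k (y - x')) - T (\<lambda>y. k (y - x))) = norm (T (\<lambda>y. k (y - x') - k (y - x)))"
      by (simp add: tempered_diff[OF T] schwartz_translate k)
    also have "\<dots> \<le> C * schwartz_norm N (\<lambda>y. k (y - x') - k (y - x))"
      by (intro C schwartz_diff schwartz_translate k)
    also have "schwartz_norm N (\<lambda>y. k (y - x') - k (y - x)) \<le> D * (norm (x' - x) * (1 + norm x + norm x') ^ N)"
    proof (rule schwartz_norm_le)
      fix y and bs :: "'a list" assume bs: "bs \<in> lists Basis" "length bs \<le> N"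
      have sm: "smooth (\<lambda>y. k (y - x))" for x by (intro schwartz_smooth schwartz_translate k)
      show "(1 + norm y) ^ N * norm (iter_deriv bs (\<lambda>y. k (y - x') - k (y - x)) y) \<le> D * (norm (x' - x) * (1 + norm x + norm x') ^ N)"
        unfolding iter_deriv_diff[OF sm sm bs(1)] iter_deriv_translate[OF schwartz_smooth[OF k] bs(1)] by (rule D(2)[OF bs])
    qed
    finally show ?thesis using C(1) by (simp add: mult_left_mono)
  qed
  show ?thesis
    unfolding continuous_on_def
  proof
    fix x
    have "((\<lambda>x'. T (\<lambda>y. k (y - x')) - T (\<lambda>y. k (y - x))) \<longlongrightarrow> 0) (at x)"
    proof (rule Lim_null_comparison)
      show "\<forall>\<^sub>F x' in at x. norm (T (\<lambda>y. k (y - x')) - T (\<lambda>y. k (y - x))) \<le> C * (D * (norm (x' - x) * (1 + norm x + norm x') ^ N))"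
        using bd by simp
      have "((\<lambda>x'. C * (D * (norm (x' - x) * (1 + norm x + norm x') ^ N))) \<longlongrightarrow> C * (D * (norm (x - x) * (1 + norm x + norm x) ^ N))) (at x)"
        by (intro tendsto_intros)
      then show "((\<lambda>x'. C * (D * (norm (x' - x) * (1 + norm x + norm x') ^ N))) \<longlongrightarrow> 0) (at x)" by simp
    qed
    then show "((\<lambda>x'. T (\<lambda>y. k (y - x'))) \<longlongrightarrow> T (\<lambda>y. k (y - x))) (at x)" by (simp only: LIM_zero_iff)
  qed
qed

lemma tempered_translate_borel:
  "T \<in> tempered \<Longrightarrow> k \<in> schwartz \<Longrightarrow> (\<lambda>x. T (\<lambda>y. k (y - x))) \<in> borel_measurable borel"
  by (rule borel_measurable_continuous_onI) (rule tempered_translate_continuous)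

text \<open>The convolution is approximated, in every Schwartz seminorm, by finite combinations of
  translates of the kernel.\<close>

theorem tempered_conv:
  fixes T :: "'a::euclidean_space distr"
  assumes T: "T \<in> tempered" and w: "rapid w" and k: "k \<in> schwartz"
  shows "integrable lborel (\<lambda>x. w x * T (\<lambda>y. k (y - x)))"
    and "T (conv w k) = (\<integral>x. w x * T (\<lambda>y. k (y - x)) \<partial>lborel)"
proof -
  define F where "F x = T (\<lambda>y. k (y - x))" for x
  have [measurable]: "w \<in> borel_measurable borel" using w by measurable
  have Fc: "continuous_on UNIV F" unfolding F_def[abs_def] by (rule tempered_translate_continuous[OF T k])
  have Fb[measurable]: "F \<in> borel_measurable borel" using Fc by (rule borel_measurable_continuous_onI)
  obtain C M where C: "0 < C" "\<And>x. norm (F x) \<le> C * (1 + norm x) ^ M"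
    using tempered_translate_bound[OF T k] unfolding F_def by blast
  show int: "integrable lborel (\<lambda>x. w x * T (\<lambda>y. k (y - x)))"
    using rapid_integrable[OF rapid_mult_bounded_growth[OF w Fb C(2)]] by (simp add: F_def mult.commute)
  \<comment> \<open>Simple functions approximating the identity of the space. Their finitely many
    fibres form the cells of a Riemann sum, and \<open>norm (s i x) \<le> 2 * norm x\<close> keeps
    polynomial weights under control.\<close>
  obtain s :: "nat \<Rightarrow> 'a \<Rightarrow> 'a" where s: "\<And>i. simple_function lborel (s i)" "\<And>x. (\<lambda>i. s i x) \<longlonglongrightarrow> x"
    "\<And>i x. norm (s i x) \<le> 2 * norm x"
    using borel_measurable_implies_sequence_metric[of "\<lambda>x::'a. x" lborel 0] by auto
  have [measurable]: "s i \<in> borel_measurable borel" for i using borel_measurable_simple_function[OF s(1)] by simp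
  define P where "P i = s i ` UNIV" for i
  have fin: "finite (P i)" for i using simple_functionD(1)[OF s(1)[of i]] by (simp add: P_def)
  define c where "c i p = (\<integral>x. indicator (s i -` {p}) x * w x \<partial>lborel)" for i p
  have pre: "s i -` {p} \<in> sets borel" for i p
    using measurable_sets[OF \<open>\<And>i. s i \<in> borel_measurable borel\<close>[of i], of "{p}"] by simp
  have ci: "integrable lborel (\<lambda>x. indicator (s i -` {p}) x * w x)" for i p
    by (rule Bochner_Integration.integrable_bound[OF rapid_integrable[OF w]])
       (use pre in \<open>auto intro!: AE_I2 borel_measurable_times borel_measurable_indicator simp: indicator_def\<close>)
  \<comment> \<open>A finite combination over the cells is an integral with \<open>s i x\<close> in
    place of \<open>x\<close>, so Riemann sums and integrals can be compared under one integral
    sign.\<close>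
  have csum: "(\<Sum>p\<in>P i. c i p * g p) = (\<integral>x. w x * g (s i x) \<partial>lborel)" "integrable lborel (\<lambda>x. w x * g (s i x))" for i and g :: "'a \<Rightarrow> complex"
  proof -
    have eq: "w x * g (s i x) = (\<Sum>p\<in>P i. indicator (s i -` {p}) x * w x * g p)" for x
    proof -
      have "(\<Sum>p\<in>P i. indicator (s i -` {p}) x * w x * g p) = (\<Sum>p\<in>P i. if p = s i x then w x * g p else 0)"
        by (intro sum.cong) (auto simp: indicator_def)
      then show ?thesis using fin[of i] by (simp add: P_def)
    qed
    show "(\<Sum>p\<in>P i. c i p * g p) = (\<integral>x. w x * g (s i x) \<partial>lborel)"
      unfolding eq c_def by (subst Bochner_Integration.integral_sum) (use ci in auto)
    show "integrable lborel (\<lambda>x. w x * g (s i x))"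
      unfolding eq by (intro Bochner_Integration.integrable_sum integrable_mult_left ci)
  qed
  define S where "S i y = (\<Sum>p\<in>P i. c i p * k (y - p))" for i y
  have Sk: "S i \<in> schwartz" for i
    unfolding S_def[abs_def] by (intro schwartz_sum fin schwartz_cmult schwartz_translate k)
  have TS: "T (S i) = (\<integral>x. w x * F (s i x) \<partial>lborel)" for i
  proof -
    have "T (S i) = (\<Sum>p\<in>P i. T (\<lambda>y. c i p * k (y - p)))"
      unfolding S_def[abs_def] by (intro tempered_sum[OF T fin] schwartz_cmult schwartz_translate k)
    also have "\<dots> = (\<Sum>p\<in>P i. c i p * F p)"
      unfolding F_def by (intro sum.cong refl tempered_cmult[OF T] schwartz_translate k)
    finally show ?thesis by (simp only: csum(1))
  qed
  have "(\<lambda>i. T (S i)) \<longlonglongrightarrow> T (conv w k)"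
  proof (rule tempered_tendsto[OF T Sk conv_schwartz[OF w k]])
    fix N
    obtain D where D: "0 < D" "\<And>bs y x x'. bs \<in> lists Basis \<Longrightarrow> length bs \<le> N \<Longrightarrow>
       (1 + norm y) ^ N * norm (iter_deriv bs k (y - x') - iter_deriv bs k (y - x)) \<le> D * (norm (x' - x) * (1 + norm x + norm x') ^ N)"
      using translate_diff_bounds[OF k] by blast
    \<comment> \<open>The integral of \<open>?e i\<close> bounds the errors of all derivatives up to
      order \<open>N\<close> at once. The integrand tends to 0 because \<open>s i x\<close> tends to
      \<open>x\<close>, and it stays below the integrable \<open>?d\<close>.\<close>
    let ?e = "\<lambda>i x. norm (w x) * (D * (norm (s i x - x) * (1 + norm x + norm (s i x)) ^ N))"
    let ?d = "\<lambda>x. (D * 3 ^ Suc N) * ((1 + norm x) ^ Suc N * norm (w x))"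
    have dom: "?e i x \<le> ?d x" for i x
    proof -
      have "norm (s i x - x) \<le> 3 * (1 + norm x)" using norm_triangle_ineq4[of "s i x" x] s(3)[of i x] by simp
      moreover have "(1 + norm x + norm (s i x)) ^ N \<le> (3 * (1 + norm x)) ^ N" using s(3)[of i x] by (intro power_mono) auto
      ultimately have "norm (s i x - x) * (1 + norm x + norm (s i x)) ^ N \<le> (3 * (1 + norm x)) * (3 * (1 + norm x)) ^ N"
        by (intro mult_mono) auto
      also have "\<dots> = 3 ^ Suc N * (1 + norm x) ^ Suc N" by (simp only: power_Suc power_mult_distrib mult_ac)
      finally have "?e i x \<le> norm (w x) * (D * (3 ^ Suc N * (1 + norm x) ^ Suc N))" using D(1) by (intro mult_left_mono) auto
      then show ?thesis by (simp only: mult_ac)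
    qed
    have e0: "0 \<le> ?e i x" for i x using D(1) by simp
    have di: "integrable lborel ?d" by (intro integrable_mult_right rapid_weight[OF w])
    have ei: "integrable lborel (?e i)" for i
      by (rule Bochner_Integration.integrable_bound[OF di]) (use dom e0 in \<open>auto intro!: AE_I2 order_trans[OF dom]\<close>)
    have lim: "(\<lambda>i. \<integral>x. ?e i x \<partial>lborel) \<longlonglongrightarrow> (\<integral>x. (0::real) \<partial>(lborel :: 'a measure))"
    proof (rule integral_dominated_convergence[where w="?d"])
      show "AE x in lborel. (\<lambda>i. ?e i x) \<longlonglongrightarrow> 0"
      proof (rule AE_I2)
        fix x :: 'a
        have "(\<lambda>i. ?e i x) \<longlonglongrightarrow> norm (w x) * (D * (norm (x - x) * (1 + norm x + norm x) ^ N))"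
          by (intro tendsto_intros s)
        then show "(\<lambda>i. ?e i x) \<longlonglongrightarrow> 0" by simp
      qed
      show "AE x in lborel. norm (?e i x) \<le> ?d x" for i using dom e0 by (intro AE_I2) (simp only: real_norm_def abs_of_nonneg)
    qed (use di in auto)
    have bound: "schwartz_norm N (\<lambda>y. S i y - conv w k y) \<le> (\<integral>x. ?e i x \<partial>lborel)" for i
    proof (rule schwartz_norm_le)
      fix y :: 'a and bs :: "'a list" assume bs: "bs \<in> lists Basis" "length bs \<le> N"
      have kb: "iter_deriv bs k \<in> schwartz" by (rule schwartz_iter_deriv[OF k bs(1)])
      have "iter_deriv bs (S i) = (\<lambda>y. \<Sum>p\<in>P i. c i p * iter_deriv bs k (y - p))"
        unfolding S_def[abs_def]
        using schwartz_smooth[OF k] schwartz_smooth[OF schwartz_translate[OF k]]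
        by (subst iter_deriv_sum[OF fin _ bs(1)]) (auto simp: smooth_cmult iter_deriv_cmult bs(1) iter_deriv_translate)
      then have "iter_deriv bs (\<lambda>y. S i y - conv w k y) y
         = (\<integral>x. w x * iter_deriv bs k (y - s i x) \<partial>lborel) - (\<integral>x. w x * iter_deriv bs k (y - x) \<partial>lborel)"
        unfolding iter_deriv_diff[OF schwartz_smooth[OF Sk] schwartz_smooth[OF conv_schwartz[OF w k]] bs(1)]
          conv_iter_deriv[OF rapid_integrable[OF w] k bs(1)]
        by (simp add: csum(1)[of i "\<lambda>p. iter_deriv bs k (y - p)"] conv_def)
      also have "\<dots> = (\<integral>x. w x * iter_deriv bs k (y - s i x) - w x * iter_deriv bs k (y - x) \<partial>lborel)"
        by (rule Bochner_Integration.integral_diff[symmetric, OF csum(2)[of "\<lambda>p. iter_deriv bs k (y - p)"] conv_integrable[OF rapid_integrable[OF w] kb]])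
      finally have eq: "iter_deriv bs (\<lambda>y. S i y - conv w k y) y = (\<integral>x. w x * iter_deriv bs k (y - s i x) - w x * iter_deriv bs k (y - x) \<partial>lborel)" .
      have "(1 + norm y) ^ N * norm (iter_deriv bs (\<lambda>y. S i y - conv w k y) y)
        \<le> (1 + norm y) ^ N * (\<integral>x. norm (w x * iter_deriv bs k (y - s i x) - w x * iter_deriv bs k (y - x)) \<partial>lborel)"
        unfolding eq by (intro mult_left_mono integral_norm_bound) auto
      also have "\<dots> = (\<integral>x. (1 + norm y) ^ N * norm (w x * iter_deriv bs k (y - s i x) - w x * iter_deriv bs k (y - x)) \<partial>lborel)"
        by simp
      also have "\<dots> \<le> (\<integral>x. ?e i x \<partial>lborel)"
      proof (rule integral_mono[OF _ ei])
        show "integrable lborel (\<lambda>x. (1 + norm y) ^ N * norm (w x * iter_deriv bs k (y - s i x) - w x * iter_deriv bs k (y - x)))"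
          by (intro integrable_mult_right integrable_norm Bochner_Integration.integrable_diff
              csum(2)[of "\<lambda>p. iter_deriv bs k (y - p)"] conv_integrable[OF rapid_integrable[OF w] kb])
        fix x
        have "(1 + norm y) ^ N * norm (w x * iter_deriv bs k (y - s i x) - w x * iter_deriv bs k (y - x))
          = norm (w x) * ((1 + norm y) ^ N * norm (iter_deriv bs k (y - s i x) - iter_deriv bs k (y - x)))"
          by (simp add: norm_mult mult_ac flip: right_diff_distrib)
        also have "\<dots> \<le> ?e i x" by (intro mult_left_mono D(2)[OF bs]) auto
        finally show "(1 + norm y) ^ N * norm (w x * iter_deriv bs k (y - s i x) - w x * iter_deriv bs k (y - x)) \<le> ?e i x" .
      qed
      finally show "(1 + norm y) ^ N * norm (iter_deriv bs (\<lambda>y. S i y - conv w k y) y) \<le> (\<integral>x. ?e i x \<partial>lborel)" .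
    qed
    show "(\<lambda>i. schwartz_norm N (\<lambda>y. S i y - conv w k y)) \<longlonglongrightarrow> 0"
    proof (rule tendsto_sandwich[of "\<lambda>_. 0"])
      show "\<forall>\<^sub>F i in sequentially. 0 \<le> schwartz_norm N (\<lambda>y. S i y - conv w k y)"
        by (intro always_eventually allI schwartz_norm_nonneg schwartz_diff Sk conv_schwartz w k)
      show "\<forall>\<^sub>F i in sequentially. schwartz_norm N (\<lambda>y. S i y - conv w k y) \<le> (\<integral>x. ?e i x \<partial>lborel)"
        using bound by (intro always_eventually allI)
    qed (use lim in simp_all)
  qed
  moreover have "(\<lambda>i. T (S i)) \<longlonglongrightarrow> (\<integral>x. w x * F x \<partial>lborel)"
    unfolding TS
  proof (rule integral_dominated_convergence[where w="\<lambda>x. (C * 2 ^ M) * ((1 + norm x) ^ M * norm (w x))"])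
    show "integrable lborel (\<lambda>x. (C * 2 ^ M) * ((1 + norm x) ^ M * norm (w x)))"
      by (intro integrable_mult_right rapid_weight[OF w])
    show "AE x in lborel. (\<lambda>i. w x * F (s i x)) \<longlonglongrightarrow> w x * F x"
      using Fc s(2) by (intro AE_I2 tendsto_mult tendsto_const isCont_tendsto_compose[of _ F]) (auto simp: continuous_on_eq_continuous_at)
    show "AE x in lborel. norm (w x * F (s i x)) \<le> (C * 2 ^ M) * ((1 + norm x) ^ M * norm (w x))" for i
    proof (rule AE_I2)
      fix x :: 'a
      have "norm (F (s i x)) \<le> C * (1 + norm (s i x)) ^ M" by (rule C)
      also have "\<dots> \<le> C * (2 * (1 + norm x)) ^ M" using s(3)[of i x] C(1) by (intro mult_left_mono power_mono) auto
      also have "\<dots> = (C * 2 ^ M) * (1 + norm x) ^ M" by (simp only: power_mult_distrib mult.assoc)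
      finally have "norm (w x) * norm (F (s i x)) \<le> norm (w x) * ((C * 2 ^ M) * (1 + norm x) ^ M)" by (intro mult_left_mono) auto
      then show "norm (w x * F (s i x)) \<le> (C * 2 ^ M) * ((1 + norm x) ^ M * norm (w x))" by (simp only: norm_mult mult_ac)
    qed
  qed measurable
  ultimately show "T (conv w k) = (\<integral>x. w x * T (\<lambda>y. k (y - x)) \<partial>lborel)"
    unfolding F_def using LIMSEQ_unique by blast
qed

subsection \<open>Functions of slow growth as distributions\<close>

definition slow :: "('a::euclidean_space \<Rightarrow> complex) \<Rightarrow> bool" where
  "slow g \<longleftrightarrow> g \<in> borel_measurable borel \<and> (\<exists>M. integrable lborel (\<lambda>x. norm (g x) / (1 + norm x) ^ M))"

lemma slow_borel [measurable_dest]: "slow g \<Longrightarrow> g \<in> borel_measurable borel"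
  by (simp add: slow_def)

lemma slow_bound:
  assumes g: "slow g"
  obtains C M where "0 \<le> C" "\<And>f. f \<in> schwartz \<Longrightarrow> integrable lborel (\<lambda>x. g x * f x)"
    "\<And>f. f \<in> schwartz \<Longrightarrow> (\<integral>x. norm (g x * f x) \<partial>lborel) \<le> C * schwartz_norm M f"
proof -
  have [measurable]: "g \<in> borel_measurable borel" using g by measurable
  obtain M where M: "integrable lborel (\<lambda>x. norm (g x) / (1 + norm x) ^ M)" using g unfolding slow_def by blast
  have pt: "norm (g x * f x) \<le> schwartz_norm M f * (norm (g x) / (1 + norm x) ^ M)" if f: "f \<in> schwartz" for f x
  proof -
    have p: "0 < (1 + norm x) ^ M" by (intro zero_less_power add_pos_nonneg) auto
    have "(1 + norm x) ^ M * norm (f x) \<le> schwartz_norm M f" using schwartz_norm_ge[OF f, of "[]" M x] by simp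
    then have "norm (f x) \<le> schwartz_norm M f / (1 + norm x) ^ M" using p by (simp add: pos_le_divide_eq mult.commute)
    then have "norm (g x) * norm (f x) \<le> norm (g x) * (schwartz_norm M f / (1 + norm x) ^ M)" by (intro mult_left_mono) auto
    then show ?thesis by (simp add: norm_mult mult.commute)
  qed
  have i: "integrable lborel (\<lambda>x. g x * f x)" if f: "f \<in> schwartz" for f
  proof (rule Bochner_Integration.integrable_bound[OF integrable_mult_right[OF M, of "schwartz_norm M f"]])
    show "(\<lambda>x. g x * f x) \<in> borel_measurable lborel" using schwartz_borel[OF f] by measurable
    show "AE x in lborel. norm (g x * f x) \<le> norm (schwartz_norm M f * (norm (g x) / (1 + norm x) ^ M))"
      by (intro AE_I2) (simp only: real_norm_def, rule order_trans[OF pt[OF f] abs_ge_self])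
  qed
  show ?thesis
  proof (rule that[of "\<integral>x. norm (g x) / (1 + norm x) ^ M \<partial>lborel" M])
    show "0 \<le> (\<integral>x. norm (g x) / (1 + norm x) ^ M \<partial>lborel)" by (rule Bochner_Integration.integral_nonneg) simp
    fix f :: "'a \<Rightarrow> complex" assume f: "f \<in> schwartz"
    have "(\<integral>x. norm (g x * f x) \<partial>lborel) \<le> (\<integral>x. schwartz_norm M f * (norm (g x) / (1 + norm x) ^ M) \<partial>lborel)"
      by (rule integral_mono[OF integrable_norm[OF i[OF f]] integrable_mult_right[OF M]]) (rule pt[OF f])
    then show "(\<integral>x. norm (g x * f x) \<partial>lborel) \<le> (\<integral>x. norm (g x) / (1 + norm x) ^ M \<partial>lborel) * schwartz_norm M f"
      by (simp only: integral_mult_right_zero mult.commute[of "integral\<^sup>L _ _"])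
  qed (rule i)
qed

lemma slow_integrable: "slow g \<Longrightarrow> f \<in> schwartz \<Longrightarrow> integrable lborel (\<lambda>x. g x * f x)"
  using slow_bound by metis

lemma regular_distr_lborel:
  assumes [measurable]: "g \<in> borel_measurable borel" "f \<in> borel_measurable borel"
  shows "regular_distr g f = (\<integral>x. g x * f x \<partial>lborel)"
  unfolding regular_distr_def by (rule integral_completion) measurable

lemma slow_tempered:
  assumes g: "slow g" shows "regular_distr g \<in> tempered"
  unfolding tempered_def
proof (intro CollectI conjI ballI allI)
  have [measurable]: "g \<in> borel_measurable borel" using g by measurable
  have eq: "regular_distr g f = (\<integral>x. g x * f x \<partial>lborel)" if "f \<in> schwartz" for f
    using schwartz_borel[OF that] by (intro regular_distr_lborel) auto
  obtain C M where C: "0 \<le> C" "\<And>f. f \<in> schwartz \<Longrightarrow> (\<integral>x. norm (g x * f x) \<partial>lborel) \<le> C * schwartz_norm M f"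
    using slow_bound[OF g] by metis
  have "norm (regular_distr g f) \<le> C * schwartz_norm M f" if f: "f \<in> schwartz" for f
    unfolding eq[OF f] by (rule order_trans[OF integral_norm_bound C(2)[OF f]])
  then show "\<exists>C N. \<forall>\<phi>\<in>schwartz. norm (regular_distr g \<phi>) \<le> C * schwartz_norm N \<phi>" by blast
  fix f h :: "'a \<Rightarrow> complex" and c assume fh: "f \<in> schwartz" "h \<in> schwartz"
  then have "(\<lambda>x. c * f x + h x) \<in> schwartz" by (intro schwartz_add schwartz_cmult)
  moreover have "(\<integral>x. g x * (c * f x + h x) \<partial>lborel) = (\<integral>x. c * (g x * f x) + g x * h x \<partial>lborel)"
    by (intro Bochner_Integration.integral_cong refl) (simp add: algebra_simps)
  moreover have "\<dots> = c * (\<integral>x. g x * f x \<partial>lborel) + (\<integral>x. g x * h x \<partial>lborel)"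
    using slow_integrable[OF g fh(1)] slow_integrable[OF g fh(2)] by simp
  ultimately show "regular_distr g (\<lambda>x. c * f x + h x) = c * regular_distr g f + regular_distr g h"
    using eq fh by simp
qed

text \<open>Representation against compactly supported functions extends by truncation: the left
  side converges by continuity of \<open>T\<close>, the right side by dominated convergence.\<close>

lemma represents_schwartz:
  assumes T: "T \<in> tempered" and g: "slow g"
    and eq: "\<And>f. f \<in> test_functions \<Longrightarrow> T f = (\<integral>x. g x * f x \<partial>lborel)" and f: "f \<in> schwartz"
  shows "T f = (\<integral>x. g x * f x \<partial>lborel)"
proof -
  have [measurable]: "g \<in> borel_measurable borel" "f \<in> borel_measurable borel" using g schwartz_borel[OF f] by measurable
  let ?f = "\<lambda>(i::nat) x. f x * cutoff ((1 / real (Suc i)) *\<^sub>R x)"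
  have test: "?f i \<in> test_functions" for i by (rule schwartz_cutoff_test[OF f])
  have [measurable]: "(cutoff :: 'a \<Rightarrow> complex) \<in> borel_measurable borel" by (rule smooth_borel[OF cutoff_smooth])
  obtain C where C: "0 < C" "\<And>x::'a. norm (cutoff x) \<le> C" using schwartz_bounded[OF test_schwartz[OF cutoff_test]] by blast
  have "(\<lambda>i. T (?f i)) \<longlonglongrightarrow> T f"
    by (rule tempered_tendsto[OF T test_schwartz[OF test] f schwartz_cutoff_tendsto[OF f]])
  moreover have "(\<lambda>i. T (?f i)) \<longlonglongrightarrow> (\<integral>x. g x * f x \<partial>lborel)"
    unfolding eq[OF test]
  proof (rule integral_dominated_convergence[where w="\<lambda>x. norm (g x * f x) * C"])
    show "integrable lborel (\<lambda>x. norm (g x * f x) * C)"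
      by (intro integrable_mult_left integrable_norm slow_integrable g f)
    show "AE x in lborel. (\<lambda>i. g x * ?f i x) \<longlonglongrightarrow> g x * f x"
    proof (rule AE_I2)
      fix x :: 'a
      obtain k where k: "norm x \<le> real k" using real_arch_simple by blast
      have "\<forall>\<^sub>F i in sequentially. g x * ?f i x = g x * f x"
        using eventually_ge_at_top[of k]
      proof eventually_elim
        case (elim i)
        then have "norm x \<le> real (Suc i)" using k by linarith
        then have "cutoff ((1 / real (Suc i)) *\<^sub>R x) = 1" by (intro cutoff_1) (simp add: divide_le_eq)
        then show ?case by simp
      qed
      then show "(\<lambda>i. g x * ?f i x) \<longlonglongrightarrow> g x * f x" by (rule tendsto_eventually)
    qed
    show "AE x in lborel. norm (g x * ?f i x) \<le> norm (g x * f x) * C" for i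
      unfolding mult.assoc[symmetric] using C(2) by (intro AE_I2) (simp only: norm_mult, intro mult_left_mono, auto)
  qed measurable
  ultimately show ?thesis by (rule LIMSEQ_unique)
qed

subsection \<open>Littlewood--Paley pieces\<close>

abbreviation pw :: "int \<Rightarrow> real" where "pw j \<equiv> 2 powr real_of_int j"

text \<open>The difference of two consecutive dyadic cutoffs, so that sums over dyadic scales
  telescope.\<close>

definition ring :: "'a::euclidean_space \<Rightarrow> complex" where
  "ring \<xi> = cutoff ((1/2) *\<^sub>R \<xi>) - cutoff \<xi>"

lemma ring_smooth: "smooth ring"
  unfolding ring_def[abs_def] by (intro smooth_diff cutoff_dilate_smooth cutoff_smooth)

lemma ring_0: "norm \<xi> \<le> 1 \<Longrightarrow> ring \<xi> = 0" "4 \<le> norm \<xi> \<Longrightarrow> ring \<xi> = 0"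
  by (simp_all add: ring_def cutoff_1 cutoff_0)

lemma ring_sum:
  "(\<Sum>j\<in>{- int J..<int J}. ring ((1 / pw j) *\<^sub>R \<xi>)) = cutoff ((1 / pw (int J)) *\<^sub>R \<xi>) - cutoff ((1 / pw (- int J)) *\<^sub>R \<xi>)"
proof -
  define e where "e j = cutoff ((1 / pw j) *\<^sub>R \<xi>)" for j :: int
  have r: "ring ((1 / pw j) *\<^sub>R \<xi>) = e (j + 1) - e j" for j
    by (simp add: ring_def e_def powr_add mult.commute)
  have "(\<Sum>j\<in>{- int J..<int J}. e (j + 1) - e j) = e (int J) - e (- int J)"
  proof (induction J)
    case (Suc J)
    have "{- int (Suc J)..<int (Suc J)} = insert (- int (Suc J)) (insert (int J) {- int J..<int J})" by auto
    then show ?case using Suc by (simp add: add.commute)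
  qed simp
  then show ?thesis by (simp only: r e_def)
qed

text \<open>The power of the norm is built into the dyadic piece. Since \<open>ring\<close> vanishes
  near the origin, negative exponents \<open>a\<close> are harmless; they occur when derivatives are
  removed.\<close>

definition band :: "real \<Rightarrow> int \<Rightarrow> 'a::euclidean_space \<Rightarrow> complex" where
  "band a j \<xi> = complex_of_real (norm \<xi> powr a) * ring ((1 / pw j) *\<^sub>R \<xi>)"

lemma band_test: "(band a j :: 'a::euclidean_space \<Rightarrow> complex) \<in> test_functions"
proof (rule testI_bounded)
  have 1: "smooth (\<lambda>\<xi>::'a. ring ((1 / pw j) *\<^sub>R \<xi>))" using smooth_affine[OF ring_smooth, of "1 / pw j" 0] by simp
  have 2: "ring ((1 / pw j) *\<^sub>R \<xi>) = 0" if "norm \<xi> < pw j" for \<xi> :: 'a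
    using that by (intro ring_0(1)) (simp add: less_imp_le)
  show "smooth (band a j :: 'a \<Rightarrow> complex)"
    unfolding band_def[abs_def] by (rule smooth_norm_powr_mult[where r="pw j", OF 1]) (auto intro: 2)
  show "band a j \<xi> = 0" if "4 * pw j \<le> norm \<xi>" for \<xi> :: 'a
    using that by (simp add: band_def ring_0 pos_le_divide_eq)
qed

lemma band_scale: "band a j \<xi> = complex_of_real (pw j powr a) * band a 0 ((1 / pw j) *\<^sub>R \<xi>)"
proof -
  have "norm \<xi> powr a = (pw j * norm ((1 / pw j) *\<^sub>R \<xi>)) powr a" by simp
  also have "\<dots> = pw j powr a * norm ((1 / pw j) *\<^sub>R \<xi>) powr a" by (rule powr_mult)
  finally show ?thesis by (simp add: band_def)
qed

lemma fourier_dilate: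
  fixes m :: "'a::euclidean_space \<Rightarrow> complex"
  assumes [measurable]: "m \<in> borel_measurable borel" and c: "0 < c"
  shows "fourier (\<lambda>\<xi>. m ((1 / c) *\<^sub>R \<xi>)) y = complex_of_real (c ^ DIM('a)) * fourier m (c *\<^sub>R y)"
proof -
  let ?f = "\<lambda>\<xi>. exp (- \<i> * complex_of_real (\<xi> \<bullet> y)) * m ((1 / c) *\<^sub>R \<xi>)"
  have "(\<integral>\<xi>. ?f (0 + c *\<^sub>R \<xi>) \<partial>lborel) = (1 / \<bar>c\<bar> ^ DIM('a)) *\<^sub>R (\<integral>\<xi>. ?f \<xi> \<partial>lborel)"
    using c by (intro lborel_integral_affine(2)) auto
  moreover have "(\<integral>\<xi>. ?f (0 + c *\<^sub>R \<xi>) \<partial>lborel) = fourier m (c *\<^sub>R y)"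
    using c by (subst fourier_lborel) auto
  moreover have "(\<integral>\<xi>. ?f \<xi> \<partial>lborel) = fourier (\<lambda>\<xi>. m ((1 / c) *\<^sub>R \<xi>)) y"
    by (subst fourier_lborel) auto
  ultimately have "fourier m (c *\<^sub>R y) = fourier (\<lambda>\<xi>. m ((1 / c) *\<^sub>R \<xi>)) y / complex_of_real (c ^ DIM('a))"
    using c by (simp add: scaleR_conv_of_real)
  then show ?thesis using c by (simp del: of_real_power)
qed

lemma fourier_cmult:
  "fourier (\<lambda>\<xi>. c * m \<xi>) y = c * fourier m y"
proof -
  have "exp (- \<i> * complex_of_real (\<xi> \<bullet> y)) * (c * m \<xi>) = c * (exp (- \<i> * complex_of_real (\<xi> \<bullet> y)) * m \<xi>)" for \<xi>
    by (simp only: mult_ac)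
  then show ?thesis unfolding fourier_def by (simp only: integral_mult_right_zero)
qed

lemma fourier_band: "fourier (band a j) y = complex_of_real (pw j powr a * pw j ^ DIM('a)) * fourier (band a 0) (pw j *\<^sub>R (y::'a::euclidean_space))"
proof -
  have [measurable]: "(band a 0 :: 'a \<Rightarrow> complex) \<in> borel_measurable borel"
    by (rule smooth_borel[OF test_smooth[OF band_test]])
  have "fourier (band a j) y = complex_of_real (pw j powr a) * fourier (\<lambda>\<xi>. band a 0 ((1 / pw j) *\<^sub>R \<xi>)) y"
  proof -
    have "band a j = (\<lambda>\<xi>::'a. complex_of_real (pw j powr a) * band a 0 ((1 / pw j) *\<^sub>R \<xi>))"
      by (rule ext, rule band_scale)
    then show ?thesis by (simp only: fourier_cmult)
  qed
  also have "fourier (\<lambda>\<xi>. band a 0 ((1 / pw j) *\<^sub>R \<xi>)) y = complex_of_real (pw j ^ DIM('a)) * fourier (band a 0) (pw j *\<^sub>R y)"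
    by (rule fourier_dilate) auto
  finally show ?thesis by simp
qed

lemma fourier_test_schwartz: "m \<in> test_functions \<Longrightarrow> fourier m \<in> schwartz"
  by (rule fourier_schwartz[OF test_schwartz])

text \<open>The kernel at index \<open>j\<close> is \<open>pw j powr a\<close> times the
  mass-preserving dilation of one Schwartz kernel to scale 2^-j, so the dyadic decay estimate
  applies with a constant independent of \<open>j\<close>.\<close>

lemma band_maximal:
  "\<exists>C>0. \<forall>g j (x::'a::euclidean_space). g \<in> borel_measurable borel \<longrightarrow>
    ennreal (norm (\<integral>y. g y * fourier (band a j) (y - x) \<partial>lborel)) \<le> ennreal (C * pw j powr a) * maximal (\<lambda>y. ennreal (norm (g y))) x"
proof -
  let ?n = "DIM('a)"
  have k: "fourier (band a j :: 'a \<Rightarrow> complex) \<in> schwartz" for j by (rule fourier_test_schwartz[OF band_test])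
  obtain D where D: "0 < D" "\<And>z::'a. norm (fourier (band a 0) z) \<le> D / (1 + norm z) ^ (?n + 1)"
    using schwartz_bound0[OF k[of 0]] by blast
  define V where "V = unit_ball_vol (real ?n) * 2 ^ (?n + 2)"
  have V: "0 < V" by (simp add: V_def)
  have "ennreal (norm (\<integral>y. g y * fourier (band a j) (y - x) \<partial>lborel)) \<le> ennreal ((D * V) * pw j powr a) * maximal (\<lambda>y. ennreal (norm (g y))) x"
    if [measurable]: "g \<in> borel_measurable borel" for g j and x :: 'a
  proof (cases "integrable lborel (\<lambda>y. g y * fourier (band a j) (y - x))")
    case True
    define A where "A = D * (pw j powr a * pw j ^ ?n)"
    have A: "0 \<le> A" using D(1) by (simp add: A_def)
    have kb: "norm (fourier (band a j) (y - x)) \<le> A * (1 / (1 + norm (x - y) / pw (- j)) ^ (?n + 1))" for y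
    proof -
      have "norm (fourier (band a j) (y - x)) = (pw j powr a * pw j ^ ?n) * norm (fourier (band a 0) (pw j *\<^sub>R (y - x)))"
        unfolding fourier_band[of a j "y - x"] norm_mult norm_of_real
        by (simp only: abs_of_nonneg[OF mult_nonneg_nonneg[OF powr_ge_zero zero_le_power[OF powr_ge_zero]]])
      also have "\<dots> \<le> (pw j powr a * pw j ^ ?n) * (D / (1 + norm (pw j *\<^sub>R (y - x))) ^ (?n + 1))"
        by (intro mult_left_mono D) auto
      also have "norm (pw j *\<^sub>R (y - x)) = norm (x - y) / pw (- j)"
      proof -
        have "pw (- j) = 1 / pw j" by (simp add: powr_minus_divide)
        then show ?thesis by (simp add: norm_minus_commute mult.commute)
      qed
      finally show ?thesis by (simp add: A_def mult_ac)
    qed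
    have "ennreal (norm (\<integral>y. g y * fourier (band a j) (y - x) \<partial>lborel)) \<le> (\<integral>\<^sup>+y. ennreal (norm (g y * fourier (band a j) (y - x))) \<partial>lborel)"
      by (rule integral_norm_bound_ennreal[OF True])
    also have "\<dots> \<le> (\<integral>\<^sup>+y. ennreal A * (ennreal (norm (g y)) * ennreal (1 / (1 + norm (x - y) / pw (- j)) ^ (?n + 1))) \<partial>lborel)"
    proof (rule nn_integral_mono)
      fix y
      have "norm (g y * fourier (band a j) (y - x)) \<le> norm (g y) * (A * (1 / (1 + norm (x - y) / pw (- j)) ^ (?n + 1)))"
        unfolding norm_mult by (intro mult_left_mono kb) auto
      then have "ennreal (norm (g y * fourier (band a j) (y - x))) \<le> ennreal (A * (norm (g y) * (1 / (1 + norm (x - y) / pw (- j)) ^ (?n + 1))))"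
        by (intro ennreal_leI) (simp only: mult_ac)
      also have "\<dots> = ennreal A * (ennreal (norm (g y)) * ennreal (1 / (1 + norm (x - y) / pw (- j)) ^ (?n + 1)))"
        using A by (subst ennreal_mult, simp, simp, subst ennreal_mult) auto
      finally show "ennreal (norm (g y * fourier (band a j) (y - x))) \<le> ennreal A * (ennreal (norm (g y)) * ennreal (1 / (1 + norm (x - y) / pw (- j)) ^ (?n + 1)))" .
    qed
    also have "\<dots> = ennreal A * (\<integral>\<^sup>+y. ennreal (norm (g y)) * ennreal (1 / (1 + norm (x - y) / pw (- j)) ^ (?n + 1)) \<partial>lborel)"
      by (rule nn_integral_cmult) measurable
    also have "\<dots> \<le> ennreal A * (ennreal (V * pw (- j) ^ ?n) * maximal (\<lambda>y. ennreal (norm (g y))) x)"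
      unfolding V_def by (intro mult_left_mono nn_integral_decay_maximal) auto
    also have "\<dots> = ennreal (A * (V * pw (- j) ^ ?n)) * maximal (\<lambda>y. ennreal (norm (g y))) x"
      using A V by (simp add: ennreal_mult mult.assoc)
    also have "A * (V * pw (- j) ^ ?n) = (D * V) * pw j powr a"
    proof -
      have "pw j ^ ?n * pw (- j) ^ ?n = 1" by (simp add: power_mult_distrib[symmetric] powr_add[symmetric])
      then have "A * (V * pw (- j) ^ ?n) = D * V * pw j powr a * 1" unfolding A_def by (metis (no_types, lifting) mult.assoc mult.left_commute)
      then show ?thesis by simp
    qed
    finally show ?thesis .
  next
    case False
    \<comment> \<open>A Bochner integral that does not exist has the value 0.\<close>
    then show ?thesis by (simp add: not_integrable_integral_eq)
  qed
  moreover have "0 < D * V" using D V by simp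
  ultimately show ?thesis by blast
qed

lemma besov_pointwise:
  fixes T :: "'a::euclidean_space distr"
  assumes B: "besov_norm \<beta> T < \<infinity>" and t: "0 < t"
  shows "AE z in lborel. norm (T (\<lambda>y. complex_of_real (heat_kernel t (z - y)))) \<le> t powr (- \<beta> / 2) * enn2real (besov_norm \<beta> T)"
proof -
  let ?f = "\<lambda>z. ennreal (norm (convolve (heat_kernel t) T z))"
  let ?B = "enn2real (besov_norm \<beta> T)"
  have BB: "besov_norm \<beta> T = ennreal ?B" using B by (simp add: less_top)
  have "ennreal (t powr (\<beta> / 2)) * esssup lebesgue ?f \<le> besov_norm \<beta> T"
    unfolding besov_norm_def using t by (intro SUP_upper2[of t]) auto
  then have le: "ennreal (t powr (\<beta> / 2)) * esssup lebesgue ?f \<le> ennreal ?B" using BB by simp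
  have "AE z in lebesgue. ?f z \<le> esssup lebesgue ?f" by (rule esssup_AE)
  then have "AE z in lborel. ?f z \<le> esssup lebesgue ?f" by (simp add: AE_completion_iff)
  then show ?thesis
  proof eventually_elim
    case (elim z)
    have "ennreal (t powr (\<beta> / 2) * norm (convolve (heat_kernel t) T z)) = ennreal (t powr (\<beta> / 2)) * ?f z"
      by (rule ennreal_mult) auto
    also have "\<dots> \<le> ennreal ?B" using elim le by (meson mult_left_mono order_trans zero_le)
    finally have "t powr (\<beta> / 2) * norm (convolve (heat_kernel t) T z) \<le> ?B" by simp
    then have "t powr (- (\<beta> / 2)) * (t powr (\<beta> / 2) * norm (convolve (heat_kernel t) T z)) \<le> t powr (- (\<beta> / 2)) * ?B"
      by (intro mult_left_mono) auto
    moreover have "t powr (- (\<beta> / 2)) * (t powr (\<beta> / 2) * c) = c" for c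
      using t by (simp add: powr_minus)
    ultimately show ?case by (simp add: convolve_def)
  qed
qed

lemma conv_shift:
  assumes [measurable]: "w \<in> borel_measurable borel" "k \<in> borel_measurable borel"
  shows "conv w k (y - x) = conv (\<lambda>z. w (z - x)) k y"
  unfolding conv_def
  using integral_translate[of "\<lambda>z. w z * k (y - x - z)" x] by (simp add: algebra_simps)

lemma integral_norm_dilate:
  assumes [measurable]: "(f::'a::euclidean_space \<Rightarrow> complex) \<in> borel_measurable borel" and c: "0 < c"
  shows "(\<integral>y. norm (complex_of_real (c ^ DIM('a)) * f (c *\<^sub>R y)) \<partial>lborel) = (\<integral>y. norm (f y) \<partial>lborel)"
proof -
  have "(\<integral>y. norm (f (0 + c *\<^sub>R y)) \<partial>lborel) = (1 / \<bar>c\<bar> ^ DIM('a)) *\<^sub>R (\<integral>y. norm (f y) \<partial>lborel)"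
    using c by (intro lborel_integral_affine(2)) auto
  then show ?thesis using c by (simp add: norm_mult norm_power)
qed

text \<open>The multiplier \<open>m\<close> is written as the heat multiplier times the test function
  \<open>m \<xi> * exp ((norm \<xi>)\<^sup>2)\<close>.\<close>

lemma band_besov:
  fixes m :: "'a::euclidean_space \<Rightarrow> complex"
  assumes m: "m \<in> test_functions"
  shows "\<exists>A>0. \<forall>T \<beta> j x. T \<in> tempered \<longrightarrow> besov_norm \<beta> T < \<infinity> \<longrightarrow>
    norm (T (\<lambda>y. fourier (\<lambda>\<xi>. m ((1 / pw j) *\<^sub>R \<xi>)) (y - x))) \<le> A * pw j powr \<beta> * enn2real (besov_norm \<beta> T)"
proof -
  let ?m = "\<lambda>\<xi>. m \<xi> * complex_of_real (exp (1 * (norm \<xi>)\<^sup>2))"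
  have mt: "?m \<in> test_functions" by (intro test_mult m smooth_gauss)
  have mb: "?m \<in> borel_measurable borel" by (rule smooth_borel[OF test_smooth[OF mt]])
  define A where "A = (\<integral>y. norm (fourier ?m y) \<partial>lborel)"
  have A0: "0 \<le> A" unfolding A_def by (rule Bochner_Integration.integral_nonneg) simp
  have "norm (T (\<lambda>y. fourier (\<lambda>\<xi>. m ((1 / pw j) *\<^sub>R \<xi>)) (y - x))) \<le> (A + 1) * pw j powr \<beta> * enn2real (besov_norm \<beta> T)"
    if T: "T \<in> tempered" and B: "besov_norm \<beta> T < \<infinity>" for T \<beta> j and x :: 'a
  proof -
    define c where "c = pw j"
    have c: "0 < c" by (simp add: c_def)
    \<comment> \<open>At this time the heat multiplier is comparable to 1 at frequencies of size
      \<open>c\<close>, and the Besov factor \<open>t powr (- \<beta> / 2)\<close> becomes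
      \<open>c powr \<beta>\<close>.\<close>
    define t where "t = 1 / c\<^sup>2"
    have t: "0 < t" using c by (simp add: t_def)
    let ?mc = "\<lambda>\<xi>. ?m ((1 / c) *\<^sub>R \<xi>)"
    let ?h = "\<lambda>z. complex_of_real (heat_kernel t z)"
    let ?B = "enn2real (besov_norm \<beta> T)"
    have ms: "?mc \<in> schwartz" using schwartz_dilate[OF test_schwartz[OF mt], of "1 / c"] c by simp
    define w where "w = fourier ?mc"
    have ws: "w \<in> schwartz" unfolding w_def by (rule fourier_schwartz[OF ms])
    have wx: "(\<lambda>z. w (z - x)) \<in> schwartz" by (rule schwartz_translate[OF ws])
    have hs: "?h \<in> schwartz" by (rule schwartz_heat_kernel[OF t])
    have mc: "(\<lambda>\<xi>. ?mc \<xi> * complex_of_real (exp (- t * (norm \<xi>)\<^sup>2))) = (\<lambda>\<xi>. m ((1 / c) *\<^sub>R \<xi>))"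
    proof
      fix \<xi> :: 'a
      have e: "1 * (norm ((1 / c) *\<^sub>R \<xi>))\<^sup>2 = t * (norm \<xi>)\<^sup>2" using c by (simp add: t_def power_divide)
      show "?mc \<xi> * complex_of_real (exp (- t * (norm \<xi>)\<^sup>2)) = m ((1 / c) *\<^sub>R \<xi>)" unfolding e mult.assoc of_real_mult[symmetric] exp_add[symmetric] by simp
    qed
    have "fourier (\<lambda>\<xi>. m ((1 / c) *\<^sub>R \<xi>)) = conv w ?h"
      using fourier_gauss_mult[OF t schwartz_integrable[OF ms]] unfolding w_def mc .
    then have "T (\<lambda>y. fourier (\<lambda>\<xi>. m ((1 / c) *\<^sub>R \<xi>)) (y - x)) = T (conv (\<lambda>z. w (z - x)) ?h)"
      by (simp add: conv_shift schwartz_borel[OF ws] cong: arg_cong[where f=T])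
    also have "\<dots> = (\<integral>z. w (z - x) * T (\<lambda>y. ?h (y - z)) \<partial>lborel)"
      by (rule tempered_conv(2)[OF T rapid_schwartz[OF wx] hs])
    also have "norm \<dots> \<le> (\<integral>z. norm (w (z - x)) * (t powr (- \<beta> / 2) * ?B) \<partial>lborel)"
    proof (rule order_trans[OF integral_norm_bound], rule integral_mono_AE)
      show "integrable lborel (\<lambda>z. norm (w (z - x) * T (\<lambda>y. ?h (y - z))))"
        by (rule integrable_norm[OF tempered_conv(1)[OF T rapid_schwartz[OF wx] hs]])
      show "integrable lborel (\<lambda>z. norm (w (z - x)) * (t powr (- \<beta> / 2) * ?B))"
        by (intro integrable_mult_left integrable_norm schwartz_integrable[OF wx])
      show "AE z in lborel. norm (w (z - x) * T (\<lambda>y. ?h (y - z))) \<le> norm (w (z - x)) * (t powr (- \<beta> / 2) * ?B)"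
        using besov_pointwise[OF B t]
      proof eventually_elim
        case (elim z)
        have "heat_kernel t (y - z) = heat_kernel t (z - y)" for y using heat_kernel_even[of t "z - y"] by simp
        then show ?case using elim unfolding norm_mult by (intro mult_left_mono) auto
      qed
    qed
    also have "\<dots> = (\<integral>z. norm (w (z - x)) \<partial>lborel) * (t powr (- \<beta> / 2) * ?B)" by simp
    also have "(\<integral>z. norm (w (z - x)) \<partial>lborel) = (\<integral>z. norm (w z) \<partial>lborel)"
      using schwartz_borel[OF ws] by (intro integral_translate[of "\<lambda>z. norm (w z)"]) measurable
    \<comment> \<open>The dilation preserves the integral of the norm, hence a constant that does
      not depend on \<open>j\<close>.\<close>
    also have "\<dots> = A"
      unfolding w_def A_def fourier_dilate[OF mb c]
      by (rule integral_norm_dilate[OF schwartz_borel[OF fourier_test_schwartz[OF mt]] c])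
    also have "t powr (- \<beta> / 2) = c powr \<beta>"
    proof -
      have "t = c powr (- 2)" using c by (simp add: t_def powr_minus_divide)
      then show ?thesis by (simp add: powr_powr)
    qed
    also have "A * (c powr \<beta> * ?B) \<le> (A + 1) * (c powr \<beta> * ?B)" using A0 by (intro mult_right_mono) auto
    finally show ?thesis unfolding c_def by (simp only: mult.assoc)
  qed
  moreover have "0 < A + 1" using A0 by simp
  ultimately show ?thesis by blast
qed

lemma fourier_modulate:
  assumes [measurable]: "m \<in> borel_measurable borel"
  shows "fourier (\<lambda>\<xi>. exp (\<i> * complex_of_real (\<xi> \<bullet> x)) * m \<xi>) y = fourier m (y - x)"
proof -
  have eq: "exp (- \<i> * complex_of_real (\<xi> \<bullet> y)) * (exp (\<i> * complex_of_real (\<xi> \<bullet> x)) * m \<xi>)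
      = exp (- \<i> * complex_of_real (\<xi> \<bullet> (y - x))) * m \<xi>" for \<xi>
    unfolding mult.assoc[symmetric] exp_add[symmetric] by (simp add: inner_diff_right algebra_simps)
  have "fourier (\<lambda>\<xi>. exp (\<i> * complex_of_real (\<xi> \<bullet> x)) * m \<xi>) y
    = (\<integral>\<xi>. exp (- \<i> * complex_of_real (\<xi> \<bullet> y)) * (exp (\<i> * complex_of_real (\<xi> \<bullet> x)) * m \<xi>) \<partial>lborel)"
    by (rule fourier_lborel) measurable
  also have "\<dots> = fourier m (y - x)" unfolding eq by (rule fourier_lborel[symmetric]) measurable
  finally show ?thesis .
qed

lemma smooth_cis: "smooth (\<lambda>x. exp (\<i> * complex_of_real (x \<bullet> \<xi>)))"
  using moderate_cis unfolding moderate_family_def by blast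

text \<open>Translation of the kernel is modulation in frequency, so the translated kernel is the
  transform of a test function. This function vanishes near the origin, which is where the defining
  identity of the fractional Laplacian may be used.\<close>

lemma frac_laplacian_band:
  fixes T U :: "'a::euclidean_space distr"
  assumes F: "frac_laplacian s T U"
  shows "T (\<lambda>y. fourier (band a j) (y - x)) = U (\<lambda>y. fourier (band (a - s) j) (y - x))"
proof -
  let ?e = "\<lambda>\<xi>. exp (\<i> * complex_of_real (\<xi> \<bullet> x))"
  let ?\<psi> = "\<lambda>\<xi>. ?e \<xi> * band (a - s) j \<xi>"
  have test: "?\<psi> \<in> test_functions" by (rule test_mult'[OF band_test smooth_cis])
  have b[measurable]: "(band a j :: 'a \<Rightarrow> complex) \<in> borel_measurable borel" for a
    by (rule smooth_borel[OF test_smooth[OF band_test]])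
  have "closure {\<xi>. ?\<psi> \<xi> \<noteq> 0} \<subseteq> - ball 0 (pw j)"
    by (rule closure_minimal) (auto simp: band_def ring_0 dist_norm not_less intro!: ccontr[of "pw j \<le> _"])
  then have "0 \<notin> closure {\<xi>. ?\<psi> \<xi> \<noteq> 0}" by auto
  then have "fourier_distr U ?\<psi> = fourier_distr T (\<lambda>\<xi>. complex_of_real (norm \<xi> powr s) * ?\<psi> \<xi>)"
    by (rule F[unfolded frac_laplacian_def, THEN conjunct2, THEN conjunct2, THEN bspec, OF test, THEN mp])
  moreover have "complex_of_real (norm \<xi> powr s) * ?\<psi> \<xi> = ?e \<xi> * band a j \<xi>" for \<xi>
  proof -
    have "norm \<xi> powr s * norm \<xi> powr (a - s) = norm \<xi> powr a" by (simp flip: powr_add)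
    then have "complex_of_real (norm \<xi> powr s) * complex_of_real (norm \<xi> powr (a - s)) = complex_of_real (norm \<xi> powr a)"
      by (simp only: of_real_mult[symmetric])
    then show ?thesis unfolding band_def by (simp only: mult_ac) (simp only: mult.assoc[symmetric])
  qed
  ultimately show ?thesis
    unfolding fourier_distr_def by (simp add: fourier_modulate[OF b, abs_def])
qed

section \<open>Summation of two competing geometric bounds\<close>

lemma sum_power_abs_le:
  fixes x :: real
  assumes x: "0 < x" "x < 1" and F: "finite (F :: int set)"
  shows "(\<Sum>j\<in>F. x ^ nat \<bar>j - m\<bar>) \<le> 2 / (1 - x)"
proof -
  have geo: "(\<Sum>i\<in>I. x ^ i) \<le> 1 / (1 - x)" if "finite I" for I
    using sum_le_suminf[OF summable_geometric[of x] that] x by (simp add: suminf_geometric)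
  have half: "(\<Sum>j\<in>G. x ^ nat \<bar>j - m\<bar>) \<le> 1 / (1 - x)" if "finite G" "inj_on (\<lambda>j. nat \<bar>j - m\<bar>) G" for G
    using geo[of "(\<lambda>j. nat \<bar>j - m\<bar>) ` G"] that by (simp add: sum.reindex)
  have "(\<Sum>j\<in>F. x ^ nat \<bar>j - m\<bar>) = (\<Sum>j\<in>{j\<in>F. m \<le> j}. x ^ nat \<bar>j - m\<bar>) + (\<Sum>j\<in>{j\<in>F. j < m}. x ^ nat \<bar>j - m\<bar>)"
    using F by (subst sum.union_disjoint[symmetric]) (auto intro!: sum.cong)
  also have "\<dots> \<le> 1 / (1 - x) + 1 / (1 - x)"
    using F by (intro add_mono half) (auto simp: inj_on_def)
  finally show ?thesis by simp
qed

text \<open>The two bounds cross over at \<open>pw j = (a / b) powr (1 / (\<sigma> + \<tau>))\<close>, and decay geometrically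
  away from the crossing.\<close>

lemma sum_min_le:
  fixes \<sigma> \<tau> :: real
  assumes st: "0 < \<sigma>" "0 < \<tau>"
  shows "\<exists>K>0. \<forall>a b F. 0 \<le> a \<longrightarrow> 0 \<le> b \<longrightarrow> finite F \<longrightarrow>
    (\<Sum>j\<in>F. min (a * pw j powr (- \<sigma>)) (b * pw j powr \<tau>)) \<le> K * (a powr (1 - \<sigma> / (\<sigma> + \<tau>)) * b powr (\<sigma> / (\<sigma> + \<tau>)))"
proof -
  define \<rho> where "\<rho> = min \<sigma> \<tau>"
  have rho: "0 < \<rho>" "\<rho> \<le> \<sigma>" "\<rho> \<le> \<tau>" using st by (auto simp: \<rho>_def)
  define x where "x = 2 powr (- \<rho>)"
  have x: "0 < x" "x < 1" using rho by (auto simp: x_def powr_less_one)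
  define K where "K = 2 powr \<rho> * (2 / (1 - x))"
  have K: "0 < K" using x by (simp add: K_def)
  have "(\<Sum>j\<in>F. min (a * pw j powr (- \<sigma>)) (b * pw j powr \<tau>)) \<le> K * (a powr (1 - \<sigma> / (\<sigma> + \<tau>)) * b powr (\<sigma> / (\<sigma> + \<tau>)))"
    if ab: "0 \<le> a" "0 \<le> b" and F: "finite F" for a b F
  proof (cases "a = 0 \<or> b = 0")
    case True
    then have "min (a * pw j powr (- \<sigma>)) (b * pw j powr \<tau>) \<le> 0" for j by auto
    then have "(\<Sum>j\<in>F. min (a * pw j powr (- \<sigma>)) (b * pw j powr \<tau>)) \<le> 0" by (intro sum_nonpos) auto
    then show ?thesis using True by auto
  next
    case False
    then have ab: "0 < a" "0 < b" using ab by auto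
    \<comment> \<open>The common value of both bounds at the real crossing point \<open>l\<close>
      defined next. Relative to \<open>D\<close> the bounds are powers of 2 in the signed distance
      to \<open>l\<close>.\<close>
    define D where "D = a powr (1 - \<sigma> / (\<sigma> + \<tau>)) * b powr (\<sigma> / (\<sigma> + \<tau>))"
    have D: "0 < D" using ab by (simp add: D_def)
    define l where "l = log 2 (a / b) / (\<sigma> + \<tau>)"
    have l2: "2 powr l = (a / b) powr (1 / (\<sigma> + \<tau>))"
      using ab by (simp add: l_def powr_def log_def)
    have Da: "a = D * 2 powr (l * \<sigma>)"
    proof -
      have "2 powr (l * \<sigma>) = (a / b) powr (\<sigma> / (\<sigma> + \<tau>))" by (simp add: l2 powr_powr[symmetric]) (simp add: powr_powr)
      also have "\<dots> = a powr (\<sigma> / (\<sigma> + \<tau>)) / b powr (\<sigma> / (\<sigma> + \<tau>))" by (rule powr_divide)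
      finally have "D * 2 powr (l * \<sigma>) = a powr (1 - \<sigma> / (\<sigma> + \<tau>)) * a powr (\<sigma> / (\<sigma> + \<tau>))" using ab by (simp add: D_def)
      also have "\<dots> = a powr 1" by (simp only: powr_add[symmetric]) simp
      finally show ?thesis using ab by simp
    qed
    have Db: "b = D * 2 powr (- (l * \<tau>))"
    proof -
      have e: "\<tau> / (\<sigma> + \<tau>) = 1 - \<sigma> / (\<sigma> + \<tau>)" using st by (simp add: field_simps)
      have "2 powr (l * \<tau>) = (a / b) powr (\<tau> / (\<sigma> + \<tau>))" by (simp add: l2 powr_powr[symmetric]) (simp add: powr_powr)
      also have "\<dots> = a powr (1 - \<sigma> / (\<sigma> + \<tau>)) / b powr (1 - \<sigma> / (\<sigma> + \<tau>))" unfolding e by (rule powr_divide)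
      finally have "b * 2 powr (l * \<tau>) = b powr 1 * (a powr (1 - \<sigma> / (\<sigma> + \<tau>)) / b powr (1 - \<sigma> / (\<sigma> + \<tau>)))" using ab by simp
      also have "b powr 1 = b powr (1 - \<sigma> / (\<sigma> + \<tau>)) * b powr (\<sigma> / (\<sigma> + \<tau>))" by (simp only: powr_add[symmetric]) simp
      finally have "b * 2 powr (l * \<tau>) = D" using ab by (simp add: D_def)
      then have "D * 2 powr (- (l * \<tau>)) = b * (2 powr (l * \<tau>) * 2 powr (- (l * \<tau>)))" by (simp only: mult.assoc[symmetric])
      then show ?thesis by (simp only: powr_add[symmetric]) simp
    qed
    have "min (a * pw j powr (- \<sigma>)) (b * pw j powr \<tau>) \<le> D * 2 powr \<rho> * x ^ nat \<bar>j - \<lfloor>l\<rfloor>\<bar>" for j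
    proof -
      have 1: "a * pw j powr (- \<sigma>) = D * 2 powr (- \<sigma> * (real_of_int j - l))"
      proof -
        have e: "2 powr (l * \<sigma>) * pw j powr (- \<sigma>) = 2 powr (- \<sigma> * (real_of_int j - l))"
          unfolding powr_powr powr_add[symmetric] by (simp add: algebra_simps)
        show ?thesis by (subst Da) (simp only: mult.assoc e)
      qed
      have 2: "b * pw j powr \<tau> = D * 2 powr (\<tau> * (real_of_int j - l))"
      proof -
        have e: "2 powr (- (l * \<tau>)) * pw j powr \<tau> = 2 powr (\<tau> * (real_of_int j - l))"
          unfolding powr_powr powr_add[symmetric] by (simp add: algebra_simps)
        show ?thesis by (subst Db) (simp only: mult.assoc e)
      qed
      have "min (a * pw j powr (- \<sigma>)) (b * pw j powr \<tau>) \<le> D * 2 powr (- \<rho> * \<bar>real_of_int j - l\<bar>)"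
      proof (cases "l \<le> real_of_int j")
        case True
        have "- \<sigma> * (real_of_int j - l) \<le> - \<rho> * \<bar>real_of_int j - l\<bar>" using True rho by (simp add: mult_right_mono)
        then have "D * 2 powr (- \<sigma> * (real_of_int j - l)) \<le> D * 2 powr (- \<rho> * \<bar>real_of_int j - l\<bar>)"
          using D by (intro mult_left_mono powr_mono) auto
        then show ?thesis unfolding 1 by (rule min.coboundedI1)
      next
        case False
        have "\<tau> * (real_of_int j - l) \<le> \<rho> * (real_of_int j - l)" using False rho by (intro mult_right_mono_neg) auto
        then have "\<tau> * (real_of_int j - l) \<le> - \<rho> * \<bar>real_of_int j - l\<bar>" using False by (simp add: algebra_simps)
        then have "D * 2 powr (\<tau> * (real_of_int j - l)) \<le> D * 2 powr (- \<rho> * \<bar>real_of_int j - l\<bar>)"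
          using D by (intro mult_left_mono powr_mono) auto
        then show ?thesis unfolding 2 by (rule min.coboundedI2)
      qed
      \<comment> \<open>Rounding \<open>l\<close> to an integer changes distances by at most 1,
        hence the factor \<open>2 powr \<rho>\<close>.\<close>
      also have "\<dots> \<le> D * 2 powr (\<rho> - \<rho> * \<bar>real_of_int (j - \<lfloor>l\<rfloor>)\<bar>)"
      proof (intro mult_left_mono powr_mono)
        have "\<bar>real_of_int (j - \<lfloor>l\<rfloor>)\<bar> \<le> 1 + \<bar>real_of_int j - l\<bar>" by linarith
        then have "\<rho> * \<bar>real_of_int (j - \<lfloor>l\<rfloor>)\<bar> \<le> \<rho> * (1 + \<bar>real_of_int j - l\<bar>)" using rho by (intro mult_left_mono) auto
        then show "- \<rho> * \<bar>real_of_int j - l\<bar> \<le> \<rho> - \<rho> * \<bar>real_of_int (j - \<lfloor>l\<rfloor>)\<bar>" by (simp add: distrib_left)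
      qed (use D in auto)
      also have "2 powr (\<rho> - \<rho> * \<bar>real_of_int (j - \<lfloor>l\<rfloor>)\<bar>) = 2 powr \<rho> * x ^ nat \<bar>j - \<lfloor>l\<rfloor>\<bar>"
      proof -
        have "x ^ nat \<bar>j - \<lfloor>l\<rfloor>\<bar> = x powr real (nat \<bar>j - \<lfloor>l\<rfloor>\<bar>)" using x(1) by (rule powr_realpow[symmetric])
        also have "real (nat \<bar>j - \<lfloor>l\<rfloor>\<bar>) = \<bar>real_of_int (j - \<lfloor>l\<rfloor>)\<bar>" by simp
        also have "x powr \<bar>real_of_int (j - \<lfloor>l\<rfloor>)\<bar> = 2 powr (- \<rho> * \<bar>real_of_int (j - \<lfloor>l\<rfloor>)\<bar>)" unfolding x_def by (rule powr_powr)
        finally show ?thesis by (simp only: powr_add[symmetric]) simp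
      qed
      finally show ?thesis by (simp only: mult.assoc)
    qed
    then have "(\<Sum>j\<in>F. min (a * pw j powr (- \<sigma>)) (b * pw j powr \<tau>)) \<le> (\<Sum>j\<in>F. D * 2 powr \<rho> * x ^ nat \<bar>j - \<lfloor>l\<rfloor>\<bar>)"
      by (rule sum_mono)
    also have "\<dots> = D * 2 powr \<rho> * (\<Sum>j\<in>F. x ^ nat \<bar>j - \<lfloor>l\<rfloor>\<bar>)" by (rule sum_distrib_left[symmetric])
    also have "\<dots> \<le> D * 2 powr \<rho> * (2 / (1 - x))" using D by (intro mult_left_mono sum_power_abs_le x F) auto
    finally show ?thesis by (simp add: K_def D_def mult_ac)
  qed
  with K show ?thesis by blast
qed

section \<open>Multipliers on the frequency side and dyadic truncation\<close>

lemma fourier_reflect_fourier: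
  fixes f :: "'a::euclidean_space \<Rightarrow> complex"
  assumes f: "f \<in> schwartz"
  shows "fourier (\<lambda>\<xi>. fourier f (- \<xi>)) y = complex_of_real ((2 * pi) ^ DIM('a)) * f y"
proof -
  have [measurable]: "fourier f \<in> borel_measurable borel" by (rule schwartz_borel[OF fourier_schwartz[OF f]])
  have "fourier (\<lambda>\<xi>. fourier f (- \<xi>)) y = (\<integral>\<xi>. exp (- \<i> * complex_of_real (\<xi> \<bullet> y)) * fourier f (- \<xi>) \<partial>lborel)"
    by (rule fourier_lborel) measurable
  also have "\<dots> = (\<integral>\<xi>. exp (- \<i> * complex_of_real ((0 - \<xi>) \<bullet> y)) * fourier f (- (0 - \<xi>)) \<partial>lborel)"
    by (rule integral_reflect[symmetric]) measurable
  finally show ?thesis using fourier_inversion[OF f, of y] by simp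
qed

lemma fourier_surj:
  fixes f :: "'a::euclidean_space \<Rightarrow> complex"
  assumes f: "f \<in> schwartz"
  obtains \<psi> where "\<psi> \<in> schwartz" "fourier \<psi> = f"
proof -
  let ?c = "complex_of_real (1 / (2 * pi) ^ DIM('a))"
  have R: "(\<lambda>\<xi>. fourier f (- \<xi>)) \<in> schwartz" using schwartz_reflect[OF fourier_schwartz[OF f], of 0] by simp
  have "fourier (\<lambda>\<xi>. ?c * fourier f (- \<xi>)) = f"
    by (intro ext) (simp only: fourier_cmult fourier_reflect_fourier[OF f], simp)
  then show ?thesis using that schwartz_cmult[OF R, of ?c] by blast
qed

lemma fourier_sum:
  assumes "\<And>i. i \<in> I \<Longrightarrow> integrable lborel (f i)"
  shows "fourier (\<lambda>x. \<Sum>i\<in>I. f i x) y = (\<Sum>i\<in>I. fourier (f i) y)"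
proof (cases "finite I")
  case True
  have [measurable]: "f i \<in> borel_measurable borel" if "i \<in> I" for i using assms[OF that] by auto
  have int: "integrable lborel (\<lambda>x. exp (- \<i> * complex_of_real (x \<bullet> y)) * f i x)" if "i \<in> I" for i
    by (rule Bochner_Integration.integrable_bound[OF assms[OF that]])
       (use that in \<open>auto simp: norm_mult simp del: mult_minus_left\<close>)
  have "fourier (\<lambda>x. \<Sum>i\<in>I. f i x) y = (\<integral>x. (\<Sum>i\<in>I. exp (- \<i> * complex_of_real (x \<bullet> y)) * f i x) \<partial>lborel)"
    unfolding sum_distrib_left[symmetric] by (rule fourier_lborel) measurable
  also have "\<dots> = (\<Sum>i\<in>I. \<integral>x. exp (- \<i> * complex_of_real (x \<bullet> y)) * f i x \<partial>lborel)"
    by (rule Bochner_Integration.integral_sum[OF int])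
  also have "\<dots> = (\<Sum>i\<in>I. fourier (f i) y)" by (intro sum.cong refl fourier_lborel[symmetric]) auto
  finally show ?thesis .
qed (simp add: fourier_def)

text \<open>The bridge between the functions
  \<open>x \<mapsto> T (\<lambda>y. fourier m (y - x))\<close>, which are estimated pointwise, and
  the distribution \<open>T\<close> with its frequencies multiplied by \<open>m\<close>. The
  constant is that of Fourier inversion.\<close>

lemma tempered_fourier_band:
  fixes T :: "'a::euclidean_space distr"
  assumes T: "T \<in> tempered" and \<psi>: "\<psi> \<in> schwartz" and m: "m \<in> schwartz"
  shows "T (fourier (\<lambda>\<xi>. m \<xi> * \<psi> \<xi>))
    = complex_of_real (1 / (2 * pi) ^ DIM('a)) * (\<integral>x. fourier \<psi> x * T (\<lambda>y. fourier m (y - x)) \<partial>lborel)"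
proof -
  let ?c = "complex_of_real ((2 * pi) ^ DIM('a))"
  have mp: "(\<lambda>\<xi>. m \<xi> * \<psi> \<xi>) \<in> schwartz"
  proof (rule schwartz_mult[OF m])
    show "moderate \<psi>"
      unfolding moderate_family_def
    proof (intro conjI allI ballI)
      fix bs :: "'a list" assume "bs \<in> lists Basis"
      from schwartz_bound[OF \<psi> this, of 0] obtain C where "\<And>x. norm (iter_deriv bs \<psi> x) \<le> C" by auto
      then show "\<exists>N C. \<forall>(i::unit) x. norm (iter_deriv bs \<psi> x) \<le> C * (1 + norm x) ^ N"
        by (intro exI[of _ 0] exI[of _ C]) simp
    qed (rule schwartz_smooth[OF \<psi>])
  qed
  have "(\<integral>x. fourier \<psi> x * T (\<lambda>y. fourier m (y - x)) \<partial>lborel) = T (conv (fourier \<psi>) (fourier m))"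
    by (rule tempered_conv(2)[OF T rapid_schwartz[OF fourier_schwartz[OF \<psi>]] fourier_schwartz[OF m], symmetric])
  also have "\<dots> = T (\<lambda>y. ?c * fourier (\<lambda>\<xi>. m \<xi> * \<psi> \<xi>) y)"
    unfolding conv_fourier_fourier[OF m \<psi>] fourier_cmult ..
  also have "\<dots> = ?c * T (fourier (\<lambda>\<xi>. m \<xi> * \<psi> \<xi>))"
    by (rule tempered_cmult[OF T fourier_schwartz[OF mp]])
  finally show ?thesis by (simp add: field_simps)
qed

lemma fourier_diff:
  assumes "integrable lborel u" "integrable lborel v"
  shows "fourier (\<lambda>x. u x - v x) y = fourier u y - fourier v y"
proof -
  have "fourier (\<lambda>x. \<Sum>i\<in>{True, False}. if i then u x else (-1) * v x) y
    = (\<Sum>i\<in>{True, False}. fourier (\<lambda>x. if i then u x else (-1) * v x) y)"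
  proof (rule fourier_sum)
    show "integrable lborel (\<lambda>x. if i then u x else (-1) * v x)" for i
      using assms by (cases i) simp_all
  qed
  then show ?thesis using fourier_cmult[of "-1" v y] by simp
qed

lemma test_annulus:
  assumes "\<psi> \<in> test_functions" "0 \<notin> closure {\<xi>. \<psi> \<xi> \<noteq> 0}"
  obtains r R where "0 < r" "0 < R" "\<And>\<xi>. norm \<xi> < r \<Longrightarrow> \<psi> \<xi> = 0" "\<And>\<xi>. R < norm \<xi> \<Longrightarrow> \<psi> \<xi> = 0"
proof -
  have "open (- closure {\<xi>. \<psi> \<xi> \<noteq> 0})" by (rule open_Compl[OF closed_closure])
  then obtain r where r: "0 < r" "ball 0 r \<subseteq> - closure {\<xi>. \<psi> \<xi> \<noteq> 0}"
    using assms(2) open_contains_ball by blast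
  have "\<psi> \<xi> = 0" if "norm \<xi> < r" for \<xi>
    using r(2) that closure_subset[of "{\<xi>. \<psi> \<xi> \<noteq> 0}"] by (auto simp: subset_iff)
  moreover have "bounded (closure {\<xi>. \<psi> \<xi> \<noteq> 0})"
    using assms(1) by (simp add: test_functions_def compact_imp_bounded)
  then obtain R where R: "0 < R" "\<And>\<xi>. \<xi> \<in> closure {\<xi>. \<psi> \<xi> \<noteq> 0} \<Longrightarrow> norm \<xi> \<le> R"
    unfolding bounded_pos by blast
  have "\<psi> \<xi> = 0" if "R < norm \<xi>" for \<xi>
    using R(2)[of \<xi>] that closure_subset[of "{\<xi>. \<psi> \<xi> \<noteq> 0}"] by (auto simp: subset_iff not_le)
  ultimately show ?thesis using that r(1) R(1) by blast
qed

lemma cutoff_large: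
  "\<exists>J0. \<forall>J\<ge>J0. \<forall>\<xi>. norm \<xi> \<le> R \<longrightarrow> cutoff ((1 / pw (int J)) *\<^sub>R \<xi>) = 1"
proof -
  obtain J0 where J0: "R < 2 ^ J0" using real_arch_pow[of 2 R] by auto
  have "cutoff ((1 / pw (int J)) *\<^sub>R \<xi>) = 1" if "J0 \<le> J" "norm \<xi> \<le> R" for J and \<xi> :: 'a
  proof (rule cutoff_1)
    have "norm \<xi> \<le> 2 ^ J" using that(2) J0 power_increasing[OF that(1), of "2::real"] by linarith
    then show "norm ((1 / pw (int J)) *\<^sub>R \<xi>) \<le> 1" by (simp add: powr_realpow)
  qed
  then show ?thesis by blast
qed

lemma cutoff_small:
  assumes "0 < r"
  shows "\<exists>J0. \<forall>J\<ge>J0. \<forall>\<xi>. r \<le> norm \<xi> \<longrightarrow> cutoff ((1 / pw (- int J)) *\<^sub>R \<xi>) = 0"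
proof -
  obtain J0 where J0: "2 / r < 2 ^ J0" using real_arch_pow[of 2 "2 / r"] by auto
  have "cutoff ((1 / pw (- int J)) *\<^sub>R \<xi>) = 0" if "J0 \<le> J" "r \<le> norm \<xi>" for J and \<xi> :: 'a
  proof (rule cutoff_0)
    have "2 / r \<le> 2 ^ J" using J0 power_increasing[OF that(1), of "2::real"] by linarith
    then have "2 \<le> 2 ^ J * r" using assms by (simp add: pos_divide_le_eq)
    also have "\<dots> \<le> 2 ^ J * norm \<xi>" using that by (intro mult_left_mono) auto
    finally show "2 \<le> norm ((1 / pw (- int J)) *\<^sub>R \<xi>)" by (simp add: powr_minus powr_realpow divide_inverse mult.commute)
  qed
  then show ?thesis by blast
qed

lemma band_sum:
  "(\<Sum>j\<in>{- int J..<int J}. band a j \<xi>) = complex_of_real (norm \<xi> powr a) * (cutoff ((1 / pw (int J)) *\<^sub>R \<xi>) - cutoff ((1 / pw (- int J)) *\<^sub>R \<xi>))"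
  unfolding band_def sum_distrib_left[symmetric] ring_sum ..

text \<open>On such multipliers every real power of the norm acts smoothly, so fractional Laplacians
  can be applied and inverted.\<close>

definition annular :: "('a::euclidean_space \<Rightarrow> complex) \<Rightarrow> bool" where
  "annular \<omega> \<longleftrightarrow> \<omega> \<in> test_functions \<and> (\<exists>r>0. \<forall>\<xi>. norm \<xi> < r \<longrightarrow> \<omega> \<xi> = 0)"

lemma annular_cmult:
  assumes "annular \<omega>" shows "annular (\<lambda>\<xi>. c * \<omega> \<xi>)"
  using assms test_mult'[of \<omega> "\<lambda>_. c"] unfolding annular_def by auto

lemma annular_band_sum: "annular (\<lambda>\<xi>::'a::euclidean_space. \<Sum>j\<in>{- int J..<int J}. band a j \<xi>)"
proof -
  have v: "(\<Sum>j\<in>{- int J..<int J}. band a j \<xi>) = 0" if "norm \<xi> < pw (- int J)" for \<xi> :: 'a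
  proof -
    have "pw (- int J) \<le> pw (int J)" by (rule powr_mono) auto
    with that have "norm \<xi> \<le> pw (int J)" "norm \<xi> \<le> pw (- int J)" by linarith+
    then have "cutoff ((1 / pw (int J)) *\<^sub>R \<xi>) = 1" "cutoff ((1 / pw (- int J)) *\<^sub>R \<xi>) = 1"
      by (auto intro!: cutoff_1 simp: pos_divide_le_eq simp del: of_int_minus of_int_of_nat_eq)
    then show ?thesis unfolding band_sum by simp
  qed
  have "(\<lambda>\<xi>::'a. \<Sum>j\<in>{- int J..<int J}. band a j \<xi>) \<in> test_functions"
  proof (rule testI_bounded[where R="2 * pw (int J)"])
    show "smooth (\<lambda>\<xi>::'a. \<Sum>j\<in>{- int J..<int J}. band a j \<xi>)"
      by (intro smooth_sum schwartz_smooth test_schwartz band_test finite_atLeastLessThan_int)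
    fix \<xi> :: 'a assume *: "2 * pw (int J) \<le> norm \<xi>"
    have "pw (- int J) \<le> pw (int J)" by (rule powr_mono) auto
    with * have "2 * pw (- int J) \<le> norm \<xi>" by linarith
    with * have "cutoff ((1 / pw (int J)) *\<^sub>R \<xi>) = 0" "cutoff ((1 / pw (- int J)) *\<^sub>R \<xi>) = 0"
      by (auto intro!: cutoff_0 simp: pos_le_divide_eq simp del: of_int_minus of_int_of_nat_eq)
    then show "(\<Sum>j\<in>{- int J..<int J}. band a j \<xi>) = 0" unfolding band_sum by simp
  qed
  with v show ?thesis unfolding annular_def by (intro conjI exI[of _ "pw (- int J)"]) auto
qed

text \<open>The last clause pins \<open>h\<close> down for \<open>s = 0\<close>, where the preceding one leaves it undetermined up to
  a polynomial.\<close>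

definition littlewood_paley_limit ::
    "real \<Rightarrow> ('a::euclidean_space) distr \<Rightarrow> ('a \<Rightarrow> real) \<Rightarrow> ('a \<Rightarrow> complex) \<Rightarrow> (nat \<Rightarrow> 'a \<Rightarrow> complex) \<Rightarrow> bool" where
  "littlewood_paley_limit s T E h S \<longleftrightarrow> slow h \<and>
    (\<forall>J. \<exists>\<omega>. annular \<omega> \<and> S J = (\<lambda>x. T (\<lambda>y. fourier \<omega> (y - x)))) \<and>
    (AE x in lborel. (\<forall>J. norm (S J x) \<le> E x) \<and> (\<lambda>J. S J x) \<longlonglongrightarrow> h x) \<and>
    (\<forall>\<psi> \<in> test_functions. 0 \<notin> closure {\<xi>. \<psi> \<xi> \<noteq> 0} \<longrightarrow>
      (\<integral>x. h x * fourier \<psi> x \<partial>lborel) = T (fourier (\<lambda>\<xi>. complex_of_real (norm \<xi> powr s) * \<psi> \<xi>))) \<and>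
    (s = 0 \<longrightarrow> (\<forall>f \<in> schwartz. T f = (\<integral>x. h x * f x \<partial>lborel)))"

text \<open>At frequency \<open>2\<^sup>j\<close> the piece of \<open>T\<close> is at most \<open>2\<close> to the power \<open>- j (s - s1)\<close> times the
  maximal function, and at most \<open>2\<close> to the power \<open>j (s1 + \<beta>)\<close> times the Besov norm. Summing the
  smaller of the two bounds yields the geometric mean.\<close>

theorem littlewood_paley:
  fixes s s1 \<beta> \<theta> :: real
  assumes s1: "0 \<le> s1" "s1 < s" and \<beta>: "0 < \<beta>" and \<theta>: "\<theta> = (s - s1) / (\<beta> + s)"
  shows "\<exists>C>0. \<forall>(T :: 'a::euclidean_space distr) U g. T \<in> tempered \<longrightarrow> besov_norm \<beta> T < \<infinity> \<longrightarrow>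
    frac_laplacian s T U \<longrightarrow> slow g \<longrightarrow> (\<forall>f \<in> schwartz. U f = (\<integral>x. g x * f x \<partial>lborel)) \<longrightarrow>
    (AE x in lborel. maximal (\<lambda>y. ennreal (norm (g y))) x < \<infinity>) \<longrightarrow>
    slow (\<lambda>x. complex_of_real (enn2real (maximal (\<lambda>y. ennreal (norm (g y))) x) powr (1 - \<theta>))) \<longrightarrow>
    (\<exists>h S. littlewood_paley_limit s1 T (\<lambda>x. C * (enn2real (maximal (\<lambda>y. ennreal (norm (g y))) x) powr (1 - \<theta>) * enn2real (besov_norm \<beta> T) powr \<theta>)) h S)"
proof -
  let ?c = "complex_of_real (1 / (2 * pi) ^ DIM('a))"
  have nc: "norm ?c \<le> 1"
  proof -
    have "1 \<le> (2 * pi) ^ DIM('a)" using pi_gt3 by (intro one_le_power) auto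
    then show ?thesis unfolding norm_of_real by (simp add: divide_le_eq)
  qed
  define \<sigma> where "\<sigma> = s - s1"
  define \<tau> where "\<tau> = s1 + \<beta>"
  have st: "0 < \<sigma>" "0 < \<tau>" using s1 \<beta> by (auto simp: \<sigma>_def \<tau>_def)
  \<comment> \<open>The two rates add up to \<open>s + \<beta>\<close>, so the exponent produced by
    \<open>sum_min_le\<close> is exactly \<theta>.\<close>
  have th: "\<sigma> / (\<sigma> + \<tau>) = \<theta>" unfolding \<theta> \<sigma>_def \<tau>_def by (simp add: add.commute)
  obtain K where K: "0 < K" "\<And>a b F. 0 \<le> a \<Longrightarrow> 0 \<le> b \<Longrightarrow> finite F \<Longrightarrow>
    (\<Sum>j\<in>F. min (a * pw j powr (- \<sigma>)) (b * pw j powr \<tau>)) \<le> K * (a powr (1 - \<theta>) * b powr \<theta>)"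
    using sum_min_le[OF st] unfolding th by blast
  obtain A1 where A1: "0 < A1" "\<And>(T :: 'a distr) \<beta> j x. T \<in> tempered \<Longrightarrow> besov_norm \<beta> T < \<infinity> \<Longrightarrow>
    norm (T (\<lambda>y. fourier (\<lambda>\<xi>. band s1 0 ((1 / pw j) *\<^sub>R \<xi>)) (y - x))) \<le> A1 * pw j powr \<beta> * enn2real (besov_norm \<beta> T)"
    using band_besov[OF band_test[of s1 0, where 'a='a]] by blast
  \<comment> \<open>The factorisation through the heat semigroup does not require a multiplier
    vanishing at the origin. Applied to the whole low-frequency cutoff it is used for the case
    \<open>s1 = 0\<close>.\<close>
  obtain A0 where A0: "0 < A0" "\<And>(T :: 'a distr) \<beta> j x. T \<in> tempered \<Longrightarrow> besov_norm \<beta> T < \<infinity> \<Longrightarrow>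
    norm (T (\<lambda>y. fourier (\<lambda>\<xi>. cutoff ((1 / pw j) *\<^sub>R \<xi>)) (y - x))) \<le> A0 * pw j powr \<beta> * enn2real (besov_norm \<beta> T)"
    using band_besov[OF cutoff_test[where 'a='a]] by blast
  obtain A2 where A2: "0 < A2" "\<And>g j (x::'a). g \<in> borel_measurable borel \<Longrightarrow>
    ennreal (norm (\<integral>y. g y * fourier (band (s1 - s) j) (y - x) \<partial>lborel)) \<le> ennreal (A2 * pw j powr (s1 - s)) * maximal (\<lambda>y. ennreal (norm (g y))) x"
    using band_maximal[of "s1 - s", where 'a='a] by blast
  define A where "A = max A1 A2"
  have A: "0 < A" "A1 \<le> A" "A2 \<le> A" using A1(1) by (auto simp: A_def)
  have bs: "band s1 j \<in> schwartz" for j and s1 by (rule test_schwartz[OF band_test])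
  have fb: "fourier (band s1 j) \<in> schwartz" for j and s1 by (rule fourier_test_schwartz[OF band_test])
  have main: "\<exists>h S. littlewood_paley_limit s1 T (\<lambda>x. (A * K) * (enn2real (maximal (\<lambda>y. ennreal (norm (g y))) x) powr (1 - \<theta>) * enn2real (besov_norm \<beta> T) powr \<theta>)) h S"
    if T: "T \<in> tempered" and B: "besov_norm \<beta> T < \<infinity>" and FL: "frac_laplacian s T U" and g: "slow g"
      and U: "\<And>f. f \<in> schwartz \<Longrightarrow> U f = (\<integral>x. g x * f x \<partial>lborel)"
      and Mfin: "AE x in lborel. maximal (\<lambda>y. ennreal (norm (g y))) x < \<infinity>"
      and Mslow: "slow (\<lambda>x. complex_of_real (enn2real (maximal (\<lambda>y. ennreal (norm (g y))) x) powr (1 - \<theta>)))"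
    for T U :: "'a distr" and g
  proof -
    define MM where "MM = maximal (\<lambda>y. ennreal (norm (g y)))"
    define M where "M x = enn2real (MM x)" for x
    define b where "b = enn2real (besov_norm \<beta> T)"
    have b0: "0 \<le> b" by (simp add: b_def)
    have [measurable]: "g \<in> borel_measurable borel" using g by measurable
    define D where "D j x = T (\<lambda>y. fourier (band s1 j) (y - x))" for j x
    have Db[measurable]: "D j \<in> borel_measurable borel" for j
      unfolding D_def[abs_def] by (rule tempered_translate_borel[OF T fb])
    have bound1: "norm (D j x) \<le> A * (b * pw j powr \<tau>)" for j x
    proof -
      have "(\<lambda>y. fourier (band s1 j) (y - x)) = (\<lambda>y. complex_of_real (pw j powr s1) * fourier (\<lambda>\<xi>. band s1 0 ((1 / pw j) *\<^sub>R \<xi>)) (y - x))"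
      proof -
        have e: "band s1 j = (\<lambda>\<xi>::'a. complex_of_real (pw j powr s1) * band s1 0 ((1 / pw j) *\<^sub>R \<xi>))" by (rule ext, rule band_scale)
        show ?thesis by (subst e) (simp only: fourier_cmult)
      qed
      moreover have "(\<lambda>y. fourier (\<lambda>\<xi>. band s1 0 ((1 / pw j) *\<^sub>R \<xi>)) (y - x)) \<in> schwartz"
        by (intro schwartz_translate fourier_schwartz schwartz_dilate[OF bs]) simp
      ultimately have "D j x = complex_of_real (pw j powr s1) * T (\<lambda>y. fourier (\<lambda>\<xi>. band s1 0 ((1 / pw j) *\<^sub>R \<xi>)) (y - x))"
        unfolding D_def by (simp only: tempered_cmult[OF T])
      then have "norm (D j x) = pw j powr s1 * norm (T (\<lambda>y. fourier (\<lambda>\<xi>. band s1 0 ((1 / pw j) *\<^sub>R \<xi>)) (y - x)))"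
        by (simp only: norm_mult norm_of_real abs_of_nonneg[OF powr_ge_zero])
      also have "\<dots> \<le> pw j powr s1 * (A1 * pw j powr \<beta> * b)" unfolding b_def by (intro mult_left_mono A1(2) T B) auto
      also have "\<dots> = A1 * (b * pw j powr \<tau>)" by (simp add: \<tau>_def powr_add)
      also have "\<dots> \<le> A * (b * pw j powr \<tau>)" using A(2) b0 by (intro mult_right_mono) auto
      finally show ?thesis .
    qed
    have bound2: "norm (D j x) \<le> A * (M x * pw j powr (- \<sigma>))" if "MM x < \<infinity>" for j x
    proof -
      have Mx: "MM x = ennreal (M x)" using that by (simp add: M_def less_top)
      have "D j x = U (\<lambda>y. fourier (band (s1 - s) j) (y - x))"
        unfolding D_def by (rule frac_laplacian_band[OF FL])
      also have "\<dots> = (\<integral>y. g y * fourier (band (s1 - s) j) (y - x) \<partial>lborel)" by (intro U schwartz_translate fb)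
      finally have "ennreal (norm (D j x)) \<le> ennreal (A2 * pw j powr (s1 - s)) * ennreal (M x)"
        using A2(2)[of g j x] by (simp add: Mx[symmetric] MM_def)
      also have "\<dots> = ennreal (A2 * pw j powr (s1 - s) * M x)" using A2(1) by (subst ennreal_mult) (auto simp: M_def)
      finally have "norm (D j x) \<le> A2 * pw j powr (s1 - s) * M x" using A2(1) by (simp add: M_def)
      also have "\<dots> = A2 * (M x * pw j powr (- \<sigma>))" by (simp add: \<sigma>_def)
      also have "\<dots> \<le> A * (M x * pw j powr (- \<sigma>))" using A(3) by (intro mult_right_mono) (auto simp: M_def)
      finally show ?thesis .
    qed
    define E where "E x = (A * K) * (M x powr (1 - \<theta>) * b powr \<theta>)" for x
    have sumD: "(\<Sum>j\<in>F. norm (D j x)) \<le> E x" if "MM x < \<infinity>" "finite F" for x F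
    proof -
      have "(\<Sum>j\<in>F. norm (D j x)) \<le> (\<Sum>j\<in>F. A * min (M x * pw j powr (- \<sigma>)) (b * pw j powr \<tau>))"
        using bound1 bound2[OF that(1)] A(1) by (intro sum_mono) (simp add: min_def)
      also have "\<dots> = A * (\<Sum>j\<in>F. min (M x * pw j powr (- \<sigma>)) (b * pw j powr \<tau>))" by (rule sum_distrib_left[symmetric])
      also have "\<dots> \<le> A * (K * (M x powr (1 - \<theta>) * b powr \<theta>))"
        using A(1) b0 that by (intro mult_left_mono K(2)) (auto simp: M_def)
      finally show ?thesis by (simp add: E_def)
    qed
    define S where "S J x = ?c * (\<Sum>j\<in>{- int J..<int J}. D j x)" for J x
    have Sb[measurable]: "S J \<in> borel_measurable borel" for J unfolding S_def[abs_def] by measurable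
    have normS: "norm (S J x) \<le> E x" if "MM x < \<infinity>" for J x
    proof -
      have "norm (S J x) \<le> 1 * norm (\<Sum>j\<in>{- int J..<int J}. D j x)"
        unfolding S_def norm_mult using nc by (intro mult_right_mono) auto
      also have "\<dots> \<le> (\<Sum>j\<in>{- int J..<int J}. norm (D j x))" using norm_sum by simp
      also have "\<dots> \<le> E x" by (intro sumD that) auto
      finally show ?thesis .
    qed
    \<comment> \<open>Finite sums of the norms are bounded by \<open>E x\<close> uniformly, so the
      series converges absolutely. The two-sided sum becomes a series over the naturals by pairing
      \<open>k\<close> with \<open>- 1 - k\<close>.\<close>
    have conv: "convergent (\<lambda>J. S J x)" if x: "MM x < \<infinity>" for x
    proof -
      let ?a = "\<lambda>k. D (int k) x + D (- 1 - int k) x"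
      have part: "(\<Sum>k<J. f (int k) + f (- 1 - int k)) = (\<Sum>j\<in>{- int J..<int J}. f j)" for J and f :: "int \<Rightarrow> 'b::comm_monoid_add"
      proof (induction J)
        case (Suc J)
        have "{- int (Suc J)..<int (Suc J)} = insert (- 1 - int J) (insert (int J) {- int J..<int J})" by auto
        then show ?case using Suc by (simp add: add_ac)
      qed simp
      have "summable (\<lambda>k. norm (D (int k) x) + norm (D (- 1 - int k) x))"
      proof (rule summableI_nonneg_bounded)
        show "(\<Sum>k<J. norm (D (int k) x) + norm (D (- 1 - int k) x)) \<le> E x" for J
          unfolding part[of "\<lambda>j. norm (D j x)"] by (intro sumD x) auto
      qed auto
      then have "summable ?a" by (rule summable_comparison_test[rotated]) (auto intro!: exI[of _ 0] norm_triangle_ineq)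
      from tendsto_mult_left[OF summable_LIMSEQ[OF this], of ?c] show ?thesis
        unfolding part[of "\<lambda>j. D j x"] S_def convergent_def by blast
    qed
    define h where "h x = lim (\<lambda>J. S J x)" for x
    have [measurable]: "h \<in> borel_measurable borel" unfolding h_def[abs_def] by measurable
    have lim: "(\<lambda>J. S J x) \<longlonglongrightarrow> h x" if "MM x < \<infinity>" for x
      using conv[OF that] by (simp add: h_def convergent_LIMSEQ_iff)
    have normh: "norm (h x) \<le> E x" if "MM x < \<infinity>" for x
      by (rule LIMSEQ_le_const2[OF tendsto_norm[OF lim[OF that]]]) (use normS[OF that] in auto)
    have fin: "AE x in lborel. MM x < \<infinity>" using Mfin by (simp add: MM_def)
    have Eb[measurable]: "E \<in> borel_measurable borel" unfolding E_def[abs_def] M_def MM_def by measurable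
    have E0: "0 \<le> E x" for x using A(1) K(1) by (simp add: E_def)
    have Eslow: "slow (\<lambda>x. complex_of_real (E x))"
    proof -
      obtain N where N: "integrable lborel (\<lambda>x. norm (complex_of_real (M x powr (1 - \<theta>))) / (1 + norm x) ^ N)"
        using Mslow unfolding slow_def M_def MM_def by blast
      have "integrable lborel (\<lambda>x. (A * K * b powr \<theta>) * (norm (complex_of_real (M x powr (1 - \<theta>))) / (1 + norm x) ^ N))"
        by (intro integrable_mult_right N)
      moreover have "(A * K * b powr \<theta>) * (norm (complex_of_real (M x powr (1 - \<theta>))) / (1 + norm x) ^ N) = norm (complex_of_real (E x)) / (1 + norm x) ^ N" for x
        unfolding norm_of_real abs_of_nonneg[OF E0] abs_of_nonneg[OF powr_ge_zero] by (simp add: E_def)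
      ultimately have "integrable lborel (\<lambda>x. norm (complex_of_real (E x)) / (1 + norm x) ^ N)" by (simp only:)
      then show ?thesis unfolding slow_def by (intro conjI exI[of _ N]) measurable
    qed
    have hslow: "slow h"
    proof -
      obtain N where N: "integrable lborel (\<lambda>x. norm (complex_of_real (E x)) / (1 + norm x) ^ N)" using Eslow unfolding slow_def by blast
      have "integrable lborel (\<lambda>x. norm (h x) / (1 + norm x) ^ N)"
      proof (rule Bochner_Integration.integrable_bound[OF N])
        show "AE x in lborel. norm (norm (h x) / (1 + norm x) ^ N) \<le> norm (norm (complex_of_real (E x)) / (1 + norm x) ^ N)"
          using fin by eventually_elim (use normh E0 in \<open>auto intro!: divide_right_mono\<close>)
      qed measurable
      then show ?thesis unfolding slow_def by (intro conjI exI[of _ N]) measurable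
    qed
    have intlim: "(\<lambda>J. \<integral>x. S J x * f x \<partial>lborel) \<longlonglongrightarrow> (\<integral>x. h x * f x \<partial>lborel)" if f: "f \<in> schwartz" for f
    proof (rule integral_dominated_convergence[where w="\<lambda>x. norm (complex_of_real (E x) * f x)"])
      have [measurable]: "f \<in> borel_measurable borel" by (rule schwartz_borel[OF f])
      show "(\<lambda>x. h x * f x) \<in> borel_measurable lborel" "(\<lambda>x. S J x * f x) \<in> borel_measurable lborel" for J by measurable
      show "integrable lborel (\<lambda>x. norm (complex_of_real (E x) * f x))" by (rule integrable_norm[OF slow_integrable[OF Eslow f]])
      show "AE x in lborel. (\<lambda>J. S J x * f x) \<longlonglongrightarrow> h x * f x"
        using fin by eventually_elim (intro tendsto_mult lim tendsto_const)
      show "AE x in lborel. norm (S J x * f x) \<le> norm (complex_of_real (E x) * f x)" for J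
        using fin by eventually_elim (use normS E0 in \<open>auto simp: norm_mult intro!: mult_right_mono\<close>)
    qed
    \<comment> \<open>Tested against a transform, the partial sum acts as one telescoped
      multiplier.\<close>
    have key: "(\<integral>x. S J x * fourier \<psi> x \<partial>lborel)
      = T (fourier (\<lambda>\<xi>. complex_of_real (norm \<xi> powr s1) * (cutoff ((1 / pw (int J)) *\<^sub>R \<xi>) - cutoff ((1 / pw (- int J)) *\<^sub>R \<xi>)) * \<psi> \<xi>))"
      if \<psi>: "\<psi> \<in> schwartz" for \<psi> J
    proof -
      let ?I = "{- int J..<int J}"
      have bp: "(\<lambda>\<xi>. band s1 j \<xi> * \<psi> \<xi>) \<in> schwartz" for j by (rule test_schwartz[OF test_mult[OF band_test schwartz_smooth[OF \<psi>]]])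
      have i: "integrable lborel (\<lambda>x. fourier \<psi> x * D j x)" for j
        unfolding D_def by (rule tempered_conv(1)[OF T rapid_schwartz[OF fourier_schwartz[OF \<psi>]] fb])
      have "(\<integral>x. S J x * fourier \<psi> x \<partial>lborel) = (\<integral>x. (\<Sum>j\<in>?I. ?c * (fourier \<psi> x * D j x)) \<partial>lborel)"
        unfolding S_def by (intro Bochner_Integration.integral_cong refl) (simp only: sum_distrib_left sum_distrib_right mult_ac)
      also have "\<dots> = (\<Sum>j\<in>?I. (\<integral>x. ?c * (fourier \<psi> x * D j x) \<partial>lborel))"
        by (intro Bochner_Integration.integral_sum integrable_mult_right i)
      also have "\<dots> = (\<Sum>j\<in>?I. ?c * (\<integral>x. fourier \<psi> x * D j x \<partial>lborel))"
        by (simp only: integral_mult_right_zero)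
      also have "\<dots> = (\<Sum>j\<in>?I. T (fourier (\<lambda>\<xi>. band s1 j \<xi> * \<psi> \<xi>)))"
        unfolding D_def by (intro sum.cong refl tempered_fourier_band[OF T \<psi> bs, symmetric])
      also have "\<dots> = T (\<lambda>y. \<Sum>j\<in>?I. fourier (\<lambda>\<xi>. band s1 j \<xi> * \<psi> \<xi>) y)"
        by (intro tempered_sum[OF T, symmetric] fourier_schwartz bp) auto
      also have "(\<lambda>y. \<Sum>j\<in>?I. fourier (\<lambda>\<xi>. band s1 j \<xi> * \<psi> \<xi>) y) = fourier (\<lambda>\<xi>. \<Sum>j\<in>?I. band s1 j \<xi> * \<psi> \<xi>)"
        by (intro ext fourier_sum[symmetric] schwartz_integrable[OF bp])
      finally show ?thesis unfolding sum_distrib_right[symmetric] band_sum .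
    qed
    show ?thesis
      unfolding littlewood_paley_limit_def
    proof (rule exI[of _ h], rule exI[of _ S], intro conjI ballI impI allI hslow)
      fix J
      let ?\<omega> = "\<lambda>\<xi>. ?c * (\<Sum>j\<in>{- int J..<int J}. band s1 j \<xi>)"
      have "S J x = T (\<lambda>y. fourier ?\<omega> (y - x))" for x
      proof -
        have "S J x = ?c * T (\<lambda>y. \<Sum>j\<in>{- int J..<int J}. fourier (band s1 j) (y - x))"
          unfolding S_def D_def by (subst tempered_sum[OF T]) (auto intro: schwartz_translate[OF fb])
        also have "\<dots> = T (\<lambda>y. ?c * (\<Sum>j\<in>{- int J..<int J}. fourier (band s1 j) (y - x)))"
          by (intro tempered_cmult[OF T, symmetric] schwartz_sum schwartz_translate fb) auto
        also have "(\<lambda>y. ?c * (\<Sum>j\<in>{- int J..<int J}. fourier (band s1 j) (y - x))) = (\<lambda>y. fourier ?\<omega> (y - x))"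
          unfolding fourier_cmult by (intro ext arg_cong[where f="(*) ?c"] fourier_sum[symmetric] schwartz_integrable[OF bs])
        finally show ?thesis .
      qed
      then show "\<exists>\<omega>. annular \<omega> \<and> S J = (\<lambda>x. T (\<lambda>y. fourier \<omega> (y - x)))"
        by (intro exI[of _ ?\<omega>] conjI annular_cmult annular_band_sum ext)
    next
      show "AE x in lborel. (\<forall>J. norm (S J x) \<le> (A * K) * (enn2real (maximal (\<lambda>y. ennreal (norm (g y))) x) powr (1 - \<theta>) * enn2real (besov_norm \<beta> T) powr \<theta>)) \<and> (\<lambda>J. S J x) \<longlonglongrightarrow> h x"
        using fin by eventually_elim (intro conjI allI lim, auto simp only: E_def[symmetric] M_def[symmetric] MM_def[symmetric] b_def[symmetric] normS)
    next
      fix \<psi> :: "'a \<Rightarrow> complex" assume \<psi>: "\<psi> \<in> test_functions" "0 \<notin> closure {\<xi>. \<psi> \<xi> \<noteq> 0}"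
      have ps: "\<psi> \<in> schwartz" by (rule test_schwartz[OF \<psi>(1)])
      obtain r R where r: "0 < r" "0 < R" "\<And>\<xi>. norm \<xi> < r \<Longrightarrow> \<psi> \<xi> = 0" "\<And>\<xi>. R < norm \<xi> \<Longrightarrow> \<psi> \<xi> = 0"
        using test_annulus[OF \<psi>] by blast
      obtain J1 where J1: "\<And>J \<xi>. J1 \<le> J \<Longrightarrow> norm (\<xi>::'a) \<le> R \<Longrightarrow> cutoff ((1 / pw (int J)) *\<^sub>R \<xi>) = 1"
        using cutoff_large[of R, where 'a='a] by blast
      obtain J2 where J2: "\<And>J \<xi>. J2 \<le> J \<Longrightarrow> r \<le> norm (\<xi>::'a) \<Longrightarrow> cutoff ((1 / pw (- int J)) *\<^sub>R \<xi>) = 0"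
        using cutoff_small[OF r(1), where 'a='a] by blast
      \<comment> \<open>On the annulus carrying \<open>\<psi>\<close> the outer cutoff is eventually
        1 and the inner one eventually 0, so the sequence is eventually constant.\<close>
      have ev: "\<forall>\<^sub>F J in sequentially. (\<integral>x. S J x * fourier \<psi> x \<partial>lborel) = T (fourier (\<lambda>\<xi>. complex_of_real (norm \<xi> powr s1) * \<psi> \<xi>))"
        using eventually_ge_at_top[of "max J1 J2"]
      proof eventually_elim
        case (elim J)
        have "complex_of_real (norm \<xi> powr s1) * (cutoff ((1 / pw (int J)) *\<^sub>R \<xi>) - cutoff ((1 / pw (- int J)) *\<^sub>R \<xi>)) * \<psi> \<xi>
          = complex_of_real (norm \<xi> powr s1) * \<psi> \<xi>" for \<xi>
        proof (cases "norm \<xi> < r \<or> R < norm \<xi>")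
          case True
          then show ?thesis using r by auto
        next
          case False
          then show ?thesis using J1[of J \<xi>] J2[of J \<xi>] elim by simp
        qed
        then show ?case unfolding key[OF ps] by (simp only:)
      qed
      show "(\<integral>x. h x * fourier \<psi> x \<partial>lborel) = T (fourier (\<lambda>\<xi>. complex_of_real (norm \<xi> powr s1) * \<psi> \<xi>))"
        by (rule LIMSEQ_unique[OF intlim[OF fourier_schwartz[OF ps]] tendsto_eventually[OF ev]])
    next
      fix f :: "'a \<Rightarrow> complex" assume s10: "s1 = 0" and f: "f \<in> schwartz"
      obtain \<psi> where ps: "\<psi> \<in> schwartz" "fourier \<psi> = f" using fourier_surj[OF f] by blast
      \<comment> \<open>Without a power of the norm the multiplier is a difference of two cutoffs.
        The wide one tends to the identity in the Schwartz topology; the narrow one contributes at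
        most a multiple of \<open>(2 powr (- \<beta>)) ^ J\<close> by the Besov bound, so nothing
        supported at frequency 0 survives.\<close>
      let ?L = "\<lambda>J \<xi>. \<psi> \<xi> * cutoff ((1 / pw (int J)) *\<^sub>R \<xi>)"
      let ?Z = "\<lambda>J \<xi>. cutoff ((1 / pw (- int J)) *\<^sub>R \<xi>) * \<psi> \<xi>"
      have cs: "(\<lambda>\<xi>::'a. cutoff ((1 / pw j) *\<^sub>R \<xi>)) \<in> test_functions" for j by (rule cutoff_dilate_test) simp
      have Ls: "?L J \<in> schwartz" for J by (rule test_schwartz[OF test_mult'[OF cs schwartz_smooth[OF ps(1)]]])
      have Zs: "?Z J \<in> schwartz" for J by (rule test_schwartz[OF test_mult[OF cs schwartz_smooth[OF ps(1)]]])
      have eqJ: "(\<integral>x. S J x * f x \<partial>lborel) = T (fourier (?L J)) - T (fourier (?Z J))" for J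
      proof -
        \<comment> \<open>At the origin \<open>0 powr 0\<close> is 0, which does no harm because
          both cutoffs are 1 there.\<close>
        have e: "complex_of_real (norm \<xi> powr s1) * (cutoff ((1 / pw (int J)) *\<^sub>R \<xi>) - cutoff ((1 / pw (- int J)) *\<^sub>R \<xi>)) * \<psi> \<xi> = ?L J \<xi> - ?Z J \<xi>" for \<xi>
          by (cases "\<xi> = 0") (simp_all add: s10 cutoff_1 algebra_simps)
        have "(\<integral>x. S J x * f x \<partial>lborel) = T (fourier (\<lambda>\<xi>. ?L J \<xi> - ?Z J \<xi>))"
          using key[OF ps(1), of J] unfolding ps(2) e .
        also have "fourier (\<lambda>\<xi>. ?L J \<xi> - ?Z J \<xi>) = (\<lambda>y. fourier (?L J) y - fourier (?Z J) y)"
          by (intro ext fourier_diff schwartz_integrable Ls Zs)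
        also have "T \<dots> = T (fourier (?L J)) - T (fourier (?Z J))" by (intro tempered_diff[OF T] fourier_schwartz Ls Zs)
        finally show ?thesis .
      qed
      have "(\<lambda>J. T (fourier (?L J))) \<longlonglongrightarrow> T f"
      proof -
        let ?u = "\<lambda>(i::nat) \<xi>. \<psi> \<xi> * cutoff ((1 / real (Suc i)) *\<^sub>R \<xi>)"
        have us: "?u i \<in> schwartz" for i by (rule test_schwartz[OF schwartz_cutoff_test[OF ps(1)]])
        have "(\<lambda>i. T (fourier (?u i))) \<longlonglongrightarrow> T f"
        proof (rule tempered_tendsto[OF T fourier_schwartz[OF us] f])
          fix N
          have lin: "fourier (\<lambda>\<xi>. ?u i \<xi> - \<psi> \<xi>) y = fourier (?u i) y - f y" for i y
            unfolding ps(2)[symmetric] by (rule fourier_diff[OF schwartz_integrable[OF us] schwartz_integrable[OF ps(1)]])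
          have "schwartz_family (\<lambda>i x. of_nat (Suc i) * (fourier (?u i) x - f x))"
            using fourier_schwartz_family[OF schwartz_family_cutoff[OF ps(1)]]
            unfolding fourier_cmult[abs_def] lin .
          then show "(\<lambda>i. schwartz_norm N (\<lambda>x. fourier (?u i) x - f x)) \<longlonglongrightarrow> 0"
            by (rule schwartz_norm_scaled_tendsto)
        qed
        \<comment> \<open>The truncation family has scales \<open>Suc i\<close>, and the index
          \<open>2 ^ J - 1\<close> selects the dyadic scale \<open>2 ^ J\<close>.\<close>
        moreover have "filterlim (\<lambda>J::nat. 2 ^ J - 1 :: nat) at_top sequentially"
        proof (rule filterlim_at_top_mono[OF filterlim_ident])
          show "\<forall>\<^sub>F J in sequentially. J \<le> 2 ^ J - (1::nat)"
          proof (rule always_eventually, rule allI)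
            fix J :: nat have "J < 2 ^ J" by (rule less_exp)
            then show "J \<le> 2 ^ J - 1" by linarith
          qed
        qed
        ultimately have "(\<lambda>J. T (fourier (?u (2 ^ J - 1)))) \<longlonglongrightarrow> T f" by (rule filterlim_compose)
        moreover have "real (Suc (2 ^ J - 1)) = pw (int J)" for J by (simp add: powr_realpow)
        ultimately show ?thesis by (simp only:)
      qed
      moreover have "(\<lambda>J. T (fourier (?Z J))) \<longlonglongrightarrow> 0"
      proof (rule Lim_null_comparison)
        let ?I = "\<integral>x. norm (f x) \<partial>lborel"
        show "\<forall>\<^sub>F J in sequentially. norm (T (fourier (?Z J))) \<le> (?I * (A0 * b)) * (2 powr (- \<beta>)) ^ J"
        proof (intro always_eventually allI)
          fix J
          have cS: "(\<lambda>\<xi>::'a. cutoff ((1 / pw (- int J)) *\<^sub>R \<xi>)) \<in> schwartz" by (rule test_schwartz[OF cs])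
          have "norm (T (fourier (?Z J))) = norm ?c * norm (\<integral>x. f x * T (\<lambda>y. fourier (\<lambda>\<xi>. cutoff ((1 / pw (- int J)) *\<^sub>R \<xi>)) (y - x)) \<partial>lborel)"
            unfolding tempered_fourier_band[OF T ps(1) cS] ps(2) by (rule norm_mult)
          also have "\<dots> \<le> 1 * (\<integral>x. norm (f x * T (\<lambda>y. fourier (\<lambda>\<xi>. cutoff ((1 / pw (- int J)) *\<^sub>R \<xi>)) (y - x))) \<partial>lborel)"
            by (intro mult_mono nc integral_norm_bound) auto
          also have "\<dots> \<le> (\<integral>x. norm (f x) * (A0 * pw (- int J) powr \<beta> * b) \<partial>lborel)"
            unfolding mult_1_left
          proof (rule integral_mono)
            show "integrable lborel (\<lambda>x. norm (f x * T (\<lambda>y. fourier (\<lambda>\<xi>. cutoff ((1 / pw (- int J)) *\<^sub>R \<xi>)) (y - x))))"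
              by (rule integrable_norm[OF tempered_conv(1)[OF T rapid_schwartz[OF f] fourier_schwartz[OF cS]]])
            show "integrable lborel (\<lambda>x. norm (f x) * (A0 * pw (- int J) powr \<beta> * b))"
              by (intro integrable_mult_left integrable_norm schwartz_integrable[OF f])
            show "norm (f x * T (\<lambda>y. fourier (\<lambda>\<xi>. cutoff ((1 / pw (- int J)) *\<^sub>R \<xi>)) (y - x))) \<le> norm (f x) * (A0 * pw (- int J) powr \<beta> * b)" for x
              unfolding norm_mult b_def by (intro mult_left_mono A0(2) T B) auto
          qed
          also have "\<dots> = ?I * (A0 * pw (- int J) powr \<beta> * b)" by (simp only: integral_mult_left_zero)
          also have "pw (- int J) powr \<beta> = (2 powr (- \<beta>)) ^ J"
          proof -
            have "pw (- int J) powr \<beta> = 2 powr (- \<beta> * real J)" by (simp add: powr_powr mult.commute)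
            also have "\<dots> = (2 powr (- \<beta>)) powr real J" by (rule powr_powr[symmetric])
            finally show ?thesis by (simp add: powr_realpow)
          qed
          finally show "norm (T (fourier (?Z J))) \<le> (?I * (A0 * b)) * (2 powr (- \<beta>)) ^ J" by (simp only: mult_ac)
        qed
        have "(\<lambda>J. (2 powr (- \<beta>)) ^ J) \<longlonglongrightarrow> 0" using \<beta> by (intro LIMSEQ_power_zero) (simp add: powr_less_one)
        from tendsto_mult_left[OF this, of "?I * (A0 * b)"]
        show "(\<lambda>J. (?I * (A0 * b)) * (2 powr (- \<beta>)) ^ J) \<longlonglongrightarrow> 0" by simp
      qed
      ultimately have "(\<lambda>J. \<integral>x. S J x * f x \<partial>lborel) \<longlonglongrightarrow> T f - 0"
        unfolding eqJ by (rule tendsto_diff)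
      then show "T f = (\<integral>x. h x * f x \<partial>lborel)"
        using LIMSEQ_unique[OF _ intlim[OF f]] by simp
    qed
  qed
  show ?thesis
  proof (intro exI[of _ "A * K"] conjI allI impI)
    show "0 < A * K" using A(1) K(1) by simp
  qed (rule main; (assumption | erule (1) bspec))
qed

subsection \<open>Approximation with annular spectrum\<close>

text \<open>The profile is known only where it is constant, not its sign in between. The square is
  nonnegative and at least 1 on the unit ball.\<close>

lemma integral_square_cutoff: "(\<integral>z. cutoff (z::'a::euclidean_space) * cutoff z \<partial>lborel) \<noteq> 0"
proof -
  define c where "c z = Re (cutoff z)" for z :: 'a
  have c: "cutoff z = complex_of_real (c z)" for z unfolding c_def by (simp add: cutoff_def)
  have "integrable lborel (\<lambda>z::'a. cutoff z * cutoff z)"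
    by (rule schwartz_integrable[OF test_schwartz[OF test_mult[OF cutoff_test cutoff_smooth]]])
  then have int: "integrable lborel (\<lambda>z. c z * c z)" unfolding c of_real_mult[symmetric] complex_of_real_integrable_eq .
  have "measure lborel (cball (0::'a) 1) = (\<integral>z. indicator (cball (0::'a) 1) z \<partial>lborel)" by simp
  also have "\<dots> \<le> (\<integral>z. c z * c z \<partial>lborel)"
  proof (rule integral_mono[OF _ int])
    show "integrable lborel (indicat_real (cball (0::'a) 1))" 
      by (intro integrable_real_indicator emeasure_bounded_finite) auto
    show "indicat_real (cball 0 1) z \<le> c z * c z" for z
      using cutoff_1[of z] c[of z] by (auto simp: indicator_def)
  qed
  finally have "0 < (\<integral>z. c z * c z \<partial>lborel)" using content_cball_pos[of 1 "0::'a"] by linarith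
  then show ?thesis unfolding c of_real_mult[symmetric] integral_complex_of_real by simp
qed

text \<open>Squared cutoffs concentrating at \<open>x\<close> act as an approximate identity up to a
  nonzero constant, so a continuous function is recovered from its integrals against test
  functions.\<close>

lemma continuous_eq_0:
  fixes u :: "'a::euclidean_space \<Rightarrow> complex"
  assumes u: "continuous_on UNIV u" and z: "\<And>\<psi>. \<psi> \<in> test_functions \<Longrightarrow> (\<integral>x. u x * \<psi> x \<partial>lborel) = 0"
  shows "u x = 0"
proof -
  let ?G = "\<lambda>z::'a. cutoff z * cutoff z"
  have Gt: "?G \<in> test_functions" by (rule test_mult[OF cutoff_test cutoff_smooth])
  have [measurable]: "u \<in> borel_measurable borel" by (rule borel_measurable_continuous_onI[OF u])
  have [measurable]: "cutoff \<in> borel_measurable (borel :: 'a measure)" by (rule schwartz_borel[OF test_schwartz[OF cutoff_test]])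
  have zero: "(\<integral>z. u (x + (1 / real (Suc i)) *\<^sub>R z) * ?G z \<partial>lborel) = 0" for i
  proof -
    have "?G \<in> schwartz" by (rule test_schwartz[OF Gt])
    have "(\<lambda>y. ?G (real (Suc i) *\<^sub>R (y - x))) \<in> test_functions"
    proof (rule testI_bounded)
      show "smooth (\<lambda>y. ?G (real (Suc i) *\<^sub>R (y - x)))"
        using smooth_affine[OF test_smooth[OF Gt], of "real (Suc i)" "- (real (Suc i) *\<^sub>R x)"]
        by (simp only: scaleR_diff_right add_uminus_conv_diff)
      fix y :: 'a assume "norm x + 2 \<le> norm y"
      then have "2 \<le> norm (y - x)" using norm_triangle_ineq2[of y x] by linarith
      also have "\<dots> \<le> real (Suc i) * norm (y - x)" by (simp add: mult_le_cancel_right1)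
      finally have "2 \<le> norm (real (Suc i) *\<^sub>R (y - x))" by simp
      then show "?G (real (Suc i) *\<^sub>R (y - x)) = 0" by (simp only: cutoff_0 mult_zero_left)
    qed
    from z[OF this] have "(\<integral>y. u y * ?G (real (Suc i) *\<^sub>R (y - x)) \<partial>lborel) = 0" .
    with lborel_integral_affine(2)[of "1 / real (Suc i)" "\<lambda>y. u y * ?G (real (Suc i) *\<^sub>R (y - x))" x]
    show ?thesis by simp
  qed
  have lim: "(\<lambda>i. \<integral>z. u (x + (1 / real (Suc i)) *\<^sub>R z) * ?G z \<partial>lborel) \<longlonglongrightarrow> (\<integral>z. u x * ?G z \<partial>lborel)"
  proof -
    have "compact (u ` cball x 2)" by (intro compact_continuous_image continuous_on_subset[OF u]) auto
    then obtain B where B: "\<And>y. y \<in> cball x 2 \<Longrightarrow> norm (u y) \<le> B"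
      by (metis compact_imp_bounded bounded_iff image_eqI)
    show ?thesis
    proof (rule integral_dominated_convergence[where w="\<lambda>z. B * norm (?G z)"])
      show "integrable lborel (\<lambda>z. B * norm (?G z))"
        by (intro integrable_mult_right integrable_norm schwartz_integrable[OF test_schwartz[OF Gt]])
      show "AE z in lborel. (\<lambda>i. u (x + (1 / real (Suc i)) *\<^sub>R z) * ?G z) \<longlonglongrightarrow> u x * ?G z"
      proof (rule AE_I2)
        fix z :: 'a
        have "(\<lambda>i. x + (1 / real (Suc i)) *\<^sub>R z) \<longlonglongrightarrow> x + 0 *\<^sub>R z"
          by (intro tendsto_intros LIMSEQ_inverse_real_of_nat[unfolded inverse_eq_divide])
        then have "(\<lambda>i. u (x + (1 / real (Suc i)) *\<^sub>R z)) \<longlonglongrightarrow> u x"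
          using u unfolding continuous_on_eq_continuous_at[OF open_UNIV] isCont_def
          by (auto intro: isCont_tendsto_compose[of x u] simp: isCont_def)
        then show "(\<lambda>i. u (x + (1 / real (Suc i)) *\<^sub>R z) * ?G z) \<longlonglongrightarrow> u x * ?G z"
          by (intro tendsto_mult tendsto_const)
      qed
      show "AE z in lborel. norm (u (x + (1 / real (Suc i)) *\<^sub>R z) * ?G z) \<le> B * norm (?G z)" for i
      proof (rule AE_I2)
        fix z :: 'a
        show "norm (u (x + (1 / real (Suc i)) *\<^sub>R z) * ?G z) \<le> B * norm (?G z)"
        proof (cases "2 \<le> norm z")
          case True then show ?thesis by (simp only: cutoff_0 mult_zero_left mult_zero_right norm_zero)
        next
          case False
          have "norm z / real (Suc i) \<le> norm z / 1" by (intro divide_left_mono) auto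
          then have "x + (1 / real (Suc i)) *\<^sub>R z \<in> cball x 2" using False by (simp add: dist_norm)
          from B[OF this] show ?thesis unfolding norm_mult by (intro mult_right_mono) auto
        qed
      qed
    qed measurable
  qed
  have "(\<integral>z. u x * ?G z \<partial>lborel) = 0" using LIMSEQ_unique[OF lim[unfolded zero] tendsto_const] .
  then have "u x * (\<integral>z. ?G z \<partial>lborel) = 0" by (simp only: integral_mult_right_zero)
  then show ?thesis using integral_square_cutoff[where 'a='a] unfolding mult_eq_0_iff by blast
qed

lemma fourier_shift:
  fixes a :: "'a::euclidean_space"
  assumes [measurable]: "m \<in> borel_measurable borel"
  shows "fourier (\<lambda>\<eta>. m (\<eta> + a)) x = exp (\<i> * complex_of_real (a \<bullet> x)) * fourier m x"
proof -
  have "fourier (\<lambda>\<eta>. m (\<eta> + a)) x = (\<integral>\<eta>. exp (- \<i> * complex_of_real (\<eta> \<bullet> x)) * m (\<eta> + a) \<partial>lborel)"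
    by (rule fourier_lborel) measurable
  also have "\<dots> = (\<integral>\<eta>. exp (- \<i> * complex_of_real ((\<eta> - a) \<bullet> x)) * m (\<eta> - a + a) \<partial>lborel)"
    by (rule integral_translate[symmetric]) measurable
  also have "\<dots> = (\<integral>\<eta>. exp (\<i> * complex_of_real (a \<bullet> x)) * (exp (- \<i> * complex_of_real (\<eta> \<bullet> x)) * m \<eta>) \<partial>lborel)"
    unfolding mult.assoc[symmetric] exp_add[symmetric] by (simp add: inner_diff_left algebra_simps)
  also have "\<dots> = exp (\<i> * complex_of_real (a \<bullet> x)) * fourier m x"
    unfolding integral_mult_right_zero by (subst fourier_lborel) auto
  finally show ?thesis .
qed

text \<open>Inversion for a \<open>w\<close> that is continuous and rapid but not known to be
  Schwartz: duality moves the inversion to test functions, and continuity turns the weak identity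
  into a pointwise one.\<close>

lemma fourier_eqI:
  fixes w :: "'a::euclidean_space \<Rightarrow> complex"
  assumes w: "rapid w" "continuous_on UNIV w" and m: "integrable lborel m" "continuous_on UNIV (fourier m)"
    and mw: "\<And>\<xi>. m \<xi> = complex_of_real (1 / (2 * pi) ^ DIM('a)) * fourier w (- \<xi>)"
  shows "fourier m = w"
proof
  fix x
  let ?c = "complex_of_real (1 / (2 * pi) ^ DIM('a))"
  have "fourier m x - w x = 0"
  proof (rule continuous_eq_0[of "\<lambda>x. fourier m x - w x"])
    show "continuous_on UNIV (\<lambda>x. fourier m x - w x)" by (intro continuous_on_diff w m)
    fix \<psi> :: "'a \<Rightarrow> complex" assume "\<psi> \<in> test_functions"
    then have \<psi>: "\<psi> \<in> schwartz" by (rule test_schwartz)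
    have F: "fourier \<psi> \<in> schwartz" by (rule fourier_schwartz[OF \<psi>])
    have R: "(\<lambda>\<xi>. fourier \<psi> (- \<xi>)) \<in> schwartz" using schwartz_reflect[OF F, of 0] by simp
    have [measurable]: "fourier \<psi> \<in> borel_measurable borel" "\<psi> \<in> borel_measurable borel"
      using schwartz_borel[OF F] schwartz_borel[OF \<psi>] by auto
    have [measurable]: "w \<in> borel_measurable borel" "fourier m \<in> borel_measurable borel" "fourier w \<in> borel_measurable borel"
      using w(1) by (auto intro: borel_measurable_continuous_onI m fourier_borel rapid_measurable)
    obtain Bm where Bm: "\<And>x. norm (fourier m x) \<le> Bm" using norm_fourier_le[OF m(1)] by blast
    have i1: "integrable lborel (\<lambda>x. fourier m x * \<psi> x)"
      by (rule rapid_integrable[OF rapid_mult_bounded_growth[OF rapid_schwartz[OF \<psi>], where M=0 and C=Bm]]) (simp_all add: Bm)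
    obtain B where B: "\<And>x. norm (\<psi> x) \<le> B" using schwartz_bounded[OF \<psi>] by blast
    have i2: "integrable lborel (\<lambda>x. w x * \<psi> x)"
      using rapid_integrable[OF rapid_mult_bounded_growth[OF w(1), where M=0 and C=B and g=\<psi>]] B by (simp add: mult.commute)
    have "(\<integral>x. fourier m x * \<psi> x \<partial>lborel) = (\<integral>\<xi>. m \<xi> * fourier \<psi> \<xi> \<partial>lborel)"
      by (rule fourier_duality[symmetric, OF m(1) schwartz_integrable[OF \<psi>]])
    also have "\<dots> = (\<integral>\<xi>. ?c * (fourier w (0 - \<xi>) * fourier \<psi> (- (0 - \<xi>))) \<partial>lborel)" unfolding mw by (simp add: mult_ac)
    also have "\<dots> = (\<integral>\<xi>. ?c * (fourier w \<xi> * fourier \<psi> (- \<xi>)) \<partial>lborel)"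
      by (rule integral_reflect[of "\<lambda>\<xi>. ?c * (fourier w \<xi> * fourier \<psi> (- \<xi>))"]) measurable
    also have "\<dots> = ?c * (\<integral>\<xi>. fourier w \<xi> * fourier \<psi> (- \<xi>) \<partial>lborel)" by (rule integral_mult_right_zero)
    also have "(\<integral>\<xi>. fourier w \<xi> * fourier \<psi> (- \<xi>) \<partial>lborel) = (\<integral>z. w z * fourier (\<lambda>\<xi>. fourier \<psi> (- \<xi>)) z \<partial>lborel)"
      by (rule fourier_duality[symmetric, OF rapid_integrable[OF w(1)] schwartz_integrable[OF R]])
    also have "\<dots> = (\<integral>z. complex_of_real ((2 * pi) ^ DIM('a)) * (w z * \<psi> z) \<partial>lborel)"
      unfolding fourier_reflect_fourier[OF \<psi>] by (simp only: mult_ac)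
    also have "\<dots> = complex_of_real ((2 * pi) ^ DIM('a)) * (\<integral>z. w z * \<psi> z \<partial>lborel)" by (rule integral_mult_right_zero)
    finally have "(\<integral>x. fourier m x * \<psi> x \<partial>lborel) = (\<integral>z. w z * \<psi> z \<partial>lborel)" by simp
    then show "(\<integral>x. (fourier m x - w x) * \<psi> x \<partial>lborel) = 0"
      unfolding left_diff_distrib by (subst Bochner_Integration.integral_diff[OF i1 i2]) simp
  qed
  then show "fourier m x = w x" by simp
qed

text \<open>Multiplying by \<open>fourier \<gamma> (\<cdot> / k)\<close> makes a translate family \<open>v\<close> rapidly decreasing, and
  perturbs its frequencies by the support \<open>O(1 / k)\<close> of the rescaled \<open>\<gamma>\<close> only.\<close>

lemma spectral_truncation:
  fixes T :: "'a::euclidean_space distr" and v :: "'a \<Rightarrow> complex"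
  assumes T: "T \<in> tempered" and \<omega>: "annular \<omega>" and v: "v = (\<lambda>x. T (\<lambda>y. fourier \<omega> (y - x)))"
  obtains m B where "\<And>i::nat. annular (m i)" "\<And>i x. norm (fourier (m i) x) \<le> B * norm (v x)"
    "\<And>x. (\<lambda>i. fourier (m i) x) \<longlonglongrightarrow> v x"
proof -
  have \<omega>t: "\<omega> \<in> test_functions" using \<omega> by (simp add: annular_def)
  have \<omega>s: "\<omega> \<in> schwartz" by (rule test_schwartz[OF \<omega>t])
  obtain r where r: "0 < r" "\<And>\<xi>. norm \<xi> < r \<Longrightarrow> \<omega> \<xi> = 0" using \<omega> by (auto simp: annular_def)
  obtain R where R: "\<And>\<xi>. R < norm \<xi> \<Longrightarrow> \<omega> \<xi> = 0"
  proof -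
    have "bounded (closure {\<xi>. \<omega> \<xi> \<noteq> 0})" using \<omega>t by (simp add: test_functions_def compact_imp_bounded)
    then obtain R where R: "\<And>\<xi>. \<xi> \<in> closure {\<xi>. \<omega> \<xi> \<noteq> 0} \<Longrightarrow> norm \<xi> \<le> R" unfolding bounded_iff by blast
    have "\<omega> \<xi> = 0" if "R < norm \<xi>" for \<xi>
      using R[of \<xi>] that closure_subset[of "{\<xi>. \<omega> \<xi> \<noteq> 0}"] by (auto simp: subset_iff not_le)
    then show thesis by (rule that)
  qed
  let ?c = "complex_of_real (1 / (2 * pi) ^ DIM('a))"
  let ?\<gamma> = "\<lambda>\<xi>::'a. cutoff \<xi> * cutoff \<xi>"
  define \<gamma>0 where "\<gamma>0 = (\<integral>z. cutoff (z::'a) * cutoff z \<partial>lborel)"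
  have \<gamma>0: "\<gamma>0 \<noteq> 0" unfolding \<gamma>0_def by (rule integral_square_cutoff)
  have \<gamma>s: "?\<gamma> \<in> schwartz" by (rule test_schwartz[OF test_mult[OF cutoff_test cutoff_smooth]])
  have F\<gamma>: "fourier ?\<gamma> \<in> schwartz" by (rule fourier_schwartz[OF \<gamma>s])
  have [measurable]: "cutoff \<in> borel_measurable (borel :: 'a measure)" by (rule schwartz_borel[OF test_schwartz[OF cutoff_test]])
  have F0: "fourier ?\<gamma> 0 = \<gamma>0" unfolding \<gamma>0_def by (subst fourier_lborel) auto
  obtain B0 where B0: "\<And>x. norm (fourier ?\<gamma> x) \<le> B0" using schwartz_bounded[OF F\<gamma>] by blast
  have vc: "continuous_on UNIV v" unfolding v by (rule tempered_translate_continuous[OF T fourier_schwartz[OF \<omega>s]])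
  have vb[measurable]: "v \<in> borel_measurable borel" by (rule borel_measurable_continuous_onI[OF vc])
  \<comment> \<open>With \<open>k \<ge> 4 / r\<close> the perturbation radius \<open>2 / k\<close>
    is at most \<open>r / 2\<close>, so the spectrum still misses a ball around the origin;
    \<open>k \<ge> 1\<close> keeps it within radius \<open>R + 2\<close>.\<close>
  obtain N0 :: nat where N0: "4 / r \<le> real N0" using real_arch_simple by blast
  define k where "k i = real (Suc i + N0)" for i
  have k: "1 \<le> k i" "4 / r \<le> k i" for i using N0 by (auto simp: k_def)
  \<comment> \<open>The constant is chosen so that the transform equals 1 at the origin, where
    \<open>fourier ?\<gamma>\<close> has the value \<open>\<gamma>0\<close>.\<close>
  define g where "g i \<xi> = (complex_of_real (k i ^ DIM('a)) / \<gamma>0) * ?\<gamma> (k i *\<^sub>R \<xi>)" for i and \<xi> :: 'a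
  have gs: "g i \<in> schwartz" for i
    unfolding g_def[abs_def] using k(1)[of i] by (intro schwartz_cmult schwartz_dilate[OF \<gamma>s]) simp
  have g0: "g i \<xi> = 0" if "2 / k i \<le> norm \<xi>" for i \<xi>
  proof -
    have "2 \<le> norm (k i *\<^sub>R \<xi>)" using that k(1)[of i] by (simp add: pos_divide_le_eq mult.commute)
    then show ?thesis unfolding g_def by (simp only: cutoff_0 mult_zero_left mult_zero_right)
  qed
  have Fg: "fourier (g i) x = fourier ?\<gamma> ((1 / k i) *\<^sub>R x) / \<gamma>0" for i x
  proof -
    have "fourier (\<lambda>\<xi>. ?\<gamma> ((1 / (1 / k i)) *\<^sub>R \<xi>)) x = complex_of_real ((1 / k i) ^ DIM('a)) * fourier ?\<gamma> ((1 / k i) *\<^sub>R x)"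
      using k(1)[of i] by (intro fourier_dilate) auto
    then show ?thesis using k(1)[of i] unfolding g_def[abs_def] fourier_cmult
      by (simp add: power_one_over power_divide)
  qed
  define w where "w i x = v x * fourier (g i) x" for i x
  define m where "m i \<xi> = ?c * fourier (w i) (- \<xi>)" for i \<xi>
  have wr: "rapid (w i)" for i
  proof -
    obtain C N where "\<And>x. norm (v x) \<le> C * (1 + norm x) ^ N"
      unfolding v using tempered_translate_bound[OF T fourier_schwartz[OF \<omega>s]] by metis
    then show ?thesis unfolding w_def[abs_def]
      by (intro rapid_mult_bounded_growth[OF rapid_schwartz[OF fourier_schwartz[OF gs]] vb])
  qed
  have wc: "continuous_on UNIV (w i)" for i
    unfolding w_def[abs_def] by (intro continuous_on_mult vc smooth_continuous schwartz_smooth fourier_schwartz gs)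
  \<comment> \<open>This form shows the spectrum of \<open>w i\<close>: \<open>T\<close> is tested
    with a product that vanishes identically unless the translated support of \<open>g i\<close>
    meets the support of \<open>\<omega>\<close>.\<close>
  have meq: "m i \<xi> = T (fourier (\<lambda>\<eta>. \<omega> \<eta> * g i (\<eta> + \<xi>)))" for i \<xi>
  proof -
    have gs': "(\<lambda>\<eta>. g i (\<eta> + \<xi>)) \<in> schwartz" using schwartz_translate[OF gs, of i "- \<xi>"] by simp
    have [measurable]: "g i \<in> borel_measurable borel" "fourier (g i) \<in> borel_measurable borel"
      by (intro schwartz_borel gs fourier_schwartz)+
    have "fourier (w i) (- \<xi>) = (\<integral>x. exp (- \<i> * complex_of_real (x \<bullet> - \<xi>)) * w i x \<partial>lborel)"
      unfolding w_def[abs_def] by (rule fourier_lborel) measurable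
    also have "\<dots> = (\<integral>x. fourier (\<lambda>\<eta>. g i (\<eta> + \<xi>)) x * v x \<partial>lborel)"
    proof (rule Bochner_Integration.integral_cong[OF refl])
      fix x :: 'a
      have "fourier (\<lambda>\<eta>. g i (\<eta> + \<xi>)) x = exp (\<i> * complex_of_real (\<xi> \<bullet> x)) * fourier (g i) x"
        by (rule fourier_shift) measurable
      then show "exp (- \<i> * complex_of_real (x \<bullet> - \<xi>)) * w i x = fourier (\<lambda>\<eta>. g i (\<eta> + \<xi>)) x * v x"
        by (simp add: w_def inner_commute)
    qed
    finally show ?thesis
      unfolding m_def v tempered_fourier_band[OF T gs' \<omega>s] by (simp only:)
  qed
  have mz: "m i \<xi> = 0" if "norm \<xi> < r / 2 \<or> R + 2 \<le> norm \<xi>" for i \<xi>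
  proof -
    have "\<omega> \<eta> * g i (\<eta> + \<xi>) = 0" for \<eta>
    proof (rule ccontr)
      assume "\<omega> \<eta> * g i (\<eta> + \<xi>) \<noteq> 0"
      then have *: "r \<le> norm \<eta>" "norm \<eta> \<le> R" "norm (\<eta> + \<xi>) < 2 / k i" using r(2) R g0 by (force simp: not_le)+
      have "2 / k i \<le> r / 2" using k(1)[of i] k(2)[of i] r(1) by (simp add: field_simps)
      moreover have "2 / k i \<le> 2" using k(1)[of i] by (simp add: field_simps)
      ultimately have "norm (\<eta> + \<xi>) < r / 2" "norm (\<eta> + \<xi>) < 2" using *(3) by linarith+
      moreover have "norm \<eta> \<le> norm (\<eta> + \<xi>) + norm \<xi>" "norm \<xi> \<le> norm (\<eta> + \<xi>) + norm \<eta>"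
        using norm_triangle_ineq4[of "\<eta> + \<xi>" \<xi>] norm_triangle_ineq4[of "\<eta> + \<xi>" \<eta>] by auto
      ultimately show False using that * by linarith
    qed
    then have "m i \<xi> = T (fourier (\<lambda>\<eta>. 0))" unfolding meq by (simp only:)
    also have "fourier (\<lambda>\<eta>::'a. 0) = (\<lambda>_. 0)" unfolding fourier_def[abs_def] by simp
    finally show ?thesis using tempered_zero[OF T] by simp
  qed
  have ms: "smooth (m i)" for i
    using smooth_cmult[OF smooth_affine[OF fourier_smooth[OF wr], of i "-1" 0], of ?c] by (simp add: m_def[abs_def])
  have mt: "m i \<in> test_functions" for i by (rule testI_bounded[OF ms, of "R + 2"]) (auto intro: mz)
  have Fm: "fourier (m i) = w i" for i
    by (rule fourier_eqI[OF wr wc]) (auto simp: m_def intro!: schwartz_integrable test_schwartz mt smooth_continuous schwartz_smooth fourier_schwartz)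
  show thesis
  proof (rule that)
    show "annular (m i)" for i unfolding annular_def using mt r(1) mz by (intro conjI exI[of _ "r / 2"]) auto
    show "norm (fourier (m i) x) \<le> (B0 / norm \<gamma>0) * norm (v x)" for i x
    proof -
      have "norm (fourier (m i) x) = norm (v x) * (norm (fourier ?\<gamma> ((1 / k i) *\<^sub>R x)) / norm \<gamma>0)"
        unfolding Fm w_def Fg by (simp only: norm_mult norm_divide)
      also have "\<dots> \<le> norm (v x) * (B0 / norm \<gamma>0)" by (intro mult_left_mono divide_right_mono B0) auto
      finally show ?thesis by (simp only: mult.commute)
    qed
    show "(\<lambda>i. fourier (m i) x) \<longlonglongrightarrow> v x" for x
    proof -
      have "filterlim k at_top sequentially" unfolding k_def[abs_def]
        using filterlim_sequentially_Suc[of "\<lambda>i. real (i + N0)" at_top] filterlim_compose[OF filterlim_real_sequentially filterlim_add_const_nat_at_top[of N0]] by simp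
      then have "(\<lambda>i. 1 / k i) \<longlonglongrightarrow> 0" by (rule tendsto_divide_0[OF tendsto_const filterlim_at_top_imp_at_infinity])
      then have "(\<lambda>i. (1 / k i) *\<^sub>R x) \<longlonglongrightarrow> 0 *\<^sub>R x" by (intro tendsto_intros)
      moreover have "isCont (fourier ?\<gamma>) 0"
        using smooth_continuous[OF schwartz_smooth[OF F\<gamma>]] by (simp add: continuous_on_eq_continuous_at)
      ultimately have "(\<lambda>i. fourier ?\<gamma> ((1 / k i) *\<^sub>R x)) \<longlonglongrightarrow> \<gamma>0"
        using isCont_tendsto_compose[of 0 "fourier ?\<gamma>"] unfolding F0[symmetric] by simp
      then have "(\<lambda>i. v x * (fourier ?\<gamma> ((1 / k i) *\<^sub>R x) / \<gamma>0)) \<longlonglongrightarrow> v x * (\<gamma>0 / \<gamma>0)"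
        by (intro tendsto_intros \<gamma>0)
      then show ?thesis unfolding Fm w_def Fg using \<gamma>0 by simp
    qed
  qed
qed

text \<open>Boundedness of the exponent lets the factor \<open>2 / \<epsilon>\<close> leave the
  power at a uniform cost, so one majorant of finite modular serves every level. The maximum with 1
  in \<open>K\<close> makes the power monotone in the exponent.\<close>

lemma modular_dominated_convergence:
  fixes Q :: "'a::euclidean_space \<Rightarrow> real" and u :: "nat \<Rightarrow> 'a \<Rightarrow> complex"
  assumes [measurable]: "Q \<in> borel_measurable borel" "\<And>k. u k \<in> borel_measurable borel"
      "v \<in> borel_measurable borel" "E \<in> borel_measurable borel"
    and Q: "\<And>x. 0 < Q x" "\<And>x. Q x \<le> b" and \<epsilon>: "0 < \<epsilon>" and E: "(\<integral>\<^sup>+x. ennreal (E x powr Q x) \<partial>lborel) < \<infinity>"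
    and dom: "AE x in lborel. (\<forall>k. norm (u k x) \<le> E x) \<and> (\<lambda>k. u k x) \<longlonglongrightarrow> v x"
  shows "(\<lambda>k. \<integral>\<^sup>+x. ennreal ((norm (u k x - v x) / \<epsilon>) powr Q x) \<partial>lborel) \<longlonglongrightarrow> 0"
proof -
  define K where "K = max 1 (2 / \<epsilon>) powr b"
  have "(\<lambda>k. \<integral>\<^sup>+x. ennreal ((norm (u k x - v x) / \<epsilon>) powr Q x) \<partial>lborel) \<longlonglongrightarrow> (\<integral>\<^sup>+x. 0 \<partial>(lborel :: 'a measure))"
  proof (rule nn_integral_dominated_convergence[where w="\<lambda>x. ennreal K * ennreal (E x powr Q x)"])
    show "(\<integral>\<^sup>+x. ennreal K * ennreal (E x powr Q x) \<partial>lborel) < \<infinity>"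
      using E by (subst nn_integral_cmult) (auto simp: ennreal_mult_less_top)
    show "AE x in lborel. ennreal ((norm (u k x - v x) / \<epsilon>) powr Q x) \<le> ennreal K * ennreal (E x powr Q x)" for k
      using dom
    proof eventually_elim
      case (elim x)
      have v: "norm (v x) \<le> E x"
        by (rule LIMSEQ_le_const2[OF tendsto_norm[OF conjunct2[OF elim]]]) (use elim in auto)
      then have E0: "0 \<le> E x" using norm_ge_zero[of "v x"] by linarith
      have "norm (u k x - v x) \<le> norm (u k x) + norm (v x)" by (rule norm_triangle_ineq4)
      then have "norm (u k x - v x) \<le> 2 * E x" using v elim by (smt (verit))
      then have "norm (u k x - v x) / \<epsilon> \<le> max 1 (2 / \<epsilon>) * E x"
      proof -
        have "norm (u k x - v x) / \<epsilon> \<le> 2 * E x / \<epsilon>" using \<epsilon> \<open>norm (u k x - v x) \<le> 2 * E x\<close> by (intro divide_right_mono) auto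
        also have "2 * E x / \<epsilon> = 2 / \<epsilon> * E x" by simp
        also have "2 / \<epsilon> * E x \<le> max 1 (2 / \<epsilon>) * E x" using E0 by (intro mult_right_mono) auto
        finally show ?thesis .
      qed
      then have "(norm (u k x - v x) / \<epsilon>) powr Q x \<le> (max 1 (2 / \<epsilon>) * E x) powr Q x"
        using Q(1)[of x] \<epsilon> by (intro powr_mono2) auto
      also have "(max 1 (2 / \<epsilon>) * E x) powr Q x = max 1 (2 / \<epsilon>) powr Q x * E x powr Q x"
        by (rule powr_mult)
      also have "max 1 (2 / \<epsilon>) powr Q x * E x powr Q x \<le> K * E x powr Q x"
        unfolding K_def using Q(2)[of x] by (intro mult_right_mono powr_mono) auto
      finally show ?case by (simp add: ennreal_mult[symmetric] K_def ennreal_leI)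
    qed
    show "AE x in lborel. (\<lambda>k. ennreal ((norm (u k x - v x) / \<epsilon>) powr Q x)) \<longlonglongrightarrow> 0"
      using dom
    proof eventually_elim
      case (elim x)
      have "(\<lambda>k. u k x - v x) \<longlonglongrightarrow> v x - v x" using elim by (intro tendsto_intros) auto
      then have "(\<lambda>k. norm (u k x - v x) / \<epsilon>) \<longlonglongrightarrow> 0"
        using \<epsilon> by (intro tendsto_divide_zero tendsto_norm_zero) simp
      then have "(\<lambda>k. (norm (u k x - v x) / \<epsilon>) powr Q x) \<longlonglongrightarrow> 0"
        by (rule tendsto_zero_powrI[OF _ tendsto_const _ Q(1)]) (use \<epsilon> in auto)
      then show ?case using tendsto_ennrealI by fastforce
    qed
  qed measurable
  then show ?thesis by simp
qed

text \<open>A partial sum approximates \<open>h\<close>, and a spectral truncation approximates the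
  partial sum. Each modular at level \<open>\<epsilon> / 2\<close> is below 1/2; the normalised
  distance is at most the larger of the two, so the modulars add up to at most 1.\<close>

lemma annular_dense:
  fixes T :: "'a::euclidean_space distr" and Q :: "'a \<Rightarrow> real" and h :: "'a \<Rightarrow> complex"
  assumes [measurable]: "Q \<in> borel_measurable borel" "h \<in> borel_measurable borel" "E \<in> borel_measurable borel"
    and Q: "\<And>x. 0 < Q x" "\<And>x. Q x \<le> b" and \<epsilon>: "0 < \<epsilon>" and E: "(\<integral>\<^sup>+x. ennreal (E x powr Q x) \<partial>lborel) < \<infinity>"
    and T: "T \<in> tempered" and S: "\<And>J::nat. \<exists>\<omega>. annular \<omega> \<and> S J = (\<lambda>x. T (\<lambda>y. fourier \<omega> (y - x)))"
    and dom: "AE x in lborel. (\<forall>J. norm (S J x) \<le> E x) \<and> (\<lambda>J. S J x) \<longlonglongrightarrow> h x"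
  shows "\<exists>m. annular m \<and> (\<integral>\<^sup>+x. ennreal ((norm (h x - fourier m x) / \<epsilon>) powr Q x) \<partial>lborel) \<le> 1"
proof -
  have Sb[measurable]: "S J \<in> borel_measurable borel" for J
  proof -
    obtain \<omega> where "annular \<omega>" "S J = (\<lambda>x. T (\<lambda>y. fourier \<omega> (y - x)))" using S by blast
    then show ?thesis
      using tempered_translate_borel[OF T fourier_test_schwartz, of \<omega>] by (simp add: annular_def)
  qed
  have half: "(0::ennreal) < 1 / 2" by (simp add: ennreal_zero_less_divide)
  have "(\<lambda>J. \<integral>\<^sup>+x. ennreal ((norm (S J x - h x) / (\<epsilon> / 2)) powr Q x) \<partial>lborel) \<longlonglongrightarrow> 0"
    by (rule modular_dominated_convergence[where E=E and b=b, OF _ _ _ _ Q _ E dom]) (use \<epsilon> in auto)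
  from order_tendstoD(2)[OF this half] obtain J
    where J: "(\<integral>\<^sup>+x. ennreal ((norm (S J x - h x) / (\<epsilon> / 2)) powr Q x) \<partial>lborel) < 1 / 2"
    unfolding eventually_sequentially by blast
  obtain \<omega> where \<omega>: "annular \<omega>" "S J = (\<lambda>x. T (\<lambda>y. fourier \<omega> (y - x)))" using S by blast
  obtain m B where m: "\<And>i::nat. annular (m i)" "\<And>i x. norm (fourier (m i) x) \<le> B * norm (S J x)"
    "\<And>x. (\<lambda>i. fourier (m i) x) \<longlonglongrightarrow> S J x"
    using spectral_truncation[OF T \<omega>] by metis
  have mb[measurable]: "fourier (m i) \<in> borel_measurable borel" for i
    using m(1)[of i] by (intro schwartz_borel fourier_test_schwartz) (simp add: annular_def)
  define B1 where "B1 = max 1 B"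
  have "(\<lambda>i. \<integral>\<^sup>+x. ennreal ((norm (fourier (m i) x - S J x) / (\<epsilon> / 2)) powr Q x) \<partial>lborel) \<longlonglongrightarrow> 0"
  proof (rule modular_dominated_convergence[where E="\<lambda>x. B1 * E x" and b=b, OF _ _ _ _ Q])
    show "AE x in lborel. (\<forall>k. norm (fourier (m k) x) \<le> B1 * E x) \<and> (\<lambda>i. fourier (m i) x) \<longlonglongrightarrow> S J x"
      using dom
    proof eventually_elim
      case (elim x)
      have "norm (fourier (m k) x) \<le> B1 * E x" for k
      proof -
        have "norm (fourier (m k) x) \<le> B * norm (S J x)" by (rule m(2))
        also have "B * norm (S J x) \<le> B1 * norm (S J x)" by (intro mult_right_mono) (auto simp: B1_def)
        also have "B1 * norm (S J x) \<le> B1 * E x" using elim by (intro mult_left_mono) (auto simp: B1_def)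
        finally show ?thesis .
      qed
      then show ?case using m(3) by blast
    qed
    have "(\<integral>\<^sup>+x. ennreal ((B1 * E x) powr Q x) \<partial>lborel) \<le> (\<integral>\<^sup>+x. ennreal (B1 powr b) * ennreal (E x powr Q x) \<partial>lborel)"
    proof (rule nn_integral_mono_AE)
      show "AE x in lborel. ennreal ((B1 * E x) powr Q x) \<le> ennreal (B1 powr b) * ennreal (E x powr Q x)"
        using dom
      proof eventually_elim
        case (elim x)
        then have "0 \<le> E x" using norm_ge_zero[of "S J x"] by (meson order_trans)
        then have "(B1 * E x) powr Q x = B1 powr Q x * E x powr Q x" by (intro powr_mult)
        also have "B1 powr Q x * E x powr Q x \<le> B1 powr b * E x powr Q x"
          using Q(2)[of x] by (intro mult_right_mono powr_mono) (auto simp: B1_def)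
        finally show ?case by (simp add: ennreal_mult[symmetric] ennreal_leI)
      qed
    qed
    also have "(\<integral>\<^sup>+x. ennreal (B1 powr b) * ennreal (E x powr Q x) \<partial>lborel) < \<infinity>"
      using E by (subst nn_integral_cmult) (auto simp: ennreal_mult_less_top)
    finally show "(\<integral>\<^sup>+x. ennreal ((B1 * E x) powr Q x) \<partial>lborel) < \<infinity>" .
  qed (use \<epsilon> in auto)
  from order_tendstoD(2)[OF this half] obtain i
    where i: "(\<integral>\<^sup>+x. ennreal ((norm (fourier (m i) x - S J x) / (\<epsilon> / 2)) powr Q x) \<partial>lborel) < 1 / 2"
    unfolding eventually_sequentially by blast
  have "(\<integral>\<^sup>+x. ennreal ((norm (h x - fourier (m i) x) / \<epsilon>) powr Q x) \<partial>lborel)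
    \<le> (\<integral>\<^sup>+x. ennreal ((norm (S J x - h x) / (\<epsilon> / 2)) powr Q x) + ennreal ((norm (fourier (m i) x - S J x) / (\<epsilon> / 2)) powr Q x) \<partial>lborel)"
  proof (rule nn_integral_mono)
    fix x :: 'a
    let ?a = "norm (S J x - h x) / (\<epsilon> / 2)" and ?b = "norm (fourier (m i) x - S J x) / (\<epsilon> / 2)"
    have "norm (h x - fourier (m i) x) \<le> norm (S J x - h x) + norm (fourier (m i) x - S J x)"
      using norm_triangle_ineq[of "h x - S J x" "S J x - fourier (m i) x"] by (simp add: norm_minus_commute)
    then have "norm (h x - fourier (m i) x) / \<epsilon> \<le> (norm (S J x - h x) + norm (fourier (m i) x - S J x)) / \<epsilon>"
      using \<epsilon> by (intro divide_right_mono) auto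
    also have "(norm (S J x - h x) + norm (fourier (m i) x - S J x)) / \<epsilon> = (?a + ?b) / 2" using \<epsilon> by (simp add: field_simps)
    also have "(?a + ?b) / 2 \<le> max ?a ?b" by (simp add: max_def)
    finally have "(norm (h x - fourier (m i) x) / \<epsilon>) powr Q x \<le> max ?a ?b powr Q x"
      using Q(1)[of x] \<epsilon> by (intro powr_mono2) auto
    also have "max ?a ?b powr Q x \<le> ?a powr Q x + ?b powr Q x" by (simp add: max_def)
    finally show "ennreal ((norm (h x - fourier (m i) x) / \<epsilon>) powr Q x) \<le> ennreal (?a powr Q x) + ennreal (?b powr Q x)"
      by (simp add: ennreal_plus[symmetric] ennreal_leI del: ennreal_plus)
  qed
  also have "(\<integral>\<^sup>+x. ennreal ((norm (S J x - h x) / (\<epsilon> / 2)) powr Q x) + ennreal ((norm (fourier (m i) x - S J x) / (\<epsilon> / 2)) powr Q x) \<partial>lborel)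
    = (\<integral>\<^sup>+x. ennreal ((norm (S J x - h x) / (\<epsilon> / 2)) powr Q x) \<partial>lborel) + (\<integral>\<^sup>+x. ennreal ((norm (fourier (m i) x - S J x) / (\<epsilon> / 2)) powr Q x) \<partial>lborel)"
    by (rule nn_integral_add) measurable
  also have "\<dots> \<le> 1 / 2 + 1 / 2" using J i by (intro add_mono) auto
  also have "1 / 2 + 1 / 2 = (1::ennreal)" by (simp add: add_divide_distrib_ennreal[symmetric])
  finally show ?thesis using m(1) by blast
qed

text \<open>Parseval's formula in bilinear form, with a reflection in place of complex
  conjugation.\<close>

lemma integral_fourier_fourier:
  fixes a b :: "'a::euclidean_space \<Rightarrow> complex"
  assumes a: "a \<in> schwartz" and b: "b \<in> schwartz"
  shows "(\<integral>x. fourier a x * fourier b x \<partial>lborel) = complex_of_real ((2 * pi) ^ DIM('a)) * (\<integral>\<xi>. a \<xi> * b (- \<xi>) \<partial>lborel)"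
proof -
  have R: "(\<lambda>\<xi>. b (- \<xi>)) \<in> schwartz" using schwartz_reflect[OF b, of 0] by simp
  have [measurable]: "b \<in> borel_measurable borel" by (rule schwartz_borel[OF b])
  have FR: "fourier (\<lambda>\<xi>. b (- \<xi>)) y = fourier b (- y)" for y
  proof -
    have "fourier (\<lambda>\<xi>. b (- \<xi>)) y = (\<integral>\<xi>. exp (- \<i> * complex_of_real ((0 - \<xi>) \<bullet> - y)) * b (0 - \<xi>) \<partial>lborel)"
      by (subst fourier_lborel) auto
    also have "\<dots> = (\<integral>\<xi>. exp (- \<i> * complex_of_real (\<xi> \<bullet> - y)) * b \<xi> \<partial>lborel)"
      by (rule integral_reflect[of "\<lambda>\<xi>. exp (- \<i> * complex_of_real (\<xi> \<bullet> - y)) * b \<xi>"]) measurable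
    also have "\<dots> = fourier b (- y)" by (rule fourier_lborel[symmetric]) measurable
    finally show ?thesis .
  qed
  have FF: "fourier (fourier b) z = complex_of_real ((2 * pi) ^ DIM('a)) * b (- z)" for z
    using fourier_reflect_fourier[OF R, of z] unfolding FR by simp
  have "(\<integral>x. fourier a x * fourier b x \<partial>lborel) = (\<integral>x. a x * fourier (fourier b) x \<partial>lborel)"
    by (rule fourier_duality[symmetric, OF schwartz_integrable[OF a] schwartz_integrable[OF fourier_schwartz[OF b]]])
  also have "\<dots> = (\<integral>x. complex_of_real ((2 * pi) ^ DIM('a)) * (a x * b (- x)) \<partial>lborel)" unfolding FF by (simp only: mult_ac)
  finally show ?thesis by (simp only: integral_mult_right_zero)
qed

lemma test_norm_powr:
  fixes \<psi> :: "'a::euclidean_space \<Rightarrow> complex"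
  assumes \<psi>: "\<psi> \<in> test_functions" and r: "0 < r" "\<And>\<xi>. norm \<xi> < r \<Longrightarrow> \<psi> \<xi> = 0"
  shows "(\<lambda>\<xi>. complex_of_real (norm \<xi> powr a) * \<psi> \<xi>) \<in> test_functions"
proof -
  have "closure {\<xi>. complex_of_real (norm \<xi> powr a) * \<psi> \<xi> \<noteq> 0} \<subseteq> closure {\<xi>. \<psi> \<xi> \<noteq> 0}" by (intro closure_mono) auto
  then have "compact (closure {\<xi>. complex_of_real (norm \<xi> powr a) * \<psi> \<xi> \<noteq> 0})"
    using \<psi> compact_Int_closed[of "closure {\<xi>. \<psi> \<xi> \<noteq> 0}" "closure {\<xi>. complex_of_real (norm \<xi> powr a) * \<psi> \<xi> \<noteq> 0}"]
    by (simp add: test_functions_def Int_absorb1)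
  then show ?thesis using smooth_norm_powr_mult[OF test_smooth[OF \<psi>] r(2,1)] by (simp add: test_functions_def)
qed

section \<open>Differences of distributions\<close>

lemma schwartz_norm_mono:
  fixes f :: "'a::euclidean_space \<Rightarrow> complex"
  assumes f: "f \<in> schwartz" and NM: "N \<le> M"
  shows "schwartz_norm N f \<le> schwartz_norm M f"
proof (rule schwartz_norm_le)
  fix x :: 'a and bs :: "'a list" assume bs: "bs \<in> lists Basis" "length bs \<le> N"
  have "(1 + norm x) ^ N * norm (iter_deriv bs f x) \<le> (1 + norm x) ^ M * norm (iter_deriv bs f x)"
    using NM by (intro mult_right_mono power_increasing) auto
  also have "(1 + norm x) ^ M * norm (iter_deriv bs f x) \<le> schwartz_norm M f"
    using bs NM by (intro schwartz_norm_ge[OF f]) auto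
  finally show "(1 + norm x) ^ N * norm (iter_deriv bs f x) \<le> schwartz_norm M f" .
qed

lemma tempered_distr_diff:
  fixes T :: "'a::euclidean_space distr"
  assumes T: "T \<in> tempered" and U: "U \<in> tempered"
  shows "(\<lambda>\<psi>. T \<psi> - U \<psi>) \<in> tempered"
proof -
  obtain C N where C: "0 < C" "\<And>f. f \<in> schwartz \<Longrightarrow> norm (T f) \<le> C * schwartz_norm N f" using tempered_bound[OF T] by blast
  obtain D M where D: "0 < D" "\<And>f. f \<in> schwartz \<Longrightarrow> norm (U f) \<le> D * schwartz_norm M f" using tempered_bound[OF U] by blast
  have "norm (T f - U f) \<le> (C + D) * schwartz_norm (max N M) f" if f: "f \<in> schwartz" for f
  proof -
    have "norm (T f - U f) \<le> norm (T f) + norm (U f)" by (rule norm_triangle_ineq4)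
    also have "norm (T f) + norm (U f) \<le> C * schwartz_norm N f + D * schwartz_norm M f" by (intro add_mono C(2) D(2) f)
    also have "C * schwartz_norm N f + D * schwartz_norm M f \<le> C * schwartz_norm (max N M) f + D * schwartz_norm (max N M) f"
      using C(1) D(1) by (intro add_mono mult_left_mono schwartz_norm_mono[OF f]) auto
    finally show ?thesis by (simp add: distrib_right)
  qed
  moreover have "T (\<lambda>x. c * f x + g x) - U (\<lambda>x. c * f x + g x) = c * (T f - U f) + (T g - U g)"
    if "f \<in> schwartz" "g \<in> schwartz" for f g c
    using tempered_linear[OF T that] tempered_linear[OF U that] by (simp add: algebra_simps)
  ultimately show ?thesis unfolding tempered_def by blast
qed

lemma slow_schwartz: "f \<in> schwartz \<Longrightarrow> slow f"
  unfolding slow_def using schwartz_integrable[of f] schwartz_borel[of f] by (auto intro!: exI[of _ 0])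

lemma slow_diff:
  assumes g: "slow g" and f: "f \<in> schwartz" shows "slow (\<lambda>x. g x - f x)"
proof -
  obtain M where M: "integrable lborel (\<lambda>x. norm (g x) / (1 + norm x) ^ M)" using g unfolding slow_def by blast
  have [measurable]: "g \<in> borel_measurable borel" "f \<in> borel_measurable borel" using slow_borel[OF g] schwartz_borel[OF f] by auto
  have "integrable lborel (\<lambda>x. norm (g x - f x) / (1 + norm x) ^ M)"
  proof (rule Bochner_Integration.integrable_bound[OF Bochner_Integration.integrable_add[OF M integrable_norm[OF schwartz_integrable[OF f]]]])
    show "AE x in lborel. norm (norm (g x - f x) / (1 + norm x) ^ M) \<le> norm (norm (g x) / (1 + norm x) ^ M + norm (f x))"
    proof (rule AE_I2)
      fix x
      have "norm (g x - f x) / (1 + norm x) ^ M \<le> (norm (g x) + norm (f x)) / (1 + norm x) ^ M"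
        by (intro divide_right_mono norm_triangle_ineq4) auto
      also have "(norm (g x) + norm (f x)) / (1 + norm x) ^ M = norm (g x) / (1 + norm x) ^ M + norm (f x) / (1 + norm x) ^ M" by (rule add_divide_distrib)
      also have "norm (f x) / (1 + norm x) ^ M \<le> norm (f x) / 1" by (intro divide_left_mono one_le_power) (auto intro!: zero_less_power add_pos_nonneg)
      finally show "norm (norm (g x - f x) / (1 + norm x) ^ M) \<le> norm (norm (g x) / (1 + norm x) ^ M + norm (f x))"
        by simp
    qed
  qed measurable
  then show ?thesis unfolding slow_def by (intro conjI exI[of _ M]) measurable
qed

text \<open>Dividing the spectrum \<open>m\<close> by the power of the norm is harmless away from
  the origin and yields a Schwartz \<open>\<phi>\<close> with fractional Laplacian
  \<open>fourier m\<close>. Approximating \<open>h\<close> by \<open>fourier m\<close> thus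
  approximates \<open>T\<close> by \<open>\<phi>\<close> in the Sobolev norm.\<close>

lemma frac_laplacian_diff:
  fixes T :: "'a::euclidean_space distr"
  assumes T: "T \<in> tempered" and h: "slow h" and m: "annular m"
    and hT: "\<And>\<psi>. \<psi> \<in> test_functions \<Longrightarrow> 0 \<notin> closure {\<xi>. \<psi> \<xi> \<noteq> 0} \<Longrightarrow>
        (\<integral>x. h x * fourier \<psi> x \<partial>lborel) = T (fourier (\<lambda>\<xi>. complex_of_real (norm \<xi> powr s) * \<psi> \<xi>))"
  shows "\<exists>\<phi> \<in> schwartz. frac_laplacian s (\<lambda>\<psi>. T \<psi> - regular_distr \<phi> \<psi>) (regular_distr (\<lambda>x. h x - fourier m x))"
proof -
  obtain r where r: "0 < r" "\<And>\<xi>. norm \<xi> < r \<Longrightarrow> m \<xi> = 0" using m by (auto simp: annular_def)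
  have mt: "m \<in> test_functions" using m by (simp add: annular_def)
  have ms: "m \<in> schwartz" by (rule test_schwartz[OF mt])
  define m' where "m' \<xi> = complex_of_real (norm \<xi> powr (- s)) * m \<xi>" for \<xi>
  have m't: "m' \<in> test_functions" unfolding m'_def[abs_def] by (rule test_norm_powr[OF mt r])
  have m's: "m' \<in> schwartz" by (rule test_schwartz[OF m't])
  define \<phi> where "\<phi> = fourier m'"
  have \<phi>: "\<phi> \<in> schwartz" unfolding \<phi>_def by (rule fourier_schwartz[OF m's])
  have Fm: "fourier m \<in> schwartz" by (rule fourier_schwartz[OF ms])
  have [measurable]: "h \<in> borel_measurable borel" "fourier m \<in> borel_measurable borel" "\<phi> \<in> borel_measurable borel"
    using slow_borel[OF h] schwartz_borel[OF Fm] schwartz_borel[OF \<phi>] by auto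
  have "fourier_distr (regular_distr (\<lambda>x. h x - fourier m x)) \<psi>
      = fourier_distr (\<lambda>\<psi>. T \<psi> - regular_distr \<phi> \<psi>) (\<lambda>\<xi>. complex_of_real (norm \<xi> powr s) * \<psi> \<xi>)"
    if \<psi>: "\<psi> \<in> test_functions" "0 \<notin> closure {\<xi>. \<psi> \<xi> \<noteq> 0}" for \<psi>
  proof -
    obtain r' where r': "0 < r'" "\<And>\<xi>. norm \<xi> < r' \<Longrightarrow> \<psi> \<xi> = 0" using test_annulus[OF \<psi>] by metis
    let ?\<Psi> = "\<lambda>\<xi>. complex_of_real (norm \<xi> powr s) * \<psi> \<xi>"
    have \<psi>s: "\<psi> \<in> schwartz" by (rule test_schwartz[OF \<psi>(1)])
    have \<Psi>s: "?\<Psi> \<in> schwartz" by (rule test_schwartz[OF test_norm_powr[OF \<psi>(1) r']])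
    have F: "fourier \<psi> \<in> schwartz" "fourier ?\<Psi> \<in> schwartz" by (intro fourier_schwartz \<psi>s \<Psi>s)+
    have [measurable]: "fourier \<psi> \<in> borel_measurable borel" "fourier ?\<Psi> \<in> borel_measurable borel" by (intro schwartz_borel F)+
    \<comment> \<open>The norm is even, so the powers \<open>- s\<close> and \<open>s\<close> cancel
      across the reflection; at the origin \<open>m\<close> vanishes.\<close>
    have "m \<xi> * \<psi> (- \<xi>) = m' \<xi> * ?\<Psi> (- \<xi>)" for \<xi>
    proof (cases "\<xi> = 0")
      case True then show ?thesis using r by (simp add: m'_def)
    next
      case False
      then have "complex_of_real (norm \<xi> powr (- s)) * complex_of_real (norm \<xi> powr s) = 1"
        unfolding of_real_mult[symmetric] powr_add[symmetric] by simp
      then show ?thesis unfolding m'_def by (simp add: mult_ac)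
    qed
    then have e: "(\<integral>x. fourier m x * fourier \<psi> x \<partial>lborel) = (\<integral>x. \<phi> x * fourier ?\<Psi> x \<partial>lborel)"
      unfolding \<phi>_def integral_fourier_fourier[OF ms \<psi>s] integral_fourier_fourier[OF m's \<Psi>s] by (simp only:)
    have "regular_distr (\<lambda>x. h x - fourier m x) (fourier \<psi>) = (\<integral>x. h x * fourier \<psi> x - fourier m x * fourier \<psi> x \<partial>lborel)"
      unfolding left_diff_distrib[symmetric] by (rule regular_distr_lborel) measurable
    also have "\<dots> = (\<integral>x. h x * fourier \<psi> x \<partial>lborel) - (\<integral>x. fourier m x * fourier \<psi> x \<partial>lborel)"
      by (intro Bochner_Integration.integral_diff slow_integrable h slow_schwartz[OF Fm] F(1))
    also have "\<dots> = T (fourier ?\<Psi>) - regular_distr \<phi> (fourier ?\<Psi>)"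
      unfolding hT[OF \<psi>] e by (subst regular_distr_lborel) auto
    finally show ?thesis unfolding fourier_distr_def .
  qed
  moreover have "(\<lambda>\<psi>. T \<psi> - regular_distr \<phi> \<psi>) \<in> tempered" by (intro tempered_distr_diff T slow_tempered slow_schwartz \<phi>)
  moreover have "regular_distr (\<lambda>x. h x - fourier m x) \<in> tempered" by (intro slow_tempered slow_diff h Fm)
  ultimately show ?thesis using \<phi> unfolding frac_laplacian_def by blast
qed

subsection \<open>Interpolation\<close>

text \<open>A nonempty open set is not negligible. This promotes essential bounds on the continuous
  reciprocal exponent to pointwise ones.\<close>

lemma AE_continuous_le:
  fixes f :: "'a::euclidean_space \<Rightarrow> real"
  assumes f: "continuous_on UNIV f" and ae: "AE x in lebesgue. f x \<le> c"
  shows "f x \<le> c"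
proof (rule ccontr)
  assume "\<not> f x \<le> c"
  then have "x \<in> {x. c < f x}" by simp
  then have ne: "{x. c < f x} \<noteq> {}" by blast
  have op: "open {x. c < f x}" by (intro open_Collect_less continuous_on_const f)
  have "{x. c < f x} \<in> null_sets lebesgue"
    using AE_iff_null_sets[of "{x. c < f x}" lebesgue] ae op by (simp add: not_less)
  then have "negligible {x. c < f x}" by (simp add: negligible_iff_null_sets)
  then show False using open_not_negligible[OF op ne] by blast
qed

lemma log_modulus_tendsto: "((\<lambda>y. C / ln (exp 1 + 1 / norm (y - x))) \<longlongrightarrow> 0) (at (x::'a::real_normed_vector))"
proof -
  have "filterlim (\<lambda>y. norm (y - x)) (at_right 0) (at x)"
    unfolding filterlim_at by (auto intro!: tendsto_norm_zero LIM_zero tendsto_ident_at simp: eventually_at_filter)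
  then have "filterlim (\<lambda>y. inverse (norm (y - x))) at_top (at x)"
    by (rule filterlim_compose[OF filterlim_inverse_at_top_right])
  then have "filterlim (\<lambda>y. exp 1 + 1 / norm (y - x)) at_top (at x)"
    unfolding inverse_eq_divide by (intro filterlim_tendsto_add_at_top[OF tendsto_const])
  from filterlim_compose[OF ln_at_top this]
  show ?thesis by (intro tendsto_divide_0[OF tendsto_const] filterlim_at_top_imp_at_infinity)
qed

text \<open>The local condition makes the reciprocal exponent continuous, so the essential bounds
  hold everywhere and \<open>p\<close> is finite throughout. Passing from \<open>1 / p\<close> to
  \<open>p\<close> multiplies differences by at most \<open>b\<^sup>2\<close>, so both log-Hoelder
  conditions survive.\<close>

lemma log_exponents_finite:
  fixes p :: "'a::euclidean_space \<Rightarrow> ereal"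
  assumes p: "p \<in> log_exponents" and p1: "1 < p_minus p" and p2: "p_plus p < \<infinity>"
  obtains P a b K Pinf where "log_exponent P a b K Pinf" "\<And>x. p x = ereal (P x)"
proof -
  obtain C L where pe: "p \<in> exponents"
    and loc: "\<And>x y. \<bar>recip p x - recip p y\<bar> \<le> C / ln (exp 1 + 1 / norm (x - y))"
    and lim: "(recip p \<longlongrightarrow> L) at_infinity"
    and dec: "\<And>x. \<bar>recip p x - L\<bar> \<le> C / ln (exp 1 + norm x)"
    using p unfolding log_exponents_def by blast
  have pm: "p \<in> borel_measurable lebesgue" and pge: "1 \<le> p x" for x using pe by (auto simp: exponents_def)
  have C0: "0 \<le> C" using loc[of 0 0] by simp
  have cont: "continuous_on UNIV (recip p)"
    unfolding continuous_on_eq_continuous_at[OF open_UNIV]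
  proof
    fix x
    have "((\<lambda>y. recip p y - recip p x) \<longlongrightarrow> 0) (at x)"
      by (rule Lim_null_comparison[OF always_eventually log_modulus_tendsto[of C x]]) (use loc in auto)
    then show "isCont (recip p) x" unfolding isCont_def by (simp add: LIM_zero_iff)
  qed
  have AEb: "AE x in lebesgue. p x \<le> p_plus p" unfolding p_plus_def by (rule esssup_AE)
  \<comment> \<open>Without a witness the contradictory statement would hold almost everywhere, and
    \<open>AE_continuous_le\<close> would give 1 \<le> 0.\<close>
  have nonempty: "\<exists>x. Q x" if "AE x in (lebesgue :: 'a measure). Q x" for Q
  proof (rule ccontr)
    assume "\<not> (\<exists>x. Q x)"
    then have "AE x in (lebesgue :: 'a measure). False" using that by simp
    then show False using AE_continuous_le[of "\<lambda>_. 1" 0] by auto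
  qed
  have "1 \<le> p_plus p" using nonempty[OF AEb] pge order_trans by blast
  then obtain b where b: "p_plus p = ereal b" "1 \<le> b" using p2 by (cases "p_plus p") auto
  obtain c where c: "1 < c" "AE x in lebesgue. c \<le> p x" using p1 unfolding p_minus_def less_Sup_iff by blast
  have "AE x in lebesgue. c \<le> p x \<and> p x \<le> ereal b" using c(2) AEb unfolding b(1) by eventually_elim simp
  from nonempty[OF this] have "c \<le> ereal b" by (auto intro: order_trans)
  then obtain a where a: "c = ereal a" "1 < a" using c(1) by (cases c) auto
  have rcp: "recip p x = 1 / t" if "p x = ereal t" "1 \<le> t" for x t
    using that by (simp add: recip_def one_ereal_def)
  have r1: "1 / b \<le> recip p x" for x
  proof -
    have "AE x in lebesgue. - recip p x \<le> - (1 / b)"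
      using AEb unfolding b(1)
    proof eventually_elim
      case (elim x)
      with pge[of x] obtain t where t: "p x = ereal t" "1 \<le> t" "t \<le> b" by (cases "p x") auto
      then show ?case unfolding rcp[OF t(1,2)] by (simp add: frac_le)
    qed
    from AE_continuous_le[OF _ this, of x] show ?thesis using cont by (simp add: continuous_on_minus)
  qed
  have r2: "recip p x \<le> 1 / a" for x
  proof (rule AE_continuous_le[OF cont])
    show "AE x in lebesgue. recip p x \<le> 1 / a"
      using AEb c(2) unfolding b(1) a(1)
    proof eventually_elim
      case (elim x)
      with a(2) obtain t where t: "p x = ereal t" "a \<le> t" by (cases "p x") auto
      then show ?case using a(2) rcp[OF t(1)] by (simp add: frac_le)
    qed
  qed
  have b0: "0 < b" "0 < a" using b a by auto
  have r0: "0 < recip p x" for x using r1[of x] b0 by (smt (verit) divide_pos_pos)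
  define P where "P x = 1 / recip p x" for x
  have pP: "p x = ereal (P x)" for x
  proof (cases "p x")
    case (real t)
    then show ?thesis using rcp[OF real] pge[of x] by (simp add: P_def)
  next
    case PInf
    then show ?thesis using r0[of x] by (simp add: recip_def)
  qed (use pge[of x] in auto)
  have Pab: "a \<le> P x" "P x \<le> b" for x
    using r1[of x] r2[of x] r0[of x] b0 unfolding P_def by (simp_all add: field_simps)
  have L: "1 / b \<le> L" "L \<le> 1 / a"
    by (rule tendsto_lowerbound[OF lim always_eventually trivial_limit_at_infinity], simp add: r1)
      (rule tendsto_upperbound[OF lim always_eventually trivial_limit_at_infinity], simp add: r2)
  have L0: "0 < L" using L(1) b0 by (smt (verit) divide_pos_pos)
  have Linf: "a \<le> 1 / L" "1 / L \<le> b" using L L0 b0 by (simp_all add: field_simps)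
  have diff: "\<bar>1 / u - 1 / v\<bar> \<le> b\<^sup>2 * \<bar>u - v\<bar>" if "0 < u" "0 < v" "1 / u \<le> b" "1 / v \<le> b" for u v :: real
  proof -
    have "1 / u - 1 / v = (1 / u) * (1 / v) * (v - u)" using that by (simp add: field_simps)
    then have "\<bar>1 / u - 1 / v\<bar> = (1 / u) * (1 / v) * \<bar>u - v\<bar>" using that by (simp add: abs_mult abs_minus_commute)
    also have "(1 / u) * (1 / v) * \<bar>u - v\<bar> \<le> (b * b) * \<bar>u - v\<bar>" using that b0 by (intro mult_right_mono mult_mono) auto
    finally show ?thesis by (simp add: power2_eq_square)
  qed
  have Pd: "1 / recip p x \<le> b" for x using Pab(2)[of x] by (simp add: P_def)
  have "log_exponent P a b (b\<^sup>2 * C) (1 / L)"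
  proof
    have "continuous_on UNIV P" unfolding P_def[abs_def] using r0 by (intro continuous_on_divide continuous_on_const cont) (auto simp: less_le)
    then show "P \<in> borel_measurable borel" by (rule borel_measurable_continuous_onI)
    show "\<bar>P x - P y\<bar> \<le> b\<^sup>2 * C / ln (exp 1 + 1 / norm (x - y))" for x y
    proof -
      have "\<bar>P x - P y\<bar> \<le> b\<^sup>2 * \<bar>recip p x - recip p y\<bar>" unfolding P_def by (rule diff[OF r0 r0 Pd Pd])
      also have "b\<^sup>2 * \<bar>recip p x - recip p y\<bar> \<le> b\<^sup>2 * (C / ln (exp 1 + 1 / norm (x - y)))" by (intro mult_left_mono loc) auto
      finally show ?thesis by simp
    qed
    show "\<bar>P x - 1 / L\<bar> \<le> b\<^sup>2 * C / ln (exp 1 + norm x)" for x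
    proof -
      have "\<bar>P x - 1 / L\<bar> \<le> b\<^sup>2 * \<bar>recip p x - L\<bar>" unfolding P_def by (rule diff[OF r0 L0 Pd Linf(2)])
      also have "b\<^sup>2 * \<bar>recip p x - L\<bar> \<le> b\<^sup>2 * (C / ln (exp 1 + norm x))" by (intro mult_left_mono dec) auto
      finally show ?thesis by simp
    qed
  qed (use a Pab Linf C0 in auto)
  then show thesis using pP by (rule that)
qed

section \<open>Borel representatives and slow growth of functions with finite modular\<close>

lemma borel_representative:
  fixes g :: "'a::euclidean_space \<Rightarrow> complex"
  assumes [measurable]: "g \<in> borel_measurable lebesgue"
  obtains g' where "g' \<in> borel_measurable borel" "AE x in lborel. g x = g' x"
proof -
  have "(\<lambda>x. Re (g x)) \<in> borel_measurable (completion lborel)" "(\<lambda>x. Im (g x)) \<in> borel_measurable (completion lborel)" by measurable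
  from this[THEN completion_ex_borel_measurable_real] obtain u v
    where [measurable]: "u \<in> borel_measurable lborel" "v \<in> borel_measurable lborel"
      and ae: "AE x in lborel. Re (g x) = u x" "AE x in lborel. Im (g x) = v x" by blast
  have "AE x in lborel. g x = Complex (u x) (v x)" using ae by eventually_elim (simp add: complex_eq_iff)
  moreover have "(\<lambda>x. Complex (u x) (v x)) \<in> borel_measurable borel" unfolding Complex_eq by measurable
  ultimately show thesis by (rule that[rotated])
qed

lemma slow_represents:
  assumes h: "slow h" shows "represents h (regular_distr h)"
  unfolding represents_def
proof (intro conjI allI impI ballI refl slow_tempered[OF h])
  have [measurable]: "h \<in> borel_measurable borel" using h by measurable
  show "h \<in> borel_measurable lebesgue" by (rule measurable_completion) simp
  obtain M where M: "integrable lborel (\<lambda>x. norm (h x) / (1 + norm x) ^ M)" using h unfolding slow_def by blast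
  fix S :: "'a set" assume S: "compact S"
  then obtain R where R: "0 < R" "\<And>x. x \<in> S \<Longrightarrow> norm x \<le> R" using compact_imp_bounded bounded_pos by metis
  have [measurable]: "S \<in> sets borel" using S by (simp add: borel_compact)
  have "integrable lborel (\<lambda>x. indicator S x *\<^sub>R h x)"
  proof (rule Bochner_Integration.integrable_bound[OF integrable_mult_right[OF M, of "(1 + R) ^ M"]])
    show "AE x in lborel. norm (indicat_real S x *\<^sub>R h x) \<le> norm ((1 + R) ^ M * (norm (h x) / (1 + norm x) ^ M))"
    proof (rule AE_I2)
      fix x :: 'a
      show "norm (indicat_real S x *\<^sub>R h x) \<le> norm ((1 + R) ^ M * (norm (h x) / (1 + norm x) ^ M))"
      proof (cases "x \<in> S")
        case True
        have "0 < (1 + norm x) ^ M" by (intro zero_less_power add_pos_nonneg) auto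
        then have "norm (h x) = (1 + norm x) ^ M * (norm (h x) / (1 + norm x) ^ M)" by (metis less_irrefl nonzero_mult_div_cancel_left times_divide_eq_right)
        also have "(1 + norm x) ^ M * (norm (h x) / (1 + norm x) ^ M) \<le> (1 + R) ^ M * (norm (h x) / (1 + norm x) ^ M)"
          using R True by (intro mult_right_mono power_mono) auto
        finally show ?thesis using True R(1) by simp
      qed simp
    qed
  qed measurable
  then show "set_integrable lebesgue S h" unfolding set_integrable_def by (subst integrable_completion) auto
qed

text \<open>Since \<open>v \<le> 1 + v powr P\<close>, a finite modular gives integrability against
  the decay weight. The affine bound by \<open>1 + v\<close> covers both \<open>g\<close> and a
  power of its maximal function.\<close>

lemma slow_Lp:
  fixes P :: "'a::euclidean_space \<Rightarrow> real" and u :: "'a \<Rightarrow> complex"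
  assumes [measurable]: "u \<in> borel_measurable borel" "P \<in> borel_measurable borel" "v \<in> borel_measurable borel"
    and P: "\<And>x. 1 \<le> P x" and v: "\<And>x. 0 \<le> v x" "AE x in lborel. norm (u x) \<le> c * (1 + v x)"
    and int: "(\<integral>\<^sup>+x. ennreal (v x powr P x) \<partial>lborel) < \<infinity>"
  shows "slow u"
proof -
  have d: "integrable lborel (\<lambda>x::'a. 1 / (1 + norm x) ^ (DIM('a) + 1))" by (rule integrable_decay)
  have i: "integrable lborel (\<lambda>x. v x powr P x)"
    using int by (intro integrableI_bounded) (auto simp: less_top)
  have "integrable lborel (\<lambda>x. norm (u x) / (1 + norm x) ^ (DIM('a) + 1))"
  proof (rule Bochner_Integration.integrable_bound)
    show "integrable lborel (\<lambda>x. \<bar>c\<bar> * (2 * (1 / (1 + norm x) ^ (DIM('a) + 1)) + v x powr P x))"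
      by (intro integrable_mult_right Bochner_Integration.integrable_add d i)
    show "AE x in lborel. norm (norm (u x) / (1 + norm x) ^ (DIM('a) + 1)) \<le> norm (\<bar>c\<bar> * (2 * (1 / (1 + norm x) ^ (DIM('a) + 1)) + v x powr P x))"
      using v(2)
    proof eventually_elim
      case (elim x)
      let ?d = "(1 + norm x) ^ (DIM('a) + 1)"
      have d1: "1 \<le> ?d" by (rule one_le_power) simp
      have "v x \<le> 1 + v x powr P x"
      proof (cases "v x \<le> 1")
        case True then show ?thesis by (meson add_increasing2 powr_ge_zero)
      next
        case False
        then have "v x powr 1 \<le> v x powr P x" using P by (intro powr_mono) auto
        then show ?thesis using False by simp
      qed
      then have "c * (1 + v x) \<le> \<bar>c\<bar> * (2 + v x powr P x)" using v(1)[of x] by (intro mult_mono) auto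
      then have "norm (u x) / ?d \<le> \<bar>c\<bar> * (2 + v x powr P x) / ?d" using elim d1 by (intro divide_right_mono) auto
      also have "\<bar>c\<bar> * (2 + v x powr P x) / ?d = \<bar>c\<bar> * (2 * (1 / ?d) + v x powr P x / ?d)" by (simp only: times_divide_eq_right add_divide_distrib[symmetric] mult_1_right)
      also have "\<bar>c\<bar> * (2 * (1 / ?d) + v x powr P x / ?d) \<le> \<bar>c\<bar> * (2 * (1 / ?d) + v x powr P x / 1)"
        using d1 by (intro mult_left_mono add_left_mono divide_left_mono) auto
      finally show ?case using d1 by simp
    qed
  qed measurable
  then show ?thesis unfolding slow_def by (intro conjI exI[of _ "DIM('a) + 1"]) measurable
qed

context log_exponent
begin

text \<open>Dividing by \<open>l\<close> brings the modular to at most 1 for the maximal theorem,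
  and raising the majorant to \<open>P / (1 - \<theta>)\<close> undoes the power
  \<open>1 - \<theta>\<close>. The level \<Lambda> lies strictly above the bound because the bound
  is 0 when the Besov norm is, and levels must be positive.\<close>

theorem sobolev_besov_representative:
  fixes s s1 \<beta> \<theta> :: real
  assumes s1: "0 \<le> s1" "s1 < s" and \<beta>: "0 < \<beta>" and \<theta>: "\<theta> = (s - s1) / (\<beta> + s)"
  shows "\<exists>C>0. \<forall>(T :: 'a distr) U g l. T \<in> tempered \<longrightarrow> besov_norm \<beta> T < \<infinity> \<longrightarrow>
    frac_laplacian s T U \<longrightarrow> represents g U \<longrightarrow> 0 < l \<longrightarrow> (\<integral>\<^sup>+x. ennreal ((norm (g x) / l) powr P x) \<partial>lebesgue) \<le> 1 \<longrightarrow>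
    (\<exists>h S E. E \<in> borel_measurable borel \<and> (\<integral>\<^sup>+x. ennreal (E x powr (P x / (1 - \<theta>))) \<partial>lborel) < \<infinity> \<and> littlewood_paley_limit s1 T E h S \<and>
      (\<forall>\<Lambda>. C * (l powr (1 - \<theta>) * enn2real (besov_norm \<beta> T) powr \<theta>) < \<Lambda> \<longrightarrow>
        (\<integral>\<^sup>+x. ennreal ((norm (h x) / \<Lambda>) powr (P x / (1 - \<theta>))) \<partial>lborel) \<le> 1))"
proof -
  have th: "0 < \<theta>" "\<theta> < 1" using s1 \<beta> by (auto simp: \<theta> divide_less_eq)
  have Q: "0 < P x / (1 - \<theta>)" "1 \<le> P x / (1 - \<theta>)" "P x / (1 - \<theta>) \<le> b / (1 - \<theta>)" for x
    using th P_pos[of x] Pb[of x] by (simp_all add: divide_right_mono pos_le_divide_eq)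
  from littlewood_paley[OF s1 \<beta> \<theta>, where 'a='a] obtain A where A: "0 < A" and LP: "\<forall>(T :: 'a distr) U g. T \<in> tempered \<longrightarrow> besov_norm \<beta> T < \<infinity> \<longrightarrow>
    frac_laplacian s T U \<longrightarrow> slow g \<longrightarrow> (\<forall>f \<in> schwartz. U f = (\<integral>x. g x * f x \<partial>lborel)) \<longrightarrow>
    (AE x in lborel. maximal (\<lambda>y. ennreal (norm (g y))) x < \<infinity>) \<longrightarrow>
    slow (\<lambda>x. complex_of_real (enn2real (maximal (\<lambda>y. ennreal (norm (g y))) x) powr (1 - \<theta>))) \<longrightarrow>
    (\<exists>h S. littlewood_paley_limit s1 T (\<lambda>x. A * (enn2real (maximal (\<lambda>y. ennreal (norm (g y))) x) powr (1 - \<theta>) * enn2real (besov_norm \<beta> T) powr \<theta>)) h S)"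
    by (elim exE conjE) (rule that)
  obtain D where D: "1 \<le> D" "\<And>f. f \<in> borel_measurable borel \<Longrightarrow> (\<And>y. 0 \<le> f y) \<Longrightarrow>
    (\<integral>\<^sup>+y. ennreal (f y powr P y) \<partial>lborel) \<le> 1 \<Longrightarrow>
    (\<integral>\<^sup>+x. epow (maximal (\<lambda>y. ennreal (f y)) x) (P x) \<partial>lborel) \<le> ennreal D"
    using modular_maximal by blast
  show ?thesis
  proof (intro exI[of _ "A * D"] conjI allI impI)
    show "0 < A * D" using A D(1) by simp
    fix T U :: "'a distr" and g l
    assume T: "T \<in> tempered" and B: "besov_norm \<beta> T < \<infinity>" and FL: "frac_laplacian s T U"
      and g: "represents g U" and l: "0 < l" and mod: "(\<integral>\<^sup>+x. ennreal ((norm (g x) / l) powr P x) \<partial>lebesgue) \<le> 1"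
    define \<nu> where "\<nu> = enn2real (besov_norm \<beta> T) powr \<theta>"
    have \<nu>: "0 \<le> \<nu>" by (simp add: \<nu>_def)
    have gm: "g \<in> borel_measurable lebesgue" using g by (simp add: represents_def)
    from borel_representative[OF this] obtain g' where [measurable]: "g' \<in> borel_measurable borel"
      and gg: "AE x in lborel. g x = g' x" .
    define f where "f y = norm (g' y) / l" for y
    have f0: "0 \<le> f y" for y using l by (simp add: f_def)
    have [measurable]: "f \<in> borel_measurable borel" unfolding f_def[abs_def] by measurable
    have fmod: "(\<integral>\<^sup>+y. ennreal (f y powr P y) \<partial>lborel) \<le> 1"
    proof -
      have "(\<integral>\<^sup>+y. ennreal (f y powr P y) \<partial>lborel) = (\<integral>\<^sup>+y. ennreal ((norm (g y) / l) powr P y) \<partial>lborel)"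
        unfolding f_def by (rule nn_integral_cong_AE) (use gg in eventually_elim, simp)
      then show ?thesis using mod by (simp only: nn_integral_completion)
    qed
    define N where "N = maximal (\<lambda>y. ennreal (f y))"
    define n where "n x = enn2real (N x)" for x
    have [measurable]: "N \<in> borel_measurable borel" unfolding N_def by measurable
    have [measurable]: "n \<in> borel_measurable borel" unfolding n_def[abs_def] by measurable
    have n0: "0 \<le> n x" for x by (simp add: n_def)
    have intN: "(\<integral>\<^sup>+x. epow (N x) (P x) \<partial>lborel) \<le> ennreal D" unfolding N_def by (rule D(2)[OF _ f0 fmod]) measurable
    have "AE x in lborel. epow (N x) (P x) \<noteq> \<infinity>"
      using intN by (intro nn_integral_noteq_infinite) (auto simp: top_unique)
    then have finN: "AE x in lborel. N x < \<infinity>"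
      by eventually_elim (auto simp: epow_def less_top split: if_splits)
    have intn: "(\<integral>\<^sup>+x. ennreal (n x powr P x) \<partial>lborel) \<le> ennreal D"
    proof -
      have "(\<integral>\<^sup>+x. ennreal (n x powr P x) \<partial>lborel) = (\<integral>\<^sup>+x. epow (N x) (P x) \<partial>lborel)"
        by (rule nn_integral_cong_AE) (use finN in eventually_elim, simp add: epow_def n_def)
      with intN show ?thesis by simp
    qed
    then have intn': "(\<integral>\<^sup>+x. ennreal (n x powr P x) \<partial>lborel) < \<infinity>" by (rule le_less_trans) simp
    have MN: "maximal (\<lambda>y. ennreal (norm (g' y))) x = ennreal l * N x" for x
    proof -
      have "ennreal (norm (g' y)) = ennreal l * ennreal (f y)" for y
        using l by (simp add: f_def ennreal_mult[symmetric])
      then show ?thesis unfolding N_def by (simp add: maximal_cmult)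
    qed
    have Mn: "enn2real (maximal (\<lambda>y. ennreal (norm (g' y))) x) = l * n x" for x
      unfolding MN n_def using l by (simp add: enn2real_mult)
    have slowg: "slow g'"
    proof (rule slow_Lp[where P=P and v=f and c=l])
      show "AE x in lborel. norm (g' x) \<le> l * (1 + f x)" using l by (simp add: f_def distrib_left)
      show "(\<integral>\<^sup>+y. ennreal (f y powr P y) \<partial>lborel) < \<infinity>" using fmod by (rule le_less_trans) simp
    qed (use P_pos f0 in \<open>auto intro: less_imp_le\<close>)
    have slowM: "slow (\<lambda>x. complex_of_real (enn2real (maximal (\<lambda>y. ennreal (norm (g' y))) x) powr (1 - \<theta>)))"
      unfolding Mn
    proof (rule slow_Lp[where P=P and v=n and c="1 + l"])
      show "AE x in lborel. norm (complex_of_real ((l * n x) powr (1 - \<theta>))) \<le> (1 + l) * (1 + n x)"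
      proof (rule AE_I2)
        fix x :: 'a
        have "(l * n x) powr (1 - \<theta>) \<le> 1 + l * n x"
        proof (cases "l * n x \<le> 1")
          case True
          then have "(l * n x) powr (1 - \<theta>) \<le> 1" using l n0[of x] th by (intro powr_le1) auto
          then show ?thesis using l n0[of x] by (simp add: add_increasing2)
        next
          case False
          then have "(l * n x) powr (1 - \<theta>) \<le> (l * n x) powr 1" using th by (intro powr_mono) auto
          then show ?thesis using False by simp
        qed
        also have "1 + l * n x \<le> (1 + l) * (1 + n x)" using l n0[of x] by (simp add: algebra_simps)
        finally show "norm (complex_of_real ((l * n x) powr (1 - \<theta>))) \<le> (1 + l) * (1 + n x)" by simp
      qed
    qed (use P_pos n0 intn' in \<open>auto intro: less_imp_le\<close>)
    have Ug: "\<forall>f \<in> schwartz. U f = (\<integral>x. g' x * f x \<partial>lborel)"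
    proof
      fix f :: "'a \<Rightarrow> complex" assume f: "f \<in> schwartz"
      show "U f = (\<integral>x. g' x * f x \<partial>lborel)"
      proof (rule represents_schwartz[OF _ slowg _ f])
        show "U \<in> tempered" using g by (simp add: represents_def)
        fix \<phi> :: "'a \<Rightarrow> complex" assume \<phi>: "\<phi> \<in> test_functions"
        have [measurable]: "\<phi> \<in> borel_measurable borel" by (rule schwartz_borel[OF test_schwartz[OF \<phi>]])
        have "U \<phi> = (\<integral>x. g x * \<phi> x \<partial>lebesgue)" using g \<phi> by (simp add: represents_def regular_distr_def)
        also have "\<dots> = (\<integral>x. g' x * \<phi> x \<partial>lebesgue)"
        proof (rule integral_cong_AE)
          have "AE x in lebesgue. g x = g' x" using gg by (simp add: AE_completion_iff)
          then show "AE x in lebesgue. g x * \<phi> x = g' x * \<phi> x" by eventually_elim simp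
          have \<phi>l: "\<phi> \<in> borel_measurable lebesgue" "g' \<in> borel_measurable lebesgue" by (rule measurable_completion; simp)+
          show "(\<lambda>x. g x * \<phi> x) \<in> borel_measurable lebesgue" "(\<lambda>x. g' x * \<phi> x) \<in> borel_measurable lebesgue"
            by (intro borel_measurable_times gm \<phi>l)+
        qed
        also have "\<dots> = (\<integral>x. g' x * \<phi> x \<partial>lborel)" by (rule integral_completion) measurable
        finally show "U \<phi> = (\<integral>x. g' x * \<phi> x \<partial>lborel)" .
      qed
    qed
    have finM: "AE x in lborel. maximal (\<lambda>y. ennreal (norm (g' y))) x < \<infinity>"
      using finN by eventually_elim (simp add: MN ennreal_mult_less_top)
    define \<Lambda>0 where "\<Lambda>0 = A * (l powr (1 - \<theta>) * \<nu>)"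
    have \<Lambda>0: "0 \<le> \<Lambda>0" using A \<nu> by (simp add: \<Lambda>0_def)
    define E where "E x = \<Lambda>0 * n x powr (1 - \<theta>)" for x
    have Eeq: "A * (enn2real (maximal (\<lambda>y. ennreal (norm (g' y))) x) powr (1 - \<theta>) * enn2real (besov_norm \<beta> T) powr \<theta>) = E x" for x
      unfolding Mn E_def \<Lambda>0_def \<nu>_def by (simp add: powr_mult)
    have [measurable]: "E \<in> borel_measurable borel" unfolding E_def[abs_def] by measurable
    have npow: "(c * n x powr (1 - \<theta>)) powr (P x / (1 - \<theta>)) = c powr (P x / (1 - \<theta>)) * n x powr P x" for c x
      using th by (simp add: powr_mult powr_powr)
    from LP[rule_format, OF T B FL slowg Ug[rule_format] finM slowM, unfolded Eeq] obtain h S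
      where hS: "littlewood_paley_limit s1 T E h S" by blast
    then have "AE x in lborel. (\<forall>J. norm (S J x) \<le> E x) \<and> (\<lambda>J. S J x) \<longlonglongrightarrow> h x" by (simp add: littlewood_paley_limit_def)
    then have hE: "AE x in lborel. norm (h x) \<le> E x"
      by eventually_elim (rule LIMSEQ_le_const2[OF tendsto_norm], auto)
    \<comment> \<open>The maximum with 1 treats small and large \<open>\<Lambda>0\<close> alike,
      given only an upper bound on the exponent.\<close>
    have intE: "(\<integral>\<^sup>+x. ennreal (E x powr (P x / (1 - \<theta>))) \<partial>lborel) < \<infinity>"
    proof -
      let ?k = "max 1 \<Lambda>0 powr (b / (1 - \<theta>))"
      have "(\<integral>\<^sup>+x. ennreal (E x powr (P x / (1 - \<theta>))) \<partial>lborel) \<le> (\<integral>\<^sup>+x. ennreal ?k * ennreal (n x powr P x) \<partial>lborel)"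
      proof (rule nn_integral_mono)
        fix x
        have "\<Lambda>0 powr (P x / (1 - \<theta>)) \<le> max 1 \<Lambda>0 powr (P x / (1 - \<theta>))" using \<Lambda>0 Q(1)[of x] by (intro powr_mono2) auto
        also have "max 1 \<Lambda>0 powr (P x / (1 - \<theta>)) \<le> ?k" using Q(3)[of x] by (intro powr_mono) auto
        finally have "E x powr (P x / (1 - \<theta>)) \<le> ?k * n x powr P x" unfolding E_def npow by (intro mult_right_mono) auto
        then show "ennreal (E x powr (P x / (1 - \<theta>))) \<le> ennreal ?k * ennreal (n x powr P x)"
          by (simp add: ennreal_mult[symmetric] ennreal_leI)
      qed
      also have "(\<integral>\<^sup>+x. ennreal ?k * ennreal (n x powr P x) \<partial>lborel) < \<infinity>"
        using intn' by (subst nn_integral_cmult) (auto simp: ennreal_mult_less_top)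
      finally show ?thesis .
    qed
    \<comment> \<open>The exponent \<open>P x / (1 - \<theta>)\<close> is at least 1, so a further
      division by \<open>D \<ge> 1\<close> shrinks the modular at least by the factor
      \<open>D\<close>. This turns the maximal bound \<open>D\<close> into 1.\<close>
    have final: "(\<integral>\<^sup>+x. ennreal ((norm (h x) / \<Lambda>) powr (P x / (1 - \<theta>))) \<partial>lborel) \<le> 1"
      if \<Lambda>: "A * D * (l powr (1 - \<theta>) * \<nu>) < \<Lambda>" for \<Lambda>
    proof -
      have D\<Lambda>: "D * \<Lambda>0 < \<Lambda>" using \<Lambda> by (simp add: \<Lambda>0_def mult_ac)
      have D0: "0 < D" using D(1) by simp
      have \<Lambda>p: "0 < \<Lambda>" using D\<Lambda> D0 \<Lambda>0 by (smt (verit) mult_nonneg_nonneg)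
      have "(\<integral>\<^sup>+x. ennreal ((norm (h x) / \<Lambda>) powr (P x / (1 - \<theta>))) \<partial>lborel) \<le> (\<integral>\<^sup>+x. ennreal (1 / D) * ennreal (n x powr P x) \<partial>lborel)"
      proof (rule nn_integral_mono_AE)
        show "AE x in lborel. ennreal ((norm (h x) / \<Lambda>) powr (P x / (1 - \<theta>))) \<le> ennreal (1 / D) * ennreal (n x powr P x)"
          using hE
        proof eventually_elim
          case (elim x)
          have "norm (h x) / \<Lambda> \<le> E x / \<Lambda>" using elim \<Lambda>p by (intro divide_right_mono) auto
          also have "E x / \<Lambda> = (\<Lambda>0 / \<Lambda>) * n x powr (1 - \<theta>)" by (simp add: E_def)
          also have "(\<Lambda>0 / \<Lambda>) * n x powr (1 - \<theta>) \<le> (1 / D) * n x powr (1 - \<theta>)"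
            using D\<Lambda> D0 \<Lambda>p by (intro mult_right_mono) (auto simp: field_simps)
          finally have "(norm (h x) / \<Lambda>) powr (P x / (1 - \<theta>)) \<le> ((1 / D) * n x powr (1 - \<theta>)) powr (P x / (1 - \<theta>))"
            using Q(1)[of x] \<Lambda>p by (intro powr_mono2) auto
          also have "((1 / D) * n x powr (1 - \<theta>)) powr (P x / (1 - \<theta>)) = (1 / D) powr (P x / (1 - \<theta>)) * n x powr P x" by (rule npow)
          also have "(1 / D) powr (P x / (1 - \<theta>)) * n x powr P x \<le> (1 / D) powr 1 * n x powr P x"
            using D(1) Q(2)[of x] by (intro mult_right_mono powr_mono') auto
          finally show ?case using D0 by (simp add: ennreal_mult[symmetric] ennreal_leI)
        qed
      qed
      also have "(\<integral>\<^sup>+x. ennreal (1 / D) * ennreal (n x powr P x) \<partial>lborel) = ennreal (1 / D) * (\<integral>\<^sup>+x. ennreal (n x powr P x) \<partial>lborel)"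
        by (rule nn_integral_cmult) measurable
      also have "\<dots> \<le> ennreal (1 / D) * ennreal D" by (intro mult_left_mono intn) auto
      also have "ennreal (1 / D) * ennreal D = 1" using D0 by (simp add: ennreal_mult[symmetric])
      finally show ?thesis .
    qed
    show "\<exists>h S E. E \<in> borel_measurable borel \<and> (\<integral>\<^sup>+x. ennreal (E x powr (P x / (1 - \<theta>))) \<partial>lborel) < \<infinity> \<and> littlewood_paley_limit s1 T E h S \<and>
      (\<forall>\<Lambda>. A * D * (l powr (1 - \<theta>) * enn2real (besov_norm \<beta> T) powr \<theta>) < \<Lambda> \<longrightarrow>
        (\<integral>\<^sup>+x. ennreal ((norm (h x) / \<Lambda>) powr (P x / (1 - \<theta>))) \<partial>lborel) \<le> 1)"
      by (rule exI[of _ h], rule exI[of _ S], rule exI[of _ E], intro conjI allI impI)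
        (use hS intE final in \<open>simp_all add: \<nu>_def\<close>)
  qed
qed

end

lemma Lp_norm_le:
  fixes h :: "'a::euclidean_space \<Rightarrow> 'b::real_normed_vector"
  assumes "0 < l" "(\<integral>\<^sup>+x. ennreal ((norm (h x) / l) powr real_of_ereal (p x)) \<partial>lborel) \<le> 1"
  shows "Lp_norm p h \<le> ennreal l"
  unfolding Lp_norm_def nn_integral_completion using assms by (intro Inf_lower) blast

text \<open>The estimate is proved at each admissible level \<open>l\<close> and passed to the
  infimum along levels below \<open>X0 + 1 / real (Suc i)\<close>. A positive slack is required,
  since the infimum need not be attained and may be 0.\<close>

lemma (in log_exponent) sobolev_besov_interpolation:
  fixes p q :: "'a \<Rightarrow> ereal" and s s1 \<beta> \<theta> :: real
  assumes s1: "0 \<le> s1" "s1 < s" and \<beta>: "0 < \<beta>" and \<theta>: "\<theta> = (s - s1) / (\<beta> + s)"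
    and p: "\<And>x. p x = ereal (P x)" and q: "q = (\<lambda>x. p x / ereal (1 - \<theta>))"
  shows "\<exists>C>0. \<forall>T. T \<in> sobolev s p \<longrightarrow> T \<in> besov \<beta> \<longrightarrow> T \<in> sobolev s1 q \<and>
      enn2real (sobolev_norm s1 q T) \<le> C * enn2real (sobolev_norm s p T) powr (1 - \<theta>) * enn2real (besov_norm \<beta> T) powr \<theta>"
proof -
  have th: "0 < \<theta>" "\<theta> < 1" using s1 \<beta> by (auto simp: \<theta> divide_less_eq)
  have s0: "0 < s" using s1 by simp
  have qr: "real_of_ereal (q x) = P x / (1 - \<theta>)" for x using th by (simp add: q p)
  have pr: "real_of_ereal (p x) = P x" for x by (simp add: p)
  have Q: "0 < P x / (1 - \<theta>)" "P x / (1 - \<theta>) \<le> b / (1 - \<theta>)" for x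
    using th P_pos[of x] Pb[of x] by (simp_all add: divide_right_mono)
  from sobolev_besov_representative[OF s1 \<beta> \<theta>] obtain C where C: "0 < C"
    and rep: "\<forall>(T :: 'a distr) U g l. T \<in> tempered \<longrightarrow> besov_norm \<beta> T < \<infinity> \<longrightarrow>
    frac_laplacian s T U \<longrightarrow> represents g U \<longrightarrow> 0 < l \<longrightarrow> (\<integral>\<^sup>+x. ennreal ((norm (g x) / l) powr P x) \<partial>lebesgue) \<le> 1 \<longrightarrow>
    (\<exists>h S E. E \<in> borel_measurable borel \<and> (\<integral>\<^sup>+x. ennreal (E x powr (P x / (1 - \<theta>))) \<partial>lborel) < \<infinity> \<and> littlewood_paley_limit s1 T E h S \<and>
      (\<forall>\<Lambda>. C * (l powr (1 - \<theta>) * enn2real (besov_norm \<beta> T) powr \<theta>) < \<Lambda> \<longrightarrow>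
        (\<integral>\<^sup>+x. ennreal ((norm (h x) / \<Lambda>) powr (P x / (1 - \<theta>))) \<partial>lborel) \<le> 1))"
    by (elim exE conjE) (rule that)
  have main: "T \<in> sobolev s1 q \<and> sobolev_norm s1 q T \<le> ennreal (C * (l powr (1 - \<theta>) * enn2real (besov_norm \<beta> T) powr \<theta>))"
    if T: "T \<in> tempered" and B: "besov_norm \<beta> T < \<infinity>" and U: "frac_laplacian s T U" "represents g U"
      and l: "0 < l" "(\<integral>\<^sup>+x. ennreal ((norm (g x) / l) powr P x) \<partial>lebesgue) \<le> 1" for T U :: "'a distr" and g l
  proof -
    define \<Lambda>0 where "\<Lambda>0 = C * (l powr (1 - \<theta>) * enn2real (besov_norm \<beta> T) powr \<theta>)"
    have \<Lambda>0: "0 \<le> \<Lambda>0" using C by (simp add: \<Lambda>0_def)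
    from rep[rule_format, OF T B U l] obtain h S E where [measurable]: "E \<in> borel_measurable borel"
      and E: "(\<integral>\<^sup>+x. ennreal (E x powr (P x / (1 - \<theta>))) \<partial>lborel) < \<infinity>" and hS: "littlewood_paley_limit s1 T E h S"
      and h3: "\<And>\<Lambda>. \<Lambda>0 < \<Lambda> \<Longrightarrow> (\<integral>\<^sup>+x. ennreal ((norm (h x) / \<Lambda>) powr (P x / (1 - \<theta>))) \<partial>lborel) \<le> 1"
      unfolding \<Lambda>0_def[symmetric] by blast
    have h: "slow h" and S: "\<exists>\<omega>. annular \<omega> \<and> S J = (\<lambda>x. T (\<lambda>y. fourier \<omega> (y - x)))"
        "AE x in lborel. (\<forall>J. norm (S J x) \<le> E x) \<and> (\<lambda>J. S J x) \<longlonglongrightarrow> h x"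
      and h1: "\<psi> \<in> test_functions \<Longrightarrow> 0 \<notin> closure {\<xi>. \<psi> \<xi> \<noteq> 0} \<Longrightarrow>
        (\<integral>x. h x * fourier \<psi> x \<partial>lborel) = T (fourier (\<lambda>\<xi>. complex_of_real (norm \<xi> powr s1) * \<psi> \<xi>))"
      and h2: "s1 = 0 \<Longrightarrow> \<forall>f \<in> schwartz. T f = (\<integral>x. h x * f x \<partial>lborel)" for \<psi> J
      using hS by (auto simp: littlewood_paley_limit_def)
    have [measurable]: "h \<in> borel_measurable borel" using h by measurable
    have hl: "h \<in> borel_measurable lebesgue" by (rule measurable_completion) simp
    have Lp: "Lp_norm q h \<le> ennreal \<Lambda>0"
    proof (rule ennreal_le_epsilon)
      fix e :: real assume e: "0 < e"
      have "Lp_norm q h \<le> ennreal (\<Lambda>0 + e)"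
        using e \<Lambda>0 h3[of "\<Lambda>0 + e"] by (intro Lp_norm_le) (auto simp: qr)
      then show "Lp_norm q h \<le> ennreal \<Lambda>0 + ennreal e" using e \<Lambda>0 by simp
    qed
    show ?thesis
    proof (cases "s1 = 0")
      case True
      have hT: "represents h T"
      proof -
        have "T f = regular_distr h f" if f: "f \<in> test_functions" for f
        proof -
          have [measurable]: "f \<in> borel_measurable borel" by (rule schwartz_borel[OF test_schwartz[OF f]])
          show ?thesis using h2[OF True] test_schwartz[OF f] by (subst regular_distr_lborel) auto
        qed
        then show ?thesis using slow_represents[OF h] T by (simp add: represents_def)
      qed
      have "h \<in> Lp_space q" using Lp hl le_less_trans[OF Lp] by (simp add: Lp_space_def)
      moreover have "sobolev_norm s1 q T \<le> Lp_norm q h" unfolding sobolev_norm_def using True hT by (auto intro!: Inf_lower)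
      ultimately show ?thesis using True hT T Lp unfolding sobolev_def \<Lambda>0_def by (auto intro: order_trans)
    next
      case False
      have le: "sobolev_norm s1 q T' \<le> Lp_norm q h'" if "frac_laplacian s1 T' U'" "represents h' U'" for T' U' h'
        unfolding sobolev_norm_def using False that by (auto intro!: Inf_lower)
      have "frac_laplacian s1 T (regular_distr h)"
        unfolding frac_laplacian_def
      proof (intro conjI T slow_tempered[OF h] ballI impI)
        fix \<psi> :: "'a \<Rightarrow> complex" assume \<psi>: "\<psi> \<in> test_functions" "0 \<notin> closure {\<xi>. \<psi> \<xi> \<noteq> 0}"
        have [measurable]: "fourier \<psi> \<in> borel_measurable borel" by (rule schwartz_borel[OF fourier_test_schwartz[OF \<psi>(1)]])
        show "fourier_distr (regular_distr h) \<psi> = fourier_distr T (\<lambda>\<xi>. complex_of_real (norm \<xi> powr s1) * \<psi> \<xi>)"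
          unfolding fourier_distr_def h1[OF \<psi>, symmetric] by (rule regular_distr_lborel) measurable
      qed
      from le[OF this slow_represents[OF h]] have norm: "sobolev_norm s1 q T \<le> ennreal \<Lambda>0" using Lp by (rule order_trans)
      have "\<exists>\<phi> \<in> schwartz. sobolev_norm s1 q (\<lambda>\<psi>. T \<psi> - regular_distr \<phi> \<psi>) < \<epsilon>" if \<epsilon>: "0 < \<epsilon>" for \<epsilon>
      proof -
        \<comment> \<open>The given bound may be infinite, so a finite positive level is chosen
          below it.\<close>
        obtain e where e: "0 < e" "ennreal e < \<epsilon>"
        proof -
          obtain c where "0 < c" "c < \<epsilon>" using dense[OF \<epsilon>] by blast
          then show thesis using that[of "enn2real c"] by (cases c) auto
        qed
        obtain m where m: "annular m" "(\<integral>\<^sup>+x. ennreal ((norm (h x - fourier m x) / e) powr (P x / (1 - \<theta>))) \<partial>lborel) \<le> 1"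
          using annular_dense[of "\<lambda>x. P x / (1 - \<theta>)" h E "b / (1 - \<theta>)" e T S, OF _ _ _ Q e(1) E T S] by auto
        obtain \<phi> where \<phi>: "\<phi> \<in> schwartz" "frac_laplacian s1 (\<lambda>\<psi>. T \<psi> - regular_distr \<phi> \<psi>) (regular_distr (\<lambda>x. h x - fourier m x))"
          using frac_laplacian_diff[OF T h m(1) h1] by blast
        have "slow (\<lambda>x. h x - fourier m x)"
          using m(1) by (intro slow_diff h fourier_test_schwartz) (simp add: annular_def)
        from le[OF \<phi>(2) slow_represents[OF this]]
        have "sobolev_norm s1 q (\<lambda>\<psi>. T \<psi> - regular_distr \<phi> \<psi>) \<le> Lp_norm q (\<lambda>x. h x - fourier m x)" .
        also have "Lp_norm q (\<lambda>x. h x - fourier m x) \<le> ennreal e" by (rule Lp_norm_le[OF e(1)]) (simp add: qr m(2))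
        also note e(2)
        finally show ?thesis using \<phi>(1) by blast
      qed
      then show ?thesis using norm False T le_less_trans[OF norm] unfolding sobolev_def \<Lambda>0_def by auto
    qed
  qed
  show ?thesis
  proof (rule exI[of _ C], intro conjI C allI impI)
    fix T assume Ts: "T \<in> sobolev s p" and Tb: "T \<in> besov \<beta>"
    have T: "T \<in> tempered" and X: "sobolev_norm s p T < \<infinity>" using Ts s0 by (auto simp: sobolev_def)
    have B: "besov_norm \<beta> T < \<infinity>" using Tb by (simp add: besov_def)
    have adm: "\<exists>U g l. frac_laplacian s T U \<and> represents g U \<and> 0 < l \<and> l < r \<and> (\<integral>\<^sup>+x. ennreal ((norm (g x) / l) powr P x) \<partial>lebesgue) \<le> 1"
      if r: "sobolev_norm s p T < ennreal r" for r
    proof -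
      obtain g U where g: "frac_laplacian s T U" "represents g U" "Lp_norm p g < ennreal r"
        using r s0 unfolding sobolev_norm_def by (auto simp: Inf_less_iff)
      then obtain l where "0 < l" "ennreal l < ennreal r" "(\<integral>\<^sup>+x. ennreal ((norm (g x) / l) powr P x) \<partial>lebesgue) \<le> 1"
        unfolding Lp_norm_def Inf_less_iff pr by blast
      with g show ?thesis by (auto simp: ennreal_less_iff)
    qed
    define X0 where "X0 = enn2real (sobolev_norm s p T)"
    define \<nu> where "\<nu> = enn2real (besov_norm \<beta> T) powr \<theta>"
    have X0: "sobolev_norm s p T = ennreal X0" "0 \<le> X0" using X by (auto simp: X0_def less_top)
    have bound: "T \<in> sobolev s1 q \<and> sobolev_norm s1 q T \<le> ennreal (C * ((X0 + 1 / real (Suc i)) powr (1 - \<theta>) * \<nu>))" for i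
    proof -
      have "sobolev_norm s p T < ennreal (X0 + 1 / real (Suc i))" unfolding X0(1) using X0(2) by (simp add: ennreal_less_iff)
      from adm[OF this] obtain U g l where l: "frac_laplacian s T U" "represents g U" "0 < l" "l < X0 + 1 / real (Suc i)"
        "(\<integral>\<^sup>+x. ennreal ((norm (g x) / l) powr P x) \<partial>lebesgue) \<le> 1" by blast
      have "l powr (1 - \<theta>) \<le> (X0 + 1 / real (Suc i)) powr (1 - \<theta>)" using l th by (intro powr_mono2) auto
      then have "C * (l powr (1 - \<theta>) * \<nu>) \<le> C * ((X0 + 1 / real (Suc i)) powr (1 - \<theta>) * \<nu>)"
        using C by (intro mult_left_mono mult_right_mono) (auto simp: \<nu>_def)
      then have "ennreal (C * (l powr (1 - \<theta>) * \<nu>)) \<le> ennreal (C * ((X0 + 1 / real (Suc i)) powr (1 - \<theta>) * \<nu>))" by (rule ennreal_leI)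
      then show ?thesis using main[OF T B l(1,2,3,5)] unfolding \<nu>_def by (auto intro: order_trans)
    qed
    then show "T \<in> sobolev s1 q" by blast
    \<comment> \<open>The slack tends to 0, and a positive power is continuous on the nonnegative
      reals, including at \<open>X0 = 0\<close>.\<close>
    have "enn2real (sobolev_norm s1 q T) \<le> C * (X0 powr (1 - \<theta>) * \<nu>)"
    proof (rule LIMSEQ_le_const)
      have "(\<lambda>i. X0 + 1 / real (Suc i)) \<longlonglongrightarrow> X0 + 0"
        by (intro tendsto_add tendsto_const LIMSEQ_inverse_real_of_nat[unfolded inverse_eq_divide])
      then have "(\<lambda>i. (X0 + 1 / real (Suc i)) powr (1 - \<theta>)) \<longlonglongrightarrow> X0 powr (1 - \<theta>)"
        using th X0(2) by (intro tendsto_powr' tendsto_const) auto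
      then show "(\<lambda>i. C * ((X0 + 1 / real (Suc i)) powr (1 - \<theta>) * \<nu>)) \<longlonglongrightarrow> C * (X0 powr (1 - \<theta>) * \<nu>)"
        by (intro tendsto_mult tendsto_const)
      have "enn2real (sobolev_norm s1 q T) \<le> C * ((X0 + 1 / real (Suc i)) powr (1 - \<theta>) * \<nu>)" for i
        using conjunct2[OF bound[of i]] C by (intro enn2real_leI) (auto simp: \<nu>_def)
      then show "\<exists>N. \<forall>i\<ge>N. enn2real (sobolev_norm s1 q T) \<le> C * ((X0 + 1 / real (Suc i)) powr (1 - \<theta>) * \<nu>)" by blast
    qed
    then show "enn2real (sobolev_norm s1 q T) \<le> C * enn2real (sobolev_norm s p T) powr (1 - \<theta>) * enn2real (besov_norm \<beta> T) powr \<theta>"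
      by (simp add: X0_def \<nu>_def mult.assoc)
  qed
qed

theorem theorem2:
  fixes p q :: "real ^ 'n \<Rightarrow> ereal" and s s1 \<beta> \<theta> :: real
  assumes "p \<in> log_exponents"
    and "1 < p_minus p" and "p_minus p \<le> p_plus p" and "p_plus p < \<infinity>"
    and "0 < s" and "ereal s < ereal (real CARD('n)) / p_plus p"
    and "0 < \<beta>"
    and "0 \<le> s1" and "s1 < s"
    and "\<theta> = (s - s1) / (\<beta> + s)"
    and "q = (\<lambda>x. p x / ereal (1 - \<theta>))"
  shows "\<theta> < 1 \<and>
    (\<exists>C>0. \<forall>(f :: real ^ 'n \<Rightarrow> real) T.
      f \<in> borel_measurable lebesgue \<and> represents (\<lambda>x. complex_of_real (f x)) T \<and>
      T \<in> sobolev s p \<and> T \<in> besov \<beta> \<longrightarrow>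
      T \<in> sobolev s1 q \<and>
      enn2real (sobolev_norm s1 q T) \<le>
        C * enn2real (sobolev_norm s p T) powr (1 - \<theta>) * enn2real (besov_norm \<beta> T) powr \<theta>)"
proof
  show "\<theta> < 1" using assms(7-10) by (simp add: divide_less_eq)
  obtain P a b K Pinf where "log_exponent P a b K Pinf" and p: "\<And>x. p x = ereal (P x)"
    using log_exponents_finite[OF assms(1,2,4)] by metis
  then interpret log_exponent P a b K Pinf by simp
  show "\<exists>C>0. \<forall>(f :: real ^ 'n \<Rightarrow> real) T.
      f \<in> borel_measurable lebesgue \<and> represents (\<lambda>x. complex_of_real (f x)) T \<and>
      T \<in> sobolev s p \<and> T \<in> besov \<beta> \<longrightarrow>
      T \<in> sobolev s1 q \<and>
      enn2real (sobolev_norm s1 q T) \<le>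
        C * enn2real (sobolev_norm s p T) powr (1 - \<theta>) * enn2real (besov_norm \<beta> T) powr \<theta>"
    using sobolev_besov_interpolation[OF assms(8,9,7,10) p assms(11)] by blast
qed

end
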